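(* Let $X$ be a projective variety over $\mathbb{C}$, and let $S_\bullet\subseteq T_\bullet$ be two finitely generated graded linear series on $X$ corresponding to a big Cartier divisor $D$ such that $\operatorname{vol}(S_\bullet)=\operatorname{vol}(T_\bullet)>0$. Suppose furthermore that $S_\bullet$ contains the ample series $D-E$. Then for all closed irreducible subvarieties $Y\subseteq X$ with $Y\not\subseteq\operatorname{Supp}(E)$ we have $$\operatorname{vol}_{X|Y}(S_\bullet)=\operatorname{vol}_{X|Y}(T_\bullet).$$
   Context: A graded linear series $S_\bullet$ on $X$ corresponding to $D$ is a collection of finite-dimensional subspaces $S_k\subseteq H^0(X,\mathcal{O}_X(kD))$, $k\ge 0$, with $S_0=\mathbb{C}$ and $S_k\cdot S_l\subseteq S_{k+l}$. $S_\bullet\subseteq T_\bullet$ means $S_k\subseteq T_k$ for all $k$. $S_\bullet$ is finitely generated if $\bigoplus_k S_k$ is a finitely generated $\mathbb{C}$-algebra. On a variety of dimension $d$, $\operatorname{vol}(S_\bullet)=\limsup_{k\to\infty}\frac{\dim S_k}{k^d/d!}$. $S_\bullet$ contains the ample series $A=D-E$ if $S_k\ne0$ for $k\gg0$ and there is a decomposition of $\mathbb{Q}$-divisors $D=A+E$ with $A$ ample and $E$ effective such that $H^0(X,\mathcal{O}_X(kA))\subseteq S_k\subseteq H^0(X,\mathcal{O}_X(kD))$ for all sufficiently divisible $k$, the inclusion of the outer groups being multiplication by a defining section of $kE$. For an irreducible subvariety $Y\subseteq X$, the restricted series $S_{|Y,\bullet}$ on $Y$ has $S_{|Y,k}$ equal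 to the image of $S_k$ under restriction $H^0(X,\mathcal{O}_X(kD))\to H^0(Y,\mathcal{O}_Y(kD))$, and $\operatorname{vol}_{X|Y}(S_\bullet):=\operatorname{vol}_Y(S_{|Y,\bullet})$ (normalized using $\dim Y$). *)

theory Defs
  imports
    "HOL-Analysis.Analysis"
    "HOL-Library.Function_Algebras"
    "HOL-Computational_Algebra.Polynomial"
begin

section \<open>Projective varieties over the complex numbers\<close>

text \<open>
  Varieties are treated through their closed points. A point of projective space is a line in the
  space of complex sequences, and the projective space of dimension \<open>N\<close> consists of the lines
  spanned by a vector supported in the coordinates \<open>0, \<dots>, N\<close>. A projective variety is a Zariski
  closed irreducible subset of some projective space (so a variety is integral).
\<close>

type_synonym cvec = "nat \<Rightarrow> complex"
type_synonym point = "cvec set"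

definition line :: "cvec \<Rightarrow> point" where
  "line v = range (\<lambda>c i. c * v i)"

definition projective_space :: "nat \<Rightarrow> point set" where
  "projective_space N = {line v | v. v \<noteq> 0 \<and> (\<forall>i>N. v i = 0)}"

text \<open>
  Homogeneous polynomials, as polynomial functions of finitely many coordinates; the zero polynomial
  is homogeneous of every degree.
\<close>

inductive homogeneous :: "nat \<Rightarrow> (cvec \<Rightarrow> complex) \<Rightarrow> bool" where
  const: "homogeneous 0 (\<lambda>v. c)"
| coord: "homogeneous 1 (\<lambda>v. v i)"
| add: "homogeneous d p \<Longrightarrow> homogeneous d q \<Longrightarrow> homogeneous d (\<lambda>v. p v + q v)"
| mult: "homogeneous d p \<Longrightarrow> homogeneous e q \<Longrightarrow> homogeneous (d + e) (\<lambda>v. p v * q v)"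

definition zero_locus :: "(cvec \<Rightarrow> complex) set \<Rightarrow> point set" where
  "zero_locus F = {x. \<forall>p\<in>F. \<forall>v\<in>x - {0}. p v = 0}"

text \<open>The Zariski topology on a set \<open>X\<close> of points, induced from projective space.\<close>

definition Zariski :: "point set \<Rightarrow> point topology" where
  "Zariski X = topology (\<lambda>U. U \<subseteq> X \<and> (\<exists>F. (\<forall>p\<in>F. \<exists>d. homogeneous d p) \<and> X - U = X \<inter> zero_locus F))"

lemma homogeneous_line:
  assumes "homogeneous d p"
  shows "p (\<lambda>i. c * v i) = c ^ d * p v"
  using assms by (induction) (auto simp: algebra_simps power_add)

lemma istopology_Zariski:
  assumes X: "X \<subseteq> line ` (- {0})"
  shows "istopology (\<lambda>U. U \<subseteq> X \<and>
    (\<exists>F. (\<forall>p\<in>F. \<exists>d. homogeneous d p) \<and> X - U = X \<inter> zero_locus F))"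
  unfolding istopology_def
proof (intro conjI allI impI)
  fix S T
  assume S: "S \<subseteq> X \<and> (\<exists>F. (\<forall>p\<in>F. \<exists>d. homogeneous d p) \<and> X - S = X \<inter> zero_locus F)"
    and T: "T \<subseteq> X \<and> (\<exists>F. (\<forall>p\<in>F. \<exists>d. homogeneous d p) \<and> X - T = X \<inter> zero_locus F)"
  show "S \<inter> T \<subseteq> X" using S by blast
  from S obtain F where F: "\<forall>p\<in>F. \<exists>d. homogeneous d p" "X - S = X \<inter> zero_locus F" by blast
  from T obtain G where G: "\<forall>p\<in>G. \<exists>d. homogeneous d p" "X - T = X \<inter> zero_locus G" by blast
  define FG where "FG = {\<lambda>v. p v * q v |p q. p \<in> F \<and> q \<in> G}"
  have hom: "\<forall>r\<in>FG. \<exists>d. homogeneous d r"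
    unfolding FG_def using F(1) G(1) homogeneous.mult by blast
  have vanish: "\<forall>v\<in>x - {0}. p v = 0"
    if "x \<in> X" and p: "homogeneous d p" and w: "w \<in> x - {0}" "p w = 0" for x p d w
  proof
    fix v assume v: "v \<in> x - {0}"
    obtain u where u: "x = line u" using X \<open>x \<in> X\<close> by blast
    obtain a where a: "w = (\<lambda>i. a * u i)" using w(1) u by (auto simp: line_def)
    obtain b where b: "v = (\<lambda>i. b * u i)" using v u by (auto simp: line_def)
    have "a \<noteq> 0" using w(1) a by (auto simp: fun_eq_iff)
    hence "v = (\<lambda>i. (b / a) * w i)" using a b by (auto simp: fun_eq_iff)
    thus "p v = 0" using homogeneous_line[OF p, of "b / a" w] w(2) by simp
  qed
  have "X \<inter> zero_locus FG \<subseteq> zero_locus F \<union> zero_locus G"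
  proof
    fix x assume x: "x \<in> X \<inter> zero_locus FG"
    show "x \<in> zero_locus F \<union> zero_locus G"
    proof (rule ccontr)
      assume n: "x \<notin> zero_locus F \<union> zero_locus G"
      then obtain p v where p: "p \<in> F" "v \<in> x - {0}" "p v \<noteq> 0" by (auto simp: zero_locus_def)
      from n obtain q w where q: "q \<in> G" "w \<in> x - {0}" "q w \<noteq> 0" by (auto simp: zero_locus_def)
      have "q v \<noteq> 0" using vanish[of x _ q v] x G(1) q p(2) by blast
      have "(\<lambda>v. p v * q v) \<in> FG" using p q by (auto simp: FG_def)
      have "r v = 0" if "r \<in> FG" for r using x p(2) that unfolding zero_locus_def by blast
      from this[OF \<open>(\<lambda>v. p v * q v) \<in> FG\<close>] have "p v * q v = 0" .
      with \<open>q v \<noteq> 0\<close> show False using p(3) by simp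
    qed
  qed
  moreover have "x \<in> zero_locus FG" if x: "x \<in> zero_locus F \<union> zero_locus G" for x
    unfolding zero_locus_def
  proof (intro CollectI ballI)
    fix r v assume "r \<in> FG" and v: "v \<in> x - {0}"
    then obtain p q where r: "r = (\<lambda>v. p v * q v)" "p \<in> F" "q \<in> G" by (auto simp: FG_def)
    have "p v = 0 \<or> q v = 0" using x v r(2,3) unfolding zero_locus_def by blast
    thus "r v = 0" using r(1) by auto
  qed
  ultimately have "X - (S \<inter> T) = X \<inter> zero_locus FG" using F(2) G(2) by blast
  thus "\<exists>F. (\<forall>p\<in>F. \<exists>d. homogeneous d p) \<and> X - (S \<inter> T) = X \<inter> zero_locus F"
    using hom by blast
next
  fix K
  assume K: "\<forall>U\<in>K. U \<subseteq> X \<and> (\<exists>F. (\<forall>p\<in>F. \<exists>d. homogeneous d p) \<and> X - U = X \<inter> zero_locus F)"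
  show "\<Union>K \<subseteq> X" using K by blast
  from K obtain F where F:
    "\<forall>U\<in>K. (\<forall>p\<in>F U. \<exists>d. homogeneous d p) \<and> X - U = X \<inter> zero_locus (F U)" by metis
  have "X - \<Union>K = X \<inter> (\<Inter>U\<in>K. zero_locus (F U))" using F by blast
  also have "(\<Inter>U\<in>K. zero_locus (F U)) = zero_locus (\<Union>U\<in>K. F U)"
    by (auto simp: zero_locus_def)
  finally have "X - \<Union>K = X \<inter> zero_locus (\<Union>U\<in>K. F U)" .
  moreover have "\<forall>p\<in>(\<Union>U\<in>K. F U). \<exists>d. homogeneous d p" using F by blast
  ultimately show "\<exists>F. (\<forall>p\<in>F. \<exists>d. homogeneous d p) \<and> X - \<Union>K = X \<inter> zero_locus F"
    by blast
qed

lemma openin_Zariski: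
  assumes "X \<subseteq> line ` (- {0})"
  shows "openin (Zariski X) U \<longleftrightarrow>
    U \<subseteq> X \<and> (\<exists>F. (\<forall>p\<in>F. \<exists>d. homogeneous d p) \<and> X - U = X \<inter> zero_locus F)"
  unfolding Zariski_def using topology_inverse'[OF istopology_Zariski[OF assms]] by simp

lemma topspace_Zariski:
  assumes "X \<subseteq> line ` (- {0})"
  shows "topspace (Zariski X) = X"
proof -
  have "v \<in> line v" for v
    unfolding line_def by (rule range_eqI[of _ _ 1]) simp
  hence "X \<inter> zero_locus {\<lambda>v. 1} = {}" using assms by (force simp: zero_locus_def)
  hence "openin (Zariski X) X"
    unfolding openin_Zariski[OF assms]
    by (intro conjI exI[of _ "{\<lambda>v. 1}"]) (auto intro: homogeneous.const)
  moreover have "U \<subseteq> X" if "openin (Zariski X) U" for U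
    using that unfolding openin_Zariski[OF assms] by blast
  ultimately show ?thesis unfolding topspace_def by blast
qed

lemma closedin_Zariski:
  assumes "X \<subseteq> line ` (- {0})"
  shows "closedin (Zariski X) Z \<longleftrightarrow>
    (\<exists>F. (\<forall>p\<in>F. \<exists>d. homogeneous d p) \<and> Z = X \<inter> zero_locus F)"
  unfolding closedin_def topspace_Zariski[OF assms] openin_Zariski[OF assms]
  by (auto simp: double_diff)

definition irreducible_set :: "point set \<Rightarrow> bool" where
  "irreducible_set Z \<longleftrightarrow> Z \<noteq> {} \<and>
     (\<forall>A B. closedin (Zariski Z) A \<and> closedin (Zariski Z) B \<and> Z = A \<union> B \<longrightarrow> A = Z \<or> B = Z)"

definition projective_variety :: "point set \<Rightarrow> bool" where
  "projective_variety X \<longleftrightarrow>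
     (\<exists>N. closedin (Zariski (projective_space N)) X) \<and> irreducible_set X"

definition closed_subvariety :: "point set \<Rightarrow> point set \<Rightarrow> bool" where
  "closed_subvariety X Y \<longleftrightarrow> closedin (Zariski X) Y \<and> irreducible_set Y"

definition variety_dim :: "point set \<Rightarrow> nat" where
  "variety_dim X = Sup {n. \<exists>Z. (\<forall>i\<le>n. closed_subvariety X (Z i)) \<and> (\<forall>i<n. Z i \<subset> Z (Suc i))}"

definition regular_map :: "point set \<Rightarrow> (point \<Rightarrow> point) \<Rightarrow> bool" where
  "regular_map X \<psi> \<longleftrightarrow>
     (\<forall>x\<in>X. \<exists>U d P. openin (Zariski X) U \<and> x \<in> U \<and> (\<forall>i. homogeneous d (P i)) \<and>
        (\<forall>y\<in>U. \<forall>v\<in>y - {0}. (\<lambda>i. P i v) \<noteq> 0 \<and> \<psi> y = line (\<lambda>i. P i v)))"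

definition closed_embedding :: "point set \<Rightarrow> nat \<Rightarrow> (point \<Rightarrow> point) \<Rightarrow> bool" where
  "closed_embedding X N \<psi> \<longleftrightarrow>
     regular_map X \<psi> \<and> closedin (Zariski (projective_space N)) (\<psi> ` X) \<and>
     inj_on \<psi> X \<and> regular_map (\<psi> ` X) (inv_into X \<psi>)"


section \<open>Rational functions\<close>

text \<open>
  A rational function on \<open>X\<close> is represented by any function on points that agrees with it on a nonempty
  open subset of \<open>X\<close>; two representatives are the same rational function if they agree generically.
\<close>

definition generically :: "point set \<Rightarrow> (point \<Rightarrow> bool) \<Rightarrow> bool" where
  "generically X P \<longleftrightarrow> (\<exists>U. openin (Zariski X) U \<and> U \<noteq> {} \<and> (\<forall>x\<in>U. P x))"

definition is_fraction ::
    "point set \<Rightarrow> (point \<Rightarrow> complex) \<Rightarrow> (cvec \<Rightarrow> complex) \<Rightarrow> (cvec \<Rightarrow> complex) \<Rightarrow> bool" where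
  "is_fraction X \<phi> p q \<longleftrightarrow> (\<exists>d. homogeneous d p \<and> homogeneous d q) \<and>
     generically X (\<lambda>y. \<forall>v\<in>y - {0}. q v \<noteq> 0 \<and> \<phi> y = p v / q v)"

definition rational :: "point set \<Rightarrow> (point \<Rightarrow> complex) \<Rightarrow> bool" where
  "rational X \<phi> \<longleftrightarrow> (\<exists>p q. is_fraction X \<phi> p q)"

text \<open>
  \<open>has_value X \<phi> x c\<close>: the rational function \<open>\<phi>\<close> lies in the local ring of \<open>X\<close> at \<open>x\<close>, and
  its value at \<open>x\<close> is \<open>c\<close>. The number \<open>\<phi> x\<close> plays no role.
\<close>

definition has_value :: "point set \<Rightarrow> (point \<Rightarrow> complex) \<Rightarrow> point \<Rightarrow> complex \<Rightarrow> bool" where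
  "has_value X \<phi> x c \<longleftrightarrow>
     (\<exists>p q. is_fraction X \<phi> p q \<and> (\<forall>v\<in>x - {0}. q v \<noteq> 0 \<and> c = p v / q v))"

definition regular_at :: "point set \<Rightarrow> (point \<Rightarrow> complex) \<Rightarrow> point \<Rightarrow> bool" where
  "regular_at X \<phi> x \<longleftrightarrow> (\<exists>c. has_value X \<phi> x c)"

definition unit_at :: "point set \<Rightarrow> (point \<Rightarrow> complex) \<Rightarrow> point \<Rightarrow> bool" where
  "unit_at X \<phi> x \<longleftrightarrow> (\<exists>c. has_value X \<phi> x c \<and> c \<noteq> 0)"


section \<open>Cartier divisors and their sections\<close>

text \<open>
  A Cartier divisor is a global section of the sheaf of nonzero rational functions modulo units. It is
  given by choosing, for every point \<open>x\<close>, a rational function \<open>D x\<close> that represents its germ at \<open>x\<close>,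
  that is, a local equation near \<open>x\<close>. Hence addition of divisors is multiplication of local equations.
\<close>

type_synonym divisor = "point \<Rightarrow> point \<Rightarrow> complex"

definition cartier :: "point set \<Rightarrow> divisor \<Rightarrow> bool" where
  "cartier X D \<longleftrightarrow>
     (\<forall>x\<in>X. rational X (D x) \<and> generically X (\<lambda>y. D x y \<noteq> 0)) \<and>
     (\<forall>x\<in>X. \<exists>U. openin (Zariski X) U \<and> x \<in> U \<and> (\<forall>y\<in>U. unit_at X (\<lambda>z. D y z / D x z) y))"

definition div_eq :: "point set \<Rightarrow> divisor \<Rightarrow> divisor \<Rightarrow> bool" where
  "div_eq X D D' \<longleftrightarrow> (\<forall>x\<in>X. unit_at X (\<lambda>z. D x z / D' x z) x)"

definition div_add :: "divisor \<Rightarrow> divisor \<Rightarrow> divisor" where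
  "div_add D D' = (\<lambda>x z. D x z * D' x z)"

definition div_mult :: "nat \<Rightarrow> divisor \<Rightarrow> divisor" where
  "div_mult k D = (\<lambda>x z. D x z ^ k)"

definition effective :: "point set \<Rightarrow> divisor \<Rightarrow> bool" where
  "effective X D \<longleftrightarrow> cartier X D \<and> (\<forall>x\<in>X. regular_at X (D x) x)"

definition div_support :: "point set \<Rightarrow> divisor \<Rightarrow> point set" where
  "div_support X D = {x\<in>X. \<not> unit_at X (D x) x}"

text \<open>
  The sections of \<open>\<O>(D)\<close> are the rational functions \<open>\<phi>\<close> such that \<open>\<phi> \<cdot> D x\<close> is regular at every
  \<open>x\<close>. Such a section is encoded by the function \<open>s\<close> whose value at \<open>x \<in> X\<close> is the value of the
  section in the fibre of \<open>\<O>(D)\<close> at \<open>x\<close>, this fibre being identified with the complex numbers by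
  means of the local generator \<open>1 / D x\<close>; and \<open>s = 0\<close> outside \<open>X\<close>. With this encoding, sums of sections,
  products of sections of \<open>\<O>(k D)\<close> and \<open>\<O>(l D)\<close> (for the local equations \<open>D x ^ k\<close>), and
  restriction of sections to subvarieties are all pointwise.
\<close>

definition section_of :: "point set \<Rightarrow> divisor \<Rightarrow> (point \<Rightarrow> complex) \<Rightarrow> (point \<Rightarrow> complex) \<Rightarrow> bool" where
  "section_of X D \<phi> s \<longleftrightarrow> rational X \<phi> \<and>
     (\<forall>x\<in>X. has_value X (\<lambda>z. \<phi> z * D x z) x (s x)) \<and> (\<forall>x. x \<notin> X \<longrightarrow> s x = 0)"

definition H0 :: "point set \<Rightarrow> divisor \<Rightarrow> (point \<Rightarrow> complex) set" where
  "H0 X D = {s. \<exists>\<phi>. section_of X D \<phi> s}"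

definition restrict_section :: "point set \<Rightarrow> (point \<Rightarrow> complex) \<Rightarrow> (point \<Rightarrow> complex)" where
  "restrict_section Y s = (\<lambda>x. if x \<in> Y then s x else 0)"

text \<open>The canonical section \<open>1\<close> of \<open>\<O>(E)\<close> for effective \<open>E\<close>; its divisor of zeros is \<open>E\<close>.\<close>

definition defining_section :: "point set \<Rightarrow> divisor \<Rightarrow> (point \<Rightarrow> complex) \<Rightarrow> bool" where
  "defining_section X E e \<longleftrightarrow> section_of X E (\<lambda>z. 1) e"

text \<open>
  The product of a section \<open>s\<close> of \<open>\<O>(A)\<close> and a section \<open>e\<close> of \<open>\<O>(E)\<close>, as a section \<open>t\<close>
  of \<open>\<O>(D)\<close>, where \<open>D\<close> and \<open>A + E\<close> are equal divisors with possibly different local equations.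
\<close>

definition section_product ::
    "point set \<Rightarrow> divisor \<Rightarrow> (point \<Rightarrow> complex) \<Rightarrow> divisor \<Rightarrow> (point \<Rightarrow> complex) \<Rightarrow>
     divisor \<Rightarrow> (point \<Rightarrow> complex) \<Rightarrow> bool" where
  "section_product X A s E e D t \<longleftrightarrow>
     (\<exists>\<phi> \<epsilon>. section_of X A \<phi> s \<and> section_of X E \<epsilon> e \<and> section_of X D (\<lambda>z. \<phi> z * \<epsilon> z) t)"

text \<open>
  Very ample: there is a closed embedding into a projective space under which \<open>\<O>(1)\<close> pulls back to
  \<open>\<O>(A)\<close>, the coordinates pulling back to the sections \<open>s 0, \<dots>, s N\<close>.
\<close>

definition very_ample :: "point set \<Rightarrow> divisor \<Rightarrow> bool" where
  "very_ample X A \<longleftrightarrow> cartier X A \<and>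
     (\<exists>N s. (\<forall>i\<le>N. s i \<in> H0 X A) \<and> (\<forall>x\<in>X. \<exists>i\<le>N. s i x \<noteq> 0) \<and>
        closed_embedding X N (\<lambda>x. line (\<lambda>i. if i \<le> N then s i x else 0)))"

definition ample :: "point set \<Rightarrow> divisor \<Rightarrow> bool" where
  "ample X A \<longleftrightarrow> cartier X A \<and> (\<exists>m>0. very_ample X (div_mult m A))"


section \<open>Q-divisors\<close>

text \<open>
  The pair \<open>(M, m)\<close> with \<open>M\<close> Cartier and \<open>m > 0\<close> stands for the element \<open>(1/m) M\<close> of the group of
  Cartier divisors tensored with the rationals. On a variety that is not normal the group of Cartier
  divisors may have torsion, which is killed by the factor \<open>N\<close> in the equality of Q-divisors.
\<close>

type_synonym qdivisor = "divisor \<times> nat"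

definition is_qdivisor :: "point set \<Rightarrow> qdivisor \<Rightarrow> bool" where
  "is_qdivisor X A \<longleftrightarrow> cartier X (fst A) \<and> snd A > 0"

definition qdiv_eq :: "point set \<Rightarrow> qdivisor \<Rightarrow> qdivisor \<Rightarrow> bool" where
  "qdiv_eq X A B \<longleftrightarrow>
     (\<exists>N>0. div_eq X (div_mult (N * snd B) (fst A)) (div_mult (N * snd A) (fst B)))"

definition qdiv_add :: "qdivisor \<Rightarrow> qdivisor \<Rightarrow> qdivisor" where
  "qdiv_add A B = (div_add (div_mult (snd B) (fst A)) (div_mult (snd A) (fst B)), snd A * snd B)"

definition qdiv_ample :: "point set \<Rightarrow> qdivisor \<Rightarrow> bool" where
  "qdiv_ample X A \<longleftrightarrow> (\<exists>F n. n > 0 \<and> ample X F \<and> qdiv_eq X A (F, n))"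

definition qdiv_effective :: "point set \<Rightarrow> qdivisor \<Rightarrow> bool" where
  "qdiv_effective X E \<longleftrightarrow> (\<exists>F n. n > 0 \<and> effective X F \<and> qdiv_eq X E (F, n))"

text \<open>
  The points at which no positive multiple of the underlying divisor \<open>M\<close> is trivial; taking all
  multiples removes torsion. If \<open>M\<close> is effective, then this is just the support of \<open>M\<close>.
\<close>

definition qdiv_support :: "point set \<Rightarrow> qdivisor \<Rightarrow> point set" where
  "qdiv_support X E = (\<Inter>N\<in>{0<..}. div_support X (div_mult N (fst E)))"


section \<open>Graded linear series\<close>

global_interpretation fun_vs: vector_space "\<lambda>(c::complex) (s::point \<Rightarrow> complex) x. c * s x"
  by standard (auto simp: fun_eq_iff algebra_simps)

type_synonym series = "nat \<Rightarrow> (point \<Rightarrow> complex) set"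

definition scalar_section :: "point set \<Rightarrow> complex \<Rightarrow> (point \<Rightarrow> complex)" where
  "scalar_section X c = restrict_section X (\<lambda>x. c)"

definition graded_linear_series :: "point set \<Rightarrow> divisor \<Rightarrow> series \<Rightarrow> bool" where
  "graded_linear_series X D S \<longleftrightarrow>
     (\<forall>k. S k \<subseteq> H0 X (div_mult k D) \<and> fun_vs.subspace (S k) \<and>
          (\<exists>B. finite B \<and> fun_vs.span B = S k)) \<and>
     S 0 = range (scalar_section X) \<and>
     (\<forall>k l. \<forall>s\<in>S k. \<forall>t\<in>S l. s * t \<in> S (k + l))"

text \<open>
  The graded algebra of a series consists of the polynomials whose \<open>k\<close>-th coefficient lies in
  \<open>S k\<close>. Its field of scalars is \<open>S 0\<close>, placed in degree zero.
\<close>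

definition graded_algebra :: "series \<Rightarrow> (point \<Rightarrow> complex) poly set" where
  "graded_algebra S = {P. \<forall>k. coeff P k \<in> S k}"

inductive_set generated_algebra :: "point set \<Rightarrow> (point \<Rightarrow> complex) poly set \<Rightarrow> (point \<Rightarrow> complex) poly set"
  for X :: "point set" and G :: "(point \<Rightarrow> complex) poly set" where
  scalar: "[:scalar_section X c:] \<in> generated_algebra X G"
| gen: "P \<in> G \<Longrightarrow> P \<in> generated_algebra X G"
| add: "P \<in> generated_algebra X G \<Longrightarrow> Q \<in> generated_algebra X G \<Longrightarrow> P + Q \<in> generated_algebra X G"
| mult: "P \<in> generated_algebra X G \<Longrightarrow> Q \<in> generated_algebra X G \<Longrightarrow> P * Q \<in> generated_algebra X G"

definition finitely_generated :: "point set \<Rightarrow> series \<Rightarrow> bool" where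
  "finitely_generated X S \<longleftrightarrow> (\<exists>G. finite G \<and> generated_algebra X G = graded_algebra S)"

definition series_volume :: "point set \<Rightarrow> series \<Rightarrow> ereal" where
  "series_volume X S =
     limsup (\<lambda>k. ereal (real (fun_vs.dim (S k)) /
       (real k ^ variety_dim X / fact (variety_dim X))))"

definition big :: "point set \<Rightarrow> divisor \<Rightarrow> bool" where
  "big X D \<longleftrightarrow> cartier X D \<and> series_volume X (\<lambda>k. H0 X (div_mult k D)) > 0"

definition restricted_series :: "point set \<Rightarrow> series \<Rightarrow> series" where
  "restricted_series Y S = (\<lambda>k. restrict_section Y ` S k)"

definition restricted_volume :: "point set \<Rightarrow> series \<Rightarrow> ereal" where
  "restricted_volume Y S = series_volume Y (restricted_series Y S)"

text \<open>
  In \<open>contains_ample_series X D S A E\<close>, "all sufficiently divisible \<open>k\<close>" means all positive multiples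
  \<open>k = j * m\<close> of some \<open>m > 0\<close> for which \<open>m A\<close> and \<open>m E\<close> are (the classes of) integral divisors
  \<open>A'\<close> and \<open>E'\<close> with \<open>m D = A' + E'\<close>, so that \<open>k A = j A'\<close> and \<open>k E = j E'\<close>.
\<close>

definition contains_ample_series ::
    "point set \<Rightarrow> divisor \<Rightarrow> series \<Rightarrow> qdivisor \<Rightarrow> qdivisor \<Rightarrow> bool" where
  "contains_ample_series X D S A E \<longleftrightarrow>
     (\<forall>\<^sub>F k in sequentially. S k \<noteq> {0}) \<and>
     is_qdivisor X A \<and> is_qdivisor X E \<and> qdiv_eq X (D, 1) (qdiv_add A E) \<and>
     qdiv_ample X A \<and> qdiv_effective X E \<and>
     (\<exists>m A' E'. m > 0 \<and> cartier X A' \<and> effective X E' \<and>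
        qdiv_eq X A (A', m) \<and> qdiv_eq X E (E', m) \<and>
        div_eq X (div_mult m D) (div_add A' E') \<and>
        (\<forall>j>0. \<exists>e. defining_section X (div_mult j E') e \<and>
           (\<forall>s\<in>H0 X (div_mult j A'). \<exists>t\<in>S (j * m).
              section_product X (div_mult j A') s (div_mult j E') e (div_mult (j * m) D) t) \<and>
           S (j * m) \<subseteq> H0 X (div_mult (j * m) D)))"

end

theory Submission
  imports Defs "HOL-Computational_Algebra.Fundamental_Theorem_Algebra"
begin

text \<open>
  If \<open>S \<subseteq> T\<close> are finitely generated series of the same positive volume, then the algebra of \<open>T\<close> is integral over that of \<open>S\<close>,
  at least along the multiples of some \<open>m\<close>. Indeed, every section in \<open>T\<close> has a denominator in \<open>S\<close>, because \<open>S\<close> contains an ample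
  series. Suppose that \<open>t \<in> T\<close> has degree \<open>m\<close> and is not integral over \<open>S\<close>. Noether normalization makes \<open>S\<close> finite over a
  polynomial ring in \<open>d + 1\<close> variables, and the denominator of \<open>t\<close> may be taken to be monic in the last variable. Then no relation for
  \<open>t\<close> over \<open>S\<close> can have a leading coefficient in the first \<open>d\<close> variables only, since a denominator of this kind and a monic one are
  coprime enough to force integrality (\<open>integral_if_coprime_denominators\<close>). So the products of monomials in these
  \<open>d\<close> variables with powers of \<open>t\<close> are independent modulo \<open>S\<close>, and the dimension of \<open>T\<close> exceeds that of \<open>S\<close> by
  a positive multiple of \<open>k\<^sup>d\<close> (\<open>integral_or_growth\<close>). As the volume of \<open>S\<close> is positive, \<open>d\<close> is at least the dimension of \<open>X\<close>, so the volumes differ. For this contradiction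
  the volume of \<open>T\<close> has to be finite, which is shown in \<open>series_growth\<close> by comparison with the homogeneous coordinate ring of \<open>X\<close>, which grows
  at most with the order \<open>dim X\<close> (\<open>coordinate_ring_growth\<close>).

  So along the multiples of \<open>m\<close> the algebra of \<open>T\<close> is a finite module over that of \<open>S\<close>, and each of the finitely many generators has a
  denominator in \<open>S\<close>. If a point \<open>y \<in> Y\<close> is not contained in the support of \<open>E\<close>, the denominators can be chosen to be nonzero at \<open>y\<close>
  (\<open>common_denominator\<close>): some section of a multiple of the ample divisor does not vanish at \<open>y\<close> but vanishes on \<open>E\<close>, and a high power
  of it is divisible by any given multiple of \<open>E\<close>, by the Nullstellensatz. The product \<open>c\<close> of the denominators of the generators satisfies
  \<open>c T\<^sub>m\<^sub>k \<subseteq> S\<^sub>m\<^sub>(\<^sub>k\<^sub>+\<^sub>j\<^sub>)\<close> for all \<open>k\<close> (\<open>conductor_exists\<close>). Its restriction to \<open>Y\<close> is not zero, so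
  multiplication by \<open>c\<close> is injective on sections over the irreducible set \<open>Y\<close>. Hence the restriction of \<open>T\<close> to \<open>Y\<close> is not
  bigger than that of \<open>S\<close>, up to a bounded shift of the degree, which does not affect the volume (\<open>restricted_volume_eq\<close>).

  Graded rings are treated as families of spaces of complex functions on an arbitrary type, indexed by the degree; forms are
  homogeneous polynomial functions of the coordinates.
\<close>

section \<open>Noetherian modules over subrings\<close>

definition subring :: "'r::comm_ring_1 set \<Rightarrow> bool" where
  "subring A \<longleftrightarrow> 1 \<in> A \<and> (\<forall>x\<in>A. \<forall>y\<in>A. x + y \<in> A \<and> x * y \<in> A) \<and> (\<forall>x\<in>A. - x \<in> A)"

lemma subringD:
  assumes "subring A"
  shows "1 \<in> A" "x \<in> A \<Longrightarrow> y \<in> A \<Longrightarrow> x + y \<in> A" "x \<in> A \<Longrightarrow> y \<in> A \<Longrightarrow> x * y \<in> A"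
    "x \<in> A \<Longrightarrow> - x \<in> A" "0 \<in> A" "x \<in> A \<Longrightarrow> y \<in> A \<Longrightarrow> x - y \<in> A" "x \<in> A \<Longrightarrow> x ^ n \<in> A"
proof -
  show 1: "1 \<in> A" and a: "\<And>x y. x \<in> A \<Longrightarrow> y \<in> A \<Longrightarrow> x + y \<in> A"
    and m: "\<And>x y. x \<in> A \<Longrightarrow> y \<in> A \<Longrightarrow> x * y \<in> A" and u: "\<And>x. x \<in> A \<Longrightarrow> - x \<in> A"
    using assms unfolding subring_def by auto
  show "0 \<in> A" using a[OF 1 u[OF 1]] by simp
  show "x \<in> A \<Longrightarrow> y \<in> A \<Longrightarrow> x - y \<in> A" using a[of x "- y"] u by simp
  show "x \<in> A \<Longrightarrow> x ^ n \<in> A" by (induction n) (auto intro: 1 m)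
qed

lemma subring_sum: "subring A \<Longrightarrow> (\<And>i. i \<in> I \<Longrightarrow> f i \<in> A) \<Longrightarrow> sum f I \<in> A"
  by (induction I rule: infinite_finite_induct) (auto intro: subringD)

lemma subring_prod: "subring A \<Longrightarrow> (\<And>i. i \<in> I \<Longrightarrow> f i \<in> A) \<Longrightarrow> prod f I \<in> A"
  by (induction I rule: infinite_finite_induct) (auto intro: subringD)

text \<open>The \<open>P\<close>-submodule of the ambient ring that is spanned by \<open>S\<close>.\<close>

inductive_set mspan :: "'r::comm_ring_1 set \<Rightarrow> 'r set \<Rightarrow> 'r set" for P S where
  zero: "0 \<in> mspan P S"
| step: "p \<in> P \<Longrightarrow> s \<in> S \<Longrightarrow> u \<in> mspan P S \<Longrightarrow> p * s + u \<in> mspan P S"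

lemma mspan_add: "u \<in> mspan P S \<Longrightarrow> v \<in> mspan P S \<Longrightarrow> u + v \<in> mspan P S"
  by (induction rule: mspan.induct) (auto simp: add.assoc intro: mspan.intros)

lemma mspan_base: "p \<in> P \<Longrightarrow> s \<in> S \<Longrightarrow> p * s \<in> mspan P S"
  using mspan.step[OF _ _ mspan.zero] by fastforce

lemma mspan_scale:
  assumes P: "subring P" and "u \<in> mspan P S" and p: "p \<in> P"
  shows "p * u \<in> mspan P S"
  using assms(2)
proof induction
  case (step q s u)
  hence "(p * q) * s + p * u \<in> mspan P S" using P p by (intro mspan.step) (auto intro: subringD)
  thus ?case by (simp add: algebra_simps)
qed (auto intro: mspan.zero)

lemma mspan_superset: "subring P \<Longrightarrow> s \<in> S \<Longrightarrow> s \<in> mspan P S"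
  using mspan_base[of 1 P s S] by (simp add: subringD)

lemma mspan_uminus: "subring P \<Longrightarrow> u \<in> mspan P S \<Longrightarrow> - u \<in> mspan P S"
  using mspan_scale[of P u S "- 1"] by (simp add: subringD)

lemma mspan_diff: "subring P \<Longrightarrow> u \<in> mspan P S \<Longrightarrow> v \<in> mspan P S \<Longrightarrow> u - v \<in> mspan P S"
  using mspan_add[of u P S "- v"] mspan_uminus by auto

lemma mspan_subset:
  assumes "subring P" "S \<subseteq> mspan P S'" shows "mspan P S \<subseteq> mspan P S'"
proof
  fix u assume "u \<in> mspan P S"
  thus "u \<in> mspan P S'"
    by induction (use assms in \<open>auto intro!: mspan.zero mspan_add mspan_scale\<close>)
qed

lemma mspan_mono: "S \<subseteq> S' \<Longrightarrow> mspan P S \<subseteq> mspan P S'"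
proof
  fix u assume "S \<subseteq> S'" "u \<in> mspan P S"
  from this(2,1) show "u \<in> mspan P S'" by induction (auto intro: mspan.intros)
qed

lemma mspan_sum: "(\<And>i. i \<in> I \<Longrightarrow> f i \<in> mspan P S) \<Longrightarrow> sum f I \<in> mspan P S"
  by (induction I rule: infinite_finite_induct) (auto intro: mspan_add mspan.zero)

lemma mspan_finite_support:
  assumes "u \<in> mspan P S" shows "\<exists>F. finite F \<and> F \<subseteq> S \<and> u \<in> mspan P F"
  using assms
proof induction
  case zero show ?case by (rule exI[of _ "{}"]) (auto intro: mspan.zero)
next
  case (step p s u)
  then obtain F where F: "finite F" "F \<subseteq> S" "u \<in> mspan P F" by blast
  have "p * s + u \<in> mspan P (insert s F)"
    using step F mspan_mono[of F "insert s F" P] by (auto intro: mspan.step)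
  thus ?case using F step by (intro exI[of _ "insert s F"]) auto
qed

lemma mspan_image:
  assumes "subring P" "finite I"
  shows "u \<in> mspan P (f ` I) \<longleftrightarrow> (\<exists>g. (\<forall>i\<in>I. g i \<in> P) \<and> u = (\<Sum>i\<in>I. g i * f i))"
proof
  assume "u \<in> mspan P (f ` I)"
  thus "\<exists>g. (\<forall>i\<in>I. g i \<in> P) \<and> u = (\<Sum>i\<in>I. g i * f i)"
  proof induction
    case zero show ?case by (rule exI[of _ "\<lambda>_. 0"]) (use assms in \<open>auto intro: subringD\<close>)
  next
    case (step p s u)
    then obtain g j where g: "\<forall>i\<in>I. g i \<in> P" "u = (\<Sum>i\<in>I. g i * f i)" and j: "j \<in> I" "s = f j" by blast
    have "p * s + u = (\<Sum>i\<in>I. (if i = j then p + g i else g i) * f i)"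
      unfolding g(2) j(2) using assms(2) j(1)
      by (subst (1 2) sum.remove[OF assms(2) j(1)]) (auto simp: algebra_simps intro!: sum.cong)
    thus ?case using g(1) step(1) assms(1)
      by (intro exI[of _ "\<lambda>i. if i = j then p + g i else g i"]) (auto intro: subringD)
  qed
next
  assume "\<exists>g. (\<forall>i\<in>I. g i \<in> P) \<and> u = (\<Sum>i\<in>I. g i * f i)"
  thus "u \<in> mspan P (f ` I)" by (auto intro!: mspan_sum mspan_base)
qed

text \<open>
  A module is noetherian if every subset of it, and not only every submodule, contains finitely many
  elements that span all of it.
\<close>

definition noetherian_module :: "'r::comm_ring_1 set \<Rightarrow> 'r set \<Rightarrow> bool" where
  "noetherian_module P M \<longleftrightarrow> (\<forall>S\<subseteq>M. \<exists>F. finite F \<and> F \<subseteq> S \<and> S \<subseteq> mspan P F)"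

lemma finite_choice_support:
  assumes "subring P" "finite L" "L \<subseteq> mspan P S"
  shows "\<exists>F. finite F \<and> F \<subseteq> S \<and> L \<subseteq> mspan P F"
proof -
  have "\<forall>u\<in>L. \<exists>F. finite F \<and> F \<subseteq> S \<and> u \<in> mspan P F"
    using assms(3) mspan_finite_support by blast
  then obtain F where F: "\<forall>u\<in>L. finite (F u) \<and> F u \<subseteq> S \<and> u \<in> mspan P (F u)" by metis
  have "u \<in> mspan P (\<Union>u\<in>L. F u)" if "u \<in> L" for u
    using F that mspan_mono[of "F u" "\<Union>u\<in>L. F u" P] by blast
  thus ?thesis using F assms(2) by (intro exI[of _ "\<Union>u\<in>L. F u"]) auto
qed

text \<open>
  Induction on the number of generators: a submodule of \<open>M + P b\<close> is spanned by lifts of generators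
  of the ideal of its \<open>b\<close>-coefficients together with its intersection with \<open>M\<close>.
\<close>

lemma noetherian_module_insert:
  assumes P: "subring P" and N: "noetherian_module P P" and M: "noetherian_module P (mspan P B)"
  shows "noetherian_module P (mspan P (insert b B))"
  unfolding noetherian_module_def
proof (intro allI impI)
  fix S assume S: "S \<subseteq> mspan P (insert b B)"
  define L where "L = {g \<in> P. \<exists>u\<in>mspan P S. u - g * b \<in> mspan P B}"
  have "L \<subseteq> P" unfolding L_def by blast
  then obtain L0 where L0: "finite L0" "L0 \<subseteq> L" "L \<subseteq> mspan P L0"
    using N unfolding noetherian_module_def by meson
  have "\<forall>g\<in>L. \<exists>u. u \<in> mspan P S \<and> u - g * b \<in> mspan P B" unfolding L_def by blast
  then obtain w where w: "\<forall>g\<in>L. w g \<in> mspan P S \<and> w g - g * b \<in> mspan P B" by metis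
  obtain N0 where N0: "finite N0" "N0 \<subseteq> mspan P S \<inter> mspan P B" "mspan P S \<inter> mspan P B \<subseteq> mspan P N0"
    using M unfolding noetherian_module_def by (meson inf.cobounded2)
  have dec: "\<exists>g\<in>P. u - g * b \<in> mspan P B" if "u \<in> mspan P (insert b B)" for u
    using that
  proof induction
    case zero show ?case by (rule bexI[of _ 0]) (auto intro: mspan.zero subringD P)
  next
    case (step p s u)
    then obtain g where g: "g \<in> P" "u - g * b \<in> mspan P B" by blast
    show ?case
    proof (cases "s = b")
      case True thus ?thesis using g step(1) P by (intro bexI[of _ "p + g"]) (auto simp: algebra_simps subringD)
    next
      case False
      hence "p * s + (u - g * b) \<in> mspan P B" using step g by (auto intro: mspan.step)
      thus ?thesis using g by (intro bexI[of _ g]) (auto simp: algebra_simps)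
    qed
  qed
  have gen: "u \<in> mspan P (w ` L0 \<union> N0)" if u: "u \<in> S" for u
  proof -
    have uS: "u \<in> mspan P S" using u P by (auto intro: mspan_superset)
    obtain g where g: "g \<in> P" "u - g * b \<in> mspan P B" using dec S u by blast
    hence "g \<in> L" using uS L_def by blast
    hence "g \<in> mspan P (id ` L0)" using L0 by auto
    then obtain h where h: "\<forall>l\<in>L0. h l \<in> P" "g = (\<Sum>l\<in>L0. h l * l)"
      unfolding mspan_image[OF P L0(1)] by auto
    define u' where "u' = (\<Sum>l\<in>L0. h l * w l)"
    have 1: "u' \<in> mspan P (w ` L0)" unfolding u'_def by (rule mspan_sum) (use h in \<open>auto intro: mspan_base\<close>)
    have "u' \<in> mspan P S" unfolding u'_def by (rule mspan_sum) (use h w L0 P in \<open>auto intro!: mspan_scale\<close>)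
    hence 2: "u - u' \<in> mspan P S" using uS P by (auto intro: mspan_diff)
    have "u' - g * b = (\<Sum>l\<in>L0. h l * (w l - l * b))"
      unfolding u'_def h(2) by (simp add: sum_subtractf sum_distrib_right right_diff_distrib mult.assoc)
    also have "\<dots> \<in> mspan P B" by (rule mspan_sum) (use h w L0 P in \<open>auto intro!: mspan_scale\<close>)
    finally have "(u - g * b) - (u' - g * b) \<in> mspan P B" by (rule mspan_diff[OF P g(2)])
    hence "u - u' \<in> mspan P B" by simp
    hence "u - u' \<in> mspan P N0" using 2 N0 by blast
    hence "u' + (u - u') \<in> mspan P (w ` L0 \<union> N0)"
      using 1 mspan_mono[of "w ` L0" "w ` L0 \<union> N0" P] mspan_mono[of N0 "w ` L0 \<union> N0" P]
      by (intro mspan_add) auto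
    thus ?thesis by simp
  qed
  have "w ` L0 \<union> N0 \<subseteq> mspan P S" using w L0 N0 by auto
  then obtain F where F: "finite F" "F \<subseteq> S" "w ` L0 \<union> N0 \<subseteq> mspan P F"
    using finite_choice_support[OF P, of "w ` L0 \<union> N0" S] L0(1) N0(1) by auto
  have "S \<subseteq> mspan P F" using gen mspan_subset[OF P F(3)] by blast
  thus "\<exists>F. finite F \<and> F \<subseteq> S \<and> S \<subseteq> mspan P F" using F by blast
qed

lemma noetherian_module_finite:
  assumes "subring P" "noetherian_module P P" "finite B"
  shows "noetherian_module P (mspan P B)"
  using assms(3)
proof induction
  case empty
  have "mspan P {} = {0}"
  proof -
    have "u = 0" if "u \<in> mspan P {}" for u using that by induction auto
    thus ?thesis using mspan.zero by auto
  qed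
  thus ?case unfolding noetherian_module_def
    by (auto intro!: exI[of _ "{}"] mspan.zero)
next
  case (insert b B) thus ?case using noetherian_module_insert[OF assms(1,2)] by blast
qed

text \<open>
  The form in which the noetherian property is used: applied to the powers of an element, it is an integral
  equation.
\<close>

lemma noetherian_module_seq:
  assumes P: "subring P" and "noetherian_module P M" and f: "range (f :: nat \<Rightarrow> _) \<subseteq> M"
  shows "\<exists>n r. (\<forall>i<n. r i \<in> P) \<and> f n = (\<Sum>i<n. r i * f i)"
proof -
  obtain F where F: "finite F" "F \<subseteq> range f" "range f \<subseteq> mspan P F"
    using assms unfolding noetherian_module_def by meson
  obtain I where I: "finite I" "F = f ` I" using F(1,2) finite_subset_image by metis
  define n where "n = Suc (Max (insert 0 I))"
  have "F \<subseteq> f ` {..<n}" unfolding I(2) n_def using I(1) by (auto simp: less_Suc_eq_le)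
  hence "f n \<in> mspan P (f ` {..<n})" using F(3) mspan_mono[of F "f ` {..<n}" P] by blast
  thus ?thesis unfolding mspan_image[OF P finite_lessThan] by auto
qed

section \<open>Hilbert's basis theorem\<close>

definition coeffs_in :: "'r::comm_ring_1 set \<Rightarrow> 'r poly set" where
  "coeffs_in A = {p. \<forall>i. coeff p i \<in> A}"

lemma subring_coeffs_in:
  assumes "subring A" shows "subring (coeffs_in A)"
  unfolding subring_def
proof (intro conjI ballI)
  show "1 \<in> coeffs_in A" using assms by (auto simp: coeffs_in_def coeff_1 intro: subringD)
  fix x assume x: "x \<in> coeffs_in A"
  show "- x \<in> coeffs_in A" using assms x by (auto simp: coeffs_in_def intro: subringD)
  fix y assume y: "y \<in> coeffs_in A"
  show "x + y \<in> coeffs_in A" using assms x y by (auto simp: coeffs_in_def intro: subringD)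
  show "x * y \<in> coeffs_in A" using assms x y
    by (auto simp: coeffs_in_def coeff_mult intro!: subring_sum subringD)
qed

lemma monom_coeffs_in: "subring A \<Longrightarrow> a \<in> A \<Longrightarrow> monom a n \<in> coeffs_in A"
  by (auto simp: coeffs_in_def intro: subringD)

text \<open>
  The classical argument: a sequence of elements of an ideal, each of minimal degree outside the
  ideal of its predecessors, contradicts a relation among their leading coefficients.
\<close>

lemma Hilbert_basis:
  assumes A: "subring A" and N: "noetherian_module A A"
  shows "noetherian_module (coeffs_in A) (coeffs_in A)"
  unfolding noetherian_module_def
proof (intro allI impI)
  let ?P = "coeffs_in A"
  have P: "subring ?P" by (rule subring_coeffs_in[OF A])
  fix S :: "'a poly set" assume S: "S \<subseteq> ?P"
  define J where "J = mspan ?P S"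
  have JP: "J \<subseteq> ?P"
  proof
    fix u assume "u \<in> J" thus "u \<in> ?P" unfolding J_def
      by induction (use P S in \<open>auto intro: subringD\<close>)
  qed
  show "\<exists>F. finite F \<and> F \<subseteq> S \<and> S \<subseteq> mspan ?P F"
  proof (rule ccontr)
    assume no: "\<not> ?thesis"
    have ex: "\<exists>g. g \<in> J \<and> g \<notin> mspan ?P G" if G: "finite G" "G \<subseteq> J" for G
    proof (rule ccontr)
      assume "\<not> ?thesis"
      hence 1: "J \<subseteq> mspan ?P G" by blast
      obtain F where F: "finite F" "F \<subseteq> S" "G \<subseteq> mspan ?P F"
        using finite_choice_support[OF P G(1) G(2)[unfolded J_def]] by blast
      have "S \<subseteq> J" unfolding J_def using P by (auto intro: mspan_superset)
      hence "S \<subseteq> mspan ?P F" using 1 mspan_subset[OF P F(3)] by blast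
      thus False using no F by blast
    qed
    define good where "good G g \<longleftrightarrow> g \<in> J \<and> g \<notin> mspan ?P G \<and>
        (\<forall>h. h \<in> J \<and> h \<notin> mspan ?P G \<longrightarrow> degree g \<le> degree h)" for G g
    have good_ex: "\<exists>g. good G g" if "finite G" "G \<subseteq> J" for G
      using ex_has_least_nat[of "\<lambda>g. g \<in> J \<and> g \<notin> mspan ?P G" _ degree] ex[OF that]
      unfolding good_def by metis
    define chain where "chain = rec_nat {} (\<lambda>_ G. insert (SOME g. good G g) G)"
    define g where "g n = (SOME g. good (chain n) g)" for n
    have ch: "chain 0 = {}" "\<And>n. chain (Suc n) = insert (g n) (chain n)"
      by (simp_all add: chain_def g_def)
    have fin: "finite (chain n) \<and> chain n \<subseteq> J" for n
    proof (induction n)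
      case (Suc n)
      hence "good (chain n) (g n)" unfolding g_def using good_ex someI_ex by metis
      thus ?case using Suc ch unfolding good_def by auto
    qed (simp add: ch)
    have good: "good (chain n) (g n)" for n
      unfolding g_def using good_ex[of "chain n"] fin someI_ex by metis
    have chain_eq: "chain n = g ` {..<n}" for n
      by (induction n) (auto simp: ch lessThan_Suc)
    have deg_mono: "degree (g i) \<le> degree (g n)" if "i \<le> n" for i n
    proof -
      have "chain i \<subseteq> chain n" unfolding chain_eq using that by auto
      hence "g n \<notin> mspan ?P (chain i)" using good[of n] mspan_mono unfolding good_def by blast
      thus ?thesis using good[of i] good[of n] unfolding good_def by blast
    qed
    have "range (\<lambda>n. lead_coeff (g n)) \<subseteq> A" using good JP unfolding good_def coeffs_in_def by blast
    from noetherian_module_seq[OF A N this] obtain n r where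
      r: "\<forall>i<n. r i \<in> A" "lead_coeff (g n) = (\<Sum>i<n. r i * lead_coeff (g i))" by blast
    define h where "h = (\<Sum>i<n. monom (r i) (degree (g n) - degree (g i)) * g i)"
    have h1: "h \<in> mspan ?P (chain n)" unfolding h_def chain_eq
      by (rule mspan_sum) (use r A in \<open>auto intro!: mspan_base monom_coeffs_in\<close>)
    hence hJ: "h \<in> J" using fin[of n] mspan_subset[OF P, of "chain n" S] unfolding J_def by blast
    have cf: "coeff (monom (r i) (degree (g n) - degree (g i)) * g i) (degree (g n)) = r i * lead_coeff (g i)"
      if "i < n" for i
      using deg_mono[of i n] that by (simp add: coeff_monom_mult)
    have dh: "degree h \<le> degree (g n)" unfolding h_def
    proof (rule degree_sum_le)
      fix i assume "i \<in> {..<n}"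
      hence "degree (g n) - degree (g i) + degree (g i) = degree (g n)" using deg_mono[of i n] by simp
      thus "degree (monom (r i) (degree (g n) - degree (g i)) * g i) \<le> degree (g n)"
        using degree_mult_le[of "monom (r i) (degree (g n) - degree (g i))" "g i"]
          degree_monom_le[of "r i" "degree (g n) - degree (g i)"] by linarith
    qed simp
    have ch: "coeff h (degree (g n)) = lead_coeff (g n)"
      unfolding h_def coeff_sum r(2) by (rule sum.cong) (use cf in auto)
    have notin: "g n - h \<notin> mspan ?P (chain n)"
    proof
      assume "g n - h \<in> mspan ?P (chain n)"
      from mspan_add[OF this h1] show False using good[of n] by (simp add: good_def)
    qed
    have J: "g n - h \<in> J" using good[of n] hJ P unfolding good_def J_def by (auto intro: mspan_diff)
    have "degree (g n) \<le> degree (g n - h)" using good[of n] notin J unfolding good_def by blast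
    moreover have "degree (g n - h) \<le> degree (g n)" using dh by (intro degree_diff_le) auto
    ultimately have "degree (g n - h) = degree (g n)" by simp
    hence "lead_coeff (g n - h) = 0" using ch by simp
    hence "g n - h = 0" unfolding leading_coeff_0_iff .
    thus False using notin by (simp add: mspan.zero)
  qed
qed

definition adjoin :: "'r::comm_ring_1 set \<Rightarrow> 'r \<Rightarrow> 'r set" where
  "adjoin A x = (\<lambda>p. poly p x) ` coeffs_in A"

lemma subring_adjoin:
  assumes "subring A" shows "subring (adjoin A x)"
  unfolding subring_def adjoin_def
proof (intro conjI ballI; (elim imageE)?; simp?)
  note P = subring_coeffs_in[OF assms]
  show "1 \<in> (\<lambda>p. poly p x) ` coeffs_in A" using P by (intro image_eqI[of _ _ 1]) (auto intro: subringD)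
  fix p assume p: "p \<in> coeffs_in A"
  show "- poly p x \<in> (\<lambda>p. poly p x) ` coeffs_in A"
    using P p by (intro image_eqI[of _ _ "- p"]) (auto intro: subringD)
  fix q assume q: "q \<in> coeffs_in A"
  have "p + q \<in> coeffs_in A" "p * q \<in> coeffs_in A" using P p q by (auto intro: subringD)
  thus "poly p x + poly q x \<in> (\<lambda>p. poly p x) ` coeffs_in A"
    "poly p x * poly q x \<in> (\<lambda>p. poly p x) ` coeffs_in A"
    by (metis (no_types, lifting) image_eqI poly_add, metis (no_types, lifting) image_eqI poly_mult)
qed

lemma adjoin_superset:
  assumes "subring A" shows "A \<subseteq> adjoin A x" "x \<in> adjoin A x"
proof -
  show "A \<subseteq> adjoin A x"
  proof
    fix a assume "a \<in> A"
    hence "monom a 0 \<in> coeffs_in A" using assms by (intro monom_coeffs_in)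
    thus "a \<in> adjoin A x" unfolding adjoin_def by (intro image_eqI[of _ _ "monom a 0"]) (auto simp: poly_monom)
  qed
  have "monom 1 1 \<in> coeffs_in A" using assms by (intro monom_coeffs_in subringD)
  thus "x \<in> adjoin A x" unfolding adjoin_def by (intro image_eqI[of _ _ "monom 1 1"]) (auto simp: poly_monom)
qed

lemma noetherian_adjoin:
  assumes A: "subring A" and N: "noetherian_module A A"
  shows "noetherian_module (adjoin A x) (adjoin A x)"
  unfolding noetherian_module_def
proof (intro allI impI)
  fix S assume "S \<subseteq> adjoin A x"
  then obtain S' where S': "S' \<subseteq> coeffs_in A" "S = (\<lambda>p. poly p x) ` S'"
    unfolding adjoin_def subset_image_iff by blast
  obtain F where F: "finite F" "F \<subseteq> S'" "S' \<subseteq> mspan (coeffs_in A) F"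
    using Hilbert_basis[OF assms] S'(1) unfolding noetherian_module_def by meson
  have "poly u x \<in> mspan (adjoin A x) ((\<lambda>p. poly p x) ` F)" if "u \<in> mspan (coeffs_in A) F" for u
    using that by induction (auto simp: adjoin_def intro: mspan.intros)
  thus "\<exists>F. finite F \<and> F \<subseteq> S \<and> S \<subseteq> mspan (adjoin A x) F"
    using F S' by (intro exI[of _ "(\<lambda>p. poly p x) ` F"]) auto
qed

section \<open>A criterion for integrality\<close>

lemma monic_power:
  assumes "lead_coeff C = (1::'r::comm_ring_1)" shows "lead_coeff (C ^ l) = 1"
proof (induction l)
  case (Suc l)
  have "coeff (C * C ^ l) (degree C + degree (C ^ l)) = 1"
    using assms Suc by (simp add: coeff_mult_degree_sum)
  hence "degree (C * C ^ l) = degree C + degree (C ^ l)"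
    using degree_mult_le[of C "C ^ l"] le_degree[of "C * C ^ l"] by (metis le_antisym one_neq_zero)
  thus ?case using assms Suc by (simp add: coeff_mult_degree_sum)
qed simp

text \<open>
  A monic polynomial is not a zero divisor modulo \<open>q\<close>: the leading coefficient of \<open>U\<close>
  is that of \<open>C U\<close>, hence a multiple of \<open>q\<close>, and the leading term can be subtracted.
\<close>

lemma monic_cancel:
  assumes A: "subring A" and C: "C \<in> coeffs_in A" "lead_coeff C = 1"
    and "U \<in> coeffs_in A" "W \<in> coeffs_in A" "C * U = smult q W"
  shows "\<exists>V\<in>coeffs_in A. U = smult q V"
  using assms(4-)
proof (induction "degree U" arbitrary: U W rule: less_induct)
  case less
  note P = subring_coeffs_in[OF A]
  show ?case
  proof (cases "U = 0")
    case True thus ?thesis using P by (intro bexI[of _ 0]) (auto intro: subringD)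
  next
    case U0: False
    define n where "n = degree U"
    define w where "w = coeff W (degree C + n)"
    have w: "w \<in> A" using less.prems(2) unfolding w_def coeffs_in_def by blast
    have lc: "lead_coeff U = q * w"
      using coeff_mult_degree_sum[of C U] less.prems(3) C(2) by (simp add: w_def n_def)
    define U' where "U' = U - smult q (monom w n)"
    have eq: "C * U' = smult q (W - C * monom w n)"
      unfolding U'_def using less.prems(3) by (simp add: algebra_simps smult_diff_right)
    have U'in: "U' \<in> coeffs_in A"
    proof -
      have "coeff U' i \<in> A" for i
        using less.prems(1) A lc unfolding U'_def coeffs_in_def n_def
        by (cases "i = degree U") (auto intro: subringD)
      thus ?thesis unfolding coeffs_in_def by blast
    qed
    have W'in: "W - C * monom w n \<in> coeffs_in A"
      using P C(1) less.prems(2) w A by (intro subringD(6)[OF P] subringD(3)[OF P] monom_coeffs_in) auto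
    have V: "\<exists>V\<in>coeffs_in A. U' = smult q V"
    proof (cases "U' = 0")
      case True thus ?thesis using P by (intro bexI[of _ 0]) (auto intro: subringD)
    next
      case False
      have "degree U' \<le> n" unfolding U'_def n_def smult_monom
        by (intro degree_diff_le degree_monom_le) auto
      moreover have "coeff U' n = 0" unfolding U'_def using lc by (simp add: n_def)
      ultimately have "degree U' < degree U"
        using False unfolding n_def by (metis le_neq_implies_less leading_coeff_0_iff)
      thus ?thesis using less.hyps U'in W'in eq by blast
    qed
    then obtain V where V: "V \<in> coeffs_in A" "U' = smult q V" by blast
    have "U = smult q (V + monom w n)" using V(2) unfolding U'_def by (simp add: smult_add_right algebra_simps)
    moreover have "V + monom w n \<in> coeffs_in A" using V(1) w A P by (intro subringD(2)[OF P] monom_coeffs_in)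
    ultimately show ?thesis by blast
  qed
qed

definition module_independent :: "'r::comm_ring_1 set \<Rightarrow> 'r set \<Rightarrow> bool" where
  "module_independent P B \<longleftrightarrow>
     (\<forall>g. (\<forall>b\<in>B. g b \<in> P) \<and> (\<Sum>b\<in>B. g b * b) = 0 \<longrightarrow> (\<forall>b\<in>B. g b = 0))"

text \<open>
  A finitely generated module inside a domain has finite rank: up to one denominator \<open>h\<close> it is contained in
  the free module on a maximal independent subset of its generators.
\<close>

lemma free_submodule:
  assumes P: "subring P" "P \<subseteq> Om" and Om: "subring Om" "\<forall>x\<in>Om. \<forall>y\<in>Om. x * y = 0 \<longrightarrow> x = 0 \<or> y = (0::'r::comm_ring_1)"
    and ne: "(1::'r) \<noteq> 0" and B: "finite B" "B \<subseteq> Om"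
  shows "\<exists>B'\<subseteq>B. module_independent P B' \<and> (\<exists>h\<in>P. h \<noteq> 0 \<and> (\<forall>u\<in>mspan P B. h * u \<in> mspan P B'))"
proof -
  have "module_independent P {}" by (simp add: module_independent_def)
  moreover have "\<forall>B'. B' \<subseteq> B \<and> module_independent P B' \<longrightarrow> card B' < Suc (card B)"
    using B by (auto simp: less_Suc_eq_le intro: card_mono)
  ultimately obtain B' where B': "B' \<subseteq> B" "module_independent P B'"
    and max: "\<forall>B''. B'' \<subseteq> B \<and> module_independent P B'' \<longrightarrow> card B'' \<le> card B'"
    using ex_has_greatest_nat[of "\<lambda>B'. B' \<subseteq> B \<and> module_independent P B'" "{}" card "Suc (card B)"] by auto
  have fin: "finite B'" using B' B finite_subset by blast
  have "\<exists>h\<in>P. h \<noteq> 0 \<and> h * b \<in> mspan P B'" if b: "b \<in> B" for b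
  proof (cases "b \<in> B'")
    case True thus ?thesis using P ne by (intro bexI[of _ 1]) (auto intro: mspan_superset subringD)
  next
    case False
    have "\<not> module_independent P (insert b B')"
      using max b B' False fin by (metis not_less_eq_eq order_refl card_insert_disjoint insert_subset)
    then obtain g where g: "\<forall>x\<in>insert b B'. g x \<in> P" "(\<Sum>x\<in>insert b B'. g x * x) = 0" "\<exists>x\<in>insert b B'. g x \<noteq> 0"
      unfolding module_independent_def by blast
    have s: "g b * b + (\<Sum>x\<in>B'. g x * x) = 0" using g(2) False fin by simp
    have "g b \<noteq> 0"
    proof
      assume 0: "g b = 0"
      hence "\<forall>x\<in>B'. g x = 0" using s B'(2) g(1) unfolding module_independent_def by auto
      thus False using g(3) 0 by auto
    qed
    moreover have "g b * b = - (\<Sum>x\<in>B'. g x * x)" using s by (simp add: eq_neg_iff_add_eq_0)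
    moreover have "- (\<Sum>x\<in>B'. g x * x) \<in> mspan P B'"
      using g(1) by (intro mspan_uminus[OF P(1)] mspan_sum mspan_base) auto
    ultimately show ?thesis using g(1) by auto
  qed
  then obtain h where h: "\<forall>b\<in>B. h b \<in> P \<and> h b \<noteq> 0 \<and> h b * b \<in> mspan P B'" by metis
  have prod: "(\<Prod>b\<in>F. h b) \<in> P \<and> (\<Prod>b\<in>F. h b) \<noteq> 0" if "F \<subseteq> B" for F
    using finite_subset[OF that B(1)] that
  proof induction
    case empty thus ?case using ne P by (auto intro: subringD)
  next
    case (insert x F)
    hence 1: "h x \<in> P" "h x \<noteq> 0" "prod h F \<in> P" "prod h F \<noteq> 0" using h by auto
    hence "h x * prod h F \<noteq> 0" "h x * prod h F \<in> P" using Om(2) P subringD(3)[OF P(1)] by blast+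
    thus ?case using insert.hyps by simp
  qed
  define H where "H = (\<Prod>b\<in>B. h b)"
  have "H * u \<in> mspan P B'" if "u \<in> mspan P B" for u
    using that
  proof induction
    case (step p b u)
    have "H * b = (\<Prod>b\<in>B - {b}. h b) * (h b * b)"
      unfolding H_def using step(2) B(1) by (simp add: prod.remove mult_ac)
    also have "\<dots> \<in> mspan P B'"
      by (rule mspan_scale[OF P(1)]) (use h prod[of "B - {b}"] step in auto)
    finally have "H * b \<in> mspan P B'" .
    hence "p * (H * b) + H * u \<in> mspan P B'"
      using mspan_add[OF mspan_scale[OF P(1) _ step(1)] step.IH] by blast
    thus ?case by (simp add: algebra_simps)
  qed (auto intro: mspan.zero)
  thus ?thesis using B' prod[of B] H_def by blast
qed

text \<open>
  Let \<open>P = A[y]\<close> be a polynomial ring over a domain and \<open>R\<close> a finite extension domain of it. An element \<open>t\<close>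
  that satisfies an equation over \<open>R\<close> with leading coefficient \<open>p \<in> A\<close>, and also has a
  denominator \<open>C(y)\<close> that is monic in \<open>y\<close>, is integral over \<open>P\<close>. Indeed, the elements \<open>H t\<^sup>l\<close>, for a
  suitable fixed \<open>H\<close>, become elements of a free module after multiplication by a power of \<open>p\<close>, and also after
  multiplication by a power of \<open>C(y)\<close>; since a monic polynomial is not a zero divisor modulo any power of \<open>p\<close>, they
  lie in the free module itself, which is noetherian.
\<close>

lemma integral_if_coprime_denominators:
  fixes t :: "'r::comm_ring_1"
  assumes Om: "subring Om" "\<forall>x\<in>Om. \<forall>y\<in>Om. x * y = 0 \<longrightarrow> x = 0 \<or> y = 0"
    and A: "subring A" "A \<subseteq> Om" and P: "P = adjoin A y" and y: "y \<in> Om"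
    and tr: "\<forall>Q\<in>coeffs_in A. poly Q y = 0 \<longrightarrow> Q = 0"
    and R: "subring R" "R \<subseteq> Om" "P \<subseteq> R" "R = mspan P B" "finite B"
    and N: "noetherian_module P P"
    and C: "C \<in> coeffs_in A" "lead_coeff C = 1" "poly C y * t \<in> R"
    and t: "t \<in> Om" and p: "p \<in> A" "p \<noteq> 0"
    and rel: "p * t ^ I = (\<Sum>i<I. r i * t ^ i)" "\<forall>i<I. r i \<in> R"
  shows "\<exists>n r. (\<forall>i<n. r i \<in> P) \<and> t ^ n = (\<Sum>i<n. r i * t ^ i)"
proof (cases "t = 0")
  case True
  thus ?thesis using subringD(5)[OF subring_adjoin[OF A(1)]] P
    by (intro exI[of _ 1] exI[of _ "\<lambda>_. 0"]) simp
next
  case t0: False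
  have sP: "subring P" unfolding P by (rule subring_adjoin[OF A(1)])
  have AP: "A \<subseteq> P" unfolding P by (rule adjoin_superset[OF A(1)])
  have ne: "(1::'r) \<noteq> 0" using p by (metis mult.right_neutral mult_zero_right)
  define c where "c = poly C y"
  have cP: "c \<in> P" unfolding c_def P adjoin_def using C by blast
  have "C \<noteq> 0" using C(2) ne by auto
  hence c0: "c \<noteq> 0" using tr C unfolding c_def by blast
  have nz: "x ^ n \<noteq> 0" if "x \<in> Om" "x \<noteq> 0" for x n
  proof (induction n)
    case (Suc n)
    thus ?case using Om(2) that subringD(7)[OF Om(1) that(1), of n] by auto
  qed (use ne in simp)
  have pO: "p \<in> Om" and cO: "c \<in> Om" and PO: "P \<subseteq> Om" using p A R cP by auto
  \<comment> \<open>\<open>M\<close> is preserved by \<open>p t\<close>, so it contains \<open>p\<^sup>l\<^sup>+\<^sup>1 t\<^sup>I\<^sup>+\<^sup>l\<close> for all \<open>l\<close>; and \<open>c\<^sup>I\<close> moves it into \<open>R\<close>.\<close>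
  define M where "M = mspan R ((\<lambda>i. t ^ i) ` {..<I})"
  have relM: "p * t ^ I \<in> M" unfolding rel(1) M_def using rel(2) by (auto intro!: mspan_sum mspan_base)
  have step: "p * t * u \<in> M" if "u \<in> M" for u
    using that unfolding M_def
  proof induction
    case (step q s u)
    then obtain i where i: "i < I" "s = t ^ i" by auto
    have "p * t * s \<in> M"
    proof (cases "Suc i = I")
      case True thus ?thesis using relM i by (simp add: mult.assoc flip: power_Suc)
    next
      case False
      hence "t ^ Suc i \<in> (\<lambda>i. t ^ i) ` {..<I}" using i by (intro imageI) auto
      moreover have "p \<in> R" using p AP R by blast
      ultimately have "p * t ^ Suc i \<in> M" unfolding M_def by (rule mspan_base[rotated])
      thus ?thesis using i by (simp add: mult.assoc)
    qed
    hence "q * (p * t * s) + p * t * u \<in> M"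
      using mspan_add[OF mspan_scale[OF R(1) _ step(1)] step.IH] unfolding M_def by blast
    thus ?case unfolding M_def by (simp add: algebra_simps)
  qed (auto intro: mspan.zero)
  have pow: "p ^ Suc l * t ^ (I + l) \<in> M" for l
  proof (induction l)
    case (Suc l)
    have "p * t * (p ^ Suc l * t ^ (I + l)) \<in> M" using step[OF Suc] .
    thus ?case by (simp add: mult_ac)
  qed (use relM in simp)
  have cM: "c ^ I * u \<in> R" if "u \<in> M" for u
    using that unfolding M_def
  proof induction
    case (step q s u)
    then obtain i where i: "i < I" "s = t ^ i" by auto
    have "c ^ I * s = c ^ (I - i) * (c * t) ^ i"
      using i by (simp add: power_mult_distrib mult.assoc[symmetric] flip: power_add)
    also have "\<dots> \<in> R" 
      by (rule subringD(3)[OF R(1) subringD(7)[OF R(1)] subringD(7)[OF R(1)]])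
        (use cP R(3) C(3) c_def in auto)
    finally have "q * (c ^ I * s) + c ^ I * u \<in> R"
      using subringD(2)[OF R(1) subringD(3)[OF R(1) step(1)] step.IH] by blast
    thus ?case by (simp add: algebra_simps)
  qed (use R in \<open>auto intro: subringD\<close>)
  have BR: "B \<subseteq> R" using R(4) sP by (auto intro: mspan_superset)
  obtain B' h where B': "B' \<subseteq> B" "module_independent P B'" and h: "h \<in> P" "h \<noteq> 0"
    "\<forall>u\<in>mspan P B. h * u \<in> mspan P B'"
    using free_submodule[OF sP PO Om ne R(5) order_trans[OF BR R(2)]] by blast
  have finB': "finite B'" using B' R finite_subset by blast
  have coords: "\<exists>g. (\<forall>b\<in>B'. g b \<in> coeffs_in A) \<and> h * u = (\<Sum>b\<in>B'. poly (g b) y * b)" if "u \<in> R" for u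
  proof -
    have "h * u \<in> mspan P (id ` B')" using h(3) that unfolding R(4) by simp
    then obtain g where g: "\<forall>b\<in>B'. g b \<in> P" "h * u = (\<Sum>b\<in>B'. g b * b)"
      unfolding mspan_image[OF sP finB'] by auto
    have "\<forall>b\<in>B'. \<exists>G. G \<in> coeffs_in A \<and> g b = poly G y" using g(1) unfolding P adjoin_def by blast
    then obtain G where "\<forall>b\<in>B'. G b \<in> coeffs_in A \<and> g b = poly (G b) y" by metis
    thus ?thesis using g(2) by (intro exI[of _ G]) auto
  qed
  define H where "H = h * c ^ I * t ^ I"
  have H0: "H \<noteq> 0"
    unfolding H_def using Om nz[OF cO c0] nz[OF t t0] h PO cO t by (metis subringD(3) subringD(7) subsetD)
  have HO: "H \<in> Om" unfolding H_def using h PO cO t Om by (intro subringD(3) subringD(7)) auto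
  have mem: "H * t ^ l \<in> R" for l
  proof -
    define g where "g = c ^ I * t ^ (I + l)"
    have gO: "g \<in> Om" unfolding g_def using cO t Om by (intro subringD(3) subringD(7))
    have 1: "p ^ Suc l * g \<in> R" using cM[OF pow[of l]] by (simp add: g_def mult_ac)
    have "c ^ l * g = (c * t) ^ (I + l)" by (simp add: g_def power_mult_distrib power_add mult_ac)
    hence 2: "c ^ l * g \<in> R" using C(3) R unfolding c_def[symmetric] by (auto intro: subringD)
    \<comment> \<open>The coordinates of \<open>h g\<close> in the free module, after multiplication by a power of \<open>p\<close> for \<open>U\<close>, and of \<open>c\<close> for \<open>W\<close>.\<close>
    obtain U where U: "\<forall>b\<in>B'. U b \<in> coeffs_in A" "h * (p ^ Suc l * g) = (\<Sum>b\<in>B'. poly (U b) y * b)"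
      using coords[OF 1] by blast
    obtain W where W: "\<forall>b\<in>B'. W b \<in> coeffs_in A" "h * (c ^ l * g) = (\<Sum>b\<in>B'. poly (W b) y * b)"
      using coords[OF 2] by blast
    have q: "p ^ Suc l \<in> A" using p A by (auto intro: subringD)
    have eq: "C ^ l * U b = smult (p ^ Suc l) (W b)" if b: "b \<in> B'" for b
    proof -
      define Z where "Z b = C ^ l * U b - smult (p ^ Suc l) (W b)" for b
      have Zin: "Z b \<in> coeffs_in A" if "b \<in> B'" for b
      proof -
        have "smult (p ^ Suc l) (W b) = monom (p ^ Suc l) 0 * W b" by (simp add: monom_0)
        thus ?thesis unfolding Z_def using U W C that q A subring_coeffs_in[OF A(1)]
          by (auto intro!: subringD(6) subringD(3) subringD(7) monom_coeffs_in)
      qed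
      have "(\<Sum>b\<in>B'. poly (Z b) y * b) = c ^ l * (h * (p ^ Suc l * g)) - p ^ Suc l * (h * (c ^ l * g))"
        unfolding U(2) W(2) unfolding Z_def c_def
        by (simp add: sum_distrib_left sum_subtractf left_diff_distrib mult.assoc poly_power del: power_Suc)
      also have "\<dots> = 0" by (simp add: mult_ac)
      finally have "(\<Sum>b\<in>B'. poly (Z b) y * b) = 0" .
      moreover have "\<forall>b\<in>B'. poly (Z b) y \<in> P" using Zin unfolding P adjoin_def by blast
      ultimately have "\<forall>b\<in>B'. poly (Z b) y = 0"
        using B'(2)[unfolded module_independent_def, rule_format, of "\<lambda>b. poly (Z b) y"] by blast
      hence "poly (Z b) y = 0" using b by blast
      hence "Z b = 0" using tr Zin b by blast
      thus ?thesis unfolding Z_def by simp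
    qed
    have lc: "lead_coeff (C ^ l) = 1" by (rule monic_power[OF C(2)])
    have "\<exists>V\<in>coeffs_in A. U b = smult (p ^ Suc l) V" if "b \<in> B'" for b
      using monic_cancel[OF A(1) _ lc _ _ eq[OF that]] U W that C subring_coeffs_in[OF A(1)]
      by (auto intro: subringD)
    then obtain V where V: "\<forall>b\<in>B'. V b \<in> coeffs_in A \<and> U b = smult (p ^ Suc l) (V b)" by metis
    define v where "v = (\<Sum>b\<in>B'. poly (V b) y * b)"
    have vR: "v \<in> R" unfolding v_def R(4) using V B' P
      by (auto intro!: mspan_sum mspan_base simp: adjoin_def)
    have "p ^ Suc l * v = (\<Sum>b\<in>B'. poly (U b) y * b)"
      unfolding v_def sum_distrib_left using V by (intro sum.cong) (auto simp del: power_Suc simp: mult.assoc)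
    hence "p ^ Suc l * (h * g - v) = 0" unfolding U(2)[symmetric] by (simp add: algebra_simps)
    moreover have "h * g - v \<in> Om" using h PO gO vR R(2) Om by (intro subringD(6) subringD(3)) auto
    ultimately have "h * g = v" using Om nz[OF pO p(2), of "Suc l"] subringD(7)[OF Om(1) pO] by (metis eq_iff_diff_eq_0)
    moreover have "H * t ^ l = h * g" by (simp add: H_def g_def power_add mult_ac)
    ultimately show ?thesis using vR by simp
  qed
  have "noetherian_module P R" unfolding R(4) by (rule noetherian_module_finite[OF sP N R(5)])
  moreover have "range (\<lambda>l. H * t ^ l) \<subseteq> R" using mem by blast
  ultimately obtain n s where s: "\<forall>i<n. s i \<in> P" "H * t ^ n = (\<Sum>i<n. s i * (H * t ^ i))"
    using noetherian_module_seq[OF sP] by blast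
  have "H * (t ^ n - (\<Sum>i<n. s i * t ^ i)) = 0"
    using s(2) by (simp add: right_diff_distrib sum_distrib_left mult_ac)
  moreover have "t ^ n - (\<Sum>i<n. s i * t ^ i) \<in> Om"
    using t Om s(1) PO by (intro subringD(6) subringD(7) subring_sum subringD(3)) auto
  ultimately have "t ^ n = (\<Sum>i<n. s i * t ^ i)" using Om(2) H0 HO by (metis eq_iff_diff_eq_0)
  thus ?thesis using s(1) by blast
qed

section \<open>Homogeneous polynomial functions\<close>

global_interpretation fv: vector_space "\<lambda>(c::complex) (s::'z \<Rightarrow> complex) x. c * s x"
  by standard (auto simp: fun_eq_iff algebra_simps)

lemma homogeneous_zero: "homogeneous d (\<lambda>v. 0)"
proof (induction d)
  case 0 show ?case by (rule homogeneous.const)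
next
  case (Suc d)
  show ?case using homogeneous.mult[OF Suc homogeneous.coord[of 0]] by simp
qed

lemma homogeneous_scale: "homogeneous d p \<Longrightarrow> homogeneous d (\<lambda>v. c * p v)"
  using homogeneous.mult[OF homogeneous.const, of d p c] by simp

lemma homogeneous_sum:
  "(\<And>i. i \<in> I \<Longrightarrow> homogeneous d (p i)) \<Longrightarrow> homogeneous d (\<lambda>v. \<Sum>i\<in>I. p i v)"
  by (induction I rule: infinite_finite_induct) (auto intro: homogeneous_zero homogeneous.add)

lemma homogeneous_coord: "homogeneous (Suc 0) (\<lambda>v. v i)"
  using homogeneous.coord by simp

lemma homogeneous_one: "homogeneous 0 (\<lambda>v. 1)" by (rule homogeneous.const)

lemma homogeneous_power:
  assumes "homogeneous d p" shows "homogeneous (n * d) (\<lambda>v. p v ^ n)"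
proof (induction n)
  case (Suc n) thus ?case using homogeneous.mult[OF assms Suc] by simp
qed (simp add: homogeneous_one)

lemma homogeneous_prod:
  "finite I \<Longrightarrow> (\<And>i. i \<in> I \<Longrightarrow> homogeneous (d i) (p i)) \<Longrightarrow>
    homogeneous (\<Sum>i\<in>I. d i) (\<lambda>v. \<Prod>i\<in>I. p i v)"
  by (induction I rule: finite_induct) (auto intro: homogeneous_one homogeneous.mult)

lemma homogeneous_compose:
  assumes "homogeneous d p" and Q: "\<And>i. homogeneous e (Q i)"
  shows "homogeneous (d * e) (\<lambda>v. p (\<lambda>i. Q i v))"
  using assms(1)
proof induction
  case (mult d p d' q) thus ?case using homogeneous.mult[OF mult.IH] by (simp add: add_mult_distrib)
qed (auto intro: homogeneous.intros Q)

lemma homogeneous_linear_compose: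
  "homogeneous d p \<Longrightarrow> (\<And>i. homogeneous 1 (Q i)) \<Longrightarrow> homogeneous d (\<lambda>v. p (\<lambda>i. Q i v))"
  using homogeneous_compose[of d p 1 Q] by simp

lemma homogeneous_degree_0: "homogeneous 0 p \<Longrightarrow> p v = p w"
  using homogeneous_line[of 0 p 0 v] homogeneous_line[of 0 p 0 w] by simp

lemma homogeneous_at_0: "homogeneous d p \<Longrightarrow> d > 0 \<Longrightarrow> p (\<lambda>i. 0) = 0"
  using homogeneous_line[of d p 0 "\<lambda>i. 0"] by (simp add: power_0_left)

definition trunc :: "nat \<Rightarrow> cvec \<Rightarrow> cvec" where
  "trunc n v = (\<lambda>i. if i < n then v i else 0)"

lemma trunc_simps [simp]:
  "i < n \<Longrightarrow> trunc n v i = v i" "\<not> i < n \<Longrightarrow> trunc n v i = 0" "trunc n (trunc n v) = trunc n v"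
  "trunc n (trunc (Suc n) v) = trunc n v" "trunc (Suc n) (trunc n v) = trunc n v"
  "trunc n (v(n := c)) = trunc n v"
  by (auto simp: trunc_def)

lemma trunc_scale: "trunc n (\<lambda>i. c * v i) = (\<lambda>i. c * trunc n v i)"
  by (auto simp: trunc_def)

lemma homogeneous_trunc: "homogeneous d p \<Longrightarrow> homogeneous d (\<lambda>v. p (trunc n v))"
proof -
  assume p: "homogeneous d p"
  have "homogeneous 1 (\<lambda>v. trunc n v i)" for i
    by (cases "i < n") (auto intro: homogeneous_zero homogeneous_coord)
  from homogeneous_linear_compose[OF p this] show ?thesis by simp
qed

text \<open>
  A form is only known as a function, so its coefficients with respect to one variable are constructed along
  with it.
\<close>

lemma homogeneous_expand:
  assumes "homogeneous k p"
  shows "\<exists>f. (\<forall>i. homogeneous (k - i) (f i)) \<and> (\<forall>i>k. f i = (\<lambda>v. 0)) \<and>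
    (\<forall>v. p (trunc (Suc n) v) = (\<Sum>i\<le>k. f i (trunc n v) * v n ^ i))"
  using assms
proof induction
  case (const c)
  show ?case
    by (intro exI[of _ "\<lambda>i. if i = 0 then (\<lambda>v. c) else (\<lambda>v. 0)"])
      (auto intro: homogeneous.const)
next
  case (coord i)
  show ?case
  proof (cases "i = n")
    case True
    thus ?thesis by (intro exI[of _ "\<lambda>j. if j = 1 then (\<lambda>v. 1) else (\<lambda>v. 0)"])
      (auto intro: homogeneous.const homogeneous_zero)
  next
    case False
    have eq: "trunc (Suc n) v i = trunc n v i" for v using False by (auto simp: trunc_def)
    show ?thesis by (intro exI[of _ "\<lambda>j. if j = 0 then (\<lambda>v. v i) else (\<lambda>v. 0)"])
      (auto intro: homogeneous_coord homogeneous_zero simp: eq)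
  qed
next
  case (add d p q)
  then obtain f g where
    "\<forall>i. homogeneous (d - i) (f i)" "\<forall>i>d. f i = (\<lambda>v. 0)"
    "\<forall>v. p (trunc (Suc n) v) = (\<Sum>i\<le>d. f i (trunc n v) * v n ^ i)"
    "\<forall>i. homogeneous (d - i) (g i)" "\<forall>i>d. g i = (\<lambda>v. 0)"
    "\<forall>v. q (trunc (Suc n) v) = (\<Sum>i\<le>d. g i (trunc n v) * v n ^ i)" by blast
  thus ?case by (intro exI[of _ "\<lambda>i v. f i v + g i v"])
    (auto intro: homogeneous.add simp: sum.distrib algebra_simps)
next
  case (mult d p e q)
  from mult.IH(1) obtain f where f: "\<forall>i. homogeneous (d - i) (f i)" "\<forall>i>d. f i = (\<lambda>v. 0)"
    "\<forall>v. p (trunc (Suc n) v) = (\<Sum>i\<le>d. f i (trunc n v) * v n ^ i)" by blast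
  from mult.IH(2) obtain g where g: "\<forall>i. homogeneous (e - i) (g i)" "\<forall>i>e. g i = (\<lambda>v. 0)"
    "\<forall>v. q (trunc (Suc n) v) = (\<Sum>i\<le>e. g i (trunc n v) * v n ^ i)" by blast
  have h: "homogeneous (d + e - r) (\<lambda>v. f k v * g (r - k) v)" if "k \<le> r" for k r
  proof (cases "k \<le> d \<and> r - k \<le> e")
    case True
    hence "d + e - r = (d - k) + (e - (r - k))" using that by linarith
    thus ?thesis using homogeneous.mult[of "d - k" "f k" "e - (r - k)" "g (r - k)"] f g by simp
  next
    case False
    hence "(\<lambda>v. f k v * g (r - k) v) = (\<lambda>v. 0)" using f g by (auto simp: not_le)
    thus ?thesis by (simp add: homogeneous_zero)
  qed
  have z: "(\<Sum>k\<le>r. f k v * g (r - k) v) = 0" if "r > d + e" for r v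
  proof (rule sum.neutral, intro ballI)
    fix k assume "k \<in> {..r}"
    hence "k > d \<or> r - k > e" using that by auto
    thus "f k v * g (r - k) v = 0" using f g by auto
  qed
  show ?case
    by (intro exI[of _ "\<lambda>r v. \<Sum>k\<le>r. f k v * g (r - k) v"] conjI allI)
      (auto intro!: homogeneous_sum h simp: f g z polynomial_product)
qed

lemma zero_in_span: "(\<lambda>x. 0) \<in> fv.span W"
  using fv.span_zero[of W] by (simp add: zero_fun_def)

section \<open>Graded rings of forms\<close>

definition forms :: "nat \<Rightarrow> ('z \<Rightarrow> cvec) \<Rightarrow> nat \<Rightarrow> ('z \<Rightarrow> complex) set" where
  "forms n y k = {\<lambda>z. p (trunc n (y z)) |p. homogeneous k p}"

text \<open>
  Algebraic independence of the first \<open>n\<close> coordinates as functions of \<open>z\<close>; forms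
  suffice to test it.
\<close>

definition independent_coords :: "nat \<Rightarrow> ('z \<Rightarrow> cvec) \<Rightarrow> bool" where
  "independent_coords n y \<longleftrightarrow>
     (\<forall>k p. homogeneous k p \<and> (\<forall>z. p (trunc n (y z)) = 0) \<longrightarrow> (\<forall>v. p (trunc n v) = 0))"

lemma formsI: "homogeneous k p \<Longrightarrow> (\<lambda>z. p (trunc n (y z))) \<in> forms n y k"
  unfolding forms_def by auto

lemma subspace_forms: "fv.subspace (forms n y k)"
  unfolding fv.subspace_def
proof (intro conjI ballI allI)
  show "0 \<in> forms n y k" unfolding forms_def using homogeneous_zero by (auto simp: fun_eq_iff)
  fix f assume "f \<in> forms n y k"
  then obtain p where p: "homogeneous k p" "f = (\<lambda>z. p (trunc n (y z)))" unfolding forms_def by auto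
  show "(\<lambda>x. c * f x) \<in> forms n y k" for c
    using formsI[OF homogeneous_scale[OF p(1)]] p(2) by simp
  fix g assume "g \<in> forms n y k"
  then obtain q where q: "homogeneous k q" "g = (\<lambda>z. q (trunc n (y z)))" unfolding forms_def by auto
  have "f + g = (\<lambda>z. p (trunc n (y z)) + q (trunc n (y z)))" using p q by (auto simp: fun_eq_iff)
  thus "f + g \<in> forms n y k"
    using formsI[OF homogeneous.add[OF p(1) q(1)]] by simp
qed

lemma forms_mult: "f \<in> forms n y k \<Longrightarrow> g \<in> forms n y l \<Longrightarrow> f * g \<in> forms n y (k + l)"
proof -
  assume "f \<in> forms n y k" "g \<in> forms n y l"
  then obtain p q where "homogeneous k p" "f = (\<lambda>z. p (trunc n (y z)))"
    "homogeneous l q" "g = (\<lambda>z. q (trunc n (y z)))" unfolding forms_def by auto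
  thus "f * g \<in> forms n y (k + l)"
    unfolding forms_def using homogeneous.mult[of k p l q] by (auto simp: fun_eq_iff)
qed

lemma coord_in_forms: "i < n \<Longrightarrow> (\<lambda>z. y z i) \<in> forms n y 1"
  unfolding forms_def using homogeneous.coord[of i] by (intro CollectI exI[of _ "\<lambda>v. v i"]) auto

lemma forms_0: "forms n y 0 = range (\<lambda>c z. c)"
proof
  show "forms n y 0 \<subseteq> range (\<lambda>c z. c)"
  proof
    fix f assume "f \<in> forms n y 0"
    then obtain p where p: "homogeneous 0 p" "f = (\<lambda>z. p (trunc n (y z)))" unfolding forms_def by auto
    have "f = (\<lambda>z. p (\<lambda>_. 0))" unfolding p(2) using homogeneous_degree_0[OF p(1)] by (simp add: fun_eq_iff)
    thus "f \<in> range (\<lambda>c z. c)" by blast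
  qed
  show "range (\<lambda>c z. c) \<subseteq> forms n y 0" using formsI[OF homogeneous.const] by blast
qed

definition exponents :: "nat \<Rightarrow> nat \<Rightarrow> (nat \<Rightarrow> nat) set" where
  "exponents n k = {a. (\<forall>i\<ge>n. a i = 0) \<and> (\<Sum>i<n. a i) = k}"

definition monomial :: "nat \<Rightarrow> (nat \<Rightarrow> nat) \<Rightarrow> cvec \<Rightarrow> complex" where
  "monomial n a v = (\<Prod>i<n. v i ^ a i)"

lemma homogeneous_monomial: "homogeneous (\<Sum>i<n. a i) (monomial n a)"
  unfolding monomial_def
  using homogeneous_prod[of "{..<n}" a "\<lambda>i v. v i ^ a i"] homogeneous_power[OF homogeneous.coord] by simp

lemma exponents_le: "a \<in> exponents n k \<Longrightarrow> a i \<le> k"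
  by (cases "i < n") (auto simp: exponents_def intro: member_le_sum)

lemma finite_card_exponents: "finite (exponents n k)" "card (exponents n k) \<le> (k + 1) ^ (n - 1)"
proof -
  let ?f = "\<lambda>a. restrict a {..<n - 1}" and ?T = "{..<n - 1} \<rightarrow>\<^sub>E {..k}"
  have inj: "inj_on ?f (exponents n k)"
  proof (rule inj_onI)
    fix a b assume a: "a \<in> exponents n k" and b: "b \<in> exponents n k" and eq: "?f a = ?f b"
    have e: "a i = b i" if "i < n - 1" for i using fun_cong[OF eq, of i] that by (simp add: restrict_def)
    show "a = b"
    proof
      fix i
      consider "i < n - 1" | "i \<ge> n" | "n = Suc i" by linarith
      thus "a i = b i"
      proof cases
        case 3
        have "(\<Sum>j<i. a j) = (\<Sum>j<i. b j)" using e 3 by (intro sum.cong) auto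
        thus ?thesis using a b 3 by (auto simp: exponents_def)
      qed (use e a b in \<open>auto simp: exponents_def\<close>)
    qed
  qed
  have im: "?f ` exponents n k \<subseteq> ?T" using exponents_le by (auto simp: PiE_def)
  have fin: "finite ?T" by (intro finite_PiE) auto
  show "finite (exponents n k)" using inj_on_finite[OF inj im fin] .
  have "card (exponents n k) \<le> card ?T" by (rule card_inj_on_le[OF inj im fin])
  also have "\<dots> = (k + 1) ^ (n - 1)" by (simp add: card_PiE)
  finally show "card (exponents n k) \<le> (k + 1) ^ (n - 1)" .
qed

lemma span_mult:
  assumes "f \<in> fv.span U" "g \<in> fv.span V" "\<And>u v. u \<in> U \<Longrightarrow> v \<in> V \<Longrightarrow> u * v \<in> fv.span W"
  shows "f * g \<in> fv.span W"
proof -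
  have 1: "u * g \<in> fv.span W" if "u \<in> U" for u
    using assms(2)
  proof (induction rule: fv.span_induct_alt)
    case base show ?case by (simp add: zero_in_span fv.span_zero)
  next
    case (step c v w)
    have eq: "u * ((\<lambda>x. c * v x) + w) = (\<lambda>x. c * (u * v) x) + u * w" by (auto simp: fun_eq_iff algebra_simps)
    show ?case unfolding eq by (rule fv.span_add[OF fv.span_scale[OF assms(3)[OF that step(1)]] step(2)])
  qed
  show ?thesis using assms(1)
  proof (induction rule: fv.span_induct_alt)
    case base show ?case by (simp add: zero_in_span fv.span_zero)
  next
    case (step c u w)
    have eq: "((\<lambda>x. c * u x) + w) * g = (\<lambda>x. c * (u * g) x) + w * g" by (auto simp: fun_eq_iff algebra_simps)
    show ?case unfolding eq by (rule fv.span_add[OF fv.span_scale[OF 1[OF step(1)]] step(2)])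
  qed
qed

lemma monomial_mult: "monomial n a v * monomial n b v = monomial n (\<lambda>i. a i + b i) v"
  by (simp add: monomial_def power_add prod.distrib)

lemma homogeneous_span_monomials:
  assumes "homogeneous k p"
  shows "(\<lambda>v. p (trunc n v)) \<in> fv.span (monomial n ` exponents n k)"
  using assms
proof induction
  case (const c)
  have "monomial n (\<lambda>_. 0) \<in> monomial n ` exponents n 0" by (auto simp: exponents_def)
  hence "(\<lambda>x. c * monomial n (\<lambda>_. 0) x) \<in> fv.span (monomial n ` exponents n 0)"
    by (intro fv.span_scale fv.span_base)
  moreover have "(\<lambda>x. c * monomial n (\<lambda>_. 0) x) = (\<lambda>x. c)" by (simp add: monomial_def)
  ultimately show ?case by simp
next
  case (coord i)
  show ?case
  proof (cases "i < n")
    case True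
    let ?a = "\<lambda>j. if j = i then 1 else (0::nat)"
    have a: "?a \<in> exponents n 1" using True by (auto simp: exponents_def)
    have "monomial n ?a = (\<lambda>v. trunc n v i)"
    proof
      fix v
      have "monomial n ?a v = (\<Prod>j<n. if j = i then v j else 1)"
        unfolding monomial_def by (intro prod.cong) auto
      thus "monomial n ?a v = trunc n v i" using True by simp
    qed
    thus ?thesis using fv.span_base[of "monomial n ?a"] a by (metis imageI)
  next
    case False
    thus ?thesis using fv.span_zero[of "monomial n ` exponents n 1"] by (simp add: zero_fun_def)
  qed
next
  case (add d p q)
  thus ?case using fv.span_add[OF add.IH] by (simp add: plus_fun_def)
next
  case (mult d p e q)
  have "(\<lambda>v. p (trunc n v)) * (\<lambda>v. q (trunc n v)) \<in> fv.span (monomial n ` exponents n (d + e))"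
  proof (rule span_mult[OF mult.IH], elim imageE, simp only:)
    fix a b assume "a \<in> exponents n d" "b \<in> exponents n e"
    hence "(\<lambda>i. a i + b i) \<in> exponents n (d + e)" by (auto simp: exponents_def sum.distrib)
    moreover have "monomial n a * monomial n b = monomial n (\<lambda>i. a i + b i)"
      using monomial_mult by (auto simp: fun_eq_iff)
    ultimately show "monomial n a * monomial n b \<in> fv.span (monomial n ` exponents n (d + e))"
      by (auto intro: fv.span_base)
  qed
  thus ?case by (simp add: times_fun_def)
qed

lemma span_precompose:
  assumes "f \<in> fv.span U" shows "(\<lambda>z. f (h z)) \<in> fv.span ((\<lambda>u z. u (h z)) ` U)"
  using assms
proof (induction rule: fv.span_induct_alt)
  case base show ?case using fv.span_zero[of "(\<lambda>u z. u (h z)) ` U"] by (simp add: zero_fun_def)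
next
  case (step c u w)
  have "(\<lambda>z. c * u (h z)) + (\<lambda>z. w (h z)) \<in> fv.span ((\<lambda>u z. u (h z)) ` U)"
    by (rule fv.span_add[OF fv.span_scale[OF fv.span_base] step(2)]) (use step in auto)
  thus ?case by (simp add: plus_fun_def)
qed

lemma forms_span_monomials:
  "forms n y k \<subseteq> fv.span ((\<lambda>a z. monomial n a (y z)) ` exponents n k)"
proof
  fix f assume "f \<in> forms n y k"
  then obtain p where p: "homogeneous k p" "f = (\<lambda>z. p (trunc n (y z)))" unfolding forms_def by auto
  from span_precompose[OF homogeneous_span_monomials[OF p(1), of n], of y]
  show "f \<in> fv.span ((\<lambda>a z. monomial n a (y z)) ` exponents n k)" by (simp add: p(2) image_image)
qed

text \<open>
  By induction on the number of variables, because a polynomial in the last variable that vanishes everywhere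
  has zero coefficients.
\<close>

lemma monomials_independent:
  assumes "finite F" "\<forall>a\<in>F. \<forall>i\<ge>n. a i = (0::nat)" "\<forall>v. (\<Sum>a\<in>F. c a * monomial n a v) = 0"
  shows "\<forall>a\<in>F. c a = 0"
  using assms
proof (induction n arbitrary: F c)
  case 0
  hence "F \<subseteq> {\<lambda>i. 0}" by (auto simp: fun_eq_iff)
  hence "F = {} \<or> F = {\<lambda>i. 0}" by blast
  thus ?case using 0(3) by (auto simp: monomial_def)
next
  case (Suc n)
  show ?case
  proof
    fix a0 assume a0: "a0 \<in> F"
    define G where "G = {a\<in>F. a n = a0 n}"
    define H where "H = (\<lambda>a. a(n := 0)) ` G"
    have inj: "inj_on (\<lambda>a. a(n := 0::nat)) G"
    proof (rule inj_onI)
      fix a b assume ab: "a \<in> G" "b \<in> G" "a(n := 0) = b(n := 0)"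
      show "a = b"
      proof
        fix i show "a i = b i" using fun_cong[OF ab(3), of i] ab(1,2) by (cases "i = n") (auto simp: G_def)
      qed
    qed
    have z: "(\<Sum>a\<in>G. c a * monomial n a v) = 0" for v
    proof -
      define Q where "Q = (\<Sum>a\<in>F. monom (c a * monomial n a v) (a n))"
      have "poly Q x = 0" for x
      proof -
        have "poly Q x = (\<Sum>a\<in>F. c a * monomial (Suc n) a (v(n := x)))"
          unfolding Q_def poly_sum by (intro sum.cong) (auto simp: poly_monom monomial_def)
        thus ?thesis using Suc.prems(3) by simp
      qed
      hence "Q = 0" using poly_all_0_iff_0 by blast
      hence "0 = coeff Q (a0 n)" by simp
      also have "\<dots> = (\<Sum>a\<in>F. if a n = a0 n then c a * monomial n a v else 0)"
        unfolding Q_def coeff_sum by (intro sum.cong) auto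
      also have "\<dots> = (\<Sum>a\<in>G. c a * monomial n a v)"
        unfolding G_def using Suc.prems(1) by (simp add: sum.inter_filter)
      finally show ?thesis by simp
    qed
    have "\<forall>b\<in>H. c (b(n := a0 n)) = 0"
    proof (rule Suc.IH)
      show "finite H" unfolding H_def G_def using Suc.prems(1) by simp
      show "\<forall>a\<in>H. \<forall>i\<ge>n. a i = 0" unfolding H_def G_def using Suc.prems(2) by (auto simp: le_Suc_eq)
      show "\<forall>v. (\<Sum>b\<in>H. c (b(n := a0 n)) * monomial n b v) = 0"
      proof
        fix v
        have "(\<Sum>b\<in>H. c (b(n := a0 n)) * monomial n b v) = (\<Sum>a\<in>G. c a * monomial n a v)"
          unfolding H_def sum.reindex[OF inj]
          by (intro sum.cong) (auto simp: G_def monomial_def fun_upd_idem)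
        thus "(\<Sum>b\<in>H. c (b(n := a0 n)) * monomial n b v) = 0" using z by simp
      qed
    qed
    moreover have "a0(n := 0) \<in> H" unfolding H_def G_def using a0 by auto
    ultimately have "c ((a0(n := 0))(n := a0 n)) = 0" by blast
    thus "c a0 = 0" by simp
  qed
qed

section \<open>Noether normalization\<close>

lemma sum_fun_apply: "(\<Sum>i\<in>I. f i) z = (\<Sum>i\<in>I. f i (z :: 'z) :: complex)"
  by (induction I rule: infinite_finite_induct) auto

lemma power_fun_apply: "(f ^ n) z = (f (z :: 'z) :: complex) ^ n"
  by (induction n) auto

definition last_unit :: "nat \<Rightarrow> cvec" where
  "last_unit n = (\<lambda>i. if i = n then 1 else 0)"

text \<open>
  The map \<open>L\<close> sends the last basis vector to \<open>u\<close>, the one with index \<open>i0\<close>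
  to the last one, and fixes the others; it is invertible because \<open>u\<close> has a nonzero coordinate
  \<open>i0\<close>.
\<close>

lemma coordinate_change:
  assumes i0: "i0 \<le> n" "u i0 \<noteq> (0::complex)"
  shows "\<exists>L M. (\<forall>i. homogeneous 1 (\<lambda>v. L v i)) \<and> (\<forall>i. homogeneous 1 (\<lambda>v. M v i)) \<and>
    (\<forall>v. L (M v) = trunc (Suc n) v) \<and> (\<forall>v. M (L v) = trunc (Suc n) v) \<and>
    (\<forall>v. M (trunc (Suc n) v) = M v) \<and> (\<forall>v. L (trunc (Suc n) v) = L v) \<and>
    (\<forall>v. trunc (Suc n) (M v) = M v) \<and> L (last_unit n) = trunc (Suc n) u"
proof -
  define L where "L v = (\<lambda>i. if i = i0 then u i0 * v n else if i = n then v i0 + u n * v n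
    else if i < n then v i + u i * v n else (0::complex))" for v
  define M where "M v = (\<lambda>i. if i = n then v i0 / u i0 else if i = i0 then v n - u n * (v i0 / u i0)
    else if i < n then v i - u i * (v i0 / u i0) else (0::complex))" for v
  have h: "homogeneous (Suc 0) (\<lambda>v. a * v i + b * v j)" for a b i j
    by (intro homogeneous.add homogeneous_scale homogeneous_coord)
  have "homogeneous 1 (\<lambda>v. L v i)" for i
    using h[of "u i0" n 0 0] h[of 1 i0 "u n" n] h[of 1 i "u i" n] homogeneous_zero[of "Suc 0"]
    unfolding L_def by (cases "i = i0"; cases "i = n"; cases "i < n") simp_all
  moreover have "homogeneous 1 (\<lambda>v. M v i)" for i
    using h[of "1 / u i0" i0 0 0] h[of 1 n "- u n / u i0" i0] h[of 1 i "- u i / u i0" i0] homogeneous_zero[of "Suc 0"]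
    unfolding M_def by (cases "i = i0"; cases "i = n"; cases "i < n") simp_all
  moreover have "L (M v) = trunc (Suc n) v" "M (L v) = trunc (Suc n) v" "M (trunc (Suc n) v) = M v"
    "L (trunc (Suc n) v) = L v" "trunc (Suc n) (M v) = M v" for v
    using i0 by (auto simp: L_def M_def trunc_def fun_eq_iff field_simps)
  moreover have "L (last_unit n) = trunc (Suc n) u"
    using i0 by (auto simp: L_def last_unit_def trunc_def fun_eq_iff)
  ultimately show ?thesis by blast
qed

text \<open>
  After a linear change of coordinates, which does not change the ring of forms, a given form does not vanish at
  the last coordinate point. Then it is monic in the last variable, up to a constant.
\<close>

lemma general_position:
  fixes y :: "'z \<Rightarrow> cvec"
  assumes p: "homogeneous k p" "k > 0" "p (trunc (Suc n) u) \<noteq> 0"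
  shows "\<exists>y'. (\<forall>l. forms (Suc n) y' l = forms (Suc n) y l) \<and>
    (independent_coords (Suc n) y \<longrightarrow> independent_coords (Suc n) y') \<and>
    (\<exists>p'. homogeneous k p' \<and> p' (last_unit n) \<noteq> 0 \<and>
      (\<forall>z. p' (trunc (Suc n) (y' z)) = p (trunc (Suc n) (y z))))"
proof -
  have "\<exists>i0\<le>n. u i0 \<noteq> 0"
  proof (rule ccontr)
    assume "\<not> ?thesis"
    hence "trunc (Suc n) u = (\<lambda>i. 0)" by (auto simp: trunc_def fun_eq_iff)
    thus False using p homogeneous_at_0[OF p(1,2)] by simp
  qed
  then obtain i0 where i0: "i0 \<le> n" "u i0 \<noteq> 0" by blast
  from coordinate_change[of i0 n u, OF i0] obtain L M where
    L: "\<And>i. homogeneous 1 (\<lambda>v. L v i)" and M: "\<And>i. homogeneous 1 (\<lambda>v. M v i)" and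
    LM: "\<And>v. L (M v) = trunc (Suc n) v" "\<And>v. M (L v) = trunc (Suc n) v"
    "\<And>v. M (trunc (Suc n) v) = M v" "\<And>v. L (trunc (Suc n) v) = L v"
    "\<And>v. trunc (Suc n) (M v) = M v" "L (last_unit n) = trunc (Suc n) u" by blast
  have hL: "homogeneous d (\<lambda>v. q (L v))" if "homogeneous d q" for d q
    using homogeneous_linear_compose[OF that L] by simp
  have hM: "homogeneous d (\<lambda>v. q (M v))" if "homogeneous d q" for d q
    using homogeneous_linear_compose[OF that M] by simp
  define y' where "y' z = M (y z)" for z
  have "forms (Suc n) y' l = forms (Suc n) y l" for l
  proof
    show "forms (Suc n) y' l \<subseteq> forms (Suc n) y l"
    proof
      fix f assume "f \<in> forms (Suc n) y' l"
      then obtain q where q: "homogeneous l q" "f = (\<lambda>z. q (trunc (Suc n) (y' z)))" unfolding forms_def by auto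
      have "f = (\<lambda>z. q (M (trunc (Suc n) (y z))))" unfolding q(2) y'_def LM(3,5) ..
      thus "f \<in> forms (Suc n) y l" using formsI[OF hM[OF q(1)]] by simp
    qed
    show "forms (Suc n) y l \<subseteq> forms (Suc n) y' l"
    proof
      fix f assume "f \<in> forms (Suc n) y l"
      then obtain q where q: "homogeneous l q" "f = (\<lambda>z. q (trunc (Suc n) (y z)))" unfolding forms_def by auto
      have "f = (\<lambda>z. q (L (trunc (Suc n) (y' z))))" unfolding q(2) y'_def LM(1,5) ..
      thus "f \<in> forms (Suc n) y' l" using formsI[OF hL[OF q(1)]] by simp
    qed
  qed
  moreover have "independent_coords (Suc n) y'" if ind: "independent_coords (Suc n) y"
    unfolding independent_coords_def
  proof (intro allI impI)
    fix l q v assume q: "homogeneous l q \<and> (\<forall>z. q (trunc (Suc n) (y' z)) = 0)"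
    hence "\<forall>z. q (M (trunc (Suc n) (y z))) = 0" unfolding y'_def LM(3,5) by blast
    hence "q (M (trunc (Suc n) (L v))) = 0" using ind hM[of l q] q unfolding independent_coords_def by blast
    thus "q (trunc (Suc n) v) = 0" unfolding LM(2,3) .
  qed
  moreover have "homogeneous k (\<lambda>v. p (L v))" "p (L (last_unit n)) \<noteq> 0" "p (L (trunc (Suc n) (y' z))) = p (trunc (Suc n) (y z))" for z
    using hL[OF p(1)] p(3) unfolding y'_def LM by auto
  ultimately show ?thesis by blast
qed

lemma monic_in_last_variable:
  assumes p: "homogeneous k p" "p (last_unit n) \<noteq> 0"
  shows "\<exists>a f. a \<noteq> 0 \<and> (\<forall>i. homogeneous (k - i) (f i)) \<and>
    (\<forall>v. p (trunc (Suc n) v) = a * v n ^ k + (\<Sum>i<k. f i (trunc n v) * v n ^ i))"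
proof -
  obtain f where f: "\<forall>i. homogeneous (k - i) (f i)"
    "\<And>v. p (trunc (Suc n) v) = (\<Sum>i\<le>k. f i (trunc n v) * v n ^ i)"
    using homogeneous_expand[OF p(1), of n] by blast
  have "homogeneous 0 (f k)" using f(1) by (metis diff_self_eq_0)
  hence c: "f k v = f k (\<lambda>_. 0)" for v using homogeneous_degree_0 by blast
  have e: "p (trunc (Suc n) v) = f k (\<lambda>_. 0) * v n ^ k + (\<Sum>i<k. f i (trunc n v) * v n ^ i)" for v
    unfolding f(2) lessThan_Suc_atMost[symmetric] using c[of "trunc n v"] by simp
  have t: "trunc n (last_unit n) = (\<lambda>i. 0)" "trunc (Suc n) (last_unit n) = last_unit n"
    by (auto simp: trunc_def last_unit_def)
  have "f i (\<lambda>i. 0) = 0" if "i < k" for i using f(1) that homogeneous_at_0[of "k - i" "f i"] by auto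
  hence "p (last_unit n) = f k (\<lambda>_. 0)" using e[of "last_unit n"] unfolding t by (simp add: last_unit_def)
  thus ?thesis using e f(1) p(2) by (intro exI[of _ "f k (\<lambda>_. 0)"] exI[of _ f]) auto
qed

text \<open>
  Graded rings and modules are families of spaces of functions, so the module that is generated over
  \<open>H\<close> by elements \<open>b\<close> of degrees \<open>e\<close> is described by spanning sets of its
  graded pieces.
\<close>

definition generated_part ::
    "(nat \<times> ('z \<Rightarrow> complex)) set \<Rightarrow> (nat \<Rightarrow> ('z \<Rightarrow> complex) set) \<Rightarrow> nat \<Rightarrow> ('z \<Rightarrow> complex) set" where
  "generated_part B H k = {g * b |g e b. (e, b) \<in> B \<and> e \<le> k \<and> g \<in> H (k - e)}"

definition finite_over :: "(nat \<Rightarrow> ('z \<Rightarrow> complex) set) \<Rightarrow> (nat \<Rightarrow> ('z \<Rightarrow> complex) set) \<Rightarrow> bool" where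
  "finite_over G H \<longleftrightarrow> (\<exists>B. finite B \<and> (\<forall>(e, b)\<in>B. b \<in> G e) \<and> (\<forall>k. G k \<subseteq> fv.span (generated_part B H k)))"

definition graded_ring :: "(nat \<Rightarrow> ('z \<Rightarrow> complex) set) \<Rightarrow> bool" where
  "graded_ring G \<longleftrightarrow> (\<forall>k. fv.subspace (G k)) \<and> 1 \<in> G 0 \<and> (\<forall>k l. \<forall>f\<in>G k. \<forall>g\<in>G l. f * g \<in> G (k + l))"

lemma graded_ringD:
  assumes "graded_ring G"
  shows "fv.subspace (G k)" "1 \<in> G 0" "f \<in> G k \<Longrightarrow> g \<in> G l \<Longrightarrow> f * g \<in> G (k + l)" "0 \<in> G k"
    "f \<in> G k \<Longrightarrow> g \<in> G k \<Longrightarrow> f + g \<in> G k" "f \<in> G k \<Longrightarrow> - f \<in> G k" "f \<in> G k \<Longrightarrow> f ^ n \<in> G (n * k)"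
proof -
  have s: "fv.subspace (G k)" for k using assms unfolding graded_ring_def by auto
  thus "fv.subspace (G k)" .
  show o: "1 \<in> G 0" using assms unfolding graded_ring_def by auto
  have m: "f \<in> G k \<Longrightarrow> g \<in> G l \<Longrightarrow> f * g \<in> G (k + l)" for f g k l
    using assms unfolding graded_ring_def by auto
  thus "f \<in> G k \<Longrightarrow> g \<in> G l \<Longrightarrow> f * g \<in> G (k + l)" .
  show "0 \<in> G k" using fv.subspace_0[OF s] .
  show "f \<in> G k \<Longrightarrow> g \<in> G k \<Longrightarrow> f + g \<in> G k" using fv.subspace_add[OF s] .
  show "f \<in> G k \<Longrightarrow> - f \<in> G k" using fv.subspace_neg[OF s] .
  show "f \<in> G k \<Longrightarrow> f ^ n \<in> G (n * k)"
    by (induction n) (auto simp: o m)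
qed

lemma graded_ring_forms: "graded_ring (forms n y)"
proof -
  have "1 \<in> forms n y 0" unfolding forms_0 by (intro image_eqI[of _ _ 1]) (auto simp: fun_eq_iff)
  thus ?thesis unfolding graded_ring_def using subspace_forms forms_mult by blast
qed

lemma finite_over_refl: "graded_ring G \<Longrightarrow> finite_over G G"
  unfolding finite_over_def generated_part_def
  by (intro exI[of _ "{(0, 1)}"]) (auto intro!: fv.span_base graded_ringD)

lemma span_minimal': "U \<subseteq> fv.span V \<Longrightarrow> fv.span U \<subseteq> fv.span V"
  by (rule fv.span_minimal) (auto intro: fv.subspace_span)

lemma finite_over_trans:
  assumes "finite_over G H" "finite_over H K" and G: "graded_ring G" and HG: "\<And>k. H k \<subseteq> G k"
  shows "finite_over G K"
proof -
  obtain B where B: "finite B" "\<forall>(e, b)\<in>B. b \<in> G e" "\<And>k. G k \<subseteq> fv.span (generated_part B H k)"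
    using assms(1) unfolding finite_over_def by blast
  obtain C where C: "finite C" "\<forall>(e, b)\<in>C. b \<in> H e" "\<And>k. H k \<subseteq> fv.span (generated_part C K k)"
    using assms(2) unfolding finite_over_def by blast
  define D where "D = (\<lambda>((e, b), (e', b')). (e + e', b' * b)) ` (B \<times> C)"
  have "finite D" unfolding D_def using B C by auto
  moreover have "\<forall>(e, b)\<in>D. b \<in> G e"
    using B(2) C(2) HG graded_ringD(3)[OF G] unfolding D_def by (fastforce simp: add.commute)
  moreover have "G k \<subseteq> fv.span (generated_part D K k)" for k
  proof -
    have "generated_part B H k \<subseteq> fv.span (generated_part D K k)"
    proof
      fix f assume "f \<in> generated_part B H k"
      then obtain g e b where f: "f = g * b" "(e, b) \<in> B" "e \<le> k" "g \<in> H (k - e)"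
        unfolding generated_part_def by blast
      show "f \<in> fv.span (generated_part D K k)" unfolding f(1)
      proof (rule span_mult[of g "generated_part C K (k - e)" b "{b}"])
        show "g \<in> fv.span (generated_part C K (k - e))" using C(3) f(4) by blast
        fix u v assume "u \<in> generated_part C K (k - e)" "v \<in> {b}"
        then obtain g' e' b' where u: "u = g' * b'" "(e', b') \<in> C" "e' \<le> k - e" "g' \<in> K (k - e - e')" "v = b"
          unfolding generated_part_def by blast
        have "(e + e', b' * b) \<in> D" unfolding D_def using f(2) u(2) by force
        moreover have "e + e' \<le> k" "g' \<in> K (k - (e + e'))" using u f(3) by auto
        ultimately have "g' * (b' * b) \<in> generated_part D K k" unfolding generated_part_def by blast
        thus "u * v \<in> fv.span (generated_part D K k)" using u by (auto intro: fv.span_base simp: mult.assoc)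
      qed (auto intro: fv.span_base)
    qed
    thus ?thesis using B(3) span_minimal' by blast
  qed
  ultimately show ?thesis unfolding finite_over_def by blast
qed

lemma forms_mono: "n \<le> m \<Longrightarrow> forms n y k \<subseteq> forms m y k"
proof
  fix f assume nm: "n \<le> m" and "f \<in> forms n y k"
  then obtain q where q: "homogeneous k q" "f = (\<lambda>z. q (trunc n (y z)))" unfolding forms_def by auto
  have "trunc n (trunc m v) = trunc n v" for v using nm by (auto simp: trunc_def)
  hence "f = (\<lambda>z. (\<lambda>v. q (trunc n v)) (trunc m (y z)))" using q(2) by simp
  thus "f \<in> forms m y k" using formsI[OF homogeneous_trunc[OF q(1)]] by metis
qed

text \<open>A relation that is monic in the last variable eliminates the high powers of this variable.\<close>

lemma finite_over_forms_step:
  fixes y :: "'z \<Rightarrow> cvec"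
  assumes p: "homogeneous k p" "p (last_unit n) \<noteq> 0" "\<forall>z. p (trunc (Suc n) (y z)) = 0"
  shows "finite_over (forms (Suc n) y) (forms n y)"
proof -
  let ?x = "\<lambda>z. y z n"
  obtain a f where a: "a \<noteq> 0" and f: "\<forall>i. homogeneous (k - i) (f i)"
    "\<forall>v. p (trunc (Suc n) v) = a * v n ^ k + (\<Sum>i<k. f i (trunc n v) * v n ^ i)"
    using monic_in_last_variable[OF p(1,2)] by blast
  have rel: "y z n ^ k = (\<Sum>i<k. (- 1 / a) * f i (trunc n (y z)) * y z n ^ i)" for z
  proof -
    have "a * y z n ^ k = - (\<Sum>i<k. f i (trunc n (y z)) * y z n ^ i)"
      using f(2) p(3) by (simp add: eq_neg_iff_add_eq_0)
    hence "y z n ^ k = (- 1 / a) * (\<Sum>i<k. f i (trunc n (y z)) * y z n ^ i)" using a by (simp add: field_simps)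
    thus ?thesis by (simp add: sum_distrib_left mult.assoc sum_negf sum_divide_distrib)
  qed
  define B where "B = (\<lambda>i. (i, ?x ^ i)) ` {..<k}"
  have pw: "?x ^ i \<in> forms (Suc n) y i" for i
    using graded_ringD(7)[OF graded_ring_forms coord_in_forms[of n "Suc n" y], of i] by simp
  have key: "g * ?x ^ i \<in> fv.span (generated_part B (forms n y) K)" if "i \<le> K" "g \<in> forms n y (K - i)" for i K g
    using that
  proof (induction i arbitrary: g rule: less_induct)
    case (less i)
    show ?case
    proof (cases "i < k")
      case True
      hence "(i, ?x ^ i) \<in> B" unfolding B_def by blast
      hence "g * ?x ^ i \<in> generated_part B (forms n y) K"
        using less.prems unfolding generated_part_def by blast
      thus ?thesis by (rule fv.span_base)
    next
      case False
      define h where "h j = (\<lambda>z. g z * f j (trunc n (y z)))" for j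
      have hf: "h j \<in> forms n y (K - (i - k + j))" if "j < k" for j
      proof -
        have "g * (\<lambda>z. f j (trunc n (y z))) \<in> forms n y ((K - i) + (k - j))"
          using less.prems f(1) by (intro forms_mult formsI) auto
        moreover have "(K - i) + (k - j) = K - (i - k + j)" using False that less.prems by auto
        ultimately show ?thesis unfolding h_def by (simp add: times_fun_def)
      qed
      have "g * ?x ^ i = (\<Sum>j<k. (\<lambda>z. (- 1 / a) * (h j * ?x ^ (i - k + j)) z))"
      proof
        fix z
        have "y z n ^ i = y z n ^ (i - k) * y z n ^ k" using False by (simp flip: power_add)
        also have "\<dots> = (\<Sum>j<k. (- 1 / a) * f j (trunc n (y z)) * y z n ^ (i - k + j))"
          unfolding rel sum_distrib_left by (intro sum.cong) (auto simp: power_add)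
        finally show "(g * ?x ^ i) z = (\<Sum>j<k. (\<lambda>z. (- 1 / a) * (h j * ?x ^ (i - k + j)) z)) z"
          by (simp add: h_def sum_distrib_left mult_ac sum_fun_apply power_fun_apply)
      qed
      also have "\<dots> \<in> fv.span (generated_part B (forms n y) K)"
        using less.IH hf False less.prems(1) by (intro fv.span_sum fv.span_scale) auto
      finally show ?thesis .
    qed
  qed
  have "forms (Suc n) y K \<subseteq> fv.span (generated_part B (forms n y) K)" for K
  proof
    fix g assume "g \<in> forms (Suc n) y K"
    then obtain q where q: "homogeneous K q" "g = (\<lambda>z. q (trunc (Suc n) (y z)))" unfolding forms_def by auto
    obtain e where e: "\<forall>i. homogeneous (K - i) (e i)"
      "\<forall>v. q (trunc (Suc n) v) = (\<Sum>i\<le>K. e i (trunc n v) * v n ^ i)"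
      using homogeneous_expand[OF q(1)] by blast
    have "g = (\<Sum>i\<le>K. (\<lambda>z. e i (trunc n (y z))) * ?x ^ i)"
      unfolding q(2) by (auto simp: fun_eq_iff e(2) sum_fun_apply power_fun_apply)
    also have "\<dots> \<in> fv.span (generated_part B (forms n y) K)"
      using e(1) by (intro fv.span_sum key formsI) auto
    finally show "g \<in> fv.span (generated_part B (forms n y) K)" .
  qed
  moreover have "finite B" "\<forall>(e, b)\<in>B. b \<in> forms (Suc n) y e" unfolding B_def using pw by auto
  ultimately show ?thesis unfolding finite_over_def by blast
qed

text \<open>
  As long as the coordinates satisfy a relation, the relation is brought into general position and the last
  variable is eliminated.
\<close>

theorem Noether_normalization:
  fixes y :: "'z \<Rightarrow> cvec"
  shows "\<exists>d w. independent_coords d w \<and> (\<forall>k. forms d w k \<subseteq> forms n y k) \<and>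
    finite_over (forms n y) (forms d w)"
proof (induction n arbitrary: y)
  case 0
  have "trunc 0 v = trunc 0 w" for v w by (auto simp: trunc_def)
  hence "independent_coords 0 y" unfolding independent_coords_def by metis
  thus ?case using finite_over_refl[OF graded_ring_forms] by blast
next
  case (Suc n)
  show ?case
  proof (cases "independent_coords (Suc n) y")
    case True thus ?thesis using finite_over_refl[OF graded_ring_forms] by blast
  next
    case False
    then obtain k p u where p: "homogeneous k p" "\<forall>z. p (trunc (Suc n) (y z)) = 0" "p (trunc (Suc n) u) \<noteq> 0"
      unfolding independent_coords_def by blast
    have "k > 0"
    proof (rule ccontr)
      assume "\<not> k > 0"
      hence "homogeneous 0 p" using p(1) by simp
      from homogeneous_degree_0[OF this] show False using p(2,3) by metis
    qed
    from general_position[OF p(1) this p(3), of y] obtain y' p' where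
      y': "\<forall>l. forms (Suc n) y' l = forms (Suc n) y l" and
      p': "homogeneous k p'" "p' (last_unit n) \<noteq> 0" "\<forall>z. p' (trunc (Suc n) (y' z)) = p (trunc (Suc n) (y z))" by blast
    have "forms (Suc n) y' = forms (Suc n) y" using y' by blast
    hence f1: "finite_over (forms (Suc n) y) (forms n y')"
      using finite_over_forms_step[OF p'(1,2), of y'] p'(3) p(2) by simp
    obtain d w where w: "independent_coords d w" "\<forall>k. forms d w k \<subseteq> forms n y' k"
      "finite_over (forms n y') (forms d w)" using Suc.IH by blast
    have sub: "forms n y' k \<subseteq> forms (Suc n) y k" for k
      using forms_mono[of n "Suc n" y' k] y' by auto
    have "finite_over (forms (Suc n) y) (forms d w)"
      by (rule finite_over_trans[OF f1 w(3) graded_ring_forms sub])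
    thus ?thesis using w sub by blast
  qed
qed

text \<open>
  The products of the module generators with monomials span, and in each degree up to \<open>k\<close> there are
  at most \<open>(k + 1)\<^sup>n\<^sup>-\<^sup>1\<close> monomials.
\<close>

lemma finite_over_dim:
  assumes "finite_over G (forms n w)"
  shows "\<exists>C. \<forall>k. \<exists>W. finite W \<and> card W \<le> C * (k + 1) ^ (n - 1) \<and> G k \<subseteq> fv.span W"
proof -
  obtain B where B: "finite B" "\<And>k. G k \<subseteq> fv.span (generated_part B (forms n w) k)"
    using assms unfolding finite_over_def by blast
  show ?thesis
  proof (intro exI[of _ "card B"] allI)
    fix k
    define W where "W = (\<Union>(e, b)\<in>B. (\<lambda>a. (\<lambda>z. monomial n a (w z)) * b) ` exponents n (k - e))"
    have "finite W" unfolding W_def using B finite_card_exponents(1) by auto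
    moreover have "card W \<le> card B * (k + 1) ^ (n - 1)"
    proof -
      have "card W \<le> (\<Sum>eb\<in>B. card ((\<lambda>(e, b). (\<lambda>a. (\<lambda>z. monomial n a (w z)) * b) ` exponents n (k - e)) eb))"
        unfolding W_def by (rule card_UN_le[OF B(1)])
      also have "\<dots> \<le> (\<Sum>eb\<in>B. (k + 1) ^ (n - 1))"
      proof (rule sum_mono)
        fix eb assume "eb \<in> B"
        obtain e b where eb: "eb = (e, b)" by (cases eb)
        have "card ((\<lambda>a. (\<lambda>z. monomial n a (w z)) * b) ` exponents n (k - e)) \<le> card (exponents n (k - e))"
          by (rule card_image_le[OF finite_card_exponents(1)])
        also have "\<dots> \<le> (k - e + 1) ^ (n - 1)" by (rule finite_card_exponents(2))
        also have "\<dots> \<le> (k + 1) ^ (n - 1)" by (intro power_mono) auto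
        finally show "card ((\<lambda>(e, b). (\<lambda>a. (\<lambda>z. monomial n a (w z)) * b) ` exponents n (k - e)) eb) \<le> (k + 1) ^ (n - 1)"
          by (simp add: eb)
      qed
      finally show ?thesis by simp
    qed
    moreover have "G k \<subseteq> fv.span W"
    proof -
      have "generated_part B (forms n w) k \<subseteq> fv.span W"
      proof
        fix f assume "f \<in> generated_part B (forms n w) k"
        then obtain g e b where f: "f = g * b" "(e, b) \<in> B" "g \<in> forms n w (k - e)"
          unfolding generated_part_def by blast
        show "f \<in> fv.span W" unfolding f(1)
        proof (rule span_mult[of g _ b "{b}"])
          show "g \<in> fv.span ((\<lambda>a z. monomial n a (w z)) ` exponents n (k - e))"
            using forms_span_monomials f(3) by blast
          fix u v assume "u \<in> (\<lambda>a z. monomial n a (w z)) ` exponents n (k - e)" "v \<in> {b}"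
          hence "u * v \<in> W" unfolding W_def using f(2) by force
          thus "u * v \<in> fv.span W" by (rule fv.span_base)
        qed (auto intro: fv.span_base)
      qed
      thus ?thesis using B(2) span_minimal' by blast
    qed
    ultimately show "\<exists>W. finite W \<and> card W \<le> card B * (k + 1) ^ (n - 1) \<and> G k \<subseteq> fv.span W" by blast
  qed
qed

section \<open>The total ring of a graded family\<close>

text \<open>
  The pieces of a graded family may intersect as spaces of functions; an auxiliary variable keeps the degrees
  apart, which makes the direct sum of the pieces a ring.
\<close>

definition total_ring :: "(nat \<Rightarrow> ('z \<Rightarrow> complex) set) \<Rightarrow> ('z \<Rightarrow> complex) poly set" where
  "total_ring G = {P. \<forall>k. coeff P k \<in> G k}"

definition graded_domain :: "(nat \<Rightarrow> ('z \<Rightarrow> complex) set) \<Rightarrow> bool" where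
  "graded_domain G \<longleftrightarrow> (\<forall>k l. \<forall>f\<in>G k. \<forall>g\<in>G l. f * g = 0 \<longrightarrow> f = 0 \<or> g = 0)"

lemma graded_ring_sum: "graded_ring G \<Longrightarrow> (\<And>i. i \<in> I \<Longrightarrow> f i \<in> G k) \<Longrightarrow> sum f I \<in> G k"
  by (rule fv.subspace_sum[OF graded_ringD(1)])

lemma subring_total_ring:
  assumes G: "graded_ring G" shows "subring (total_ring G)"
  unfolding subring_def
proof (intro conjI ballI)
  have "coeff 1 k \<in> G k" for k using G by (cases "k = 0") (auto simp: coeff_1 intro: graded_ringD)
  thus "1 \<in> total_ring G" unfolding total_ring_def by blast
  fix P assume P: "P \<in> total_ring G"
  hence "coeff (- P) k \<in> G k" for k using graded_ringD(6)[OF G] unfolding total_ring_def by simp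
  thus "- P \<in> total_ring G" unfolding total_ring_def by blast
  fix Q assume Q: "Q \<in> total_ring G"
  have "coeff (P + Q) k \<in> G k" for k using P Q graded_ringD(5)[OF G] unfolding total_ring_def by simp
  thus "P + Q \<in> total_ring G" unfolding total_ring_def by blast
  have "coeff (P * Q) k \<in> G k" for k
  proof -
    have "coeff P i * coeff Q (k - i) \<in> G k" if "i \<le> k" for i
      using graded_ringD(3)[OF G, of "coeff P i" i "coeff Q (k - i)" "k - i"] P Q that
      unfolding total_ring_def by simp
    thus ?thesis unfolding coeff_mult by (intro graded_ring_sum[OF G]) auto
  qed
  thus "P * Q \<in> total_ring G" unfolding total_ring_def by blast
qed

lemma monom_total_ring: "graded_ring G \<Longrightarrow> f \<in> G k \<Longrightarrow> monom f k \<in> total_ring G"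
  by (auto simp: total_ring_def graded_ringD)

lemma total_ring_mono: "(\<And>k. H k \<subseteq> G k) \<Longrightarrow> total_ring H \<subseteq> total_ring G"
  unfolding total_ring_def by blast

lemma domain_total_ring:
  assumes "graded_domain G"
  shows "\<forall>P\<in>total_ring G. \<forall>Q\<in>total_ring G. P * Q = 0 \<longrightarrow> P = 0 \<or> Q = 0"
proof (intro ballI impI)
  fix P Q assume P: "P \<in> total_ring G" "Q \<in> total_ring G" and 0: "P * Q = 0"
  have "lead_coeff P * lead_coeff Q = 0"
    using coeff_mult_degree_sum[of P Q] 0 by simp
  hence "lead_coeff P = 0 \<or> lead_coeff Q = 0"
    using assms P unfolding graded_domain_def total_ring_def by blast
  thus "P = 0 \<or> Q = 0" unfolding leading_coeff_0_iff .
qed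

lemma total_ring_sum_monoms: "P = (\<Sum>k\<le>degree P. monom (coeff P k) k)"
  using poly_as_sum_of_monoms[of P] by simp

lemma monom_sum: "monom (\<Sum>i\<in>I. f i) k = (\<Sum>i\<in>I. monom (f i) k)"
  by (induction I rule: infinite_finite_induct) (auto simp: add_monom[symmetric])

lemma monom_one_power: "monom f 1 ^ i = monom (f ^ i :: 'z \<Rightarrow> complex) i"
  by (simp add: monom_power)

lemma total_ring_forms_Suc:
  "total_ring (forms (Suc n) w) = adjoin (total_ring (forms n w)) (monom (\<lambda>z. w z n) 1)"
proof
  let ?x = "\<lambda>z. w z n" and ?A = "total_ring (forms n w)"
  have sA: "subring ?A" by (rule subring_total_ring[OF graded_ring_forms])
  note sP = subring_adjoin[OF sA, of "monom ?x 1"]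
  have sT: "subring (total_ring (forms (Suc n) w))" by (rule subring_total_ring[OF graded_ring_forms])
  show "total_ring (forms (Suc n) w) \<subseteq> adjoin ?A (monom ?x 1)"
  proof
    fix P assume P: "P \<in> total_ring (forms (Suc n) w)"
    have "monom (coeff P k) k \<in> adjoin ?A (monom ?x 1)" for k
    proof -
      have "coeff P k \<in> forms (Suc n) w k" using P unfolding total_ring_def by blast
      then obtain q where q: "homogeneous k q" "coeff P k = (\<lambda>z. q (trunc (Suc n) (w z)))"
        unfolding forms_def by auto
      obtain e where e: "\<forall>i. homogeneous (k - i) (e i)"
        "\<forall>v. q (trunc (Suc n) v) = (\<Sum>i\<le>k. e i (trunc n v) * v n ^ i)"
        using homogeneous_expand[OF q(1)] by blast
      have "coeff P k = (\<Sum>i\<le>k. (\<lambda>z. e i (trunc n (w z))) * ?x ^ i)"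
        unfolding q(2) by (auto simp: fun_eq_iff e(2) sum_fun_apply power_fun_apply)
      hence "monom (coeff P k) k = (\<Sum>i\<le>k. monom (\<lambda>z. e i (trunc n (w z))) (k - i) * monom ?x 1 ^ i)"
        by (simp add: monom_sum monom_one_power mult_monom del: One_nat_def)
      also have "\<dots> \<in> adjoin ?A (monom ?x 1)"
      proof (rule subring_sum[OF sP])
        fix i
        have "monom (\<lambda>z. e i (trunc n (w z))) (k - i) \<in> ?A"
          using e(1) by (intro monom_total_ring graded_ring_forms formsI) auto
        thus "monom (\<lambda>z. e i (trunc n (w z))) (k - i) * monom ?x 1 ^ i \<in> adjoin ?A (monom ?x 1)"
          using adjoin_superset[OF sA, of "monom ?x 1"] subringD(3,7)[OF sP] by blast
      qed
      finally show ?thesis .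
    qed
    thus "P \<in> adjoin ?A (monom ?x 1)" by (subst total_ring_sum_monoms) (intro subring_sum[OF sP])
  qed
  show "adjoin ?A (monom ?x 1) \<subseteq> total_ring (forms (Suc n) w)"
  proof
    fix P assume "P \<in> adjoin ?A (monom ?x 1)"
    then obtain Q where Q: "Q \<in> coeffs_in ?A" "P = poly Q (monom ?x 1)" unfolding adjoin_def by blast
    have "?A \<subseteq> total_ring (forms (Suc n) w)" by (intro total_ring_mono forms_mono) simp
    hence "coeff Q i \<in> total_ring (forms (Suc n) w)" for i using Q(1) unfolding coeffs_in_def by blast
    moreover have "monom ?x 1 \<in> total_ring (forms (Suc n) w)"
      by (intro monom_total_ring graded_ring_forms coord_in_forms) simp
    ultimately show "P \<in> total_ring (forms (Suc n) w)"
      unfolding Q(2) poly_altdef by (intro subring_sum[OF sT] subringD(3,7)[OF sT])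
  qed
qed

text \<open>
  The coefficient in degree \<open>k\<close> of a polynomial relation for \<open>w\<^sub>n\<close> is a form in
  \<open>w\<^sub>0, \<dots>, w\<^sub>n\<close>. By independence it vanishes identically, hence so do its
  coefficients with respect to the last variable.
\<close>

lemma last_coordinate_transcendental:
  assumes ind: "independent_coords (Suc n) w"
  shows "\<forall>Q\<in>coeffs_in (total_ring (forms n w)). poly Q (monom (\<lambda>z. w z n) 1) = 0 \<longrightarrow> Q = 0"
proof (intro ballI impI)
  let ?x = "\<lambda>z. w z n"
  fix Q assume Q: "Q \<in> coeffs_in (total_ring (forms n w))" "poly Q (monom ?x 1) = 0"
  have "coeff (coeff Q i) j = 0" if i: "i \<le> degree Q" for i j
  proof -
    define k where "k = i + j"
    have "\<exists>q. homogeneous (k - l) q \<and> coeff (coeff Q l) (k - l) = (\<lambda>z. q (trunc n (w z)))" for l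
      using Q(1) unfolding coeffs_in_def total_ring_def forms_def by blast
    then obtain q where q: "\<And>l. homogeneous (k - l) (q l)"
      "\<And>l. coeff (coeff Q l) (k - l) = (\<lambda>z. q l (trunc n (w z)))" by metis
    define I where "I = {l. l \<le> degree Q \<and> l \<le> k}"
    have fin: "finite I" unfolding I_def by auto
    define p where "p v = (\<Sum>l\<in>I. q l (trunc n v) * v n ^ l)" for v
    have hp: "homogeneous k p" unfolding p_def
    proof (rule homogeneous_sum)
      fix l assume "l \<in> I"
      hence "k - l + l = k" unfolding I_def by simp
      moreover have "homogeneous (k - l + l) (\<lambda>v. q l (trunc n v) * v n ^ l)"
        using homogeneous.mult[OF homogeneous_trunc[OF q(1)[of l], of n]
            homogeneous_power[OF homogeneous.coord[of n], of l]] by simp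
      ultimately show "homogeneous k (\<lambda>v. q l (trunc n v) * v n ^ l)" by simp
    qed
    have "p (trunc (Suc n) (w z)) = 0" for z
    proof -
      have "coeff (poly Q (monom ?x 1)) k = (\<Sum>l\<le>degree Q. if l \<le> k then coeff (coeff Q l) (k - l) * ?x ^ l else 0)"
        unfolding poly_altdef coeff_sum monom_one_power
      proof (rule sum.cong)
        fix l
        show "coeff (coeff Q l * monom (?x ^ l) l) k = (if l \<le> k then coeff (coeff Q l) (k - l) * ?x ^ l else 0)"
          unfolding mult.commute[of "coeff Q l" "monom _ _"] coeff_monom_mult by (auto simp: mult.commute)
      qed simp
      also have "\<dots> = (\<Sum>l\<in>I. coeff (coeff Q l) (k - l) * ?x ^ l)"
        unfolding I_def by (simp add: sum.inter_filter[symmetric] atMost_def)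
      finally have "(\<Sum>l\<in>I. coeff (coeff Q l) (k - l) * ?x ^ l) z = 0" using Q(2) by simp
      thus ?thesis unfolding p_def by (simp add: q(2) sum_fun_apply power_fun_apply)
    qed
    hence p0: "p (trunc (Suc n) v) = 0" for v using ind hp unfolding independent_coords_def by blast
    have "q i (trunc n v) = 0" for v
    proof -
      define S where "S = (\<Sum>l\<in>I. monom (q l (trunc n v)) l)"
      have "poly S s = p (trunc (Suc n) (v(n := s)))" for s
        unfolding S_def p_def poly_sum by (intro sum.cong) (auto simp: poly_monom)
      hence "S = 0" using p0 poly_all_0_iff_0[of S] by simp
      hence "0 = coeff S i" by simp
      also have "\<dots> = q i (trunc n v)" unfolding S_def coeff_sum using fin i
        by (simp add: I_def k_def)
      finally show ?thesis by simp
    qed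
    thus ?thesis using q(2)[of i] by (simp add: k_def fun_eq_iff)
  qed
  hence "coeff Q i = 0" for i by (cases "i \<le> degree Q") (auto simp: poly_eq_iff coeff_eq_0)
  thus "Q = 0" by (simp add: poly_eq_iff)
qed

lemma forms_no_variables: "k > 0 \<Longrightarrow> forms 0 w k = {0}"
proof -
  assume k: "k > 0"
  have t: "trunc 0 v = (\<lambda>i. 0)" for v by (auto simp: trunc_def)
  show ?thesis
  proof
    show "forms 0 w k \<subseteq> {0}" unfolding forms_def t using homogeneous_at_0 k by (auto simp: fun_eq_iff)
    show "{0} \<subseteq> forms 0 w k" using graded_ringD(4)[OF graded_ring_forms] by blast
  qed
qed

lemma noetherian_forms: "noetherian_module (total_ring (forms n w)) (total_ring (forms n w))"
proof (induction n)
  case 0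
  let ?P = "total_ring (forms 0 w)"
  have el: "\<exists>c. u = monom (\<lambda>z. c) 0" if u: "u \<in> ?P" for u
  proof -
    have "coeff u k \<in> forms 0 w k" for k using u unfolding total_ring_def by blast
    hence 0: "coeff u k = 0" if "k > 0" for k using forms_no_variables[OF that] by blast
    have "coeff u 0 \<in> forms 0 w 0" using u unfolding total_ring_def by blast
    then obtain c where "coeff u 0 = (\<lambda>z. c)" unfolding forms_0 by blast
    hence "u = monom (\<lambda>z. c) 0" using 0 by (auto simp: poly_eq_iff)
    thus ?thesis by blast
  qed
  have mon: "monom (\<lambda>z. c) 0 \<in> ?P" for c by (intro monom_total_ring graded_ring_forms) (auto simp: forms_0)
  show ?case unfolding noetherian_module_def
  proof (intro allI impI)
    fix S assume S: "S \<subseteq> ?P"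
    show "\<exists>F. finite F \<and> F \<subseteq> S \<and> S \<subseteq> mspan ?P F"
    proof (cases "S \<subseteq> {0}")
      case True thus ?thesis by (intro exI[of _ "{}"]) (auto intro: mspan.zero)
    next
      case False
      then obtain s where s: "s \<in> S" "s \<noteq> 0" by blast
      obtain c where c: "s = monom (\<lambda>z. c) 0" using el s S by blast
      have c0: "c \<noteq> 0" using s c by (auto simp: zero_fun_def[symmetric])
      have "u \<in> mspan ?P {s}" if uS: "u \<in> S" for u
      proof -
        obtain b where b: "u = monom (\<lambda>z. b) 0" using el uS S by blast
        have "u = monom (\<lambda>z. b / c) 0 * s" unfolding b c mult_monom using c0 by (simp add: times_fun_def)
        thus ?thesis using mspan_base[OF mon, of s "{s}"] by simp
      qed
      thus ?thesis using s by (intro exI[of _ "{s}"]) auto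
    qed
  qed
next
  case (Suc n)
  show ?case unfolding total_ring_forms_Suc
    by (rule noetherian_adjoin[OF subring_total_ring[OF graded_ring_forms] Suc])
qed

lemma total_ring_mspan:
  assumes G: "graded_ring G" and H: "graded_ring H" "\<And>k. H k \<subseteq> G k"
    and B: "finite B" "\<forall>(e, b)\<in>B. b \<in> G e" "\<And>k. G k \<subseteq> fv.span (generated_part B H k)"
  shows "total_ring G = mspan (total_ring H) ((\<lambda>(e, b). monom b e) ` B)"
proof
  let ?M = "mspan (total_ring H) ((\<lambda>(e, b). monom b e) ` B)"
  note sH = subring_total_ring[OF H(1)] and sG = subring_total_ring[OF G]
  show "total_ring G \<subseteq> ?M"
  proof
    fix P assume P: "P \<in> total_ring G"
    have "monom f k \<in> ?M" if "f \<in> fv.span (generated_part B H k)" for f k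
      using that
    proof (induction rule: fv.span_induct_alt)
      case base show ?case using mspan.zero by (simp only: monom_eq_0 zero_fun_def[symmetric])
    next
      case (step c u v)
      then obtain g e b where u: "u = g * b" "(e, b) \<in> B" "e \<le> k" "g \<in> H (k - e)"
        unfolding generated_part_def by blast
      have "(\<lambda>z. c * g z) \<in> H (k - e)" using fv.subspace_scale[OF graded_ringD(1)[OF H(1)] u(4)] .
      hence "monom (\<lambda>z. c * g z) (k - e) \<in> total_ring H" by (rule monom_total_ring[OF H(1)])
      moreover have "monom b e \<in> (\<lambda>(e, b). monom b e) ` B" using u(2) by force
      ultimately have "monom (\<lambda>z. c * g z) (k - e) * monom b e \<in> ?M" by (rule mspan_base)
      moreover have "monom (\<lambda>z. c * g z) (k - e) * monom b e = monom (\<lambda>z. c * u z) k"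
        using u by (simp add: mult_monom times_fun_def mult.assoc)
      ultimately have "monom (\<lambda>z. c * u z) k + monom v k \<in> ?M" 
        using mspan_add step.IH by metis
      thus ?case unfolding add_monom .
    qed
    hence "monom (coeff P k) k \<in> ?M" for k using P B(3) unfolding total_ring_def by blast
    thus "P \<in> ?M" by (subst total_ring_sum_monoms) (intro mspan_sum)
  qed
  show "?M \<subseteq> total_ring G"
  proof
    fix u assume "u \<in> ?M"
    thus "u \<in> total_ring G"
    proof induction
      case (step p s u)
      then obtain e b where s: "s = monom b e" "(e, b) \<in> B" by auto
      hence "s \<in> total_ring G" using B(2) monom_total_ring[OF G] by auto
      moreover have "p \<in> total_ring G" using step total_ring_mono[of H G] H(2) by blast
      ultimately show ?case using step.IH subringD(2,3)[OF sG] by blast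
    qed (use sG in \<open>auto intro: subringD\<close>)
  qed
qed

lemma finite_over_forms_noetherian:
  assumes G: "graded_ring G" and H: "\<And>k. forms n w k \<subseteq> G k" and F: "finite_over G (forms n w)"
  shows "noetherian_module (total_ring (forms n w)) (total_ring G)"
proof -
  obtain B where B: "finite B" "\<forall>(e, b)\<in>B. b \<in> G e" "\<And>k. G k \<subseteq> fv.span (generated_part B (forms n w) k)"
    using F unfolding finite_over_def by blast
  show ?thesis unfolding total_ring_mspan[OF G graded_ring_forms H B]
    using B by (intro noetherian_module_finite subring_total_ring graded_ring_forms noetherian_forms) auto
qed

text \<open>
  Comparison of the coefficients in degree \<open>n e\<close> makes the coefficients of an integral equation
  homogeneous.
\<close>

lemma homogeneous_relation:
  assumes s: "\<forall>i<n. s i \<in> total_ring H" "monom (f :: 'z \<Rightarrow> complex) e ^ n = (\<Sum>i<n. s i * monom f e ^ i)"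
  shows "\<exists>h. (\<forall>i<n. h i \<in> H ((n - i) * e)) \<and> f ^ n = (\<Sum>i<n. h i * f ^ i)"
proof (intro exI conjI allI impI)
  show "coeff (s i) ((n - i) * e) \<in> H ((n - i) * e)" if "i < n" for i
    using s(1) that unfolding total_ring_def by blast
  have "f ^ n = coeff (monom f e ^ n) (e * n)" by (simp add: monom_power)
  also have "\<dots> = (\<Sum>i<n. coeff (monom (f ^ i) (e * i) * s i) (e * n))"
    unfolding s(2) coeff_sum by (intro sum.cong) (auto simp: monom_power mult.commute)
  also have "\<dots> = (\<Sum>i<n. coeff (s i) ((n - i) * e) * f ^ i)"
  proof (rule sum.cong)
    fix i assume "i \<in> {..<n}"
    hence "e * i \<le> e * n" "e * n - e * i = (n - i) * e" by (auto simp: diff_mult_distrib2 mult.commute)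
    thus "coeff (monom (f ^ i) (e * i) * s i) (e * n) = coeff (s i) ((n - i) * e) * f ^ i"
      unfolding coeff_monom_mult by (auto simp: mult.commute)
  qed simp
  finally show "f ^ n = (\<Sum>i<n. coeff (s i) ((n - i) * e) * f ^ i)" .
qed

lemma integral_over_forms:
  assumes G: "graded_ring G" and H: "\<And>k. forms n w k \<subseteq> G k" and F: "finite_over G (forms n w)"
    and f: "f \<in> G e"
  shows "\<exists>N h. (\<forall>i<N. h i \<in> forms n w ((N - i) * e)) \<and> f ^ N = (\<Sum>i<N. h i * f ^ i)"
proof -
  have "monom f e ^ l \<in> total_ring G" for l
    using subringD(7)[OF subring_total_ring[OF G] monom_total_ring[OF G f]] .
  hence "range (\<lambda>l. monom f e ^ l) \<subseteq> total_ring G" by blast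
  from noetherian_module_seq[OF subring_total_ring[OF graded_ring_forms] finite_over_forms_noetherian[OF G H F] this]
  obtain N s where "\<forall>i<N. s i \<in> total_ring (forms n w)" "monom f e ^ N = (\<Sum>i<N. s i * monom f e ^ i)" by blast
  from homogeneous_relation[OF this] show ?thesis by blast
qed

section \<open>Growth of a graded ring after adjoining an element\<close>

lemma graded_domain_power:
  assumes "graded_ring T" "graded_domain T" "c \<in> T e" "c \<noteq> 0" shows "c ^ n \<noteq> 0"
proof (induction n)
  case 0
  show ?case using assms(4) by (auto simp: fun_eq_iff)
next
  case (Suc n)
  have "c ^ n \<in> T (n * e)" by (rule graded_ringD(7)[OF assms(1,3)])
  thus ?case using Suc assms(2,3,4) unfolding graded_domain_def by (metis power_Suc)
qed

text \<open>
  The integrality criterion for the rings of forms in \<open>d\<close> and \<open>d + 1\<close> variables: the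
  denominator \<open>q\<close> of \<open>t\<close> is monic in the last variable, up to a constant, while
  \<open>p\<close> is a form in the other variables.
\<close>

lemma graded_integral_if_relation:
  fixes R T :: "nat \<Rightarrow> ('z \<Rightarrow> complex) set"
  assumes R: "graded_ring R" and T: "graded_ring T" "\<And>k. R k \<subseteq> T k" "graded_domain T"
    and w: "independent_coords (Suc d) w" "\<And>k. forms (Suc d) w k \<subseteq> R k" "finite_over R (forms (Suc d) w)"
    and q: "homogeneous e q" "q (last_unit d) \<noteq> 0" "(\<lambda>z. q (trunc (Suc d) (w z))) * t \<in> R (e + 1)"
    and t: "t \<in> T 1"
    and rel: "p \<in> forms d w l" "p \<noteq> 0" "p * t ^ I = (\<Sum>i<I. r i * t ^ i)" "\<forall>i<I. r i \<in> R (l + I - i)"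
  shows "\<exists>N h. (\<forall>i<N. h i \<in> R (N - i)) \<and> t ^ N = (\<Sum>i<N. h i * t ^ i)"
proof -
  let ?A = "total_ring (forms d w)" and ?P = "total_ring (forms (Suc d) w)" and ?x = "\<lambda>z. w z d"
  have gA: "graded_ring (forms d w)" and gP: "graded_ring (forms (Suc d) w)" by (rule graded_ring_forms)+
  note sA = subring_total_ring[OF gA] and sP = subring_total_ring[OF gP]
  have AP: "?A \<subseteq> ?P" by (rule total_ring_mono[OF forms_mono]) simp
  have PR: "?P \<subseteq> total_ring R" by (rule total_ring_mono[OF w(2)])
  have RT: "total_ring R \<subseteq> total_ring T" by (rule total_ring_mono[OF T(2)])
  obtain B where B: "finite B" "\<forall>(e, b)\<in>B. b \<in> R e" "\<And>k. R k \<subseteq> fv.span (generated_part B (forms (Suc d) w) k)"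
    using w(3) unfolding finite_over_def by blast
  obtain a f where a: "a \<noteq> 0" and f: "\<forall>i. homogeneous (e - i) (f i)"
    "\<forall>v. q (trunc (Suc d) v) = a * v d ^ e + (\<Sum>i<e. f i (trunc d v) * v d ^ i)"
    using monic_in_last_variable[OF q(1,2)] by blast
  define g where "g i = (\<lambda>z. (1 / a) * f i (trunc d (w z)))" for i
  have gin: "g i \<in> forms d w (e - i)" for i
    unfolding g_def using f(1) fv.subspace_scale[OF subspace_forms formsI] by blast
  define C where "C = monom 1 e + (\<Sum>i<e. monom (monom (g i) (e - i)) i)"
  have Cin: "C \<in> coeffs_in ?A" unfolding C_def
    using sA gin by (intro subringD(2)[OF subring_coeffs_in[OF sA]] subring_sum[OF subring_coeffs_in[OF sA]]
      monom_coeffs_in monom_total_ring gA) (auto intro: subringD)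
  have lead: "lead_coeff C = 1"
  proof -
    have ce: "coeff C e = 1" unfolding C_def by (simp add: coeff_sum)
    have "coeff C i = 0" if "i > e" for i unfolding C_def using that by (simp add: coeff_sum)
    hence "degree C \<le> e" by (intro degree_le) auto
    moreover have "(1 :: ('z \<Rightarrow> complex) poly) \<noteq> 0" by simp
    hence "e \<le> degree C" using ce by (intro le_degree) simp
    ultimately show ?thesis using ce by simp
  qed
  have pC: "poly C (monom ?x 1) = monom (\<lambda>z. (1 / a) * q (trunc (Suc d) (w z))) e"
  proof -
    have "poly C (monom ?x 1) = monom (?x ^ e) e + (\<Sum>i<e. monom (g i * ?x ^ i) e)"
      unfolding C_def poly_add poly_sum poly_monom monom_one_power by (simp add: mult_monom)
    also have "\<dots> = monom (?x ^ e + (\<Sum>i<e. g i * ?x ^ i)) e" unfolding monom_sum[symmetric] add_monom ..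
    also have "?x ^ e + (\<Sum>i<e. g i * ?x ^ i) = (\<lambda>z. (1 / a) * q (trunc (Suc d) (w z)))"
    proof
      fix z
      have "(1 / a) * (a * u + v) = u + (1 / a) * v" for u v using a by (simp add: distrib_left)
      thus "(?x ^ e + (\<Sum>i<e. g i * ?x ^ i)) z = (1 / a) * q (trunc (Suc d) (w z))"
        unfolding f(2)[rule_format] by (simp add: g_def sum_fun_apply power_fun_apply sum_divide_distrib mult.assoc)
    qed
    finally show ?thesis .
  qed
  have Ct: "poly C (monom ?x 1) * monom t 1 \<in> total_ring R"
  proof -
    have "(\<lambda>z. (1 / a) * ((\<lambda>z. q (trunc (Suc d) (w z))) * t) z) \<in> R (e + 1)"
      by (rule fv.subspace_scale[OF graded_ringD(1)[OF R] q(3)])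
    from monom_total_ring[OF R this] show ?thesis unfolding pC mult_monom by (simp add: times_fun_def mult.assoc)
  qed
  have rel': "monom p l * monom t 1 ^ I = (\<Sum>i<I. monom (r i) (l + I - i) * monom t 1 ^ i)"
    unfolding monom_one_power mult_monom rel(3) monom_sum by (intro sum.cong) auto
  have "\<exists>n s. (\<forall>i<n. s i \<in> ?P) \<and> monom t 1 ^ n = (\<Sum>i<n. s i * monom t 1 ^ i)"
  proof (rule integral_if_coprime_denominators[where Om = "total_ring T" and A = ?A and y = "monom ?x 1"
        and R = "total_ring R" and B = "(\<lambda>(e, b). monom b e) ` B" and C = C and p = "monom p l" and I = I])
    show "subring (total_ring T)" by (rule subring_total_ring[OF T(1)])
    show "\<forall>x\<in>total_ring T. \<forall>y\<in>total_ring T. x * y = 0 \<longrightarrow> x = 0 \<or> y = 0" by (rule domain_total_ring[OF T(3)])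
    show "?A \<subseteq> total_ring T" using AP PR RT by blast
    show "?P = adjoin ?A (monom ?x 1)" by (rule total_ring_forms_Suc)
    have "monom ?x 1 \<in> ?P" by (intro monom_total_ring gP coord_in_forms) simp
    thus "monom ?x 1 \<in> total_ring T" using PR RT by blast
    show "\<forall>Q\<in>coeffs_in ?A. poly Q (monom ?x 1) = 0 \<longrightarrow> Q = 0" by (rule last_coordinate_transcendental[OF w(1)])
    show "subring (total_ring R)" by (rule subring_total_ring[OF R])
    show "total_ring R = mspan ?P ((\<lambda>(e, b). monom b e) ` B)" by (rule total_ring_mspan[OF R gP w(2) B])
    show "monom t 1 \<in> total_ring T" by (rule monom_total_ring[OF T(1) t])
    show "monom p l \<in> ?A" by (rule monom_total_ring[OF gA rel(1)])
    show "monom p l \<noteq> 0" using rel(2) by simp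
    show "\<forall>i<I. monom (r i) (l + I - i) \<in> total_ring R" using rel(4) monom_total_ring[OF R] by blast
  qed (use sA AP PR RT noetherian_forms Cin lead Ct rel' B in auto)
  then obtain n s where s: "\<forall>i<n. s i \<in> ?P" "monom t 1 ^ n = (\<Sum>i<n. s i * monom t 1 ^ i)" by blast
  hence "\<forall>i<n. s i \<in> total_ring R" using PR by blast
  from homogeneous_relation[OF this s(2)] show ?thesis unfolding mult_1_right by blast
qed

text \<open>
  An element of a finite extension of a ring of forms has a nonzero multiple in that ring: the constant term of an
  integral equation of least degree.
\<close>

lemma multiple_in_forms:
  assumes R: "graded_ring R" "\<And>k. forms n w k \<subseteq> R k" "finite_over R (forms n w)"
    and T: "graded_ring T" "\<And>k. R k \<subseteq> T k" "graded_domain T"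
    and c: "c \<in> R e" "c \<noteq> 0" "c * t \<in> R (e + 1)"
  shows "\<exists>N>0. \<exists>g\<in>forms n w (N * e). g \<noteq> 0 \<and> g * t \<in> R (N * e + 1)"
proof -
  define Q where "Q N h \<longleftrightarrow> (\<forall>i<N. h i \<in> forms n w ((N - i) * e)) \<and> c ^ N = (\<Sum>i<N. h i * c ^ i)" for N h
  have "\<exists>N h. Q N h" unfolding Q_def by (rule integral_over_forms[OF R c(1)])
  then obtain N h where h: "Q N h" and min: "\<And>M. M < N \<Longrightarrow> \<not> (\<exists>h. Q M h)"
    using exists_least_iff[of "\<lambda>N. \<exists>h. Q N h"] by blast
  have N0: "N \<noteq> 0"
  proof
    assume "N = 0"
    hence "c ^ 0 = 0" using h unfolding Q_def by simp
    thus False using c(2) by (auto simp: fun_eq_iff)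
  qed
  then obtain M where M: "N = Suc M" using not0_implies_Suc by blast
  define b where "b = c ^ M - (\<Sum>i<M. h (Suc i) * c ^ i)"
  have bR: "b \<in> R (M * e)"
  proof -
    have "h (Suc i) * c ^ i \<in> R (M * e)" if "i < M" for i
    proof -
      have "h (Suc i) \<in> R ((M - i) * e)" using h that R(2) unfolding Q_def M by fastforce
      hence "h (Suc i) * c ^ i \<in> R ((M - i) * e + i * e)"
        using graded_ringD(3)[OF R(1)] graded_ringD(7)[OF R(1) c(1)] by blast
      thus ?thesis using that by (simp flip: add_mult_distrib)
    qed
    hence "(\<Sum>i<M. h (Suc i) * c ^ i) \<in> R (M * e)" by (intro graded_ring_sum[OF R(1)]) auto
    thus ?thesis unfolding b_def
      using fv.subspace_diff[OF graded_ringD(1)[OF R(1)] graded_ringD(7)[OF R(1) c(1)]] by blast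
  qed
  have eq: "h 0 = c * b"
  proof -
    have "c * c ^ M = h 0 + (\<Sum>i<M. h (Suc i) * (c * c ^ i))"
      using h unfolding Q_def M sum.lessThan_Suc_shift by simp
    thus ?thesis unfolding b_def by (simp add: right_diff_distrib sum_distrib_left mult_ac)
  qed
  have "b \<noteq> 0"
  proof
    assume "b = 0"
    hence "Q M (\<lambda>i. h (Suc i))" using h unfolding Q_def M b_def by auto
    thus False using min[of M] M by auto
  qed
  hence "h 0 \<noteq> 0" using eq c bR T unfolding graded_domain_def by (metis subsetD)
  moreover have "h 0 \<in> forms n w (N * e)" using h N0 unfolding Q_def by fastforce
  moreover have "h 0 * t \<in> R (N * e + 1)"
  proof -
    have "b * (c * t) \<in> R (M * e + (e + 1))" by (rule graded_ringD(3)[OF R(1) bR c(3)])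
    thus ?thesis unfolding eq M by (simp add: mult_ac add_ac)
  qed
  ultimately show ?thesis using N0 by blast
qed

text \<open>
  If no relation \<open>p t\<^sup>I = \<Sum>\<^bsub>i < I\<^esub> r\<^sub>i t\<^sup>i\<close> with
  \<open>r\<^sub>i \<in> R\<close> has a leading coefficient \<open>p\<close> that is a nonzero form in the
  first \<open>d\<close> variables only, then the products of monomials in these variables with positive powers
  of \<open>t\<close> are linearly independent modulo \<open>R\<close>.
\<close>

lemma growth_if_no_relation:
  fixes R T :: "nat \<Rightarrow> ('z \<Rightarrow> complex) set"
  assumes R: "graded_ring R" and T: "graded_ring T" "\<And>k. R k \<subseteq> T k" "finite W" "T k \<subseteq> fv.span W"
    and w: "independent_coords (Suc d) w" "\<And>k. forms (Suc d) w k \<subseteq> R k"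
    and t: "t \<in> T 1" and k: "k \<ge> 1"
    and no: "\<And>p l I r. p \<in> forms d w l \<Longrightarrow> p \<noteq> 0 \<Longrightarrow> \<forall>i<I. r i \<in> R (l + I - i) \<Longrightarrow>
      p * t ^ I \<noteq> (\<Sum>i<I. r i * t ^ i)"
  shows "fv.dim (R k) + ((k - 1) div d + 1) ^ d \<le> fv.dim (T k)"
proof -
  \<comment> \<open>A box of exponents of total degree at most \<open>k - 1\<close>, so that the exponent of \<open>t\<close> in \<open>m a\<close> is positive.\<close>
  define E where "E = {a. (\<forall>i<d. a i \<le> (k - 1) div d) \<and> (\<forall>i\<ge>d. a i = (0::nat))}"
  define deg where "deg a = (\<Sum>i<d. a i)" for a :: "nat \<Rightarrow> nat"
  define m where "m a = (\<lambda>z. monomial d a (w z)) * t ^ (k - deg a)" for a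
  have degE: "deg a \<le> k - 1" if "a \<in> E" for a
  proof -
    have "deg a \<le> d * ((k - 1) div d)" unfolding deg_def using sum_bounded_above[of "{..<d}" a "(k - 1) div d"] that E_def by simp
    also have "\<dots> \<le> k - 1" by simp
    finally show ?thesis .
  qed
  have mon: "(\<lambda>z. monomial d a (w z)) \<in> forms d w (deg a)" for a
  proof -
    have "monomial d a v = monomial d a (trunc d v)" for v unfolding monomial_def by (intro prod.cong) auto
    thus ?thesis using formsI[OF homogeneous_monomial[of a d], of d w] by (simp add: deg_def)
  qed
  have formsR: "forms d w l \<subseteq> R l" for l using forms_mono[of d "Suc d" w l] w(2) by auto
  have mT: "m a \<in> T k" if "a \<in> E" for a
  proof -
    have "(\<lambda>z. monomial d a (w z)) \<in> T (deg a)" using mon formsR T(2) by blast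
    moreover have "t ^ (k - deg a) \<in> T (k - deg a)" using graded_ringD(7)[OF T(1) t] by simp
    ultimately have "m a \<in> T (deg a + (k - deg a))" unfolding m_def by (rule graded_ringD(3)[OF T(1)])
    thus ?thesis using degE[OF that] k by simp
  qed
  have key: "c a = 0" if F: "finite F" "F \<subseteq> E" and f: "f \<in> R k" "(\<Sum>a\<in>F. (\<lambda>z. c a * m a z)) = f" and a: "a \<in> F" for F c f a
  proof (rule ccontr)
    assume "c a \<noteq> 0"
    define F' where "F' = {a\<in>F. c a \<noteq> 0}"
    have F': "finite F'" "F' \<noteq> {}" "F' \<subseteq> E" "\<forall>a\<in>F'. c a \<noteq> 0" using F a \<open>c a \<noteq> 0\<close> unfolding F'_def by auto
    \<comment> \<open>The highest power of \<open>t\<close> in the relation; its coefficient is the forbidden leading coefficient.\<close>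
    define I where "I = Max ((\<lambda>a. k - deg a) ` F')"
    have Ile: "k - deg a \<le> I" if "a \<in> F'" for a unfolding I_def using F' that by auto
    have "I \<in> (\<lambda>a. k - deg a) ` F'" unfolding I_def using F' by (intro Max_in) auto
    then obtain a0 where a0: "a0 \<in> F'" "I = k - deg a0" by blast
    have I: "I \<ge> 1" "I \<le> k" "deg a0 = k - I" using a0 degE F'(3) k by fastforce+
    define G where "G i = {a\<in>F'. k - deg a = i}" for i
    have degG: "deg a = k - i" if "a \<in> G i" "i \<le> k" for a i using that degE F'(3) k unfolding G_def by fastforce
    define s where "s i = (\<Sum>a\<in>G i. (\<lambda>z. c a * monomial d a (w z)))" for i
    have sin: "s i \<in> forms d w (k - i)" if "i \<le> k" for i
      unfolding s_def
    proof (intro graded_ring_sum[OF graded_ring_forms] fv.subspace_scale[OF subspace_forms])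
      fix a assume "a \<in> G i"
      thus "(\<lambda>z. monomial d a (w z)) \<in> forms d w (k - i)" using degG[OF _ that] mon[of a] by simp
    qed
    have tot: "f = (\<Sum>i\<le>I. s i * t ^ i)"
    proof -
      have "f = (\<Sum>a\<in>F'. (\<lambda>z. c a * m a z))" unfolding f(2)[symmetric] F'_def
        by (rule sum.mono_neutral_right) (use F in \<open>auto simp: fun_eq_iff\<close>)
      also have "\<dots> = (\<Sum>i\<le>I. \<Sum>a\<in>G i. (\<lambda>z. c a * m a z))"
        unfolding G_def by (rule sum.group[symmetric]) (use F' Ile in auto)
      also have "\<dots> = (\<Sum>i\<le>I. s i * t ^ i)"
        unfolding s_def sum_distrib_right
        by (intro sum.cong) (auto simp: fun_eq_iff m_def G_def mult.assoc)
      finally show ?thesis .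
    qed
    have "s I \<noteq> 0"
    proof
      assume s0: "s I = 0"
      have "s I z = (\<Sum>a\<in>G I. c a * monomial d a (w z))" for z by (simp add: s_def sum_fun_apply)
      hence z: "(\<Sum>a\<in>G I. c a * monomial d a (w z)) = 0" for z using s0 by simp
      define q where "q v = (\<Sum>a\<in>G I. c a * monomial d a v)" for v
      have tr: "monomial d a (trunc (Suc d) v) = monomial d a v" for a v unfolding monomial_def by (intro prod.cong) auto
      have "homogeneous (k - I) q" unfolding q_def
      proof (intro homogeneous_sum homogeneous_scale)
        fix a assume "a \<in> G I"
        thus "homogeneous (k - I) (monomial d a)"
          using degG[OF _ I(2)] homogeneous_monomial[of a d] unfolding deg_def by simp
      qed
      moreover have "q (trunc (Suc d) (w y)) = 0" for y unfolding q_def tr using z .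
      ultimately have "q (trunc (Suc d) v) = 0" for v using w(1) unfolding independent_coords_def by blast
      hence "\<forall>v. (\<Sum>a\<in>G I. c a * monomial d a v) = 0" unfolding q_def tr by blast
      moreover have "finite (G I)" "\<forall>a\<in>G I. \<forall>i\<ge>d. a i = 0" using F' unfolding G_def E_def by auto
      ultimately have "\<forall>a\<in>G I. c a = 0" using monomials_independent by blast
      thus False using a0 F'(4) unfolding G_def by auto
    qed
    define r where "r i = (if i = 0 then f - s 0 else - s i)" for i
    have "\<forall>i<I. r i \<in> R ((k - I) + I - i)"
    proof (intro allI impI)
      fix i assume i: "i < I"
      have "s i \<in> R (k - i)" using sin[of i] formsR i I by auto
      thus "r i \<in> R ((k - I) + I - i)"
        unfolding r_def using f(1) I graded_ringD(6)[OF R] fv.subspace_diff[OF graded_ringD(1)[OF R]] by auto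
    qed
    moreover have "s I * t ^ I = (\<Sum>i<I. r i * t ^ i)"
    proof -
      have "(\<Sum>i<I. r i * t ^ i) = (\<Sum>i<I. (if i = 0 then f else 0) - s i * t ^ i)"
        unfolding r_def by (intro sum.cong) (auto simp: algebra_simps)
      also have "\<dots> = f - (\<Sum>i<I. s i * t ^ i)" using I by (simp add: sum_subtractf)
      also have "\<dots> = s I * t ^ I" unfolding tot lessThan_Suc_atMost[symmetric] by simp
      finally show ?thesis by simp
    qed
    ultimately show False using no[of "s I" "k - I" I r] sin[of I] I \<open>s I \<noteq> 0\<close> by blast
  qed
  have finE: "finite E" and cardE: "card E = ((k - 1) div d + 1) ^ d"
  proof -
    have "bij_betw (\<lambda>a. restrict a {..<d}) E ({..<d} \<rightarrow>\<^sub>E {..(k - 1) div d})"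
      by (rule bij_betwI[where g = "\<lambda>a i. if i < d then a i else 0"])
        (auto simp: E_def PiE_def extensional_def fun_eq_iff)
    from bij_betw_same_card[OF this] bij_betw_finite[OF this]
    show "finite E" "card E = ((k - 1) div d + 1) ^ d" by (simp_all add: card_PiE finite_PiE)
  qed
  have injm: "inj_on m E"
  proof (rule inj_onI, rule ccontr)
    fix a b assume ab: "a \<in> E" "b \<in> E" "m a = m b" "a \<noteq> b"
    let ?c = "\<lambda>x. if x = a then 1 else - 1 :: complex"
    have "(\<Sum>x\<in>{a, b}. (\<lambda>z. ?c x * m x z)) = (\<lambda>z. ?c a * m a z) + (\<lambda>z. ?c b * m b z)"
      using ab(4) by simp
    also have "\<dots> = 0" unfolding ab(3) if_P[OF refl] if_not_P[OF ab(4)[symmetric]] by (rule ext) simp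
    finally have "?c a = 0" using ab(1,2) by (intro key[OF _ _ graded_ringD(4)[OF R], of "{a, b}" ?c a]) auto
    thus False by simp
  qed
  obtain U where U: "U \<subseteq> R k" "fv.independent U" "R k \<subseteq> fv.span U" "card U = fv.dim (R k)"
    using fv.basis_exists by blast
  obtain V where V: "V \<subseteq> T k" "fv.independent V" "T k \<subseteq> fv.span V" "card V = fv.dim (T k)"
    using fv.basis_exists by blast
  have "V \<subseteq> fv.span W" using V T by blast
  hence finV: "finite V" using fv.independent_span_bound[OF T(3) V(2)] by blast
  have "U \<subseteq> fv.span V" using U V T by blast
  hence finU: "finite U" using fv.independent_span_bound[OF finV U(2)] by blast
  have spanU: "u \<in> R k" if "u \<in> fv.span U" for u
    using that fv.span_minimal[OF U(1) graded_ringD(1)[OF R]] by blast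
  have mR: "m a \<notin> R k" if "a \<in> E" for a
  proof
    assume "m a \<in> R k"
    from key[OF _ _ this, of "{a}" "\<lambda>_. 1" a] that show False by simp
  qed
  have disj: "U \<inter> m ` E = {}" using mR U(1) by blast
  have ind: "fv.independent (U \<union> m ` E)"
  proof -
    have fin: "finite (U \<union> m ` E)" using finU finE by simp
    show ?thesis unfolding fv.dependent_finite[OF fin]
    proof
      assume "\<exists>c. (\<exists>v\<in>U \<union> m ` E. c v \<noteq> 0) \<and> (\<Sum>v\<in>U \<union> m ` E. (\<lambda>x. c v * v x)) = 0"
      then obtain c where c: "\<exists>v\<in>U \<union> m ` E. c v \<noteq> 0" "(\<Sum>v\<in>U \<union> m ` E. (\<lambda>x. c v * v x)) = 0" by blast
      have sum: "(\<Sum>v\<in>U. (\<lambda>x. c v * v x)) + (\<Sum>a\<in>E. (\<lambda>x. c (m a) * m a x)) = 0"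
        using c(2) finU finE disj by (simp add: sum.union_disjoint sum.reindex[OF injm])
      have "- (\<Sum>v\<in>U. (\<lambda>x. c v * v x)) \<in> R k"
        using U(1) by (intro graded_ringD(6)[OF R] graded_ring_sum[OF R] fv.subspace_scale[OF graded_ringD(1)[OF R]]) auto
      from key[OF finE order_refl this] have z: "c (m a) = 0" if "a \<in> E" for a
        using sum that by (simp add: eq_neg_iff_add_eq_0 add.commute)
      hence "(\<Sum>a\<in>E. (\<lambda>x. c (m a) * m a x)) = 0" by (intro sum.neutral) (auto simp: fun_eq_iff)
      hence "(\<Sum>v\<in>U. (\<lambda>x. c v * v x)) = 0" using sum by simp
      hence "\<forall>v\<in>U. c v = 0" using U(2) unfolding fv.dependent_finite[OF finU] by blast
      thus False using c(1) z by blast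
    qed
  qed
  have "U \<union> m ` E \<subseteq> fv.span V" using U T V mT by blast
  hence "card (U \<union> m ` E) \<le> card V" using fv.independent_span_bound[OF finV ind] by blast
  moreover have "card (U \<union> m ` E) = card U + card E"
    using finU finE disj by (simp add: card_Un_disjoint card_image[OF injm])
  ultimately show ?thesis using U(4) V(4) cardE by simp
qed

lemma finite_over_constants:
  assumes "finite_over G (forms 0 w)" shows "\<exists>j. \<forall>k\<ge>j. G k \<subseteq> {0}"
proof -
  obtain B where B: "finite B" "\<And>k. G k \<subseteq> fv.span (generated_part B (forms 0 w) k)"
    using assms unfolding finite_over_def by blast
  define j where "j = Suc (Max (insert 0 (fst ` B)))"
  have j: "e < j" if "(e, b) \<in> B" for e b
    using B(1) that unfolding j_def by (force simp: less_Suc_eq_le intro: Max_ge)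
  have "G k \<subseteq> {0}" if k: "k \<ge> j" for k
  proof -
    have "generated_part B (forms 0 w) k \<subseteq> {0}"
    proof
      fix f assume "f \<in> generated_part B (forms 0 w) k"
      then obtain g e b where f: "f = g * b" "(e, b) \<in> B" "g \<in> forms 0 w (k - e)"
        unfolding generated_part_def by blast
      have "k - e > 0" using j[OF f(2)] k by simp
      hence "g = 0" using f(3) forms_no_variables[of "k - e" w] by blast
      hence "f = 0" unfolding f(1) by (simp add: fun_eq_iff)
      thus "f \<in> {0}" by simp
    qed
    hence "fv.span (generated_part B (forms 0 w) k) \<subseteq> {0}"
      using fv.span_mono[of _ "{0}"] fv.span_insert_0[of "{}"] by auto
    thus ?thesis using B(2) by blast
  qed
  thus ?thesis by blast
qed

text \<open>
  The dichotomy behind the theorem: \<open>t\<close> is integral over \<open>R\<close>, or \<open>T\<close> is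
  bigger than \<open>R\<close> by as much as the full order of growth of \<open>R\<close>. This is the algebraic
  form of the fact that a birational linear projection lowers the degree of a projective variety whenever its
  center meets the variety. The denominator \<open>c\<close> of \<open>t\<close> yields a denominator that is a
  form and, in general position, monic in the last variable. So a relation for \<open>t\<close> whose leading
  coefficient does not involve this variable would make \<open>t\<close> integral, and without such relations
  the powers of \<open>t\<close> contribute new elements.
\<close>

theorem integral_or_growth:
  fixes R T :: "nat \<Rightarrow> ('z \<Rightarrow> complex) set"
  assumes R: "graded_ring R" "\<And>k. forms n x k \<subseteq> R k" "finite_over R (forms n x)"
    and T: "graded_ring T" "\<And>k. R k \<subseteq> T k" "graded_domain T" "\<And>k. \<exists>W. finite W \<and> T k \<subseteq> fv.span W"
    and t: "t \<in> T 1" and c: "c \<in> R e" "e > 0" "c \<noteq> 0" "c * t \<in> R (e + 1)"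
  shows "\<exists>d. (\<exists>C. \<forall>k. \<exists>W. finite W \<and> card W \<le> C * (k + 1) ^ d \<and> R k \<subseteq> fv.span W) \<and>
    ((\<exists>N h. (\<forall>i<N. h i \<in> R (N - i)) \<and> t ^ N = (\<Sum>i<N. h i * t ^ i)) \<or>
     (\<forall>k\<ge>1. fv.dim (R k) + ((k - 1) div d + 1) ^ d \<le> fv.dim (T k)))"
proof -
  obtain D w where w: "independent_coords D w" "\<And>k. forms D w k \<subseteq> forms n x k"
    "finite_over (forms n x) (forms D w)" using Noether_normalization[of n x] by blast
  have wR: "forms D w k \<subseteq> R k" for k using w(2) R(2) by blast
  have fin: "finite_over R (forms D w)" by (rule finite_over_trans[OF R(3) w(3) R(1,2)])
  have "D \<noteq> 0"
  proof
    assume D: "D = 0"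
    obtain j where j: "\<forall>k\<ge>j. R k \<subseteq> {0}"
      using finite_over_constants[of R w] fin unfolding D by blast
    have "j * e \<ge> j" using c(2) by simp
    moreover have "c ^ j \<in> R (j * e)" by (rule graded_ringD(7)[OF R(1) c(1)])
    ultimately have "c ^ j = 0" using j by blast
    thus False using graded_domain_power[OF T(1,3) _ c(3)] c(1) T(2) by blast
  qed
  then obtain d where d: "D = Suc d" using not0_implies_Suc by blast
  obtain N g where g: "N > 0" "g \<in> forms (Suc d) w (N * e)" "g \<noteq> 0" "g * t \<in> R (N * e + 1)"
    using multiple_in_forms[OF R(1) wR fin T(1-3) c(1,3,4)] unfolding d by blast
  obtain q where q: "homogeneous (N * e) q" "g = (\<lambda>z. q (trunc (Suc d) (w z)))" using g(2) unfolding forms_def by blast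
  obtain z where z: "q (trunc (Suc d) (w z)) \<noteq> 0" using g(3) q(2) by (auto simp: fun_eq_iff)
  have "N * e > 0" using g(1) c(2) by simp
  from general_position[OF q(1) this z, of w] obtain w' q' where
    w': "\<forall>l. forms (Suc d) w' l = forms (Suc d) w l" "independent_coords (Suc d) w'" and
    q': "homogeneous (N * e) q'" "q' (last_unit d) \<noteq> 0" "\<forall>z. q' (trunc (Suc d) (w' z)) = q (trunc (Suc d) (w z))"
    using w(1) unfolding d by blast
  have eqf: "forms (Suc d) w' = forms (Suc d) w" using w'(1) by blast
  have w'R: "forms (Suc d) w' k \<subseteq> R k" for k using wR d eqf by simp
  have fin': "finite_over R (forms (Suc d) w')" using fin d eqf by simp
  have q't: "(\<lambda>z. q' (trunc (Suc d) (w' z))) * t \<in> R (N * e + 1)" using g(4) q(2) q'(3) by simp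
  show ?thesis
  proof (rule exI[of _ d], rule conjI)
    show "\<exists>C. \<forall>k. \<exists>W. finite W \<and> card W \<le> C * (k + 1) ^ d \<and> R k \<subseteq> fv.span W"
      using finite_over_dim[OF fin'] by simp
    show "(\<exists>N h. (\<forall>i<N. h i \<in> R (N - i)) \<and> t ^ N = (\<Sum>i<N. h i * t ^ i)) \<or>
     (\<forall>k\<ge>1. fv.dim (R k) + ((k - 1) div d + 1) ^ d \<le> fv.dim (T k))"
    proof (rule disjCI, rule ccontr)
      assume nk: "\<not> (\<forall>k\<ge>1. fv.dim (R k) + ((k - 1) div d + 1) ^ d \<le> fv.dim (T k))"
        and ni: "\<not> (\<exists>N h. (\<forall>i<N. h i \<in> R (N - i)) \<and> t ^ N = (\<Sum>i<N. h i * t ^ i))"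
      from nk obtain k where k: "k \<ge> 1" "\<not> fv.dim (R k) + ((k - 1) div d + 1) ^ d \<le> fv.dim (T k)" by blast
      obtain W where W: "finite W" "T k \<subseteq> fv.span W" using T(4) by blast
      have "fv.dim (R k) + ((k - 1) div d + 1) ^ d \<le> fv.dim (T k)"
        using graded_integral_if_relation[OF R(1) T(1-3) w'(2) w'R fin' q'(1,2) q't t] ni
        by (intro growth_if_no_relation[OF R(1) T(1,2) W w'(2) w'R t k(1)]) blast
      thus False using k(2) by blast
    qed
  qed
qed

section \<open>The Nullstellensatz\<close>

lemma prod_fun_apply: "(\<Prod>i\<in>I. f i) z = (\<Prod>i\<in>I. f i (z :: 'z) :: complex)"
  by (induction I rule: infinite_finite_induct) auto

definition monomials_upto :: "nat \<Rightarrow> nat \<Rightarrow> (cvec \<Rightarrow> complex) set" where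
  "monomials_upto n K = (\<Union>k\<le>K. monomial n ` exponents n k)"

text \<open>Polynomial functions in the first \<open>n\<close> coordinates, not necessarily homogeneous.\<close>

definition polyfuns :: "nat \<Rightarrow> (cvec \<Rightarrow> complex) set" where
  "polyfuns n = (\<Union>K. fv.span (monomials_upto n K))"

lemma monomials_upto_mono: "K \<le> L \<Longrightarrow> monomials_upto n K \<subseteq> monomials_upto n L"
  unfolding monomials_upto_def by (intro UN_mono) auto

lemma polyfuns_homogeneous: "homogeneous k p \<Longrightarrow> (\<lambda>v. p (trunc n v)) \<in> polyfuns n"
proof -
  assume p: "homogeneous k p"
  have "monomial n ` exponents n k \<subseteq> monomials_upto n k" unfolding monomials_upto_def by auto
  from subsetD[OF fv.span_mono[OF this] homogeneous_span_monomials[OF p]]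
  show ?thesis unfolding polyfuns_def by blast
qed

lemma polyfuns_const: "(\<lambda>v. c) \<in> polyfuns n"
  using polyfuns_homogeneous[OF homogeneous.const] by simp

lemma polyfuns_coord: "i < n \<Longrightarrow> (\<lambda>v. v i) \<in> polyfuns n"
  using polyfuns_homogeneous[OF homogeneous.coord, of n i] by simp

lemma polyfuns_add: "f \<in> polyfuns n \<Longrightarrow> g \<in> polyfuns n \<Longrightarrow> f + g \<in> polyfuns n"
proof -
  assume "f \<in> polyfuns n" "g \<in> polyfuns n"
  then obtain K L where K: "f \<in> fv.span (monomials_upto n K)" "g \<in> fv.span (monomials_upto n L)"
    unfolding polyfuns_def by blast
  have "f \<in> fv.span (monomials_upto n (max K L))" "g \<in> fv.span (monomials_upto n (max K L))"
    using K fv.span_mono[OF monomials_upto_mono] by (meson max.cobounded1 max.cobounded2 subsetD)+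
  from fv.span_add[OF this] show ?thesis unfolding polyfuns_def by blast
qed

lemma polyfuns_mult: "f \<in> polyfuns n \<Longrightarrow> g \<in> polyfuns n \<Longrightarrow> f * g \<in> polyfuns n"
proof -
  assume "f \<in> polyfuns n" "g \<in> polyfuns n"
  then obtain K L where K: "f \<in> fv.span (monomials_upto n K)" "g \<in> fv.span (monomials_upto n L)"
    unfolding polyfuns_def by blast
  have "f * g \<in> fv.span (monomials_upto n (K + L))"
  proof (rule span_mult[OF K])
    fix u v assume "u \<in> monomials_upto n K" "v \<in> monomials_upto n L"
    then obtain a b k l where ab: "u = monomial n a" "v = monomial n b" "a \<in> exponents n k" "b \<in> exponents n l" "k \<le> K" "l \<le> L"
      unfolding monomials_upto_def by auto
    have "(\<lambda>i. a i + b i) \<in> exponents n (k + l)" using ab by (auto simp: exponents_def sum.distrib)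
    moreover have "u * v = monomial n (\<lambda>i. a i + b i)" unfolding ab using monomial_mult by (auto simp: fun_eq_iff)
    moreover have "k + l \<le> K + L" using ab by simp
    ultimately have "u * v \<in> monomials_upto n (K + L)" unfolding monomials_upto_def by blast
    thus "u * v \<in> fv.span (monomials_upto n (K + L))" by (rule fv.span_base)
  qed
  thus ?thesis unfolding polyfuns_def by blast
qed

lemma subring_polyfuns: "subring (polyfuns n)"
  unfolding subring_def
proof (intro conjI ballI)
  show "1 \<in> polyfuns n" using polyfuns_const[of 1 n] by (simp add: one_fun_def)
  fix f assume f: "f \<in> polyfuns n"
  have "(\<lambda>v. - 1) * f \<in> polyfuns n" by (rule polyfuns_mult[OF polyfuns_const f])
  thus "- f \<in> polyfuns n" by (simp add: times_fun_def fun_Compl_def)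
qed (auto intro: polyfuns_add polyfuns_mult)

lemma polyfuns_scale: "f \<in> polyfuns n \<Longrightarrow> (\<lambda>v. c * f v) \<in> polyfuns n"
  using polyfuns_mult[OF polyfuns_const, of f n c] by (simp add: times_fun_def)

definition ideal_of :: "'r::comm_ring_1 set \<Rightarrow> 'r set \<Rightarrow> bool" where
  "ideal_of R M \<longleftrightarrow> M \<subseteq> R \<and> 0 \<in> M \<and> (\<forall>x\<in>M. \<forall>y\<in>M. x + y \<in> M) \<and> (\<forall>r\<in>R. \<forall>x\<in>M. r * x \<in> M)"

lemma maximal_ideal_exists:
  fixes R :: "'r::comm_ring_1 set"
  assumes R: "subring R" and I: "ideal_of R I" "1 \<notin> I"
  shows "\<exists>M. I \<subseteq> M \<and> ideal_of R M \<and> 1 \<notin> M \<and>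
    (\<forall>x\<in>R. x \<notin> M \<longrightarrow> (\<exists>g\<in>R. g * x - 1 \<in> M))"
proof -
  define A where "A = {M. I \<subseteq> M \<and> ideal_of R M \<and> 1 \<notin> M}"
  have "\<exists>M\<in>A. \<forall>N\<in>A. M \<subseteq> N \<longrightarrow> N = M"
  proof (rule subset_Zorn_nonempty)
    show "A \<noteq> {}" using I unfolding A_def by blast
    fix C assume C: "C \<noteq> {}" "subset.chain A C"
    have CA: "C \<subseteq> A" using C(2) by (simp add: subset_chain_def)
    have "ideal_of R (\<Union>C)" unfolding ideal_of_def
    proof (intro conjI ballI)
      show "\<Union>C \<subseteq> R" using CA unfolding A_def ideal_of_def by blast
      show "0 \<in> \<Union>C" using C(1) CA unfolding A_def ideal_of_def by blast
      fix x assume "x \<in> \<Union>C"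
      then obtain X where X: "X \<in> C" "x \<in> X" by blast
      { fix y assume "y \<in> \<Union>C"
        then obtain Y where Y: "Y \<in> C" "y \<in> Y" by blast
        have "X \<subseteq> Y \<or> Y \<subseteq> X" using C(2) X Y by (auto simp: subset_chain_def)
        thus "x + y \<in> \<Union>C" using X Y CA unfolding A_def ideal_of_def by blast }
      fix r assume "r \<in> R"
      thus "r * x \<in> \<Union>C" using X CA unfolding A_def ideal_of_def by blast
    qed
    moreover have "I \<subseteq> \<Union>C" using C(1) CA unfolding A_def by blast
    moreover have "1 \<notin> \<Union>C" using CA unfolding A_def by blast
    ultimately show "\<Union>C \<in> A" unfolding A_def by blast
  qed
  then obtain M where MA: "M \<in> A" and "\<forall>N\<in>A. M \<subseteq> N \<longrightarrow> N = M" ..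
  hence max: "N = M" if "N \<in> A" "M \<subseteq> N" for N using that by blast
  have M: "I \<subseteq> M" "ideal_of R M" "1 \<notin> M" using MA unfolding A_def by auto
  have "\<exists>g\<in>R. g * x - 1 \<in> M" if x: "x \<in> R" "x \<notin> M" for x
  proof (rule ccontr)
    assume no: "\<not> ?thesis"
    define N where "N = {g * x + m |g m. g \<in> R \<and> m \<in> M}"
    have MN: "M \<subseteq> N" unfolding N_def using subringD(5)[OF R] by force
    have xN: "x \<in> N" unfolding N_def using subringD(1)[OF R] M(2) unfolding ideal_of_def
      by (intro CollectI exI[of _ 1] exI[of _ 0]) auto
    have "ideal_of R N" unfolding ideal_of_def
    proof (intro conjI ballI)
      show "N \<subseteq> R" unfolding N_def using R x M(2) unfolding ideal_of_def by (auto intro!: subringD(2,3)[OF R])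
      show "0 \<in> N" using MN M(2) unfolding ideal_of_def by blast
      fix a assume "a \<in> N"
      then obtain g m where a: "a = g * x + m" "g \<in> R" "m \<in> M" unfolding N_def by blast
      { fix b assume "b \<in> N"
        then obtain g' m' where b: "b = g' * x + m'" "g' \<in> R" "m' \<in> M" unfolding N_def by blast
        have "a + b = (g + g') * x + (m + m')" unfolding a b by (simp add: algebra_simps)
        moreover have "g + g' \<in> R" "m + m' \<in> M" using a b R M(2) unfolding ideal_of_def by (auto intro: subringD)
        ultimately show "a + b \<in> N" unfolding N_def by blast }
      fix r assume r: "r \<in> R"
      have "r * a = (r * g) * x + r * m" unfolding a by (simp add: algebra_simps)
      moreover have "r * g \<in> R" "r * m \<in> M" using a r R M(2) unfolding ideal_of_def by (auto intro: subringD)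
      ultimately show "r * a \<in> N" unfolding N_def by blast
    qed
    moreover have "1 \<notin> N"
    proof
      assume "1 \<in> N"
      then obtain g m where g: "1 = g * x + m" "g \<in> R" "m \<in> M" unfolding N_def by blast
      have "(- 1) * m \<in> M" using g(3) M(2) subringD(1,4)[OF R] unfolding ideal_of_def by blast
      moreover have "m = 1 - g * x" using g(1) by (metis add_diff_cancel_left')
      hence "(- 1) * m = g * x - 1" by simp
      ultimately show False using no g(2) by auto
    qed
    ultimately have "N \<in> A" using MN M(1) unfolding A_def by blast
    thus False using max MN xN x(2) by blast
  qed
  thus ?thesis using M by blast
qed

lemma uncountable_complex: "uncountable (UNIV :: complex set)"
proof
  assume "countable (UNIV :: complex set)"
  hence "countable (range complex_of_real)" by (rule countable_subset[rotated]) simp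
  moreover have "inj complex_of_real" by (auto intro: injI)
  ultimately have "countable (UNIV :: real set)" by (rule countable_image_inj_on)
  thus False using uncountable_UNIV_real by blast
qed

text \<open>
  Uncountably many elements of a space with a countable spanning set satisfy a nontrivial linear relation.
\<close>

lemma polyfuns_relation:
  assumes "\<And>l::complex. g l \<in> polyfuns n"
  shows "\<exists>F c. finite F \<and> (\<exists>l\<in>F. c l \<noteq> 0) \<and> (\<Sum>l\<in>F. (\<lambda>v. c l * g l v)) = (0 :: cvec \<Rightarrow> complex)"
proof -
  have "\<exists>K. infinite {l. g l \<in> fv.span (monomials_upto n K)}"
  proof (rule ccontr)
    assume "\<not> ?thesis"
    hence "countable (\<Union>K. {l. g l \<in> fv.span (monomials_upto n K)})" by (auto intro: countable_finite)
    moreover have "(\<Union>K. {l. g l \<in> fv.span (monomials_upto n K)}) = UNIV" using assms unfolding polyfuns_def by blast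
    ultimately show False using uncountable_complex by simp
  qed
  then obtain K where K: "infinite {l. g l \<in> fv.span (monomials_upto n K)}" by blast
  have fin: "finite (monomials_upto n K)" unfolding monomials_upto_def using finite_card_exponents(1) by auto
  obtain F where F: "F \<subseteq> {l. g l \<in> fv.span (monomials_upto n K)}" "finite F" "card F = Suc (card (monomials_upto n K))"
    using infinite_arbitrarily_large[OF K] by blast
  show ?thesis
  proof (cases "inj_on g F")
    case True
    have "fv.dependent (g ` F)"
    proof (rule ccontr)
      assume "\<not> fv.dependent (g ` F)"
      moreover have "g ` F \<subseteq> fv.span (monomials_upto n K)" using F(1) by blast
      ultimately have "card (g ` F) \<le> card (monomials_upto n K)" using fv.independent_span_bound[OF fin] by blast
      thus False using F(3) card_image[OF True] by simp
    qed
    from this[unfolded fv.dependent_finite[OF finite_imageI[OF F(2)]]]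
    obtain c where c: "(\<exists>u\<in>g ` F. c u \<noteq> 0) \<and> (\<Sum>u\<in>g ` F. (\<lambda>v. c u * u v)) = 0" ..
    have "(\<Sum>l\<in>F. (\<lambda>v. c (g l) * g l v)) = 0" using c by (simp add: sum.reindex[OF True])
    moreover have "\<exists>l\<in>F. c (g l) \<noteq> 0" using c by blast
    ultimately show ?thesis using F(2) by (intro exI[of _ F] exI[of _ "\<lambda>l. c (g l)"] conjI)
  next
    case False
    then obtain a b where ab: "a \<noteq> b" "g a = g b" unfolding inj_on_def by blast
    have "(\<Sum>l\<in>{a, b}. (\<lambda>v. (if l = a then 1 else - 1) * g l v)) = (\<lambda>v. 1 * g b v) + (\<lambda>v. - 1 * g b v)"
      using ab by simp
    also have "\<dots> = 0" by (rule ext) simp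
    finally show ?thesis by (intro exI[of _ "{a, b}"] exI[of _ "\<lambda>l. if l = a then 1 else - 1"]) auto
  qed
qed

text \<open>
  Modulo a maximal ideal every coordinate is a constant: otherwise all the differences \<open>x\<^sub>i - l\<close> would have
  inverses, and a linear relation between these inverses makes \<open>x\<^sub>i\<close> algebraic over the algebraically closed
  field of constants.
\<close>

lemma coordinate_constant_mod_maximal:
  assumes M: "ideal_of (polyfuns n) M" "1 \<notin> M"
    and max: "\<forall>x\<in>polyfuns n. x \<notin> M \<longrightarrow> (\<exists>g\<in>polyfuns n. g * x - 1 \<in> M)"
    and i: "i < n"
  shows "\<exists>l. (\<lambda>v. v i - l) \<in> M"
proof (rule ccontr)
  assume no: "\<nexists>l. (\<lambda>v. v i - l) \<in> M"
  let ?R = "polyfuns n"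
  note R = subring_polyfuns[of n]
  have Madd: "x + y \<in> M" if "x \<in> M" "y \<in> M" for x y using M that unfolding ideal_of_def by blast
  have Mmult: "r * x \<in> M" if "r \<in> ?R" "x \<in> M" for r x using M that unfolding ideal_of_def by blast
  have M0: "0 \<in> M" using M unfolding ideal_of_def by blast
  have lin: "(\<lambda>v. v i - l) \<in> ?R" for l
    using subringD(6)[OF R polyfuns_coord[OF i] polyfuns_const[of l]] by (simp add: fun_diff_def)
  have "\<forall>l. \<exists>g\<in>?R. g * (\<lambda>v. v i - l) - 1 \<in> M" using max no lin by blast
  then obtain g where g: "\<And>l. g l \<in> ?R" "\<And>l. g l * (\<lambda>v. v i - l) - 1 \<in> M" by metis
  obtain F c where F: "finite F" "\<exists>l\<in>F. c l \<noteq> 0" "(\<Sum>l\<in>F. (\<lambda>v. c l * g l v)) = 0"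
    using polyfuns_relation[of g n] g(1) by blast
  have polyR: "(\<lambda>v. poly q (v i)) \<in> ?R" for q
  proof (induction q)
    case 0 show ?case using subringD(5)[OF R] by (simp add: zero_fun_def)
  next
    case (pCons a q)
    have "(\<lambda>v. a) + (\<lambda>v. v i) * (\<lambda>v. poly q (v i)) \<in> ?R"
      using pCons by (intro polyfuns_add polyfuns_mult polyfuns_const polyfuns_coord i)
    thus ?case by (simp add: plus_fun_def times_fun_def)
  qed
  define P where "P l = (\<Prod>m\<in>F - {l}. [:- m, 1:])" for l
  define q where "q = (\<Sum>l\<in>F. smult (c l) (P l))"
  have "q \<noteq> 0"
  proof
    assume "q = 0"
    obtain l where l: "l \<in> F" "c l \<noteq> 0" using F(2) by blast
    have z: "poly (P m) l = 0" if "m \<in> F" "m \<noteq> l" for m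
      unfolding P_def poly_prod using that l F(1) by (intro prod_zero bexI[of _ l]) auto
    have "poly q l = (\<Sum>m\<in>F. if m = l then c l * poly (P l) l else 0)"
      unfolding q_def poly_sum by (intro sum.cong) (auto simp: z)
    also have "\<dots> = c l * poly (P l) l" using F(1) l(1) by simp
    finally have "poly (P l) l = 0" using \<open>q = 0\<close> l(2) by simp
    thus False unfolding P_def poly_prod using F(1) by auto
  qed
  moreover have "(\<lambda>v. poly q (v i)) \<in> M"
  proof -
    have "(\<Sum>l\<in>F. (\<lambda>v. - c l * poly (P l) (v i)) * (g l * (\<lambda>v. v i - l) - 1)) \<in> M"
    proof -
      have "(\<lambda>v. - c l * poly (P l) (v i)) * (g l * (\<lambda>v. v i - l) - 1) \<in> M" for l
        using polyfuns_scale[OF polyR] by (intro Mmult g)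
      thus ?thesis using Madd M0 by (induction F rule: infinite_finite_induct) auto
    qed
    also have "(\<Sum>l\<in>F. (\<lambda>v. - c l * poly (P l) (v i)) * (g l * (\<lambda>v. v i - l) - 1)) = (\<lambda>v. poly q (v i))"
    proof
      fix v
      define Q where "Q = (\<Prod>m\<in>F. v i - m)"
      have Q: "poly (P l) (v i) * (v i - l) = Q" if "l \<in> F" for l
        unfolding Q_def P_def poly_prod using F(1) that by (simp add: prod.remove mult.commute)
      have "(\<Sum>l\<in>F. c l * g l v) = 0" using F(3) by (metis (no_types, lifting) sum.cong sum_fun_apply zero_fun_apply)
      have "(\<Sum>l\<in>F. (\<lambda>v. - c l * poly (P l) (v i)) * (g l * (\<lambda>v. v i - l) - 1)) v
        = (\<Sum>l\<in>F. c l * poly (P l) (v i) - Q * (c l * g l v))"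
        unfolding sum_fun_apply by (intro sum.cong) (auto simp: Q[symmetric] algebra_simps)
      also have "\<dots> = (\<Sum>l\<in>F. c l * poly (P l) (v i)) - Q * (\<Sum>l\<in>F. c l * g l v)"
        by (simp add: sum_subtractf sum_distrib_left)
      also have "\<dots> = poly q (v i)" using \<open>(\<Sum>l\<in>F. c l * g l v) = 0\<close> unfolding q_def by (simp add: poly_sum)
      finally show "(\<Sum>l\<in>F. (\<lambda>v. - c l * poly (P l) (v i)) * (g l * (\<lambda>v. v i - l) - 1)) v = poly q (v i)" .
    qed
    finally show ?thesis .
  qed
  moreover have "False" if "q \<noteq> 0" "(\<lambda>v. poly q (v i)) \<in> M" for q
    using that
  proof (induction "degree q" arbitrary: q rule: less_induct)
    case less
    show ?case
    proof (cases "degree q = 0")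
      case True
      then obtain a where a: "q = [:a:]" by (rule degree_eq_zeroE)
      have "(\<lambda>v. 1 / a) * (\<lambda>v. poly q (v i)) \<in> M" by (intro Mmult polyfuns_const less.prems)
      moreover have "(\<lambda>v. 1 / a) * (\<lambda>v. poly q (v i)) = 1" using a less.prems(1) by (auto simp: fun_eq_iff)
      ultimately show False using M(2) by simp
    next
      case False
      hence "\<not> constant (poly q)" by (simp add: constant_degree)
      then obtain l where "poly q l = 0" using fundamental_theorem_of_algebra by blast
      then obtain q' where q': "q = [:- l, 1:] * q'" using poly_eq_0_iff_dvd by blast
      have q0: "q' \<noteq> 0" using q' less.prems(1) by auto
      have "degree ([:- l, 1:] * q') = degree [:- l, 1:] + degree q'" by (rule degree_mult_eq) (use q0 in auto)
      hence "degree q' < degree q" unfolding q'[symmetric] by simp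
      moreover have "(\<lambda>v. poly q' (v i)) \<in> M"
      proof -
        have "(\<lambda>v. - poly q' (v i)) \<in> ?R" using polyR[of "- q'"] by simp
        hence "g l * (\<lambda>v. poly q (v i)) + (\<lambda>v. - poly q' (v i)) * (g l * (\<lambda>v. v i - l) - 1) \<in> M"
          by (intro Madd Mmult g less.prems)
        also have "g l * (\<lambda>v. poly q (v i)) + (\<lambda>v. - poly q' (v i)) * (g l * (\<lambda>v. v i - l) - 1) = (\<lambda>v. poly q' (v i))"
          by (rule ext) (simp add: q' algebra_simps)
        finally show ?thesis .
      qed
      ultimately show False using less.hyps q0 by blast
    qed
  qed
  ultimately show False by blast
qed

text \<open>
  Otherwise \<open>S\<close> lies in a maximal ideal. If the \<open>i\<close>-th coordinate is congruent to the
  constant \<open>u\<^sub>i\<close>, then every polynomial function is congruent to its value at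
  \<open>u\<close>, so all elements of \<open>S\<close> vanish at \<open>u\<close>.
\<close>

theorem weak_Nullstellensatz:
  assumes S: "S \<subseteq> polyfuns n" and no: "\<And>v. \<exists>f\<in>S. f v \<noteq> 0"
  shows "1 \<in> mspan (polyfuns n) S"
proof (rule ccontr)
  assume n1: "1 \<notin> mspan (polyfuns n) S"
  let ?R = "polyfuns n"
  note R = subring_polyfuns[of n]
  have "mspan ?R S \<subseteq> ?R"
  proof
    fix u assume "u \<in> mspan ?R S"
    thus "u \<in> ?R"
    proof induction
      case (step p s u)
      show ?case by (rule subringD(2)[OF R subringD(3)[OF R step(1) subsetD[OF S step(2)]] step.IH])
    qed (rule subringD(5)[OF R])
  qed
  hence "ideal_of ?R (mspan ?R S)" unfolding ideal_of_def
    using mspan.zero mspan_add mspan_scale[OF R] by blast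
  from maximal_ideal_exists[OF R this n1] obtain M where M: "mspan ?R S \<subseteq> M" "ideal_of ?R M" "1 \<notin> M"
    "\<forall>x\<in>?R. x \<notin> M \<longrightarrow> (\<exists>g\<in>?R. g * x - 1 \<in> M)" by blast
  have Madd: "x + y \<in> M" if "x \<in> M" "y \<in> M" for x y using M that unfolding ideal_of_def by blast
  have Mmult: "r * x \<in> M" if "r \<in> ?R" "x \<in> M" for r x using M that unfolding ideal_of_def by blast
  have M0: "0 \<in> M" using M unfolding ideal_of_def by blast
  have "\<forall>i. \<exists>l. i < n \<longrightarrow> (\<lambda>v. v i - l) \<in> M" using coordinate_constant_mod_maximal[OF M(2,3,4)] by blast
  then obtain u where u: "\<And>i. i < n \<Longrightarrow> (\<lambda>v. v i - u i) \<in> M" by metis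
  define A where "A = {f \<in> ?R. (\<lambda>v. f v - f u) \<in> M}"
  have sA: "subring A" unfolding subring_def
  proof (intro conjI ballI)
    have "(\<lambda>v. 1 - 1 :: complex) \<in> M" using M0 by (simp add: zero_fun_def)
    thus "1 \<in> A" unfolding A_def using subringD(1)[OF R] by (simp add: one_fun_def zero_fun_def[symmetric] M0)
    fix f assume "f \<in> A"
    hence f: "f \<in> ?R" "(\<lambda>v. f v - f u) \<in> M" unfolding A_def by auto
    have "(\<lambda>v. - 1) * (\<lambda>v. f v - f u) \<in> M" by (intro Mmult polyfuns_const f)
    thus "- f \<in> A" unfolding A_def using f subringD(4)[OF R] by (simp add: times_fun_def)
    fix h assume "h \<in> A"
    hence h: "h \<in> ?R" "(\<lambda>v. h v - h u) \<in> M" unfolding A_def by auto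
    have eq: "(\<lambda>v. f v - f u) + (\<lambda>v. h v - h u) = (\<lambda>v. (f + h) v - (f + h) u)" by (auto simp: fun_eq_iff)
    show "f + h \<in> A" using Madd[OF f(2) h(2)] polyfuns_add[OF f(1) h(1)] unfolding A_def eq by blast
    have "f * (\<lambda>v. h v - h u) + (\<lambda>v. h u) * (\<lambda>v. f v - f u) \<in> M" by (intro Madd Mmult polyfuns_const f h)
    moreover have "f * (\<lambda>v. h v - h u) + (\<lambda>v. h u) * (\<lambda>v. f v - f u) = (\<lambda>v. (f * h) v - (f * h) u)"
      by (auto simp: fun_eq_iff algebra_simps)
    ultimately show "f * h \<in> A" unfolding A_def using polyfuns_mult[OF f(1) h(1)] by simp
  qed
  have cA: "(\<lambda>v. c) \<in> A" for c unfolding A_def using polyfuns_const M0 by (simp add: zero_fun_def)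
  have xA: "(\<lambda>v. v i) \<in> A" if "i < n" for i unfolding A_def using polyfuns_coord u that by simp
  have "?R \<subseteq> A"
  proof
    fix f assume "f \<in> ?R"
    then obtain K where "f \<in> fv.span (monomials_upto n K)" unfolding polyfuns_def by blast
    thus "f \<in> A"
    proof (induction rule: fv.span_induct_alt)
      case base show ?case using subringD(5)[OF sA] .
    next
      case (step c w h)
      then obtain a where "w = monomial n a" unfolding monomials_upto_def by auto
      hence "w = (\<Prod>i<n. (\<lambda>v. v i) ^ a i)"
        by (simp add: fun_eq_iff monomial_def prod_fun_apply power_fun_apply)
      hence "w \<in> A" using xA by (auto intro!: subring_prod[OF sA] subringD(7)[OF sA])
      hence "(\<lambda>v. c) * w + h \<in> A" using step cA subringD(2,3)[OF sA] by blast
      thus ?case by (simp add: times_fun_def plus_fun_def)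
    qed
  qed
  obtain f where f: "f \<in> S" "f u \<noteq> 0" using no by blast
  have fM: "f \<in> M" using f M(1) mspan_superset[OF R] by blast
  have "(\<lambda>v. f v - f u) \<in> M" using \<open>?R \<subseteq> A\<close> f(1) S unfolding A_def by blast
  hence "(\<lambda>v. 1 / f u) * (f + (\<lambda>v. - 1) * (\<lambda>v. f v - f u)) \<in> M" using fM by (intro Mmult Madd polyfuns_const)
  moreover have "(\<lambda>v. 1 / f u) * (f + (\<lambda>v. - 1) * (\<lambda>v. f v - f u)) = 1" using f(2) by (auto simp: fun_eq_iff)
  ultimately show False using M(3) by simp
qed

lemma polyfuns_clear_denominator:
  assumes a: "homogeneous e a" and g: "g \<in> polyfuns (Suc n)"
  shows "\<exists>J. \<exists>G\<in>polyfuns n. \<forall>v. trunc n v = v \<and> a v \<noteq> 0 \<longrightarrow> a v ^ J * g (v(n := 1 / a v)) = G v"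
proof -
  define A where "A = (\<lambda>v. a (trunc n v))"
  have "A \<in> polyfuns n" unfolding A_def by (rule polyfuns_homogeneous[OF a])
  hence A: "A ^ j \<in> polyfuns n" for j by (rule subringD(7)[OF subring_polyfuns])
  obtain K where "g \<in> fv.span (monomials_upto (Suc n) K)" using g unfolding polyfuns_def by blast
  thus ?thesis
  proof (induction rule: fv.span_induct_alt)
    case base
    show ?case by (rule exI[of _ 0], rule bexI[of _ "\<lambda>v. 0"]) (auto intro: polyfuns_const)
  next
    case (step c w h)
    then obtain J G where G: "G \<in> polyfuns n"
      "\<And>v. trunc n v = v \<Longrightarrow> a v \<noteq> 0 \<Longrightarrow> a v ^ J * h (v(n := 1 / a v)) = G v" by blast
    obtain b where b: "w = monomial (Suc n) b" using step(1) unfolding monomials_upto_def by auto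
    define B where "B = (\<lambda>v. c * monomial n (\<lambda>i. if i < n then b i else 0) (trunc n v))"
    have B: "B \<in> polyfuns n" unfolding B_def by (rule polyfuns_scale[OF polyfuns_homogeneous[OF homogeneous_monomial]])
    have w: "w (v(n := s)) = monomial n (\<lambda>i. if i < n then b i else 0) (trunc n v) * s ^ b n" for v s
    proof -
      have "(\<Prod>i<n. (v(n := s)) i ^ b i) = (\<Prod>i<n. trunc n v i ^ (if i < n then b i else 0))"
        by (intro prod.cong) auto
      thus ?thesis unfolding b monomial_def by simp
    qed
    show ?case
    proof (rule exI[of _ "b n + J"], rule bexI[of _ "A ^ J * B + A ^ b n * G"], intro allI impI)
      fix v assume v: "trunc n v = v \<and> a v \<noteq> 0"
      have "a v ^ b n * (c * w (v(n := 1 / a v))) = B v" using v unfolding w B_def by (simp add: power_divide)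
      hence "a v ^ (b n + J) * (c * w (v(n := 1 / a v))) = a v ^ J * B v" by (simp add: power_add mult_ac)
      moreover have "a v ^ (b n + J) * h (v(n := 1 / a v)) = a v ^ b n * G v"
        using G(2)[of v] v by (simp add: power_add mult_ac)
      ultimately show "a v ^ (b n + J) * ((\<lambda>x. c * w x) + h) (v(n := 1 / a v)) = (A ^ J * B + A ^ b n * G) v"
        using v by (simp add: A_def power_fun_apply algebra_simps)
    qed (intro polyfuns_add polyfuns_mult A B G)
  qed
qed

lemma polyfuns_components:
  assumes "G \<in> polyfuns n"
  shows "\<exists>K H. (\<forall>k. homogeneous k (H k)) \<and> (\<forall>k>K. H k = (\<lambda>v. 0)) \<and> (\<forall>v. G v = (\<Sum>k\<le>K. H k v))"
proof -
  obtain K where "G \<in> fv.span (monomials_upto n K)" using assms unfolding polyfuns_def by blast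
  hence "\<exists>H. (\<forall>k. homogeneous k (H k)) \<and> (\<forall>k>K. H k = (\<lambda>v. 0)) \<and> (\<forall>v. G v = (\<Sum>k\<le>K. H k v))"
  proof (induction rule: fv.span_induct_alt)
    case base show ?case by (rule exI[of _ "\<lambda>k v. 0"]) (auto intro: homogeneous_zero)
  next
    case (step c w h)
    then obtain H where H: "\<forall>k. homogeneous k (H k)" "\<forall>k>K. H k = (\<lambda>v. 0)" "\<forall>v. h v = (\<Sum>k\<le>K. H k v)" by blast
    obtain k b where b: "w = monomial n b" "b \<in> exponents n k" "k \<le> K" using step(1) unfolding monomials_upto_def by auto
    have w: "homogeneous k w" using homogeneous_monomial[of b n] b unfolding exponents_def by simp
    show ?case
    proof (rule exI[of _ "\<lambda>l v. (if l = k then c * w v else 0) + H l v"], intro conjI allI impI)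
      show "homogeneous l (\<lambda>v. (if l = k then c * w v else 0) + H l v)" for l
        using H(1) w by (cases "l = k") (auto intro: homogeneous.add homogeneous_scale)
      show "(\<lambda>v. (if l = k then c * w v else 0) + H l v) = (\<lambda>v. 0)" if "l > K" for l
        using H(2) that b(3) by auto
      show "((\<lambda>x. c * w x) + h) v = (\<Sum>l\<le>K. (if l = k then c * w v else 0) + H l v)" for v
        using H(3) b(3) by (simp add: sum.distrib)
    qed
  qed
  thus ?thesis by blast
qed

text \<open>
  The homogeneous Nullstellensatz, by the trick of Rabinowitsch: \<open>1 - x\<^sub>n a\<close> and the given forms have no
  common zero; then \<open>x\<^sub>n = 1 / a\<close> is substituted in the resulting representation of \<open>1\<close>.
\<close>

theorem homogeneous_Nullstellensatz:
  assumes F: "\<forall>f\<in>F. \<exists>d. homogeneous d f" and p: "homogeneous d p" and a: "homogeneous e a"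
    and van: "\<And>v. trunc n v = v \<Longrightarrow> \<forall>f\<in>F. f v = 0 \<Longrightarrow> p v = 0 \<Longrightarrow> a v = 0"
    and ex: "trunc n v0 = v0" "\<forall>f\<in>F. f v0 = 0" "a v0 \<noteq> 0"
  shows "\<exists>M k r. M > 0 \<and> homogeneous k r \<and> k + d = M * e \<and>
    (\<forall>v. trunc n v = v \<and> (\<forall>f\<in>F. f v = 0) \<longrightarrow> a v ^ M = p v * r v)"
proof -
  let ?l = "\<lambda>v. 1 - v n * a (trunc n v)"
  let ?R = "polyfuns (Suc n)"
  note R = subring_polyfuns[of "Suc n"]
  define S where "S = insert ?l ((\<lambda>f v. f (trunc n v)) ` insert p F)"
  have low: "(\<lambda>v. f (trunc n v)) \<in> ?R" if "homogeneous d f" for f d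
    using polyfuns_homogeneous[OF homogeneous_trunc[OF that, of n], of "Suc n"] by simp
  have "1 - (\<lambda>v. v n) * (\<lambda>v. a (trunc n v)) \<in> ?R"
    by (intro subringD(6)[OF R] subringD(1)[OF R] polyfuns_mult polyfuns_coord low[OF a]) simp
  hence "?l \<in> ?R" by (simp add: fun_diff_def times_fun_def one_fun_def)
  hence S: "S \<subseteq> ?R" unfolding S_def using low F p by auto
  have "1 \<in> mspan ?R S"
  proof (rule weak_Nullstellensatz[OF S], rule ccontr)
    fix v assume "\<not> (\<exists>f\<in>S. f v \<noteq> 0)"
    hence z: "\<forall>f\<in>S. f v = 0" by blast
    have "\<forall>f\<in>F. f (trunc n v) = 0" "p (trunc n v) = 0" using z unfolding S_def by auto
    hence "a (trunc n v) = 0" using van[of "trunc n v"] by simp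
    moreover have "?l \<in> S" unfolding S_def by (rule insertI1)
    note bspec[OF z this]
    ultimately show False by simp
  qed
  define V where "V v \<longleftrightarrow> trunc n v = v \<and> (\<forall>f\<in>F. f v = 0)" for v
  have "\<exists>g\<in>?R. \<forall>v. V v \<and> a v \<noteq> 0 \<longrightarrow> u (v(n := 1 / a v)) = g (v(n := 1 / a v)) * p v" if "u \<in> mspan ?R S" for u
    using that
  proof induction
    case zero show ?case using polyfuns_const[of 0 "Suc n"] by (intro bexI[of _ "\<lambda>v. 0"]) auto
  next
    case (step q s u)
    then obtain g where g: "g \<in> ?R" "\<And>v. V v \<Longrightarrow> a v \<noteq> 0 \<Longrightarrow> u (v(n := 1 / a v)) = g (v(n := 1 / a v)) * p v" by blast
    show ?case
    proof (cases "s = (\<lambda>v. p (trunc n v))")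
      case True
      have "q + g \<in> ?R" using step g by (intro polyfuns_add)
      thus ?thesis using g(2) True by (intro bexI[of _ "q + g"]) (auto simp: V_def algebra_simps simp del: fun_upd_apply)
    next
      case False
      hence "s = ?l \<or> (\<exists>f\<in>F. s = (\<lambda>v. f (trunc n v)))" using step(2) unfolding S_def by auto
      hence "s (v(n := 1 / a v)) = 0" if "V v" "a v \<noteq> 0" for v using that unfolding V_def by auto
      thus ?thesis using g by (intro bexI[of _ g]) (auto simp del: fun_upd_apply)
    qed
  qed
  from this[OF \<open>1 \<in> mspan ?R S\<close>] obtain g where g: "g \<in> ?R"
    "\<And>v. V v \<Longrightarrow> a v \<noteq> 0 \<Longrightarrow> 1 = g (v(n := 1 / a v)) * p v" by auto
  obtain J G where G: "G \<in> polyfuns n"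
    "\<And>v. trunc n v = v \<Longrightarrow> a v \<noteq> 0 \<Longrightarrow> a v ^ J * g (v(n := 1 / a v)) = G v"
    using polyfuns_clear_denominator[OF a g(1)] by blast
  obtain K H where H: "\<forall>k. homogeneous k (H k)" "\<forall>k>K. H k = (\<lambda>v. 0)" "\<And>v. G v = (\<Sum>k\<le>K. H k v)"
    using polyfuns_components[OF G(1)] by blast
  have eq: "a v ^ J = G v * p v" if "V v" "a v \<noteq> 0" for v
    using g(2)[OF that] G(2)[of v] that unfolding V_def by (metis mult.assoc mult.right_neutral)
  have comp: "a v ^ J = (\<Sum>k\<le>K. if k + d = e * J then H k v * p v else 0)" if v: "V v" "a v \<noteq> 0" for v
  proof -
    \<comment> \<open>Replacing \<open>v\<close> by \<open>s v\<close> and comparing the powers of \<open>s\<close> selects the component of the right degree.\<close>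
    define Q where "Q = monom (a v ^ J) (e * J) - (\<Sum>k\<le>K. monom (H k v * p v) (k + d))"
    have "poly Q s = 0" if s: "s \<noteq> 0" for s
    proof -
      let ?w = "\<lambda>i. s * v i"
      have "f ?w = 0" if f: "f \<in> F" for f
      proof -
        obtain d' where "homogeneous d' f" using F f by blast
        from homogeneous_line[OF this] show ?thesis using v(1) f unfolding V_def by simp
      qed
      hence "V ?w" using v(1) unfolding V_def trunc_scale by auto
      moreover have aw: "a ?w = s ^ e * a v" by (rule homogeneous_line[OF a])
      ultimately have "(s ^ e * a v) ^ J = G ?w * p ?w" using eq[of ?w] s v(2) by simp
      also have "G ?w = (\<Sum>k\<le>K. s ^ k * H k v)" unfolding H(3) using homogeneous_line H(1) by (intro sum.cong) auto
      finally have "(s ^ e * a v) ^ J = (\<Sum>k\<le>K. s ^ k * H k v) * (s ^ d * p v)"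
        unfolding homogeneous_line[OF p] .
      moreover have "(s ^ e * a v) ^ J = a v ^ J * s ^ (e * J)"
        by (simp add: power_mult_distrib power_mult mult.commute[of "a v ^ J"])
      moreover have "(\<Sum>k\<le>K. s ^ k * H k v) * (s ^ d * p v) = (\<Sum>k\<le>K. H k v * p v * s ^ (k + d))"
        unfolding sum_distrib_right by (intro sum.cong) (auto simp: power_add mult_ac)
      ultimately show ?thesis unfolding Q_def by (simp add: poly_sum poly_monom)
    qed
    hence "poly ([:0, 1:] * Q) s = 0" for s by (cases "s = 0") auto
    hence "[:0, 1:] * Q = 0" using poly_all_0_iff_0 by blast
    hence "Q = 0" by simp
    hence "coeff Q (e * J) = 0" by simp
    hence "a v ^ J = (\<Sum>k\<le>K. coeff (monom (H k v * p v) (k + d)) (e * J))" unfolding Q_def by (simp add: coeff_sum)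
    also have "\<dots> = (\<Sum>k\<le>K. if k + d = e * J then H k v * p v else 0)" by (intro sum.cong) auto
    finally show ?thesis .
  qed
  have dle: "d \<le> e * J"
  proof (rule ccontr)
    assume "\<not> ?thesis"
    hence "a v0 ^ J = 0" using comp[of v0] ex unfolding V_def by simp
    thus False using ex by simp
  qed
  have eq2: "a v ^ J = H (e * J - d) v * p v" if "V v" "a v \<noteq> 0" for v
  proof -
    have "(\<Sum>k\<le>K. if k + d = e * J then H k v * p v else 0) = (\<Sum>k\<le>K. if k = e * J - d then H k v * p v else 0)"
      using dle by (intro sum.cong) auto
    also have "\<dots> = H (e * J - d) v * p v" using H(2) by (simp add: not_le)
    finally show ?thesis using comp[OF that] by simp
  qed
  show ?thesis
  proof (intro exI conjI allI impI)
    show "Suc J > 0" by simp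
    show "homogeneous (e + (e * J - d)) (\<lambda>v. a v * H (e * J - d) v)" using a H(1) by (intro homogeneous.mult) auto
    show "e + (e * J - d) + d = Suc J * e" using dle by simp
    fix v assume "trunc n v = v \<and> (\<forall>f\<in>F. f v = 0)"
    thus "a v ^ Suc J = p v * (a v * H (e * J - d) v)"
      using eq2[of v] unfolding V_def by (cases "a v = 0") (auto simp: mult_ac)
  qed
qed

section \<open>Zariski closed sets\<close>

text \<open>
  Forms are evaluated at a fixed vector of each point, since their vanishing does not depend on the vector.
\<close>

definition rep :: "point \<Rightarrow> cvec" where
  "rep x = (SOME v. v \<in> x - {0})"

abbreviation points :: "point set" where "points \<equiv> line ` (- {0})"

lemma rep_point:
  assumes "x \<in> points" shows "rep x \<in> x" "rep x \<noteq> 0" "x = line (rep x)"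
proof -
  obtain u where u: "u \<noteq> 0" "x = line u" using assms by blast
  have "u \<in> x" unfolding u(2) line_def by (rule range_eqI[of _ _ 1]) simp
  hence r: "rep x \<in> x - {0}" unfolding rep_def using u(1) by (intro someI[of "\<lambda>v. v \<in> x - {0}" u]) simp
  thus "rep x \<in> x" "rep x \<noteq> 0" by auto
  obtain c where c: "rep x = (\<lambda>i. c * u i)" using r unfolding u(2) line_def by blast
  have c0: "c \<noteq> 0" using r c by (auto simp: fun_eq_iff)
  have e: "(\<lambda>i. b * u i) = (\<lambda>i. (b / c) * rep x i)" "(\<lambda>i. b * rep x i) = (\<lambda>i. (b * c) * u i)" for b
    using c0 by (auto simp: c fun_eq_iff)
  show "x = line (rep x)"
  proof (intro subset_antisym subsetI)
    fix w assume "w \<in> x"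
    then obtain b where "w = (\<lambda>i. b * u i)" unfolding u(2) line_def by auto
    hence "w = (\<lambda>i. (b / c) * rep x i)" using e(1) by (rule trans)
    thus "w \<in> line (rep x)" unfolding line_def by (rule range_eqI)
  next
    fix w assume "w \<in> line (rep x)"
    then obtain b where "w = (\<lambda>i. b * rep x i)" unfolding line_def by auto
    hence "w = (\<lambda>i. (b * c) * u i)" using e(2) by (rule trans)
    thus "w \<in> x" unfolding u(2) line_def by (rule range_eqI)
  qed
qed

lemma in_point: "x \<in> points \<Longrightarrow> v \<in> x - {0} \<Longrightarrow> \<exists>c. c \<noteq> 0 \<and> v = (\<lambda>i. c * rep x i)"
proof -
  assume "x \<in> points" "v \<in> x - {0}"
  then obtain c where "v = (\<lambda>i. c * rep x i)" "v \<noteq> 0" using rep_point(3)[of x] unfolding line_def by blast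
  thus ?thesis by (intro exI[of _ c]) (auto simp: fun_eq_iff)
qed

lemma line_point:
  assumes "v \<noteq> 0" shows "line v \<in> points" "\<exists>c. c \<noteq> 0 \<and> v = (\<lambda>i. c * rep (line v) i)"
proof -
  show p: "line v \<in> points" using assms by blast
  have "v \<in> line v" unfolding line_def by (rule range_eqI[of _ _ 1]) simp
  thus "\<exists>c. c \<noteq> 0 \<and> v = (\<lambda>i. c * rep (line v) i)" using in_point[OF p, of v] assms by blast
qed

lemma homogeneous_at_point:
  assumes "homogeneous d p" "x \<in> points" "v \<in> x - {0}"
  shows "p v = 0 \<longleftrightarrow> p (rep x) = 0"
proof -
  obtain c where "c \<noteq> 0" "v = (\<lambda>i. c * rep x i)" using in_point[OF assms(2,3)] by blast
  thus ?thesis using homogeneous_line[OF assms(1), of c "rep x"] by simp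
qed

definition homogeneous_set :: "(cvec \<Rightarrow> complex) set \<Rightarrow> bool" where
  "homogeneous_set F \<longleftrightarrow> (\<forall>p\<in>F. \<exists>d. homogeneous d p)"

definition vanishing :: "point set \<Rightarrow> (cvec \<Rightarrow> complex) set \<Rightarrow> point set" where
  "vanishing X F = {x \<in> X. \<forall>p\<in>F. p (rep x) = 0}"

lemma vanishing_zero_locus:
  assumes "X \<subseteq> points" "homogeneous_set F" shows "X \<inter> zero_locus F = vanishing X F"
proof -
  have "(\<forall>v\<in>x - {0}. p v = 0) \<longleftrightarrow> p (rep x) = 0" if x: "x \<in> X" and p: "p \<in> F" for x p
  proof -
    obtain d where d: "homogeneous d p" using p assms(2) unfolding homogeneous_set_def by blast
    have xp: "x \<in> points" using x assms(1) by blast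
    show ?thesis using homogeneous_at_point[OF d xp] rep_point[OF xp] by blast
  qed
  thus ?thesis unfolding vanishing_def zero_locus_def by blast
qed

lemma closedin_vanishing:
  assumes "X \<subseteq> points"
  shows "closedin (Zariski X) Z \<longleftrightarrow> (\<exists>F. homogeneous_set F \<and> Z = vanishing X F)"
  unfolding closedin_Zariski[OF assms] homogeneous_set_def[symmetric]
  using vanishing_zero_locus[OF assms] by metis

lemma openin_nonvanishing:
  assumes "X \<subseteq> points"
  shows "openin (Zariski X) U \<longleftrightarrow> (\<exists>F. homogeneous_set F \<and> U = X - vanishing X F)"
proof -
  have "openin (Zariski X) U \<longleftrightarrow> U \<subseteq> X \<and> closedin (Zariski X) (X - U)"
    using openin_closedin_eq[of "Zariski X" U] topspace_Zariski[OF assms] by simp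
  also have "\<dots> \<longleftrightarrow> (\<exists>F. homogeneous_set F \<and> U = X - vanishing X F)"
    unfolding closedin_vanishing[OF assms] vanishing_def by blast
  finally show ?thesis .
qed

lemma homogeneous_singleton: "homogeneous d p \<Longrightarrow> homogeneous_set {p}"
  unfolding homogeneous_set_def by blast

lemma open_basic:
  assumes "X \<subseteq> points" "homogeneous d g" shows "openin (Zariski X) {x \<in> X. g (rep x) \<noteq> 0}"
  unfolding openin_nonvanishing[OF assms(1)]
  by (rule exI[of _ "{g}"]) (auto simp: vanishing_def homogeneous_singleton[OF assms(2)])

lemma open_contains_basic:
  assumes "X \<subseteq> points" "openin (Zariski X) U" "x \<in> U"
  shows "\<exists>d g. homogeneous d g \<and> g (rep x) \<noteq> 0 \<and> (\<forall>z\<in>X. g (rep z) \<noteq> 0 \<longrightarrow> z \<in> U)"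
proof -
  obtain F where F: "homogeneous_set F" "U = X - vanishing X F"
    using assms(2) unfolding openin_nonvanishing[OF assms(1)] by blast
  then obtain g where g: "g \<in> F" "g (rep x) \<noteq> 0" using assms(3) unfolding vanishing_def by blast
  obtain d where "homogeneous d g" using F(1) g(1) unfolding homogeneous_set_def by blast
  thus ?thesis using g F(2) unfolding vanishing_def by blast
qed

lemma irreducible_nonempty: "irreducible_set Z \<Longrightarrow> Z \<noteq> {}"
  unfolding irreducible_set_def by blast

lemma irreducible_product:
  assumes Z: "Z \<subseteq> points" "irreducible_set Z" and pq: "homogeneous d p" "homogeneous e q"
    and 0: "\<forall>x\<in>Z. p (rep x) = 0 \<or> q (rep x) = 0"
  shows "(\<forall>x\<in>Z. p (rep x) = 0) \<or> (\<forall>x\<in>Z. q (rep x) = 0)"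
proof -
  have c: "closedin (Zariski Z) (vanishing Z {p})" "closedin (Zariski Z) (vanishing Z {q})"
    unfolding closedin_vanishing[OF Z(1)] using homogeneous_singleton pq by blast+
  moreover have "Z = vanishing Z {p} \<union> vanishing Z {q}" using 0 unfolding vanishing_def by auto
  ultimately have "vanishing Z {p} = Z \<or> vanishing Z {q} = Z" using Z(2) unfolding irreducible_set_def by blast
  thus ?thesis unfolding vanishing_def by blast
qed

lemma irreducible_witness:
  assumes "Z \<subseteq> points" "irreducible_set Z" "homogeneous d p" "homogeneous e q"
    and "x \<in> Z" "p (rep x) \<noteq> 0" "y \<in> Z" "q (rep y) \<noteq> 0"
  shows "\<exists>z\<in>Z. p (rep z) \<noteq> 0 \<and> q (rep z) \<noteq> 0"
  using irreducible_product[OF assms(1-4)] assms(5-) by blast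

lemma projective_space_points: "projective_space N \<subseteq> points"
  unfolding projective_space_def by auto

lemma rep_projective_space:
  assumes "x \<in> projective_space N" shows "trunc (Suc N) (rep x) = rep x"
proof -
  obtain v where v: "x = line v" "v \<noteq> 0" "\<forall>i>N. v i = 0" using assms unfolding projective_space_def by blast
  obtain c where c: "c \<noteq> 0" "v = (\<lambda>i. c * rep x i)" using line_point(2)[OF v(2)] v(1) by blast
  have "rep x i = 0" if "i > N" for i using v(3) that c by (auto dest: fun_cong[where x = i])
  thus ?thesis by (auto simp: trunc_def fun_eq_iff)
qed

lemma line_in_projective_space:
  assumes "v \<noteq> 0" "trunc (Suc N) v = v" shows "line v \<in> projective_space N"
proof -
  have "\<forall>i>N. v i = 0" 
  proof (intro allI impI)
    fix i assume "i > N"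
    thus "v i = 0" using fun_cong[OF assms(2), of i] by (simp add: trunc_def)
  qed
  thus ?thesis unfolding projective_space_def using assms(1) by blast
qed

lemma closed_in_closed:
  assumes "X \<subseteq> points" "closedin (Zariski X) Y" "closedin (Zariski Y) Z"
  shows "closedin (Zariski X) Z"
proof -
  obtain F where F: "homogeneous_set F" "Y = vanishing X F"
    using assms(2) unfolding closedin_vanishing[OF assms(1)] by blast
  have "Y \<subseteq> points" using assms(1) F(2) unfolding vanishing_def by blast
  from assms(3)[unfolded closedin_vanishing[OF this]]
  obtain G where G: "homogeneous_set G" "Z = vanishing Y G" by blast
  have "homogeneous_set (F \<union> G)" "Z = vanishing X (F \<union> G)"
    using F G unfolding homogeneous_set_def vanishing_def by auto
  thus ?thesis unfolding closedin_vanishing[OF assms(1)] by blast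
qed

lemma closedin_subset_topspace: "X \<subseteq> points \<Longrightarrow> closedin (Zariski X) Z \<Longrightarrow> Z \<subseteq> X"
  using closedin_subset[of "Zariski X" Z] topspace_Zariski by simp

lemma closedin_self: "X \<subseteq> points \<Longrightarrow> closedin (Zariski X) X"
  using closedin_topspace[of "Zariski X"] topspace_Zariski by simp

text \<open>
  Homogeneous coordinates on \<open>X\<close>. The value \<open>0\<close> outside \<open>X\<close> is harmless, because a form of positive
  degree vanishes there.
\<close>

definition coords :: "point set \<Rightarrow> point \<Rightarrow> cvec" where
  "coords X z = (if z \<in> X then rep z else (\<lambda>i. 0))"

lemma coords_simps [simp]: "x \<in> X \<Longrightarrow> coords X x = rep x" "x \<notin> X \<Longrightarrow> coords X x = (\<lambda>i. 0)"
  by (auto simp: coords_def)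

text \<open>
  Forms that vanish on the member \<open>i + 1\<close> of a descending sequence of closed sets but not on the
  member \<open>i\<close> contradict the noetherian property of the coordinate ring.
\<close>

lemma noetherian_topology:
  assumes X: "X \<subseteq> projective_space N"
  shows "wf {(Z', Z). closedin (Zariski X) Z' \<and> closedin (Zariski X) Z \<and> Z' \<subset> Z}"
proof (rule ccontr)
  have Xp: "X \<subseteq> points" using X projective_space_points by blast
  assume "\<not> ?thesis"
  then obtain Z where "\<forall>i. (Z (Suc i), Z i) \<in> {(Z', Z). closedin (Zariski X) Z' \<and> closedin (Zariski X) Z \<and> Z' \<subset> Z}"
    unfolding wf_iff_no_infinite_down_chain by blast
  hence Z: "closedin (Zariski X) (Z (Suc i)) \<and> closedin (Zariski X) (Z i) \<and> Z (Suc i) \<subset> Z (i::nat)" for i by simp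
  have "\<exists>d f x. homogeneous d f \<and> (\<forall>z\<in>Z (Suc i). f (rep z) = 0) \<and> x \<in> Z i \<and> f (rep x) \<noteq> 0" for i
  proof -
    obtain F where F: "homogeneous_set F" "Z (Suc i) = vanishing X F" 
      using Z[of i] unfolding closedin_vanishing[OF Xp] by blast
    obtain x where x: "x \<in> Z i" "x \<notin> Z (Suc i)" using Z by blast
    have "x \<in> X" using x Z closedin_subset_topspace[OF Xp] by blast
    then obtain f where "f \<in> F" "f (rep x) \<noteq> 0" using x F(2) unfolding vanishing_def by blast
    thus ?thesis using F x unfolding homogeneous_set_def vanishing_def by blast
  qed
  then obtain d f x where f: "\<And>i. homogeneous (d i) (f i)" "\<And>i z. z \<in> Z (Suc i) \<Longrightarrow> f i (rep z) = 0"
    "\<And>i. x i \<in> Z i" "\<And>i. f i (rep (x i)) \<noteq> 0" by metis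
  have mono: "Z j \<subseteq> Z i" if "i \<le> j" for i j using lift_Suc_antimono_le[of Z, OF _ that] Z by blast
  let ?y = "coords X"
  let ?R = "total_ring (forms (Suc N) ?y)"
  define g where "g i = monom (\<lambda>z. f i (trunc (Suc N) (?y z))) (d i)" for i
  have "range g \<subseteq> ?R" unfolding g_def using monom_total_ring[OF graded_ring_forms formsI[OF f(1)]] by blast
  from noetherian_module_seq[OF subring_total_ring[OF graded_ring_forms] noetherian_forms this]
  obtain n r where r: "g n = (\<Sum>i<n. r i * g i)" by blast
  have "x n \<in> X" using f(3) Z closedin_subset_topspace[OF Xp] by blast
  hence y: "trunc (Suc N) (?y (x n)) = rep (x n)" using rep_projective_space X by auto
  have "f n (rep (x n)) = coeff (g n) (d n) (x n)" unfolding g_def by (simp add: y)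
  also have "\<dots> = (\<Sum>i<n. coeff (r i * g i) (d n) (x n))" unfolding r by (simp add: coeff_sum sum_fun_apply)
  also have "\<dots> = 0"
  proof (rule sum.neutral, intro ballI)
    fix i assume "i \<in> {..<n}"
    hence "x n \<in> Z (Suc i)" using mono[of "Suc i" n] f(3) by auto
    hence "f i (rep (x n)) = 0" by (rule f(2))
    moreover have "coeff (g i * r i) (d n) (x n) = (if d n < d i then 0 else f i (rep (x n)) * coeff (r i) (d n - d i) (x n))"
      unfolding g_def coeff_monom_mult by (simp add: y)
    ultimately show "coeff (r i * g i) (d n) (x n) = 0" by (simp add: mult.commute)
  qed
  finally show False using f(4) by blast
qed

lemma minimal_closed:
  assumes X: "X \<subseteq> projective_space N" and Z: "closedin (Zariski X) Z" "Q Z"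
  shows "\<exists>W\<subseteq>Z. closedin (Zariski X) W \<and> Q W \<and> (\<forall>V. closedin (Zariski X) V \<and> V \<subset> W \<longrightarrow> \<not> Q V)"
proof -
  let ?A = "{W. closedin (Zariski X) W \<and> W \<subseteq> Z \<and> Q W}"
  have "Z \<in> ?A" using Z by simp
  from wfE_min[OF noetherian_topology[OF X] this] obtain W where W: "W \<in> ?A"
    "\<And>V. (V, W) \<in> {(Z', Z). closedin (Zariski X) Z' \<and> closedin (Zariski X) Z \<and> Z' \<subset> Z} \<Longrightarrow> V \<notin> ?A" by blast
  show ?thesis
  proof (intro exI[of _ W] conjI allI impI)
    fix V assume V: "closedin (Zariski X) V \<and> V \<subset> W"
    show "\<not> Q V" using W(2)[of V] W(1) V by auto
  qed (use W(1) in auto)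
qed

lemma quasi_compact:
  assumes X: "X \<subseteq> projective_space N" and U: "\<And>x. x \<in> X \<Longrightarrow> x \<in> U x \<and> openin (Zariski X) (U x)"
  shows "\<exists>F. finite F \<and> F \<subseteq> X \<and> X \<subseteq> (\<Union>x\<in>F. U x)"
proof -
  have Xp: "X \<subseteq> points" using X projective_space_points by blast
  define Q where "Q Z \<longleftrightarrow> (\<exists>F. finite F \<and> F \<subseteq> X \<and> Z = X - (\<Union>x\<in>F. U x))" for Z
  have "Q X" unfolding Q_def by (rule exI[of _ "{}"]) simp
  from minimal_closed[of X N X Q, OF X closedin_self[OF Xp] this] obtain W where
    W: "W \<subseteq> X" "closedin (Zariski X) W" "Q W" "\<And>V. closedin (Zariski X) V \<Longrightarrow> V \<subset> W \<Longrightarrow> \<not> Q V" by blast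
  obtain F where F: "finite F" "F \<subseteq> X" "W = X - (\<Union>x\<in>F. U x)" using W(3) unfolding Q_def by blast
  have "W = {}"
  proof (rule ccontr)
    assume "W \<noteq> {}"
    then obtain x where x: "x \<in> W" by blast
    have xU: "x \<in> U x" "openin (Zariski X) (U x)" using U x W(1) by auto
    have "closedin (Zariski X) (W - U x)" by (rule closedin_diff[OF W(2) xU(2)])
    moreover have "W - U x \<subset> W" using x xU by blast
    moreover have "W - U x = X - (\<Union>x\<in>insert x F. U x)" using F(3) by blast
    hence "Q (W - U x)" unfolding Q_def using F x W(1) by (intro exI[of _ "insert x F"]) auto
    ultimately show False using W(4) by blast
  qed
  thus ?thesis using F by blast
qed

section \<open>Dimension and growth\<close>

lemma homogeneous_on_line:
  assumes "homogeneous d p" shows "\<exists>P. \<forall>s. poly P s = p (\<lambda>i. a i + s * b i)"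
  using assms
proof induction
  case (const c) show ?case by (rule exI[of _ "[:c:]"]) simp
next
  case (coord i) show ?case by (rule exI[of _ "[:a i, b i:]"]) (simp add: algebra_simps)
next
  case (add d p q)
  then obtain P Q where "\<forall>s. poly P s = p (\<lambda>i. a i + s * b i)" "\<forall>s. poly Q s = q (\<lambda>i. a i + s * b i)" by blast
  thus ?case by (intro exI[of _ "P + Q"]) simp
next
  case (mult d p e q)
  then obtain P Q where "\<forall>s. poly P s = p (\<lambda>i. a i + s * b i)" "\<forall>s. poly Q s = q (\<lambda>i. a i + s * b i)" by blast
  thus ?case by (intro exI[of _ "P * Q"]) simp
qed

text \<open>It suffices to look at the line through \<open>u\<close> and \<open>v\<close>.\<close>

lemma homogeneous_common_nonzero:
  assumes "homogeneous d p" "p (trunc n u) \<noteq> 0" "homogeneous e q" "q (trunc n v) \<noteq> 0"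
  shows "\<exists>w. p (trunc n w) \<noteq> 0 \<and> q (trunc n w) \<noteq> 0"
proof -
  let ?a = "trunc n u" and ?b = "\<lambda>i. trunc n v i - trunc n u i"
  obtain P Q where P: "\<forall>s. poly P s = p (\<lambda>i. ?a i + s * ?b i)" and Q: "\<forall>s. poly Q s = q (\<lambda>i. ?a i + s * ?b i)"
    using homogeneous_on_line[OF assms(1), of ?a ?b] homogeneous_on_line[OF assms(3), of ?a ?b] by blast
  have "poly P 0 \<noteq> 0" "poly Q 1 \<noteq> 0" using P Q assms by simp_all
  hence "P * Q \<noteq> 0" by auto
  then obtain s where "poly (P * Q) s \<noteq> 0" using poly_all_0_iff_0[of "P * Q"] by blast
  moreover have "(\<lambda>i. ?a i + s * ?b i) = trunc n (\<lambda>i. ?a i + s * ?b i)" by (auto simp: trunc_def)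
  ultimately show ?thesis using P Q by (intro exI[of _ "\<lambda>i. ?a i + s * ?b i"]) auto
qed

text \<open>
  Algebraic independence of the first \<open>D\<close> components of \<open>L\<close> as functions on the cone
  over \<open>Z\<close>.
\<close>

definition independent_on :: "(cvec \<Rightarrow> cvec) \<Rightarrow> nat \<Rightarrow> point set \<Rightarrow> bool" where
  "independent_on L D Z \<longleftrightarrow> (\<forall>k p. homogeneous k p \<and> (\<forall>x\<in>Z. p (trunc D (L (rep x))) = 0) \<longrightarrow>
     (\<forall>v. p (trunc D v) = 0))"

text \<open>
  If \<open>W\<close> were the union of two smaller closed sets, the product of relations on these would be a
  relation on \<open>W\<close>.
\<close>

lemma minimal_independent_irreducible:
  assumes X: "X \<subseteq> points" and W: "closedin (Zariski X) W" "independent_on L D W"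
    and min: "\<And>V. closedin (Zariski X) V \<Longrightarrow> V \<subset> W \<Longrightarrow> \<not> independent_on L D V"
  shows "irreducible_set W"
  unfolding irreducible_set_def
proof (intro conjI allI impI)
  show "W \<noteq> {}"
  proof
    assume "W = {}"
    hence "(1::complex) = 0" using W(2) homogeneous_one unfolding independent_on_def by (metis empty_iff)
    thus False by simp
  qed
  fix A B assume AB: "closedin (Zariski W) A \<and> closedin (Zariski W) B \<and> W = A \<union> B"
  show "A = W \<or> B = W"
  proof (rule ccontr)
    assume "\<not> (A = W \<or> B = W)"
    hence "A \<subset> W" "B \<subset> W" using AB by auto
    moreover have "closedin (Zariski X) A" "closedin (Zariski X) B"
      using AB closed_in_closed[OF X W(1)] by auto
    ultimately have n: "\<not> independent_on L D A" "\<not> independent_on L D B" using min by auto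
    from n(1) obtain k p u where p: "homogeneous k p" "\<forall>x\<in>A. p (trunc D (L (rep x))) = 0" "p (trunc D u) \<noteq> 0"
      unfolding independent_on_def by blast
    from n(2) obtain l q v where q: "homogeneous l q" "\<forall>x\<in>B. q (trunc D (L (rep x))) = 0" "q (trunc D v) \<noteq> 0"
      unfolding independent_on_def by blast
    obtain w where w: "p (trunc D w) \<noteq> 0" "q (trunc D w) \<noteq> 0"
      using homogeneous_common_nonzero[OF p(1,3) q(1,3)] by blast
    have "\<forall>x\<in>W. p (trunc D (L (rep x))) * q (trunc D (L (rep x))) = 0" using p(2) q(2) AB by auto
    hence "p (trunc D w) * q (trunc D w) = 0"
      using W(2)[unfolded independent_on_def, rule_format, OF conjI[OF homogeneous.mult[OF p(1) q(1)]], of w] by blast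
    thus False using w by simp
  qed
qed

text \<open>
  Going down along a hyperplane section: the remaining forms stay independent on
  \<open>W \<inter> {L\<^sub>D = 0}\<close>. If a form \<open>f\<close> in them vanished there, a power of \<open>f\<close> would be a multiple
  \<open>L\<^sub>D r\<close> by the Nullstellensatz; since \<open>r\<close> is integral over the forms in the
  \<open>L\<^sub>i\<close>, the form \<open>f\<close> would vanish identically.
\<close>

lemma independent_on_section:
  assumes X: "X \<subseteq> projective_space N" "closedin (Zariski (projective_space N)) X"
    and W: "closedin (Zariski X) W" "independent_on L (Suc D) W"
    and L: "\<And>i. homogeneous 1 (\<lambda>v. L v i)" and D: "D > 0"
    and int: "\<And>k r. homogeneous k r \<Longrightarrow> \<exists>n h. (\<forall>i<n. homogeneous ((n - i) * k) (h i)) \<and>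
        (\<forall>x\<in>W. r (rep x) ^ n = (\<Sum>i<n. h i (trunc (Suc D) (L (rep x))) * r (rep x) ^ i))"
  shows "independent_on L D {x \<in> W. L (rep x) D = 0}"
proof -
  have Xp: "X \<subseteq> points" using X(1) projective_space_points by blast
  have "closedin (Zariski (projective_space N)) W"
    by (rule closed_in_closed[OF projective_space_points X(2) W(1)])
  then obtain F where F: "homogeneous_set F" "W = vanishing (projective_space N) F"
    unfolding closedin_vanishing[OF projective_space_points] by blast
  have comp: "homogeneous k (\<lambda>v. f (trunc D (L v)))" if "homogeneous k f" for k f
    using homogeneous_linear_compose[OF homogeneous_trunc[OF that, of D] L] by simp
  have pos: "f (trunc D u) = 0" if f: "homogeneous k f" "k > 0" "\<forall>x\<in>{x \<in> W. L (rep x) D = 0}. f (trunc D (L (rep x))) = 0" for k f u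
  proof (cases "\<forall>x\<in>W. f (trunc D (L (rep x))) = 0")
    case True
    hence "\<forall>x\<in>W. f (trunc D (trunc (Suc D) (L (rep x)))) = 0" by simp
    hence "f (trunc D (trunc (Suc D) u)) = 0"
      using W(2)[unfolded independent_on_def, rule_format, OF conjI[OF homogeneous_trunc[OF f(1), of D]], of u] by blast
    thus ?thesis by simp
  next
    case False
    then obtain x0 where x0: "x0 \<in> W" "f (trunc D (L (rep x0))) \<noteq> 0" by blast
    let ?a = "\<lambda>v. f (trunc D (L v))" and ?p = "\<lambda>v. L v D"
    have van: "?a v = 0" if v: "trunc (Suc N) v = v" "\<forall>g\<in>F. g v = 0" "?p v = 0" for v
    proof (cases "v = 0")
      case True
      thus ?thesis using homogeneous_at_0[OF comp[OF f(1)] f(2)] by (simp add: zero_fun_def)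
    next
      case False
      obtain c where c: "c \<noteq> 0" "v = (\<lambda>i. c * rep (line v) i)" using line_point(2)[OF False] by blast
      have z: "g v = 0 \<longleftrightarrow> g (rep (line v)) = 0" if "homogeneous d g" for d g
        using homogeneous_line[OF that, of c "rep (line v)"] c by simp
      have "line v \<in> W" unfolding F(2) vanishing_def using line_in_projective_space[OF False v(1)] v(2) z F(1)
        unfolding homogeneous_set_def by blast
      moreover have "L (rep (line v)) D = 0" using z[OF L[of D]] v(3) by simp
      ultimately have "?a (rep (line v)) = 0" using f(3) by blast
      thus ?thesis using z[OF comp[OF f(1)]] by simp
    qed
    have x0N: "trunc (Suc N) (rep x0) = rep x0" "\<forall>g\<in>F. g (rep x0) = 0"
      using x0(1) rep_projective_space unfolding F(2) vanishing_def by auto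
    obtain M l r where r: "M > 0" "homogeneous l r" "l + 1 = M * k"
      "\<And>v. trunc (Suc N) v = v \<Longrightarrow> \<forall>g\<in>F. g v = 0 \<Longrightarrow> ?a v ^ M = ?p v * r v"
      using homogeneous_Nullstellensatz[OF F(1)[unfolded homogeneous_set_def] L[of D] comp[OF f(1)] van x0N x0(2)] by blast
    have rW: "?a (rep x) ^ M = ?p (rep x) * r (rep x)" if "x \<in> W" for x
      using that rep_projective_space r(4) unfolding F(2) vanishing_def by auto
    obtain n h where h: "\<And>i. i < n \<Longrightarrow> homogeneous ((n - i) * l) (h i)"
      "\<And>x. x \<in> W \<Longrightarrow> r (rep x) ^ n = (\<Sum>i<n. h i (trunc (Suc D) (L (rep x))) * r (rep x) ^ i)"
      using int[OF r(2)] by blast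
    \<comment> \<open>The integral equation of \<open>r\<close>, multiplied by \<open>L\<^sub>D\<^sup>n\<close> and rewritten with \<open>f\<^sup>M = L\<^sub>D r\<close>. For \<open>L\<^sub>D = 0\<close> only its first term survives.\<close>
    define Phi where "Phi v = f (trunc D v) ^ (M * n) - (\<Sum>i<n. h i v * (v D ^ (n - i) * f (trunc D v) ^ (M * i)))" for v
    have "homogeneous (M * n * k) Phi"
    proof -
      have "homogeneous (M * n * k) (\<lambda>v. h i v * (v D ^ (n - i) * f (trunc D v) ^ (M * i)))" if i: "i < n" for i
      proof -
        have "homogeneous ((n - i) * l + ((n - i) * 1 + M * i * k)) (\<lambda>v. h i v * (v D ^ (n - i) * f (trunc D v) ^ (M * i)))"
          by (intro homogeneous.mult h(1)[OF i] homogeneous_power homogeneous_trunc f(1) homogeneous.coord)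
        moreover have "(n - i) * l + ((n - i) * 1 + M * i * k) = (n - i) * (l + 1) + i * (M * k)"
          by (simp add: distrib_left mult_ac)
        moreover have "(n - i) * (M * k) + i * (M * k) = M * n * k" using i by (simp flip: add_mult_distrib)
        ultimately show ?thesis unfolding r(3) by simp
      qed
      hence s: "homogeneous (M * n * k) (\<lambda>v. \<Sum>i<n. h i v * (v D ^ (n - i) * f (trunc D v) ^ (M * i)))"
        by (intro homogeneous_sum) auto
      show ?thesis unfolding Phi_def
        using homogeneous.add[OF homogeneous_power[OF homogeneous_trunc[OF f(1), of D], of "M * n"] homogeneous_scale[OF s, of "- 1"]]
        by simp
    qed
    moreover have "\<forall>x\<in>W. Phi (trunc (Suc D) (L (rep x))) = 0"
    proof
      fix x assume x: "x \<in> W"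
      let ?v = "rep x"
      have "?a ?v ^ (M * n) = ?p ?v ^ n * r ?v ^ n" using rW[OF x] by (simp add: power_mult power_mult_distrib)
      also have "\<dots> = (\<Sum>i<n. h i (trunc (Suc D) (L ?v)) * (?p ?v ^ (n - i) * ?a ?v ^ (M * i)))"
        unfolding h(2)[OF x] sum_distrib_left
      proof (rule sum.cong)
        fix i assume "i \<in> {..<n}"
        hence "?p ?v ^ n = ?p ?v ^ (n - i) * ?p ?v ^ i" by (simp flip: power_add)
        moreover have "?a ?v ^ (M * i) = ?p ?v ^ i * r ?v ^ i" using rW[OF x] by (simp add: power_mult power_mult_distrib)
        ultimately show "?p ?v ^ n * (h i (trunc (Suc D) (L ?v)) * r ?v ^ i) = h i (trunc (Suc D) (L ?v)) * (?p ?v ^ (n - i) * ?a ?v ^ (M * i))"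
          by simp
      qed simp
      finally show "Phi (trunc (Suc D) (L ?v)) = 0" unfolding Phi_def by simp
    qed
    ultimately have "Phi (trunc (Suc D) (trunc D u)) = 0" using W(2) unfolding independent_on_def by blast
    hence "f (trunc D u) ^ (M * n) = 0" unfolding Phi_def by (simp add: sum.neutral)
    thus ?thesis by simp
  qed
  show ?thesis unfolding independent_on_def
  proof (intro allI impI)
    fix k f u assume f: "homogeneous k f \<and> (\<forall>x\<in>{x \<in> W. L (rep x) D = 0}. f (trunc D (L (rep x))) = 0)"
    show "f (trunc D u) = 0"
    proof (cases "k > 0")
      case True thus ?thesis using pos f by blast
    next
      case False
      hence k: "homogeneous 0 f" using f by simp
      \<comment> \<open>A constant is multiplied by a coordinate, to have positive degree.\<close>
      have "homogeneous (0 + 1) (\<lambda>v. f v * v 0)" by (rule homogeneous.mult[OF k homogeneous.coord])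
      from pos[OF this] f have "f (trunc D (\<lambda>i. 1)) * trunc D (\<lambda>i. 1) 0 = 0" by simp
      hence "f (trunc D (\<lambda>i. 1)) = 0" using D by simp
      thus ?thesis using homogeneous_degree_0[OF k] by metis
    qed
  qed
qed

text \<open>
  A minimal closed set on which the forms are independent is irreducible; it is then cut by the last form, and
  the others stay independent on the section. The forms with indices between \<open>D\<close> and
  \<open>D0\<close> have already been cut out, so they drop out of the integral equations.
\<close>

lemma irreducible_chain:
  assumes X: "X \<subseteq> projective_space N" "closedin (Zariski (projective_space N)) X"
    and L: "\<And>i. homogeneous 1 (\<lambda>v. L v i)"
    and int: "\<And>k r. homogeneous k r \<Longrightarrow> \<exists>n h. (\<forall>i<n. homogeneous ((n - i) * k) (h i)) \<and>
        (\<forall>x\<in>X. r (rep x) ^ n = (\<Sum>i<n. h i (trunc D0 (L (rep x))) * r (rep x) ^ i))"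
    and Z: "closedin (Zariski X) Z" "independent_on L D Z" "\<forall>x\<in>Z. \<forall>j. D \<le> j \<and> j < D0 \<longrightarrow> L (rep x) j = 0" "D \<le> D0"
  shows "\<exists>W. (\<forall>i<D. closedin (Zariski X) (W i) \<and> irreducible_set (W i) \<and> W i \<subseteq> Z) \<and>
    (\<forall>i. Suc i < D \<longrightarrow> W i \<subset> W (Suc i))"
  using Z
proof (induction D arbitrary: Z)
  case 0 show ?case by simp
next
  case (Suc D)
  have Xp: "X \<subseteq> points" using X(1) projective_space_points by blast
  from minimal_closed[OF X(1) Suc.prems(1), of "independent_on L (Suc D)", OF Suc.prems(2)] obtain V where
    V: "V \<subseteq> Z" "closedin (Zariski X) V" "independent_on L (Suc D) V"
    "\<And>U. closedin (Zariski X) U \<Longrightarrow> U \<subset> V \<Longrightarrow> \<not> independent_on L (Suc D) U" by blast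
  have irr: "irreducible_set V" by (rule minimal_independent_irreducible[OF Xp V(2-4)])
  have VX: "V \<subseteq> X" using closedin_subset_topspace[OF Xp V(2)] .
  show ?case
  proof (cases "D = 0")
    case True
    thus ?thesis using V irr by (intro exI[of _ "\<lambda>_. V"]) auto
  next
    case False
    define Y where "Y = {x \<in> V. L (rep x) D = 0}"
    have tr: "trunc D0 (L (rep x)) = trunc (Suc D) (L (rep x))" if "x \<in> V" for x
      using Suc.prems(3,4) V(1) that by (auto simp: trunc_def fun_eq_iff not_less)
    have indY: "independent_on L D Y" unfolding Y_def
    proof (rule independent_on_section[OF X V(2,3) L])
      show "D > 0" using False by simp
      fix k r assume "homogeneous k r"
      from int[OF this] obtain n h where h: "\<forall>i<n. homogeneous ((n - i) * k) (h i)"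
        "\<forall>x\<in>X. r (rep x) ^ n = (\<Sum>i<n. h i (trunc D0 (L (rep x))) * r (rep x) ^ i)" by blast
      have "r (rep x) ^ n = (\<Sum>i<n. h i (trunc (Suc D) (L (rep x))) * r (rep x) ^ i)" if "x \<in> V" for x
        using h(2) VX that unfolding tr[OF that, symmetric] by blast
      thus "\<exists>n h. (\<forall>i<n. homogeneous ((n - i) * k) (h i)) \<and>
        (\<forall>x\<in>V. r (rep x) ^ n = (\<Sum>i<n. h i (trunc (Suc D) (L (rep x))) * r (rep x) ^ i))"
        using h(1) by blast
    qed
    have clY: "closedin (Zariski X) Y"
    proof -
      obtain F where F: "homogeneous_set F" "V = vanishing X F" using V(2) unfolding closedin_vanishing[OF Xp] by blast
      have "Y = vanishing X (insert (\<lambda>v. L v D) F)" unfolding Y_def F(2) vanishing_def by auto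
      moreover have "homogeneous_set (insert (\<lambda>v. L v D) F)" using F(1) L unfolding homogeneous_set_def by blast
      ultimately show ?thesis unfolding closedin_vanishing[OF Xp] by blast
    qed
    have "\<forall>x\<in>Y. \<forall>j. D \<le> j \<and> j < D0 \<longrightarrow> L (rep x) j = 0"
    proof (intro ballI allI impI)
      fix x j assume "x \<in> Y" "D \<le> j \<and> j < D0"
      thus "L (rep x) j = 0" using Suc.prems(3) V(1) unfolding Y_def by (cases "j = D") auto
    qed
    from Suc.IH[OF clY indY this] Suc.prems(4) obtain W where
      W: "\<And>i. i < D \<Longrightarrow> closedin (Zariski X) (W i) \<and> irreducible_set (W i) \<and> W i \<subseteq> Y"
      "\<And>i. Suc i < D \<Longrightarrow> W i \<subset> W (Suc i)" by auto
    have "Y \<noteq> V"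
    proof
      assume "Y = V"
      hence "\<forall>x\<in>V. trunc (Suc D) (L (rep x)) D = 0" unfolding Y_def by auto
      hence "trunc (Suc D) (\<lambda>i. 1) D = 0" using V(3) homogeneous.coord[of D] unfolding independent_on_def by blast
      thus False by simp
    qed
    hence YV: "Y \<subset> V" unfolding Y_def by blast
    show ?thesis
    proof (intro exI[of _ "\<lambda>i. if i < D then W i else V"] conjI allI impI)
      fix i
      show "i < Suc D \<Longrightarrow> closedin (Zariski X) (if i < D then W i else V)" using W(1) V(2) by simp
      show "i < Suc D \<Longrightarrow> irreducible_set (if i < D then W i else V)" using W(1) irr by simp
      show "i < Suc D \<Longrightarrow> (if i < D then W i else V) \<subseteq> Z" using W(1)[of i] YV V(1) by auto
      show "(if i < D then W i else V) \<subset> (if Suc i < D then W (Suc i) else V)" if "Suc i < Suc D"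
        using that W(1)[of i] W(2)[of i] YV by auto
    qed
  qed
qed

text \<open>
  Conversely, forms \<open>f\<^sub>i\<close> that vanish on the \<open>i\<close>-th member of a chain of
  irreducible sets but not on the next one are algebraically independent, together with a form that does not
  vanish on the first member: in a relation on the member \<open>m + 1\<close>, the lowest power of
  \<open>f\<^sub>m\<close> is cancelled, by irreducibility, and restriction to the member \<open>m\<close>
  leaves a relation among the other forms.
\<close>

lemma chain_monomials_independent:
  assumes Z: "\<And>i. i \<le> n \<Longrightarrow> Z i \<subseteq> points \<and> irreducible_set (Z i)" "\<And>i. i < n \<Longrightarrow> Z i \<subseteq> Z (Suc i)"
    and f: "\<And>i. i < n \<Longrightarrow> homogeneous q (f i)" "\<And>i x. i < n \<Longrightarrow> x \<in> Z i \<Longrightarrow> f i (rep x) = 0"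
      "\<And>i. i < n \<Longrightarrow> \<exists>x\<in>Z (Suc i). f i (rep x) \<noteq> 0"
    and l: "homogeneous q l" "x0 \<in> Z 0" "l (rep x0) \<noteq> 0"
    and m: "m \<le> n" and A: "finite A" "\<forall>a\<in>A. \<forall>i\<ge>m. a i = 0" "\<forall>a\<in>A. (\<Sum>i<m. a i) \<le> T"
    and rel: "\<forall>x\<in>Z m. (\<Sum>a\<in>A. c a * ((\<Prod>i<m. f i (rep x) ^ a i) * l (rep x) ^ (T - (\<Sum>i<m. a i)))) = 0"
  shows "\<forall>a\<in>A. c a = (0::complex)"
  using m A rel
proof (induction m arbitrary: A T c)
  case 0
  hence "A \<subseteq> {\<lambda>i. 0}" by (auto simp: fun_eq_iff)
  hence "A = {} \<or> A = {\<lambda>i. 0}" by blast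
  thus ?case using 0(5) l by auto
next
  case (Suc m)
  show ?case
  proof (rule ccontr)
    assume "\<not> ?case"
    define B where "B = {a\<in>A. c a \<noteq> 0}"
    have B: "finite B" "B \<noteq> {}" "B \<subseteq> A" using \<open>\<not> ?case\<close> Suc.prems(2) unfolding B_def by auto
    define mu where "mu = Min ((\<lambda>a. a m) ` B)"
    have mu: "mu \<le> a m" if "a \<in> B" for a unfolding mu_def using B that by auto
    have "mu \<in> (\<lambda>a. a m) ` B" unfolding mu_def using B by (intro Min_in) auto
    then obtain b where b: "b \<in> B" "b m = mu" by blast
    define G where "G v = (\<Sum>a\<in>B. c a * ((\<Prod>i<m. f i v ^ a i) * f m v ^ (a m - mu) * l v ^ (T - (\<Sum>i<Suc m. a i))))" for v
    have hG: "homogeneous ((T - mu) * q) G" unfolding G_def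
    proof (intro homogeneous_sum homogeneous_scale)
      fix a assume a: "a \<in> B"
      have s: "(\<Sum>i<m. a i) + a m \<le> T" using Suc.prems(4) a B(3) by auto
      have "homogeneous ((\<Sum>i<m. a i * q) + (a m - mu) * q + (T - (\<Sum>i<Suc m. a i)) * q)
        (\<lambda>v. (\<Prod>i<m. f i v ^ a i) * f m v ^ (a m - mu) * l v ^ (T - (\<Sum>i<Suc m. a i)))"
        using Suc.prems(1) f(1) l(1) by (intro homogeneous.mult homogeneous_prod homogeneous_power) auto
      moreover have "(\<Sum>i<m. a i * q) + (a m - mu) * q + (T - (\<Sum>i<Suc m. a i)) * q = (T - mu) * q"
        using s mu[OF a] by (simp flip: sum_distrib_right add_mult_distrib)
      ultimately show "homogeneous ((T - mu) * q)
        (\<lambda>v. (\<Prod>i<m. f i v ^ a i) * f m v ^ (a m - mu) * l v ^ (T - (\<Sum>i<Suc m. a i)))" by simp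
    qed
    have fm: "homogeneous (mu * q) (\<lambda>v. f m v ^ mu)" using Suc.prems(1) f(1) by (intro homogeneous_power) auto
    have "f m (rep x) ^ mu * G (rep x) = 0" if x: "x \<in> Z (Suc m)" for x
    proof -
      have "f m (rep x) ^ mu * G (rep x) = (\<Sum>a\<in>B. c a * ((\<Prod>i<Suc m. f i (rep x) ^ a i) * l (rep x) ^ (T - (\<Sum>i<Suc m. a i))))"
        unfolding G_def sum_distrib_left
      proof (rule sum.cong)
        fix a assume "a \<in> B"
        hence "f m (rep x) ^ a m = f m (rep x) ^ mu * f m (rep x) ^ (a m - mu)" using mu by (simp flip: power_add)
        thus "f m (rep x) ^ mu * (c a * ((\<Prod>i<m. f i (rep x) ^ a i) * f m (rep x) ^ (a m - mu) * l (rep x) ^ (T - (\<Sum>i<Suc m. a i)))) =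
          c a * ((\<Prod>i<Suc m. f i (rep x) ^ a i) * l (rep x) ^ (T - (\<Sum>i<Suc m. a i)))" by simp
      qed simp
      also have "\<dots> = (\<Sum>a\<in>A. c a * ((\<Prod>i<Suc m. f i (rep x) ^ a i) * l (rep x) ^ (T - (\<Sum>i<Suc m. a i))))"
        unfolding B_def by (rule sum.mono_neutral_left) (use Suc.prems(2) in auto)
      finally show ?thesis using Suc.prems(5) x by simp
    qed
    hence "(\<forall>x\<in>Z (Suc m). f m (rep x) ^ mu = 0) \<or> (\<forall>x\<in>Z (Suc m). G (rep x) = 0)"
      using Z(1) Suc.prems(1) by (intro irreducible_product[OF _ _ fm hG]) auto
    moreover obtain x1 where "x1 \<in> Z (Suc m)" "f m (rep x1) \<noteq> 0" using f(3)[of m] Suc.prems(1) by auto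
    ultimately have G0: "\<forall>x\<in>Z (Suc m). G (rep x) = 0" by auto
    define B' where "B' = {a\<in>B. a m = mu}"
    have inj: "inj_on (\<lambda>a. a(m := 0)) B'"
    proof (rule inj_onI)
      fix a b assume ab: "a \<in> B'" "b \<in> B'" "a(m := 0) = b(m := 0)"
      show "a = b"
      proof
        fix i show "a i = b i" using fun_cong[OF ab(3), of i] ab(1,2) by (cases "i = m") (auto simp: B'_def)
      qed
    qed
    have "\<forall>a\<in>(\<lambda>a. a(m := 0)) ` B'. c (a(m := mu)) = 0"
    proof (rule Suc.IH[of _ "T - mu"])
      show "m \<le> n" using Suc.prems(1) by simp
      show "finite ((\<lambda>a. a(m := 0)) ` B')" unfolding B'_def using B by auto
      show "\<forall>a\<in>(\<lambda>a. a(m := 0)) ` B'. \<forall>i\<ge>m. a i = 0"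
        using Suc.prems(3) B(3) unfolding B'_def by (auto simp: Suc_le_eq)
      have s: "(\<Sum>i<m. (a(m := 0)) i) = (\<Sum>i<m. a i)" for a :: "nat \<Rightarrow> nat" by (intro sum.cong) auto
      have le: "(\<Sum>i<m. a i) + mu \<le> T" if "a \<in> B'" for a using Suc.prems(4) B(3) that unfolding B'_def by auto
      thus "\<forall>a\<in>(\<lambda>a. a(m := 0)) ` B'. (\<Sum>i<m. a i) \<le> T - mu" using s by fastforce
      show "\<forall>x\<in>Z m. (\<Sum>a\<in>(\<lambda>a. a(m := 0)) ` B'. c (a(m := mu)) * ((\<Prod>i<m. f i (rep x) ^ a i) * l (rep x) ^ (T - mu - (\<Sum>i<m. a i)))) = 0"
      proof
        fix x assume x: "x \<in> Z m"
        have mn: "m < n" using Suc.prems(1) by simp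
        have xs: "x \<in> Z (Suc m)" and fx: "f m (rep x) = 0" using subsetD[OF Z(2)[OF mn] x] f(2)[OF mn x] by auto
        have "(\<Sum>a\<in>(\<lambda>a. a(m := 0)) ` B'. c (a(m := mu)) * ((\<Prod>i<m. f i (rep x) ^ a i) * l (rep x) ^ (T - mu - (\<Sum>i<m. a i))))
          = (\<Sum>a\<in>B'. c a * ((\<Prod>i<m. f i (rep x) ^ a i) * f m (rep x) ^ (a m - mu) * l (rep x) ^ (T - (\<Sum>i<Suc m. a i))))"
          unfolding sum.reindex[OF inj]
        proof (rule sum.cong)
          fix a assume a: "a \<in> B'"
          have "a(m := mu) = a" using a unfolding B'_def by auto
          moreover have "(\<Prod>i<m. f i (rep x) ^ (a(m := 0)) i) = (\<Prod>i<m. f i (rep x) ^ a i)" by (intro prod.cong) auto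
          moreover have "T - mu - (\<Sum>i<m. a i) = T - (\<Sum>i<Suc m. a i)" "a m - mu = 0" using a unfolding B'_def by auto
          ultimately show "((\<lambda>a. c (a(m := mu)) * ((\<Prod>i<m. f i (rep x) ^ a i) * l (rep x) ^ (T - mu - (\<Sum>i<m. a i)))) \<circ> (\<lambda>a. a(m := 0))) a =
            c a * ((\<Prod>i<m. f i (rep x) ^ a i) * f m (rep x) ^ (a m - mu) * l (rep x) ^ (T - (\<Sum>i<Suc m. a i)))"
            unfolding o_def s by simp
        qed simp
        also have "\<dots> = G (rep x)" unfolding G_def B'_def
          by (rule sum.mono_neutral_left) (use B(1) mu fx in \<open>auto simp: power_0_left dest: le_antisym\<close>)
        finally show "(\<Sum>a\<in>(\<lambda>a. a(m := 0)) ` B'. c (a(m := mu)) * ((\<Prod>i<m. f i (rep x) ^ a i) * l (rep x) ^ (T - mu - (\<Sum>i<m. a i)))) = 0"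
          using G0 xs by simp
      qed
    qed
    moreover have "b(m := 0) \<in> (\<lambda>a. a(m := 0)) ` B'" unfolding B'_def using b by blast
    ultimately have "c ((b(m := 0))(m := mu)) = 0" by blast
    moreover have "(b(m := 0))(m := mu) = b" using b(2) by auto
    ultimately show False using b(1) unfolding B_def by simp
  qed
qed

lemma card_le_if_independent_family:
  fixes g :: "'a \<Rightarrow> 'z \<Rightarrow> complex"
  assumes A: "finite A" and W: "finite W" "g ` A \<subseteq> fv.span W"
    and ind: "\<And>c. (\<And>z. (\<Sum>a\<in>A. c a * g a z) = 0) \<Longrightarrow> \<forall>a\<in>A. c a = 0"
  shows "card A \<le> card W"
proof -
  have inj: "inj_on g A"
  proof (rule inj_onI, rule ccontr)
    fix a b assume ab: "a \<in> A" "b \<in> A" "g a = g b" "a \<noteq> b"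
    let ?c = "\<lambda>x. (if x = a then 1 else 0) - (if x = b then 1 else 0 :: complex)"
    have "(\<Sum>x\<in>A. ?c x * g x z) = 0" for z
    proof -
      have "(\<Sum>x\<in>A. ?c x * g x z) = (\<Sum>x\<in>A. if x = a then g x z else 0) - (\<Sum>x\<in>A. if x = b then g x z else 0)"
        unfolding sum_subtractf[symmetric] by (intro sum.cong) auto
      thus ?thesis using A ab by simp
    qed
    from ind[of ?c, OF this] ab show False by auto
  qed
  have "\<not> fv.dependent (g ` A)"
  proof
    assume "fv.dependent (g ` A)"
    from this[unfolded fv.dependent_finite[OF finite_imageI[OF A]]]
    obtain c where c: "(\<exists>u\<in>g ` A. c u \<noteq> 0) \<and> (\<Sum>u\<in>g ` A. (\<lambda>v. c u * u v)) = 0" ..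
    have s: "(\<Sum>a\<in>A. (\<lambda>v. c (g a) * g a v)) = 0" using c by (simp add: sum.reindex[OF inj])
    have "(\<Sum>a\<in>A. c (g a) * g a z) = 0" for z using fun_cong[OF s, of z] by (simp add: sum_fun_apply)
    thus False using ind[of "\<lambda>a. c (g a)"] c by auto
  qed
  from fv.independent_span_bound[OF W(1) this W(2)] show ?thesis by (simp add: card_image[OF inj])
qed

lemma power_growth_bound:
  fixes n d C B :: nat
  assumes "\<And>K. (K + 1) ^ n \<le> C * (B * K + 1) ^ d" shows "n \<le> d"
proof (rule ccontr)
  assume "\<not> n \<le> d"
  hence n: "Suc d \<le> n" by simp
  define K where "K = C * (B + 1) ^ d"
  have "(K + 1) ^ Suc d \<le> (K + 1) ^ n" using n by (intro power_increasing) auto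
  also have "\<dots> \<le> C * (B * K + 1) ^ d" by (rule assms)
  also have "\<dots> \<le> C * ((B + 1) * (K + 1)) ^ d" by (intro mult_le_mono power_mono) auto
  also have "\<dots> = K * (K + 1) ^ d" unfolding K_def by (simp only: power_mult_distrib mult.assoc)
  finally show False by simp
qed

text \<open>
  The monomials in such forms, brought to the same degree by means of the last form, are
  \<open>(K + 1)\<^sup>n\<close> independent elements of the coordinate ring in a degree proportional to \<open>K\<close>.
\<close>

lemma chain_length_le_growth:
  assumes X: "X \<subseteq> projective_space N"
    and W: "\<And>k. \<exists>W. finite W \<and> card W \<le> C * (k + 1) ^ d \<and> forms (Suc N) (coords X) k \<subseteq> fv.span W"
    and Z: "\<forall>i\<le>n. closed_subvariety X (Z i)" "\<forall>i<n. Z i \<subset> Z (Suc i)"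
  shows "n \<le> d"
proof -
  have Xp: "X \<subseteq> points" using X projective_space_points by blast
  have ZX: "Z i \<subseteq> X" if "i \<le> n" for i
    using Z(1) that closedin_subset_topspace[OF Xp] unfolding closed_subvariety_def by blast
  have Zp: "Z i \<subseteq> points \<and> irreducible_set (Z i)" if "i \<le> n" for i
    using Z(1) that ZX[OF that] Xp unfolding closed_subvariety_def by auto
  have mono: "Z 0 \<subseteq> Z i" if "i \<le> n" for i
    using that
  proof (induction i)
    case (Suc i) thus ?case using Z(2) by (metis Suc_le_lessD order_less_imp_le psubset_imp_subset subset_trans)
  qed simp
  have "\<forall>i. \<exists>e g x. i < n \<longrightarrow> homogeneous e g \<and> (\<forall>z\<in>Z i. g (rep z) = 0) \<and> x \<in> Z (Suc i) \<and> g (rep x) \<noteq> 0"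
  proof (intro allI)
    fix i
    show "\<exists>e g x. i < n \<longrightarrow> homogeneous e g \<and> (\<forall>z\<in>Z i. g (rep z) = 0) \<and> x \<in> Z (Suc i) \<and> g (rep x) \<noteq> 0"
    proof (cases "i < n")
      case True
      hence "closedin (Zariski X) (Z i)" using Z(1) unfolding closed_subvariety_def by simp
      then obtain F where F: "homogeneous_set F" "Z i = vanishing X F" unfolding closedin_vanishing[OF Xp] by blast
      obtain x where x: "x \<in> Z (Suc i)" "x \<notin> Z i" using Z(2) True by blast
      have "x \<in> X" using x ZX[of "Suc i"] True by auto
      then obtain g where "g \<in> F" "g (rep x) \<noteq> 0" using x F(2) unfolding vanishing_def by blast
      thus ?thesis using F x unfolding homogeneous_set_def vanishing_def by blast
    qed simp
  qed
  then obtain e g x where g: "\<And>i. i < n \<Longrightarrow> homogeneous (e i) (g i)" "\<And>i z. i < n \<Longrightarrow> z \<in> Z i \<Longrightarrow> g i (rep z) = 0"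
    "\<And>i. i < n \<Longrightarrow> x i \<in> Z (Suc i)" "\<And>i. i < n \<Longrightarrow> g i (rep (x i)) \<noteq> 0" by metis
  obtain x0 where x0: "x0 \<in> Z 0" using irreducible_nonempty Zp[of 0] by auto
  have "x0 \<in> points" using x0 Zp[of 0] by blast
  hence "rep x0 \<noteq> 0" by (rule rep_point(2))
  then obtain j where j: "rep x0 j \<noteq> 0" by (auto simp: fun_eq_iff)
  define q where "q = (\<Sum>i<n. e i)"
  have eq: "e i \<le> q" if "i < n" for i unfolding q_def using that by (intro member_le_sum) auto
  define f where "f i = (\<lambda>v. g i v * v j ^ (q - e i))" for i
  define l where "l = (\<lambda>v :: cvec. v j ^ q)"
  have hp: "homogeneous k (\<lambda>v. v j ^ k)" for k using homogeneous_power[OF homogeneous.coord[of j], of k] by simp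
  have hf: "homogeneous q (f i)" if "i < n" for i
    using homogeneous.mult[OF g(1)[OF that] hp[of "q - e i"]] eq[OF that] unfolding f_def by simp
  have fnz: "\<exists>z\<in>Z (Suc i). f i (rep z) \<noteq> 0" if i: "i < n" for i
  proof -
    have "x0 \<in> Z (Suc i)" using x0 mono[of "Suc i"] i by auto
    from irreducible_witness[OF _ _ g(1)[OF i] hp[of 1] g(3,4)[OF i] this] Zp[of "Suc i"] i j
    show ?thesis unfolding f_def by auto
  qed
  have bound: "(K + 1) ^ n \<le> C * (n * q * K + 1) ^ d" for K
  proof -
    define T where "T = n * K"
    define A where "A = {a. (\<forall>i<n. a i \<le> K) \<and> (\<forall>i\<ge>n. a i = (0::nat))}"
    have sA: "(\<Sum>i<n. a i) \<le> T" if "a \<in> A" for a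
      using sum_bounded_above[of "{..<n}" a K] that unfolding A_def T_def by simp
    have bij: "bij_betw (\<lambda>a. restrict a {..<n}) A ({..<n} \<rightarrow>\<^sub>E {..K})"
      by (rule bij_betwI[where g = "\<lambda>a i. if i < n then a i else 0"])
        (auto simp: A_def PiE_def extensional_def fun_eq_iff)
    have A: "finite A" "card A = (K + 1) ^ n"
      using bij_betw_finite[OF bij] bij_betw_same_card[OF bij] by (simp_all add: card_PiE finite_PiE)
    define P where "P a v = (\<Prod>i<n. f i v ^ a i) * l v ^ (T - (\<Sum>i<n. a i))" for a v
    have hP: "homogeneous (T * q) (P a)" if a: "a \<in> A" for a
    proof -
      have "homogeneous ((\<Sum>i<n. a i * q) + (T - (\<Sum>i<n. a i)) * q) (P a)"
        unfolding P_def l_def using hf hp by (intro homogeneous.mult homogeneous_prod homogeneous_power) auto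
      moreover have "(\<Sum>i<n. a i * q) + (T - (\<Sum>i<n. a i)) * q = T * q"
        using sA[OF a] by (simp flip: sum_distrib_right add_mult_distrib)
      ultimately show ?thesis by simp
    qed
    define G where "G a z = P a (trunc (Suc N) (coords X z))" for a z
    obtain W where W: "finite W" "card W \<le> C * (T * q + 1) ^ d" "forms (Suc N) (coords X) (T * q) \<subseteq> fv.span W"
      using W[of "T * q"] by (elim exE conjE) (rule that)
    have "G ` A \<subseteq> fv.span W" using W(3) formsI[OF hP] unfolding G_def by blast
    hence "card A \<le> card W"
    proof (rule card_le_if_independent_family[OF A(1) W(1)])
      fix c assume c: "\<And>z. (\<Sum>a\<in>A. c a * G a z) = 0"
      show "\<forall>a\<in>A. c a = 0"
      proof (rule chain_monomials_independent[where n = n and m = n and Z = Z and q = q and f = f and l = l and T = T])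
        show "\<forall>x\<in>Z n. (\<Sum>a\<in>A. c a * ((\<Prod>i<n. f i (rep x) ^ a i) * l (rep x) ^ (T - (\<Sum>i<n. a i)))) = 0"
        proof
          fix x assume "x \<in> Z n"
          hence x: "x \<in> X" using ZX by auto
          hence "G a x = (\<Prod>i<n. f i (rep x) ^ a i) * l (rep x) ^ (T - (\<Sum>i<n. a i))" for a
            unfolding G_def P_def using rep_projective_space X by auto
          thus "(\<Sum>a\<in>A. c a * ((\<Prod>i<n. f i (rep x) ^ a i) * l (rep x) ^ (T - (\<Sum>i<n. a i)))) = 0" using c[of x] by simp
        qed
        show "f i (rep z) = 0" if "i < n" "z \<in> Z i" for i z using g(2)[OF that] unfolding f_def by simp
      qed (use Zp Z(2) hf fnz x0 j hp A sA in \<open>auto simp: l_def A_def\<close>)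
    qed
    thus ?thesis using A(2) W(2) unfolding T_def by (simp add: mult_ac)
  qed
  show ?thesis by (rule power_growth_bound[OF bound])
qed

text \<open>
  The coordinate ring is finite over \<open>D\<close> independent linear forms, so its order of growth is at
  most \<open>D - 1\<close>. These forms cut out a chain of length \<open>D - 1\<close>. Because no chain is
  longer than the order of growth, the supremum that defines the dimension is attained, and the dimension is at
  least \<open>D - 1\<close>.
\<close>

theorem coordinate_ring_growth:
  assumes X: "X \<subseteq> projective_space N" "closedin (Zariski (projective_space N)) X" "irreducible_set X"
  shows "\<exists>C. \<forall>k. \<exists>W. finite W \<and> card W \<le> C * (k + 1) ^ variety_dim X \<and> forms (Suc N) (coords X) k \<subseteq> fv.span W"
proof -
  have Xp: "X \<subseteq> points" using X(1) projective_space_points by blast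
  let ?y = "coords X"
  obtain D w where w: "independent_coords D w" "\<And>k. forms D w k \<subseteq> forms (Suc N) ?y k"
    "finite_over (forms (Suc N) ?y) (forms D w)" using Noether_normalization[of "Suc N" ?y] by blast
  obtain C where C: "\<And>k. \<exists>W. finite W \<and> card W \<le> C * (k + 1) ^ (D - 1) \<and> forms (Suc N) ?y k \<subseteq> fv.span W"
    using finite_over_dim[OF w(3)] by blast
  obtain x0 where x0: "x0 \<in> X" using irreducible_nonempty[OF X(3)] by blast
  have tr: "trunc (Suc N) (rep x) = rep x" if "x \<in> X" for x using rep_projective_space that X(1) by blast
  have "D \<noteq> 0"
  proof
    assume "D = 0"
    with w(3) have "finite_over (forms (Suc N) ?y) (forms 0 w)" by simp
    from finite_over_constants[OF this] obtain k where k: "forms (Suc N) ?y k \<subseteq> {0}" by blast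
    have "rep x0 \<noteq> 0" using rep_point(2) x0 Xp by blast
    then obtain j where j: "rep x0 j \<noteq> 0" by (auto simp: fun_eq_iff)
    have "(\<lambda>z. (trunc (Suc N) (?y z)) j ^ k) \<in> forms (Suc N) ?y k"
      using formsI[OF homogeneous_power[OF homogeneous.coord[of j], of k]] by simp
    hence "(\<lambda>z. (trunc (Suc N) (?y z)) j ^ k) = 0" using k by blast
    from fun_cong[OF this, of x0] show False using j x0 tr by simp
  qed
  have "\<exists>q. i < D \<longrightarrow> homogeneous 1 q \<and> (\<forall>z. w z i = q (trunc (Suc N) (?y z)))" for i
  proof (cases "i < D")
    case True
    hence "(\<lambda>z. w z i) \<in> forms (Suc N) ?y 1" using coord_in_forms[of i D w] w(2)[of 1] by blast
    then obtain q where "homogeneous 1 q" "(\<lambda>z. w z i) = (\<lambda>z. q (trunc (Suc N) (?y z)))" unfolding forms_def by blast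
    thus ?thesis by (intro exI[of _ q]) (simp add: fun_eq_iff)
  qed simp
  then obtain q where q: "\<And>i. i < D \<Longrightarrow> homogeneous 1 (q i)" "\<And>i z. i < D \<Longrightarrow> w z i = q i (trunc (Suc N) (?y z))" by metis
  define L where "L v = (\<lambda>i. if i < D then q i v else 0)" for v
  have L: "homogeneous 1 (\<lambda>v. L v i)" for i
    unfolding L_def using q(1) homogeneous_zero by (cases "i < D") auto
  have Lw: "trunc D (L (rep x)) = trunc D (w x)" if "x \<in> X" for x
    using q(2)[of _ x] that tr by (auto simp: trunc_def L_def fun_eq_iff)
  have w0: "trunc D (w z) = (\<lambda>i. 0)" if "z \<notin> X" for z
  proof -
    have "trunc (Suc N) (?y z) = (\<lambda>i. 0)" using that by (auto simp: trunc_def)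
    hence "w z i = 0" if "i < D" for i using q[OF that] homogeneous_at_0[of 1 "q i"] by simp
    thus ?thesis by (auto simp: trunc_def)
  qed
  have ind: "independent_on L D X" unfolding independent_on_def
  proof (intro allI impI)
    fix k p v assume p: "homogeneous k p \<and> (\<forall>x\<in>X. p (trunc D (L (rep x))) = 0)"
    have "p (trunc D (w z)) = 0" for z
    proof (cases "z \<in> X")
      case True thus ?thesis using p Lw by simp
    next
      case False
      show ?thesis
      proof (cases "k = 0")
        case True
        hence "homogeneous 0 p" using p by simp
        from homogeneous_degree_0[OF this, of "trunc D (w z)" "trunc D (L (rep x0))"] show ?thesis using p x0 by simp
      next
        case False thus ?thesis using homogeneous_at_0[of k p] p w0[OF \<open>z \<notin> X\<close>] by simp
      qed
    qed
    thus "p (trunc D v) = 0" using w(1)[unfolded independent_coords_def, rule_format, of k p v] p by blast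
  qed
  have int: "\<exists>n h. (\<forall>i<n. homogeneous ((n - i) * k) (h i)) \<and>
      (\<forall>x\<in>X. r (rep x) ^ n = (\<Sum>i<n. h i (trunc D (L (rep x))) * r (rep x) ^ i))" if r: "homogeneous k r" for k r
  proof -
    let ?f = "\<lambda>z. r (trunc (Suc N) (?y z))"
    obtain n H where H: "\<forall>i<n. H i \<in> forms D w ((n - i) * k)" "?f ^ n = (\<Sum>i<n. H i * ?f ^ i)"
      using integral_over_forms[OF graded_ring_forms w(2,3) formsI[OF r]] by blast
    have "\<forall>i. \<exists>h. i < n \<longrightarrow> homogeneous ((n - i) * k) h \<and> H i = (\<lambda>z. h (trunc D (w z)))"
      using H(1) unfolding forms_def by blast
    then obtain h where h: "\<And>i. i < n \<Longrightarrow> homogeneous ((n - i) * k) (h i)" "\<And>i. i < n \<Longrightarrow> H i = (\<lambda>z. h i (trunc D (w z)))" by metis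
    have "r (rep x) ^ n = (\<Sum>i<n. h i (trunc D (L (rep x))) * r (rep x) ^ i)" if x: "x \<in> X" for x
    proof -
      have "r (rep x) ^ n = (?f ^ n) x" using x tr by (simp add: power_fun_apply)
      also have "\<dots> = (\<Sum>i<n. h i (trunc D (L (rep x))) * r (rep x) ^ i)"
        unfolding H(2) using h(2) x tr Lw by (simp add: sum_fun_apply power_fun_apply)
      finally show ?thesis .
    qed
    thus ?thesis using h(1) by blast
  qed
  have vac: "\<forall>x\<in>X. \<forall>j. D \<le> j \<and> j < D \<longrightarrow> L (rep x) j = 0" by auto
  have "\<exists>Z. (\<forall>i<D. closedin (Zariski X) (Z i) \<and> irreducible_set (Z i) \<and> Z i \<subseteq> X) \<and>
      (\<forall>i. Suc i < D \<longrightarrow> Z i \<subset> Z (Suc i))"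
    using irreducible_chain[where L = L and D = D and ?D0.0 = D and Z = X,
        OF X(1,2) L int closedin_self[OF Xp] ind vac order_refl] by simp
  then obtain Z where Z: "\<forall>i<D. closedin (Zariski X) (Z i) \<and> irreducible_set (Z i) \<and> Z i \<subseteq> X"
    "\<forall>i. Suc i < D \<longrightarrow> Z i \<subset> Z (Suc i)" by (elim exE conjE) (rule that)
  let ?S = "{n. \<exists>Z. (\<forall>i\<le>n. closed_subvariety X (Z i)) \<and> (\<forall>i<n. Z i \<subset> Z (Suc i))}"
  have "n \<le> D - 1" if n: "n \<in> ?S" for n
  proof -
    obtain Y where "\<forall>i\<le>n. closed_subvariety X (Y i)" "\<forall>i<n. Y i \<subset> Y (Suc i)"
      using n by (elim CollectE exE conjE) (rule that)
    thus ?thesis using chain_length_le_growth[OF X(1) C, of n Y] by simp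
  qed
  hence "bdd_above ?S" by (rule bdd_aboveI)
  moreover have "D - 1 \<in> ?S" using Z \<open>D \<noteq> 0\<close> unfolding closed_subvariety_def by (intro CollectI exI[of _ Z]) auto
  ultimately have dim: "D - 1 \<le> variety_dim X" unfolding variety_dim_def by (rule cSup_upper[rotated])
  show ?thesis
  proof (intro exI[of _ C] allI)
    fix k
    obtain W where W: "finite W" "card W \<le> C * (k + 1) ^ (D - 1)" "forms (Suc N) ?y k \<subseteq> fv.span W" using C by blast
    have "C * (k + 1) ^ (D - 1) \<le> C * (k + 1) ^ variety_dim X"
      by (intro mult_le_mono2 power_increasing dim) simp
    thus "\<exists>W. finite W \<and> card W \<le> C * (k + 1) ^ variety_dim X \<and> forms (Suc N) ?y k \<subseteq> fv.span W"
      using W order_trans by blast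
  qed
qed

section \<open>Values of rational functions and sections\<close>

lemma generically_mono:
  "generically X P \<Longrightarrow> (\<And>x. x \<in> X \<Longrightarrow> P x \<Longrightarrow> Q x) \<Longrightarrow> X \<subseteq> points \<Longrightarrow> generically X Q"
proof -
  assume g: "generically X P" and PQ: "\<And>x. x \<in> X \<Longrightarrow> P x \<Longrightarrow> Q x" and X: "X \<subseteq> points"
  obtain U where U: "openin (Zariski X) U" "U \<noteq> {}" "\<forall>x\<in>U. P x" using g unfolding generically_def by blast
  have "U \<subseteq> X" using openin_subset[OF U(1)] topspace_Zariski[OF X] by simp
  thus ?thesis unfolding generically_def using U PQ by (intro exI[of _ U]) auto
qed

locale irreducible_points =
  fixes X :: "point set"
  assumes Xp: "X \<subseteq> points" and irr: "irreducible_set X"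
begin

lemma generically_conj:
  assumes "generically X P" "generically X Q" shows "generically X (\<lambda>x. P x \<and> Q x)"
proof -
  obtain U V where U: "openin (Zariski X) U" "U \<noteq> {}" "\<forall>x\<in>U. P x"
    and V: "openin (Zariski X) V" "V \<noteq> {}" "\<forall>x\<in>V. Q x" using assms unfolding generically_def by blast
  obtain u where u: "u \<in> U" using U by blast
  obtain v where v: "v \<in> V" using V by blast
  have uv: "u \<in> X" "v \<in> X" using u v openin_subset[OF U(1)] openin_subset[OF V(1)] topspace_Zariski[OF Xp] by auto
  obtain d g where g: "homogeneous d g" "g (rep u) \<noteq> 0" "\<forall>z\<in>X. g (rep z) \<noteq> 0 \<longrightarrow> z \<in> U"
    using open_contains_basic[OF Xp U(1) u] by blast
  obtain e h where h: "homogeneous e h" "h (rep v) \<noteq> 0" "\<forall>z\<in>X. h (rep z) \<noteq> 0 \<longrightarrow> z \<in> V"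
    using open_contains_basic[OF Xp V(1) v] by blast
  obtain z where "z \<in> X" "g (rep z) \<noteq> 0" "h (rep z) \<noteq> 0"
    using irreducible_witness[OF Xp irr g(1) h(1) uv(1) g(2) uv(2) h(2)] by blast
  hence "U \<inter> V \<noteq> {}" using g(3) h(3) by blast
  thus ?thesis unfolding generically_def using U V by (intro exI[of _ "U \<inter> V"]) auto
qed

lemma generically_basic: "homogeneous d g \<Longrightarrow> x \<in> X \<Longrightarrow> g (rep x) \<noteq> 0 \<Longrightarrow> generically X (\<lambda>z. g (rep z) \<noteq> 0)"
  unfolding generically_def using open_basic[OF Xp] by blast

lemma generically_all: "(\<And>x. x \<in> X \<Longrightarrow> P x) \<Longrightarrow> generically X P"
  unfolding generically_def using closedin_self[OF Xp] irreducible_nonempty[OF irr] topspace_Zariski[OF Xp]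
    openin_topspace[of "Zariski X"] by (intro exI[of _ X]) auto

lemma generically_vanishing:
  assumes p: "homogeneous d p" and g: "generically X (\<lambda>z. p (rep z) = 0)" and x: "x \<in> X"
  shows "p (rep x) = 0"
proof (rule ccontr)
  assume "p (rep x) \<noteq> 0"
  from generically_conj[OF generically_basic[OF p x this] g] show False unfolding generically_def by auto
qed

text \<open>
  The representation of a rational function by forms of an explicit degree, evaluated at the fixed vectors of
  the points.
\<close>

definition fraction :: "(point \<Rightarrow> complex) \<Rightarrow> nat \<Rightarrow> (cvec \<Rightarrow> complex) \<Rightarrow> (cvec \<Rightarrow> complex) \<Rightarrow> bool" where
  "fraction \<phi> d p q \<longleftrightarrow> homogeneous d p \<and> homogeneous d q \<and>
     generically X (\<lambda>y. q (rep y) \<noteq> 0 \<and> \<phi> y = p (rep y) / q (rep y))"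

lemma fractionD:
  assumes "fraction \<phi> d p q"
  shows "homogeneous d p" "homogeneous d q" "generically X (\<lambda>y. q (rep y) \<noteq> 0 \<and> \<phi> y = p (rep y) / q (rep y))"
  using assms unfolding fraction_def by auto

lemma quotient_at_point:
  assumes "homogeneous d p" "homogeneous d q" "x \<in> X"
  shows "(\<forall>v\<in>x - {0}. q v \<noteq> 0 \<and> c = p v / q v) \<longleftrightarrow> q (rep x) \<noteq> 0 \<and> c = p (rep x) / q (rep x)"
proof -
  have xp: "x \<in> points" using assms(3) Xp by blast
  have "q v \<noteq> 0 \<and> c = p v / q v" if v: "v \<in> x - {0}" and c: "q (rep x) \<noteq> 0 \<and> c = p (rep x) / q (rep x)" for v
  proof -
    obtain a where "a \<noteq> 0" "v = (\<lambda>i. a * rep x i)" using in_point[OF xp v] by blast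
    thus ?thesis using c homogeneous_line[OF assms(1), of a "rep x"] homogeneous_line[OF assms(2), of a "rep x"] by simp
  qed
  moreover have "rep x \<in> x - {0}" using rep_point[OF xp] by blast
  ultimately show ?thesis by blast
qed

lemma is_fraction_iff: "is_fraction X \<phi> p q \<longleftrightarrow> (\<exists>d. fraction \<phi> d p q)"
proof -
  have "generically X (\<lambda>y. \<forall>v\<in>y - {0}. q v \<noteq> 0 \<and> \<phi> y = p v / q v) \<longleftrightarrow>
    generically X (\<lambda>y. q (rep y) \<noteq> 0 \<and> \<phi> y = p (rep y) / q (rep y))"
    if "homogeneous d p" "homogeneous d q" for d
  proof
    show "generically X (\<lambda>y. q (rep y) \<noteq> 0 \<and> \<phi> y = p (rep y) / q (rep y))"
      if "generically X (\<lambda>y. \<forall>v\<in>y - {0}. q v \<noteq> 0 \<and> \<phi> y = p v / q v)"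
      by (rule generically_mono[OF that _ Xp]) (use quotient_at_point \<open>homogeneous d p\<close> \<open>homogeneous d q\<close> in blast)
    show "generically X (\<lambda>y. \<forall>v\<in>y - {0}. q v \<noteq> 0 \<and> \<phi> y = p v / q v)"
      if "generically X (\<lambda>y. q (rep y) \<noteq> 0 \<and> \<phi> y = p (rep y) / q (rep y))"
      by (rule generically_mono[OF that _ Xp]) (use quotient_at_point \<open>homogeneous d p\<close> \<open>homogeneous d q\<close> in blast)
  qed
  thus ?thesis unfolding is_fraction_def fraction_def by blast
qed

lemma rational_iff: "rational X \<phi> \<longleftrightarrow> (\<exists>d p q. fraction \<phi> d p q)"
  unfolding rational_def is_fraction_iff by blast

lemma has_value_iff:
  assumes "x \<in> X"
  shows "has_value X \<phi> x c \<longleftrightarrow> (\<exists>d p q. fraction \<phi> d p q \<and> q (rep x) \<noteq> 0 \<and> c = p (rep x) / q (rep x))"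
proof
  assume "has_value X \<phi> x c"
  then obtain p q d where f: "fraction \<phi> d p q" "\<forall>v\<in>x - {0}. q v \<noteq> 0 \<and> c = p v / q v"
    unfolding has_value_def is_fraction_iff by (elim exE conjE) (rule that)
  from f(2) have "q (rep x) \<noteq> 0 \<and> c = p (rep x) / q (rep x)"
    unfolding quotient_at_point[OF fractionD(1,2)[OF f(1)] assms] .
  with f(1) show "\<exists>d p q. fraction \<phi> d p q \<and> q (rep x) \<noteq> 0 \<and> c = p (rep x) / q (rep x)" by (intro exI conjI) auto
next
  assume "\<exists>d p q. fraction \<phi> d p q \<and> q (rep x) \<noteq> 0 \<and> c = p (rep x) / q (rep x)"
  then obtain d p q where f: "fraction \<phi> d p q" "q (rep x) \<noteq> 0 \<and> c = p (rep x) / q (rep x)" by (elim exE) (rule that, auto)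
  from f(2) have "\<forall>v\<in>x - {0}. q v \<noteq> 0 \<and> c = p v / q v"
    unfolding quotient_at_point[OF fractionD(1,2)[OF f(1)] assms, symmetric] .
  with f(1) show "has_value X \<phi> x c" unfolding has_value_def is_fraction_iff by (intro exI conjI)
qed

lemma has_value_cases:
  assumes "has_value X \<phi> x c" "x \<in> X"
  obtains d p q where "fraction \<phi> d p q" "q (rep x) \<noteq> 0" "c = p (rep x) / q (rep x)"
  using assms(1) unfolding has_value_iff[OF assms(2)] by (elim exE conjE)

lemma has_value_fraction: "fraction \<phi> d p q \<Longrightarrow> x \<in> X \<Longrightarrow> q (rep x) \<noteq> 0 \<Longrightarrow> has_value X \<phi> x (p (rep x) / q (rep x))"
  unfolding has_value_iff by (intro exI conjI) auto

lemma fraction_cong: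
  assumes "fraction \<phi> d p q" "generically X (\<lambda>z. \<psi> z = \<phi> z)" shows "fraction \<psi> d p q"
  unfolding fraction_def
proof (intro conjI fractionD(1,2)[OF assms(1)])
  show "generically X (\<lambda>y. q (rep y) \<noteq> 0 \<and> \<psi> y = p (rep y) / q (rep y))"
    by (rule generically_mono[OF generically_conj[OF assms(2) fractionD(3)[OF assms(1)]] _ Xp]) simp
qed

text \<open>
  A form that vanishes on a nonempty open set vanishes on \<open>X\<close>; hence fractions that agree
  generically agree wherever both are defined, and values of rational functions are unique.
\<close>

lemma fraction_equal:
  assumes "fraction \<phi> d p q" "fraction \<phi> e a b" "x \<in> X"
  shows "p (rep x) * b (rep x) = a (rep x) * q (rep x)"
proof -
  note 1 = fractionD[OF assms(1)] and 2 = fractionD[OF assms(2)]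
  have h: "homogeneous (d + e) (\<lambda>v. p v * b v + (- 1) * (q v * a v))"
    by (intro homogeneous.add homogeneous_scale homogeneous.mult 1 2)
  have "generically X (\<lambda>z. p (rep z) * b (rep z) + (- 1) * (q (rep z) * a (rep z)) = 0)"
  proof (rule generically_mono[OF generically_conj[OF 1(3) 2(3)] _ Xp])
    fix z assume z: "(q (rep z) \<noteq> 0 \<and> \<phi> z = p (rep z) / q (rep z)) \<and> (b (rep z) \<noteq> 0 \<and> \<phi> z = a (rep z) / b (rep z))"
    hence "\<phi> z = p (rep z) / q (rep z)" "\<phi> z = a (rep z) / b (rep z)" by blast+
    hence "p (rep z) / q (rep z) = a (rep z) / b (rep z)" by (rule trans[OF sym])
    hence "p (rep z) * b (rep z) = a (rep z) * q (rep z)" using z frac_eq_eq by blast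
    thus "p (rep z) * b (rep z) + (- 1) * (q (rep z) * a (rep z)) = 0" by (simp add: mult.commute)
  qed
  from generically_vanishing[OF h this assms(3)] show ?thesis by (simp add: mult.commute)
qed

lemma has_value_unique:
  assumes "has_value X \<phi> x c" "has_value X \<phi> x c'" "x \<in> X" shows "c = c'"
proof -
  obtain d p q where p: "fraction \<phi> d p q" "q (rep x) \<noteq> 0" "c = p (rep x) / q (rep x)"
    by (rule has_value_cases[OF assms(1) assms(3)])
  obtain e a b where a: "fraction \<phi> e a b" "b (rep x) \<noteq> 0" "c' = a (rep x) / b (rep x)"
    by (rule has_value_cases[OF assms(2) assms(3)])
  show ?thesis unfolding p(3) a(3) frac_eq_eq[OF p(2) a(2)] by (rule fraction_equal[OF p(1) a(1) assms(3)])
qed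

lemma has_value_cong:
  assumes "has_value X \<phi> x c" "generically X (\<lambda>z. \<psi> z = \<phi> z)" "x \<in> X" shows "has_value X \<psi> x c"
proof -
  obtain d p q where p: "fraction \<phi> d p q" "q (rep x) \<noteq> 0" "c = p (rep x) / q (rep x)"
    by (rule has_value_cases[OF assms(1,3)])
  show ?thesis unfolding p(3) by (rule has_value_fraction[OF fraction_cong[OF p(1) assms(2)] assms(3) p(2)])
qed

lemma fraction_mult:
  assumes "fraction \<phi> d p q" "fraction \<psi> e a b"
  shows "fraction (\<lambda>z. \<phi> z * \<psi> z) (d + e) (\<lambda>v. p v * a v) (\<lambda>v. q v * b v)"
proof -
  note 1 = fractionD[OF assms(1)] and 2 = fractionD[OF assms(2)]
  have "generically X (\<lambda>y. q (rep y) * b (rep y) \<noteq> 0 \<and> \<phi> y * \<psi> y = p (rep y) * a (rep y) / (q (rep y) * b (rep y)))"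
    by (rule generically_mono[OF generically_conj[OF 1(3) 2(3)] _ Xp]) simp
  thus ?thesis unfolding fraction_def using homogeneous.mult[OF 1(1) 2(1)] homogeneous.mult[OF 1(2) 2(2)] by simp
qed

lemma fraction_add:
  assumes "fraction \<phi> d p q" "fraction \<psi> e a b"
  shows "fraction (\<lambda>z. \<phi> z + \<psi> z) (d + e) (\<lambda>v. p v * b v + q v * a v) (\<lambda>v. q v * b v)"
proof -
  note 1 = fractionD[OF assms(1)] and 2 = fractionD[OF assms(2)]
  have "generically X (\<lambda>y. q (rep y) * b (rep y) \<noteq> 0 \<and>
      \<phi> y + \<psi> y = (p (rep y) * b (rep y) + q (rep y) * a (rep y)) / (q (rep y) * b (rep y)))"
    by (rule generically_mono[OF generically_conj[OF 1(3) 2(3)] _ Xp]) (simp add: add_frac_eq mult.commute)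
  thus ?thesis unfolding fraction_def
    using homogeneous.add[OF homogeneous.mult[OF 1(1) 2(2)] homogeneous.mult[OF 1(2) 2(1)]] homogeneous.mult[OF 1(2) 2(2)]
    by simp
qed

lemma fraction_const: "fraction (\<lambda>z. c) 0 (\<lambda>v. c) (\<lambda>v. 1)"
  unfolding fraction_def by (auto intro: homogeneous.const generically_all)

lemma has_value_mult:
  assumes "has_value X \<phi> x c" "has_value X \<psi> x c'" "x \<in> X"
  shows "has_value X (\<lambda>z. \<phi> z * \<psi> z) x (c * c')"
proof -
  obtain d p q where p: "fraction \<phi> d p q" "q (rep x) \<noteq> 0" "c = p (rep x) / q (rep x)"
    by (rule has_value_cases[OF assms(1,3)])
  obtain e a b where a: "fraction \<psi> e a b" "b (rep x) \<noteq> 0" "c' = a (rep x) / b (rep x)"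
    by (rule has_value_cases[OF assms(2,3)])
  show ?thesis using has_value_fraction[OF fraction_mult[OF p(1) a(1)] assms(3)] p(2) a(2)
    unfolding p(3) a(3) by simp
qed

lemma has_value_add:
  "has_value X \<phi> x c \<Longrightarrow> has_value X \<psi> x c' \<Longrightarrow> x \<in> X \<Longrightarrow> has_value X (\<lambda>z. \<phi> z + \<psi> z) x (c + c')"
proof -
  assume 1: "has_value X \<phi> x c" and 2: "has_value X \<psi> x c'" and x: "x \<in> X"
  obtain d p q where p: "fraction \<phi> d p q" "q (rep x) \<noteq> 0" "c = p (rep x) / q (rep x)"
    by (rule has_value_cases[OF 1 x])
  obtain e a b where a: "fraction \<psi> e a b" "b (rep x) \<noteq> 0" "c' = a (rep x) / b (rep x)"
    by (rule has_value_cases[OF 2 x])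
  show ?thesis using has_value_fraction[OF fraction_add[OF p(1) a(1)] x] p(2) a(2)
    unfolding p(3) a(3) by (simp add: add_frac_eq mult.commute)
qed

lemma has_value_const: "x \<in> X \<Longrightarrow> has_value X (\<lambda>z. c) x c"
  using has_value_fraction[OF fraction_const] by simp

lemma has_value_power: "has_value X \<phi> x c \<Longrightarrow> x \<in> X \<Longrightarrow> has_value X (\<lambda>z. \<phi> z ^ n) x (c ^ n)"
  by (induction n) (auto intro: has_value_const has_value_mult)

lemma has_value_inverse:
  assumes "has_value X \<phi> x c" "c \<noteq> 0" "x \<in> X" shows "has_value X (\<lambda>z. 1 / \<phi> z) x (1 / c)"
proof -
  obtain d p q where p: "fraction \<phi> d p q" "q (rep x) \<noteq> 0" "c = p (rep x) / q (rep x)"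
    by (rule has_value_cases[OF assms(1) assms(3)])
  have px: "p (rep x) \<noteq> 0" using p assms(2) by auto
  have "homogeneous d p" using p(1) unfolding fraction_def by blast
  from generically_conj[OF generically_basic[OF this assms(3) px]] p(1)
  have "generically X (\<lambda>y. p (rep y) \<noteq> 0 \<and> q (rep y) \<noteq> 0 \<and> \<phi> y = p (rep y) / q (rep y))"
    unfolding fraction_def by blast
  moreover have "generically X (\<lambda>y. p (rep y) \<noteq> 0 \<and> q (rep y) \<noteq> 0 \<and> \<phi> y = p (rep y) / q (rep y)) \<Longrightarrow>
      fraction (\<lambda>z. 1 / \<phi> z) d q p"
    unfolding fraction_def
  proof (intro conjI fractionD(1,2)[OF p(1)])
    assume g: "generically X (\<lambda>y. p (rep y) \<noteq> 0 \<and> q (rep y) \<noteq> 0 \<and> \<phi> y = p (rep y) / q (rep y))"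
    show "generically X (\<lambda>y. p (rep y) \<noteq> 0 \<and> 1 / \<phi> y = q (rep y) / p (rep y))"
      by (rule generically_mono[OF g _ Xp]) simp
  qed
  ultimately have "fraction (\<lambda>z. 1 / \<phi> z) d q p" by blast
  from has_value_fraction[OF this assms(3) px] show ?thesis using p by simp
qed

lemma unit_at_mult: "unit_at X \<phi> x \<Longrightarrow> unit_at X \<psi> x \<Longrightarrow> x \<in> X \<Longrightarrow> unit_at X (\<lambda>z. \<phi> z * \<psi> z) x"
  unfolding unit_at_def using has_value_mult by (metis mult_eq_0_iff)

lemma unit_at_power: "unit_at X \<phi> x \<Longrightarrow> x \<in> X \<Longrightarrow> unit_at X (\<lambda>z. \<phi> z ^ n) x"
  unfolding unit_at_def using has_value_power by (metis power_not_zero)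

lemma unit_at_inverse: "unit_at X \<phi> x \<Longrightarrow> x \<in> X \<Longrightarrow> unit_at X (\<lambda>z. 1 / \<phi> z) x"
  unfolding unit_at_def using has_value_inverse by (metis divide_eq_0_iff one_neq_zero)

lemma unit_at_cong: "unit_at X \<phi> x \<Longrightarrow> generically X (\<lambda>z. \<psi> z = \<phi> z) \<Longrightarrow> x \<in> X \<Longrightarrow> unit_at X \<psi> x"
  unfolding unit_at_def using has_value_cong by blast

lemma cartierD:
  assumes "cartier X D" "x \<in> X"
  shows "rational X (D x)" "generically X (\<lambda>y. D x y \<noteq> 0)"
    "\<exists>d g. homogeneous d g \<and> g (rep x) \<noteq> 0 \<and> (\<forall>z\<in>X. g (rep z) \<noteq> 0 \<longrightarrow> unit_at X (\<lambda>w. D z w / D x w) z)"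
proof -
  show "rational X (D x)" "generically X (\<lambda>y. D x y \<noteq> 0)" using assms unfolding cartier_def by auto
  obtain U where U: "openin (Zariski X) U" "x \<in> U" "\<forall>y\<in>U. unit_at X (\<lambda>z. D y z / D x z) y"
    using assms unfolding cartier_def by blast
  thus "\<exists>d g. homogeneous d g \<and> g (rep x) \<noteq> 0 \<and> (\<forall>z\<in>X. g (rep z) \<noteq> 0 \<longrightarrow> unit_at X (\<lambda>w. D z w / D x w) z)"
    using open_contains_basic[OF Xp U(1,2)] by blast
qed

lemma rational_mult: "rational X \<phi> \<Longrightarrow> rational X \<psi> \<Longrightarrow> rational X (\<lambda>z. \<phi> z * \<psi> z)"
  unfolding rational_iff using fraction_mult by blast

lemma rational_add: "rational X \<phi> \<Longrightarrow> rational X \<psi> \<Longrightarrow> rational X (\<lambda>z. \<phi> z + \<psi> z)"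
  unfolding rational_iff using fraction_add by blast

lemma rational_const: "rational X (\<lambda>z. c)"
  unfolding rational_iff using fraction_const by blast

lemma rational_power: "rational X \<phi> \<Longrightarrow> rational X (\<lambda>z. \<phi> z ^ n)"
  by (induction n) (auto intro: rational_const rational_mult)

lemma rational_cong: "rational X \<phi> \<Longrightarrow> generically X (\<lambda>z. \<psi> z = \<phi> z) \<Longrightarrow> rational X \<psi>"
  unfolding rational_iff using fraction_cong by blast

lemma cartier_power:
  assumes D: "cartier X D" shows "cartier X (div_mult k D)"
  unfolding cartier_def
proof (intro conjI ballI)
  fix x assume x: "x \<in> X"
  show "rational X (div_mult k D x)" unfolding div_mult_def by (rule rational_power[OF cartierD(1)[OF D x]])
  show "generically X (\<lambda>y. div_mult k D x y \<noteq> 0)" unfolding div_mult_def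
    by (rule generically_mono[OF cartierD(2)[OF D x] _ Xp]) simp
  obtain U where U: "openin (Zariski X) U" "x \<in> U" "\<forall>y\<in>U. unit_at X (\<lambda>z. D y z / D x z) y"
    using D x unfolding cartier_def by blast
  have "unit_at X (\<lambda>z. div_mult k D y z / div_mult k D x z) y" if "y \<in> U" for y
  proof -
    have "y \<in> X" using that openin_subset[OF U(1)] topspace_Zariski[OF Xp] by auto
    from unit_at_power[OF _ this, of "\<lambda>z. D y z / D x z" k] U(3) that
    show ?thesis by (simp add: div_mult_def power_divide)
  qed
  thus "\<exists>U. openin (Zariski X) U \<and> x \<in> U \<and> (\<forall>y\<in>U. unit_at X (\<lambda>z. div_mult k D y z / div_mult k D x z) y)"
    using U by blast
qed

lemma section_value: "section_of X D \<phi> s \<Longrightarrow> x \<in> X \<Longrightarrow> has_value X (\<lambda>z. \<phi> z * D x z) x (s x)"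
  unfolding section_of_def by blast

text \<open>
  Near a point \<open>x\<close> a section is given by a single fraction, up to the units by which the local equations differ.
\<close>

lemma section_locally:
  assumes D: "cartier X D" and s: "section_of X D \<phi> s" and x: "x \<in> X"
  shows "\<exists>d a b e g. fraction (\<lambda>z. \<phi> z * D x z) d a b \<and> homogeneous e g \<and> g (rep x) \<noteq> 0 \<and>
    (\<forall>z\<in>X. g (rep z) \<noteq> 0 \<longrightarrow> b (rep z) \<noteq> 0 \<and> unit_at X (\<lambda>w. D z w / D x w) z \<and>
      (\<exists>u. u \<noteq> 0 \<and> s z = u * (a (rep z) / b (rep z))))"
proof -
  obtain d a b where a: "fraction (\<lambda>z. \<phi> z * D x z) d a b" "b (rep x) \<noteq> 0"
    by (rule has_value_cases[OF section_value[OF s x] x])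
  obtain e g where g: "homogeneous e g" "g (rep x) \<noteq> 0" "\<forall>z\<in>X. g (rep z) \<noteq> 0 \<longrightarrow> unit_at X (\<lambda>w. D z w / D x w) z"
    using cartierD(3)[OF D x] by blast
  have "\<exists>u. u \<noteq> 0 \<and> s z = u * (a (rep z) / b (rep z))" if z: "z \<in> X" "g (rep z) \<noteq> 0" "b (rep z) \<noteq> 0" for z
  proof -
    obtain u where u: "has_value X (\<lambda>w. D z w / D x w) z u" "u \<noteq> 0" using g(3) z unfolding unit_at_def by blast
    have "has_value X (\<lambda>w. D z w / D x w * (\<phi> w * D x w)) z (u * (a (rep z) / b (rep z)))"
      by (rule has_value_mult[OF u(1) has_value_fraction[OF a(1) z(1,3)] z(1)])
    moreover have "generically X (\<lambda>w. \<phi> w * D z w = D z w / D x w * (\<phi> w * D x w))"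
      by (rule generically_mono[OF cartierD(2)[OF D x] _ Xp]) simp
    ultimately have "has_value X (\<lambda>w. \<phi> w * D z w) z (u * (a (rep z) / b (rep z)))"
      by (rule has_value_cong[OF _ _ z(1)])
    from has_value_unique[OF section_value[OF s z(1)] this z(1)] show ?thesis using u(2) by blast
  qed
  moreover have "homogeneous (e + d) (\<lambda>v. g v * b v)" using g(1) a(1) unfolding fraction_def by (intro homogeneous.mult) auto
  ultimately show ?thesis using a g
    by (intro exI[of _ d] exI[of _ a] exI[of _ b] exI[of _ "e + d"] exI[of _ "\<lambda>v. g v * b v"]) auto
qed

lemma section_nonvanishing_open:
  assumes D: "cartier X D" and s: "section_of X D \<phi> s" and x: "x \<in> X" "s x \<noteq> 0"
  shows "\<exists>d g. homogeneous d g \<and> g (rep x) \<noteq> 0 \<and> (\<forall>z\<in>X. g (rep z) \<noteq> 0 \<longrightarrow> s z \<noteq> 0)"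
proof -
  obtain d a b e g where l: "fraction (\<lambda>z. \<phi> z * D x z) d a b" "homogeneous e g" "g (rep x) \<noteq> 0"
    "\<forall>z\<in>X. g (rep z) \<noteq> 0 \<longrightarrow> b (rep z) \<noteq> 0 \<and> unit_at X (\<lambda>w. D z w / D x w) z \<and>
      (\<exists>u. u \<noteq> 0 \<and> s z = u * (a (rep z) / b (rep z)))"
    using section_locally[OF D s x(1)] by (elim exE conjE) (rule that)
  have "homogeneous (e + d) (\<lambda>v. g v * a v)" using l(1,2) unfolding fraction_def by (intro homogeneous.mult) auto
  moreover have "g (rep x) * a (rep x) \<noteq> 0" using l(3,4) x by fastforce
  moreover have "s z \<noteq> 0" if "z \<in> X" "g (rep z) * a (rep z) \<noteq> 0" for z using l(4) that by fastforce
  ultimately show ?thesis by blast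
qed

lemma section_unique:
  assumes "section_of X D \<phi> s" "section_of X D \<psi> t" "generically X (\<lambda>z. \<phi> z = \<psi> z)"
  shows "s = t"
proof
  fix x
  show "s x = t x"
  proof (cases "x \<in> X")
    case True
    have "generically X (\<lambda>z. \<phi> z * D x z = \<psi> z * D x z)" by (rule generically_mono[OF assms(3) _ Xp]) simp
    from has_value_cong[OF section_value[OF assms(2) True] this True]
    show ?thesis using has_value_unique[OF section_value[OF assms(1) True]] True by blast
  next
    case False thus ?thesis using assms unfolding section_of_def by simp
  qed
qed

lemma section_linear:
  assumes "section_of X D \<phi> s" "section_of X D \<psi> t"
  shows "section_of X D (\<lambda>z. c * \<phi> z + \<psi> z) (\<lambda>z. c * s z + t z)"
  unfolding section_of_def
proof (intro conjI ballI allI impI)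
  show "rational X (\<lambda>z. c * \<phi> z + \<psi> z)"
    using assms unfolding section_of_def by (intro rational_add rational_mult rational_const) auto
  fix x assume x: "x \<in> X"
  have "has_value X (\<lambda>z. c * (\<phi> z * D x z) + \<psi> z * D x z) x (c * s x + t x)"
    using assms x by (intro has_value_add has_value_mult has_value_const section_value)
  thus "has_value X (\<lambda>z. (c * \<phi> z + \<psi> z) * D x z) x (c * s x + t x)" by (simp add: algebra_simps)
next
  fix x assume "x \<notin> X" thus "c * s x + t x = 0" using assms unfolding section_of_def by simp
qed

lemma section_zero: "cartier X D \<Longrightarrow> section_of X D (\<lambda>z. 0) (\<lambda>z. 0)"
  unfolding section_of_def using has_value_const[of _ 0] rational_const[of 0] by simp

lemma section_mult:
  assumes "section_of X D \<phi> s" "section_of X D' \<psi> t"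
  shows "section_of X (div_add D D') (\<lambda>z. \<phi> z * \<psi> z) (\<lambda>z. s z * t z)"
  unfolding section_of_def
proof (intro conjI ballI allI impI)
  show "rational X (\<lambda>z. \<phi> z * \<psi> z)" using assms unfolding section_of_def by (intro rational_mult) auto
  fix x assume x: "x \<in> X"
  have "has_value X (\<lambda>z. \<phi> z * D x z * (\<psi> z * D' x z)) x (s x * t x)"
    using assms x by (intro has_value_mult section_value)
  thus "has_value X (\<lambda>z. \<phi> z * \<psi> z * div_add D D' x z) x (s x * t x)" by (simp add: div_add_def mult_ac)
next
  fix x assume "x \<notin> X" thus "s x * t x = 0" using assms unfolding section_of_def by simp
qed

lemma div_add_mult: "div_add (div_mult k D) (div_mult l D) = div_mult (k + l) D"
  by (auto simp: div_add_def div_mult_def power_add fun_eq_iff)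

lemma section_zero_generic:
  assumes D: "cartier X D" and s: "section_of X D \<phi> s" and 0: "\<And>x. x \<in> X \<Longrightarrow> s x = 0"
  shows "generically X (\<lambda>z. \<phi> z = 0)"
proof -
  obtain x where x: "x \<in> X" using irreducible_nonempty[OF irr] by blast
  obtain d a b e g where l: "fraction (\<lambda>z. \<phi> z * D x z) d a b" "homogeneous e g" "g (rep x) \<noteq> 0"
    "\<forall>z\<in>X. g (rep z) \<noteq> 0 \<longrightarrow> b (rep z) \<noteq> 0 \<and> unit_at X (\<lambda>w. D z w / D x w) z \<and>
      (\<exists>u. u \<noteq> 0 \<and> s z = u * (a (rep z) / b (rep z)))"
    using section_locally[OF D s x] by (elim exE conjE) (rule that)
  have "generically X (\<lambda>z. a (rep z) = 0)"
    by (rule generically_mono[OF generically_basic[OF l(2) x l(3)] _ Xp]) (use l(4) 0 in fastforce)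
  moreover have "homogeneous d a" using l(1) unfolding fraction_def by blast
  ultimately have a0: "a (rep z) = 0" if "z \<in> X" for z using generically_vanishing that by blast
  have f: "generically X (\<lambda>z. b (rep z) \<noteq> 0 \<and> \<phi> z * D x z = a (rep z) / b (rep z))" using l(1) unfolding fraction_def by blast
  show ?thesis by (rule generically_mono[OF generically_conj[OF f cartierD(2)[OF D x]] _ Xp]) (use a0 in auto)
qed

lemma section_determines_function:
  assumes D: "cartier X D" and s: "section_of X D \<phi> s" "section_of X D \<psi> s"
  shows "generically X (\<lambda>z. \<phi> z = \<psi> z)"
proof -
  have "generically X (\<lambda>z. - 1 * \<phi> z + \<psi> z = 0)"
    by (rule section_zero_generic[OF D section_linear[OF s]]) simp
  thus ?thesis by (rule generically_mono[OF _ _ Xp]) simp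
qed

end

section \<open>Denominators from the ample series\<close>

lemma closed_preimage_regular_map:
  assumes X: "X \<subseteq> points" and Y: "Y \<subseteq> points" and r: "regular_map Y r" "r ` Y \<subseteq> X"
    and Z: "closedin (Zariski X) Z"
  shows "closedin (Zariski Y) {y \<in> Y. r y \<in> Z}"
proof -
  obtain F where F: "homogeneous_set F" "Z = vanishing X F" using Z unfolding closedin_vanishing[OF X] by blast
  have "openin (Zariski Y) {y \<in> Y. r y \<notin> Z}"
  proof (subst openin_subopen, intro ballI)
    fix y assume "y \<in> {y \<in> Y. r y \<notin> Z}"
    hence y: "y \<in> Y" "r y \<notin> Z" by auto
    obtain f where f: "f \<in> F" "f (rep (r y)) \<noteq> 0" using y r(2) F(2) unfolding vanishing_def by blast
    obtain e where e: "homogeneous e f" using F(1) f(1) unfolding homogeneous_set_def by blast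
    obtain U d P where U: "openin (Zariski Y) U" "y \<in> U" "\<forall>i. homogeneous d (P i)"
      "\<forall>z\<in>U. \<forall>v\<in>z - {0}. (\<lambda>i. P i v) \<noteq> 0 \<and> r z = line (\<lambda>i. P i v)"
      using r(1) y(1) unfolding regular_map_def by meson
    have UY: "U \<subseteq> Y" using openin_subset[OF U(1)] topspace_Zariski[OF Y] by simp
    have iff: "f (rep (r z)) = 0 \<longleftrightarrow> f (\<lambda>i. P i (rep z)) = 0" if "z \<in> U" for z
    proof -
      have zp: "z \<in> points" using that UY Y by blast
      have "rep z \<in> z - {0}" using rep_point[OF zp] by blast
      hence n: "(\<lambda>i. P i (rep z)) \<noteq> 0" "r z = line (\<lambda>i. P i (rep z))" using U(4) that by blast+
      obtain c where "c \<noteq> 0" "(\<lambda>i. P i (rep z)) = (\<lambda>i. c * rep (r z) i)" using line_point(2)[OF n(1)] n(2) by auto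
      thus ?thesis using homogeneous_line[OF e, of c "rep (r z)"] by simp
    qed
    let ?V = "U \<inter> {z \<in> Y. f (\<lambda>i. P i (rep z)) \<noteq> 0}"
    have hc: "homogeneous (e * d) (\<lambda>v. f (\<lambda>i. P i v))" by (rule homogeneous_compose[OF e]) (use U(3) in blast)
    have "openin (Zariski Y) ?V" by (rule openin_Int[OF U(1) open_basic[OF Y hc]])
    moreover have "y \<in> ?V" using U(2) y(1) iff f(2) by blast
    moreover have "?V \<subseteq> {y \<in> Y. r y \<notin> Z}"
    proof
      fix z assume z: "z \<in> ?V"
      hence "f (rep (r z)) \<noteq> 0" using iff by blast
      thus "z \<in> {y \<in> Y. r y \<notin> Z}" using z f(1) unfolding F(2) vanishing_def by blast
    qed
    ultimately show "\<exists>T. openin (Zariski Y) T \<and> y \<in> T \<and> T \<subseteq> {y \<in> Y. r y \<notin> Z}" by blast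
  qed
  hence "closedin (Zariski Y) (topspace (Zariski Y) - {y \<in> Y. r y \<notin> Z})" by blast
  moreover have "topspace (Zariski Y) - {y \<in> Y. r y \<notin> Z} = {y \<in> Y. r y \<in> Z}" using topspace_Zariski[OF Y] by blast
  ultimately show ?thesis by simp
qed

context irreducible_points
begin

lemma regular_at_mult: "regular_at X \<phi> x \<Longrightarrow> regular_at X \<psi> x \<Longrightarrow> x \<in> X \<Longrightarrow> regular_at X (\<lambda>z. \<phi> z * \<psi> z) x"
  unfolding regular_at_def using has_value_mult by blast

lemma regular_at_power: "regular_at X \<phi> x \<Longrightarrow> x \<in> X \<Longrightarrow> regular_at X (\<lambda>z. \<phi> z ^ n) x"
  unfolding regular_at_def using has_value_power by blast

lemma regular_at_cong: "regular_at X \<phi> x \<Longrightarrow> generically X (\<lambda>z. \<psi> z = \<phi> z) \<Longrightarrow> x \<in> X \<Longrightarrow> regular_at X \<psi> x"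
  unfolding regular_at_def using has_value_cong by blast

lemma unit_regular: "unit_at X \<phi> x \<Longrightarrow> regular_at X \<phi> x"
  unfolding regular_at_def unit_at_def by blast

lemma section_exists:
  assumes "rational X \<phi>" "\<And>x. x \<in> X \<Longrightarrow> regular_at X (\<lambda>z. \<phi> z * D x z) x"
  shows "\<exists>s. section_of X D \<phi> s"
proof -
  have "\<forall>x. \<exists>c. (x \<in> X \<longrightarrow> has_value X (\<lambda>z. \<phi> z * D x z) x c) \<and> (x \<notin> X \<longrightarrow> c = 0)"
    using assms(2) unfolding regular_at_def by metis
  then obtain s where "\<And>x. (x \<in> X \<longrightarrow> has_value X (\<lambda>z. \<phi> z * D x z) x (s x)) \<and> (x \<notin> X \<longrightarrow> s x = 0)" by metis
  thus ?thesis using assms(1) unfolding section_of_def by blast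
qed

lemma section_cong:
  assumes "section_of X D \<phi> s" "generically X (\<lambda>z. \<psi> z = \<phi> z)" shows "section_of X D \<psi> s"
  unfolding section_of_def
proof (intro conjI ballI allI impI)
  show "rational X \<psi>" using assms rational_cong unfolding section_of_def by blast
  fix x assume x: "x \<in> X"
  have "generically X (\<lambda>z. \<psi> z * D x z = \<phi> z * D x z)" by (rule generically_mono[OF assms(2) _ Xp]) simp
  from has_value_cong[OF section_value[OF assms(1) x] this x]
  show "has_value X (\<lambda>z. \<psi> z * D x z) x (s x)" .
next
  fix x assume "x \<notin> X" thus "s x = 0" using assms(1) unfolding section_of_def by blast
qed

lemma section_unit_at: "section_of X D \<phi> s \<Longrightarrow> x \<in> X \<Longrightarrow> s x \<noteq> 0 \<longleftrightarrow> unit_at X (\<lambda>z. \<phi> z * D x z) x"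
  unfolding unit_at_def using section_value has_value_unique by metis

lemma section_regular_at: "section_of X D \<phi> s \<Longrightarrow> x \<in> X \<Longrightarrow> regular_at X (\<lambda>z. \<phi> z * D x z) x"
  unfolding regular_at_def using section_value by blast

text \<open>Sums and products of sections of multiples of \<open>V\<close> are formed pointwise.\<close>

lemma section_form:
  assumes V: "cartier X V" and s: "\<forall>i\<le>M. s i \<in> H0 X V" and G: "homogeneous q G"
  shows "\<exists>\<Gamma>. section_of X (div_mult q V) \<Gamma>
    (\<lambda>z. if z \<in> X then G (\<lambda>i. if i \<le> M then s i z else 0) else 0)"
  using G
proof induction
  case (const c)
  show ?case
  proof (intro exI)
    show "section_of X (div_mult 0 V) (\<lambda>z. c) (\<lambda>z. if z \<in> X then c else 0)"
      unfolding section_of_def div_mult_def by (simp add: has_value_const rational_const)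
  qed
next
  case (coord i)
  show ?case
  proof (cases "i \<le> M")
    case True
    then obtain \<phi> where \<phi>: "section_of X V \<phi> (s i)" using s unfolding H0_def by blast
    hence "(\<lambda>z. if z \<in> X then (if i \<le> M then s i z else 0) else 0) = s i"
      using True unfolding section_of_def by auto
    thus ?thesis using \<phi> by (intro exI[of _ \<phi>]) (simp add: div_mult_def)
  next
    case False
    thus ?thesis using section_zero[OF cartier_power[OF V, of 1]]
      by (intro exI[of _ "\<lambda>z. 0"]) (simp cong: if_cong)
  qed
next
  case (add d p q)
  then obtain \<phi> \<psi> where "section_of X (div_mult d V) \<phi> (\<lambda>z. if z \<in> X then p (\<lambda>i. if i \<le> M then s i z else 0) else 0)"
    "section_of X (div_mult d V) \<psi> (\<lambda>z. if z \<in> X then q (\<lambda>i. if i \<le> M then s i z else 0) else 0)" by blast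
  from section_linear[OF this, of 1] show ?case
    by (intro exI[of _ "\<lambda>z. 1 * \<phi> z + \<psi> z"]) (elim back_subst[of "section_of X (div_mult d V) _"], auto)
next
  case (mult d p e q)
  then obtain \<phi> \<psi> where "section_of X (div_mult d V) \<phi> (\<lambda>z. if z \<in> X then p (\<lambda>i. if i \<le> M then s i z else 0) else 0)"
    "section_of X (div_mult e V) \<psi> (\<lambda>z. if z \<in> X then q (\<lambda>i. if i \<le> M then s i z else 0) else 0)" by blast
  from section_mult[OF this] show ?case unfolding div_add_mult
    by (intro exI[of _ "\<lambda>z. \<phi> z * \<psi> z"]) (elim back_subst[of "section_of X (div_mult (d + e) V) _"], auto)
qed

text \<open>
  The inverse of a closed embedding is regular, so the image of a closed set is closed. One of its equations
  does not vanish at the image of a given point outside; it is pulled back.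
\<close>

lemma separating_form:
  assumes s: "\<And>x. x \<in> X \<Longrightarrow> \<exists>i\<le>M. s i x \<noteq> (0::complex)"
    and emb: "closed_embedding X M (\<lambda>x. line (\<lambda>i. if i \<le> M then s i x else 0))"
    and Z: "closedin (Zariski X) Z" and y: "y \<in> X" "y \<notin> Z"
  shows "\<exists>q>0. \<exists>G. homogeneous q G \<and> G (\<lambda>i. if i \<le> M then s i y else 0) \<noteq> 0 \<and>
    (\<forall>z\<in>Z. G (\<lambda>i. if i \<le> M then s i z else 0) = 0)"
proof -
  define sv where "sv z = (\<lambda>i. if i \<le> M then s i z else 0)" for z
  define \<psi> where "\<psi> x = line (sv x)" for x
  have emb': "inj_on \<psi> X" "regular_map (\<psi> ` X) (inv_into X \<psi>)"
    using emb unfolding closed_embedding_def \<psi>_def[abs_def] sv_def by auto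
  have sv0: "sv x \<noteq> 0" if "x \<in> X" for x
    using s[OF that] unfolding sv_def by (auto simp: fun_eq_iff)
  have \<psi>p: "\<psi> ` X \<subseteq> points" using sv0 unfolding \<psi>_def by blast
  have ZX: "Z \<subseteq> X" by (rule closedin_subset_topspace[OF Xp Z])
  have "closedin (Zariski (\<psi> ` X)) {w \<in> \<psi> ` X. inv_into X \<psi> w \<in> Z}"
    by (rule closed_preimage_regular_map[OF Xp \<psi>p emb'(2) _ Z]) (auto intro: inv_into_into)
  moreover have "{w \<in> \<psi> ` X. inv_into X \<psi> w \<in> Z} = \<psi> ` Z" using ZX emb'(1) by (auto simp: inv_into_f_f)
  ultimately obtain H where H: "homogeneous_set H" "\<psi> ` Z = vanishing (\<psi> ` X) H"
    unfolding closedin_vanishing[OF \<psi>p] by auto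
  have "\<psi> y \<notin> \<psi> ` Z" using emb'(1) y ZX by (auto dest: inj_onD)
  then obtain g where g: "g \<in> H" "g (rep (\<psi> y)) \<noteq> 0" using H(2) y(1) unfolding vanishing_def by blast
  obtain d where d: "homogeneous d g" using H(1) g(1) unfolding homogeneous_set_def by blast
  have iff: "g (sv z) = 0 \<longleftrightarrow> g (rep (\<psi> z)) = 0" if z: "z \<in> X" for z
  proof -
    obtain c where "c \<noteq> 0" "sv z = (\<lambda>i. c * rep (\<psi> z) i)" using line_point(2)[OF sv0[OF z]] unfolding \<psi>_def by blast
    thus ?thesis using homogeneous_line[OF d, of c "rep (\<psi> z)"] by simp
  qed
  \<comment> \<open>The equation is multiplied by a coordinate, to have positive degree.\<close>
  obtain i where i: "sv y i \<noteq> 0" using sv0[OF y(1)] by (auto simp: fun_eq_iff)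
  have "homogeneous (d + 1) (\<lambda>v. g v * v i)" by (rule homogeneous.mult[OF d homogeneous.coord])
  moreover have "g (sv y) * sv y i \<noteq> 0" using iff[OF y(1)] g(2) i by simp
  moreover have "g (sv z) * sv z i = 0" if "z \<in> Z" for z
  proof -
    have "\<psi> z \<in> vanishing (\<psi> ` X) H" using that H(2) by blast
    hence "g (rep (\<psi> z)) = 0" using g(1) unfolding vanishing_def by blast
    thus ?thesis using iff that ZX by auto
  qed
  ultimately show ?thesis unfolding sv_def by (intro exI[of _ "d + 1"] conjI exI[of _ "\<lambda>v. g v * v i"]) auto
qed

end

locale irreducible_projective = irreducible_points +
  fixes N :: nat
  assumes XN: "X \<subseteq> projective_space N" and closed: "closedin (Zariski (projective_space N)) X"
begin

text \<open>
  If a section \<open>s\<close> vanishes wherever the section \<open>1\<close> of the effective divisor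
  \<open>E\<close> does, then locally a power of \<open>s\<close> is divisible by the equation of
  \<open>E\<close>. By the Nullstellensatz, this holds for the numerators \<open>a\<close> of \<open>s\<close>
  and \<open>p\<close> of \<open>E\<close>, after multiplication of \<open>a\<close> by a form \<open>g\<close>
  that does not vanish at \<open>x\<close>.
\<close>

lemma power_divisible_locally:
  assumes E: "cartier X E" "section_of X E (\<lambda>z. 1) e" and V: "cartier X V" "section_of X V \<Gamma> s"
    and van: "\<forall>z\<in>X. e z = 0 \<longrightarrow> s z = 0" and y: "y \<in> X" "s y \<noteq> 0" and x: "x \<in> X"
  shows "\<exists>W d h. homogeneous d h \<and> h (rep x) \<noteq> 0 \<and>
    (\<forall>w\<ge>W. \<forall>z\<in>X. h (rep z) \<noteq> 0 \<longrightarrow> regular_at X (\<lambda>v. (\<Gamma> v * V z v) ^ w / E z v ^ l) z)"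
proof -
  obtain d p q e1 g1 where l1: "fraction (\<lambda>z. 1 * E x z) d p q" "homogeneous e1 g1" "g1 (rep x) \<noteq> 0"
    "\<forall>z\<in>X. g1 (rep z) \<noteq> 0 \<longrightarrow> q (rep z) \<noteq> 0 \<and> unit_at X (\<lambda>w. E z w / E x w) z \<and>
      (\<exists>u. u \<noteq> 0 \<and> e z = u * (p (rep z) / q (rep z)))"
    using section_locally[OF E x] by (elim exE conjE) (rule that)
  obtain d2 a b e2 g2 where l2: "fraction (\<lambda>z. \<Gamma> z * V x z) d2 a b" "homogeneous e2 g2" "g2 (rep x) \<noteq> 0"
    "\<forall>z\<in>X. g2 (rep z) \<noteq> 0 \<longrightarrow> b (rep z) \<noteq> 0 \<and> unit_at X (\<lambda>w. V z w / V x w) z \<and>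
      (\<exists>u. u \<noteq> 0 \<and> s z = u * (a (rep z) / b (rep z)))"
    using section_locally[OF V x] by (elim exE conjE) (rule that)
  note f1 = fractionD[OF l1(1)] and f2 = fractionD[OF l2(1)]
  have "rep x \<noteq> 0" using rep_point(2) x Xp by blast
  then obtain j where j: "rep x j \<noteq> 0" by (auto simp: fun_eq_iff)
  \<comment> \<open>Where \<open>g\<close> does not vanish, both local descriptions hold; the factor \<open>v\<^sub>j\<close> makes the degree positive.\<close>
  define g where "g v = g1 v * (g2 v * v j)" for v
  define dg where "dg = e1 + (e2 + 1)"
  have hg: "homogeneous dg g" unfolding g_def dg_def by (intro homogeneous.mult l1(2) l2(2) homogeneous.coord)
  have gx: "g (rep x) \<noteq> 0" using l1(3) l2(3) j by (simp add: g_def)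
  have hag: "homogeneous (d2 + dg) (\<lambda>v. a v * g v)" by (rule homogeneous.mult[OF f2(1) hg])
  obtain F where F: "homogeneous_set F" "X = vanishing (projective_space N) F"
    using closed unfolding closedin_vanishing[OF projective_space_points] by blast
  have cone: "trunc (Suc N) (rep z) = rep z" "\<forall>f\<in>F. f (rep z) = 0" if "z \<in> X" for z
    using that rep_projective_space XN F(2) unfolding vanishing_def by auto
  have agp: "a (rep z) * g (rep z) = 0" if z: "z \<in> X" "p (rep z) = 0" for z
  proof (rule ccontr)
    assume "a (rep z) * g (rep z) \<noteq> 0"
    hence n: "a (rep z) \<noteq> 0" "g1 (rep z) \<noteq> 0" "g2 (rep z) \<noteq> 0" by (auto simp: g_def)
    have "e z = 0" using l1(4) z n(2) by fastforce
    hence "s z = 0" using van z by blast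
    thus False using l2(4) z(1) n by fastforce
  qed
  have van': "a v * g v = 0" if v: "trunc (Suc N) v = v" "\<forall>f\<in>F. f v = 0" "p v = 0" for v
  proof (cases "v = 0")
    case True
    have "dg > 0" by (simp add: dg_def)
    thus ?thesis using homogeneous_at_0[OF hg] True by (simp add: zero_fun_def)
  next
    case False
    obtain c where c: "c \<noteq> 0" "v = (\<lambda>i. c * rep (line v) i)" using line_point(2)[OF False] by blast
    have z: "f v = 0 \<longleftrightarrow> f (rep (line v)) = 0" if "homogeneous d f" for d f
      using homogeneous_line[OF that, of c "rep (line v)"] c by simp
    have "line v \<in> X" unfolding F(2) vanishing_def using line_in_projective_space[OF False v(1)] v(2) z F(1)
      unfolding homogeneous_set_def by blast
    moreover have "p (rep (line v)) = 0" using z[OF f1(1)] v(3) by simp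
    ultimately show ?thesis using agp z[OF hag] by simp
  qed
  obtain dy hy where hy: "homogeneous dy hy" "hy (rep y) \<noteq> 0" "\<forall>z\<in>X. hy (rep z) \<noteq> 0 \<longrightarrow> s z \<noteq> 0"
    using section_nonvanishing_open[OF V y] by blast
  obtain z0 where z0: "z0 \<in> X" "hy (rep z0) \<noteq> 0" "g (rep z0) \<noteq> 0"
    using irreducible_witness[OF Xp irr hy(1) hg y(1) hy(2) x gx] by blast
  have "g2 (rep z0) \<noteq> 0" using z0(3) by (simp add: g_def)
  hence "a (rep z0) \<noteq> 0" using l2(4) hy(3) z0(1,2) by fastforce
  hence ex: "a (rep z0) * g (rep z0) \<noteq> 0" using z0 by simp
  obtain W k r where r: "W > 0" "homogeneous k r" "k + d = W * (d2 + dg)"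
    "\<forall>v. trunc (Suc N) v = v \<and> (\<forall>f\<in>F. f v = 0) \<longrightarrow> (a v * g v) ^ W = p v * r v"
    using homogeneous_Nullstellensatz[OF F(1)[unfolded homogeneous_set_def] f1(1) hag van' cone[OF z0(1)] ex] by blast
  have rX: "(a (rep z) * g (rep z)) ^ W = p (rep z) * r (rep z)" if "z \<in> X" for z using r(4) cone[OF that] by blast
  have gen: "fraction (\<lambda>v. (\<Gamma> v * V x v) ^ w / E x v ^ l) (d2 * w + W * l * dg)
      (\<lambda>v. a v ^ (w - W * l) * r v ^ l * q v ^ l) (\<lambda>v. g v ^ (W * l) * b v ^ w)" if w: "w \<ge> W * l" for w
    unfolding fraction_def
  proof (intro conjI)
    have "homogeneous ((w - W * l) * d2 + l * k + l * d) (\<lambda>v. a v ^ (w - W * l) * r v ^ l * q v ^ l)"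
      by (intro homogeneous.mult homogeneous_power f1 f2 r(2))
    moreover have "(w - W * l) * d2 + l * k + l * d = d2 * w + W * l * dg"
    proof -
      have "(w - W * l) * d2 + l * k + l * d = (w - W * l) * d2 + l * (k + d)" by (simp add: distrib_left)
      also have "\<dots> = ((w - W * l) + W * l) * d2 + W * l * dg"
        unfolding r(3) by (simp add: distrib_left distrib_right mult_ac)
      also have "\<dots> = d2 * w + W * l * dg" using w by (simp add: mult.commute)
      finally show ?thesis .
    qed
    ultimately show "homogeneous (d2 * w + W * l * dg) (\<lambda>v. a v ^ (w - W * l) * r v ^ l * q v ^ l)" by metis
    have "homogeneous (W * l * dg + w * d2) (\<lambda>v. g v ^ (W * l) * b v ^ w)"
      by (intro homogeneous.mult homogeneous_power hg f2)
    thus "homogeneous (d2 * w + W * l * dg) (\<lambda>v. g v ^ (W * l) * b v ^ w)" by (simp add: ac_simps)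
    show "generically X (\<lambda>v. g (rep v) ^ (W * l) * b (rep v) ^ w \<noteq> 0 \<and> (\<Gamma> v * V x v) ^ w / E x v ^ l =
      a (rep v) ^ (w - W * l) * r (rep v) ^ l * q (rep v) ^ l / (g (rep v) ^ (W * l) * b (rep v) ^ w))"
    proof (rule generically_mono[OF generically_conj[OF generically_conj[OF f1(3) f2(3)]
          generically_conj[OF cartierD(2)[OF E(1) x] generically_basic[OF hg x gx]]] _ Xp])
      fix v assume v: "v \<in> X" and H: "((q (rep v) \<noteq> 0 \<and> 1 * E x v = p (rep v) / q (rep v)) \<and>
          (b (rep v) \<noteq> 0 \<and> \<Gamma> v * V x v = a (rep v) / b (rep v))) \<and> (E x v \<noteq> 0 \<and> g (rep v) \<noteq> 0)"
      have p0: "p (rep v) \<noteq> 0" using H by auto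
      have "a (rep v) ^ w * g (rep v) ^ (W * l) = a (rep v) ^ (w - W * l) * (a (rep v) * g (rep v)) ^ (W * l)"
        using w by (simp add: power_mult_distrib mult.assoc[symmetric] flip: power_add)
      also have "\<dots> = a (rep v) ^ (w - W * l) * (p (rep v) ^ l * r (rep v) ^ l)"
        using rX[OF v] by (simp add: power_mult power_mult_distrib)
      finally have key: "a (rep v) ^ w * g (rep v) ^ (W * l) = a (rep v) ^ (w - W * l) * (p (rep v) ^ l * r (rep v) ^ l)" .
      have "(\<Gamma> v * V x v) ^ w / E x v ^ l = (a (rep v) ^ w / b (rep v) ^ w) / (p (rep v) ^ l / q (rep v) ^ l)"
        using H by (simp add: power_divide)
      also have "\<dots> = a (rep v) ^ w * q (rep v) ^ l / (b (rep v) ^ w * p (rep v) ^ l)" by simp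
      also have "\<dots> = a (rep v) ^ (w - W * l) * r (rep v) ^ l * q (rep v) ^ l / (g (rep v) ^ (W * l) * b (rep v) ^ w)"
      proof (subst frac_eq_eq)
        show "a (rep v) ^ w * q (rep v) ^ l * (g (rep v) ^ (W * l) * b (rep v) ^ w) =
          a (rep v) ^ (w - W * l) * r (rep v) ^ l * q (rep v) ^ l * (b (rep v) ^ w * p (rep v) ^ l)"
          using arg_cong[OF key, of "\<lambda>t. t * (q (rep v) ^ l * b (rep v) ^ w)"] by (simp only: mult_ac)
      qed (use H p0 in auto)
      finally show "g (rep v) ^ (W * l) * b (rep v) ^ w \<noteq> 0 \<and> (\<Gamma> v * V x v) ^ w / E x v ^ l =
        a (rep v) ^ (w - W * l) * r (rep v) ^ l * q (rep v) ^ l / (g (rep v) ^ (W * l) * b (rep v) ^ w)" using H by simp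
    qed
  qed
  have reg: "regular_at X (\<lambda>v. (\<Gamma> v * V z v) ^ w / E z v ^ l) z" if w: "w \<ge> W * l" and z: "z \<in> X" "g (rep z) \<noteq> 0" for w z
  proof -
    have g12: "g1 (rep z) \<noteq> 0" "g2 (rep z) \<noteq> 0" using z(2) by (auto simp: g_def)
    have u1: "unit_at X (\<lambda>w. E z w / E x w) z" using l1(4) z(1) g12(1) by blast
    have u2: "unit_at X (\<lambda>w. V z w / V x w) z" "b (rep z) \<noteq> 0" using l2(4) z(1) g12(2) by blast+
    have "g (rep z) ^ (W * l) * b (rep z) ^ w \<noteq> 0" using z(2) u2(2) by simp
    from has_value_fraction[OF gen[OF w] z(1) this]
    have r0: "regular_at X (\<lambda>v. (\<Gamma> v * V x v) ^ w / E x v ^ l) z" unfolding regular_at_def by blast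
    have "regular_at X (\<lambda>v. (\<Gamma> v * V x v) ^ w / E x v ^ l * ((V z v / V x v) ^ w * (1 / (E z v / E x v)) ^ l)) z"
      using z(1) by (intro regular_at_mult r0 regular_at_power unit_regular u2 unit_at_inverse u1)
    moreover have "generically X (\<lambda>v. (\<Gamma> v * V z v) ^ w / E z v ^ l =
        (\<Gamma> v * V x v) ^ w / E x v ^ l * ((V z v / V x v) ^ w * (1 / (E z v / E x v)) ^ l))"
      by (rule generically_mono[OF generically_conj[OF cartierD(2)[OF V(1) x] cartierD(2)[OF E(1) x]] _ Xp])
        (simp add: power_mult_distrib power_divide)
    ultimately show ?thesis by (rule regular_at_cong[OF _ _ z(1)])
  qed
  show ?thesis using hg gx reg by (intro exI[of _ "W * l"] exI[of _ dg] exI[of _ g]) blast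
qed

text \<open>The variety is quasi-compact, so one exponent suffices.\<close>

lemma power_divisible:
  assumes E: "cartier X E" "section_of X E (\<lambda>z. 1) e" and V: "cartier X V" "section_of X V \<Gamma> s"
    and van: "\<forall>z\<in>X. e z = 0 \<longrightarrow> s z = 0" and y: "y \<in> X" "s y \<noteq> 0"
  shows "\<exists>W. \<forall>w\<ge>W. \<forall>z\<in>X. regular_at X (\<lambda>v. (\<Gamma> v * V z v) ^ w / E z v ^ l) z"
proof -
  define P where "P x W U \<longleftrightarrow> openin (Zariski X) U \<and> x \<in> U \<and>
    (\<forall>w\<ge>W. \<forall>z\<in>U. regular_at X (\<lambda>v. (\<Gamma> v * V z v) ^ w / E z v ^ l) z)" for x W U
  have "\<forall>x\<in>X. \<exists>W U. P x W U"
  proof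
    fix x assume x: "x \<in> X"
    obtain W d h where h: "homogeneous d h" "h (rep x) \<noteq> 0"
      "\<forall>w\<ge>W. \<forall>z\<in>X. h (rep z) \<noteq> 0 \<longrightarrow> regular_at X (\<lambda>v. (\<Gamma> v * V z v) ^ w / E z v ^ l) z"
      using power_divisible_locally[OF E V van y x, of l] by (elim exE conjE) (rule that)
    hence "P x W {z \<in> X. h (rep z) \<noteq> 0}" unfolding P_def using x open_basic[OF Xp h(1)] by simp
    thus "\<exists>W U. P x W U" by blast
  qed
  then obtain W U where WU: "\<forall>x\<in>X. P x (W x) (U x)" by metis
  have "x \<in> U x \<and> openin (Zariski X) (U x)" if "x \<in> X" for x using WU that unfolding P_def by blast
  from quasi_compact[OF XN, of U, OF this] obtain F where F: "finite F" "F \<subseteq> X" "X \<subseteq> (\<Union>x\<in>F. U x)" by blast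
  show ?thesis
  proof (intro exI[of _ "\<Sum>x\<in>F. W x"] allI impI ballI)
    fix w z assume w: "w \<ge> (\<Sum>x\<in>F. W x)" and z: "z \<in> X"
    obtain x where x: "x \<in> F" "z \<in> U x" using F(3) z by blast
    have "W x \<le> (\<Sum>x\<in>F. W x)" using F(1) x(1) by (intro member_le_sum) auto
    hence "w \<ge> W x" using w by simp
    moreover have "P x (W x) (U x)" using WU x(1) F(2) by blast
    ultimately show "regular_at X (\<lambda>v. (\<Gamma> v * V z v) ^ w / E z v ^ l) z" unfolding P_def using x(2) by blast
  qed
qed

lemma div_eq_unit: "div_eq X D D' \<Longrightarrow> x \<in> X \<Longrightarrow> unit_at X (\<lambda>z. D x z / D' x z) x"
  unfolding div_eq_def by blast

text \<open>
  Two divisors that are commensurable with \<open>A\<close> at \<open>x\<close> are commensurable with each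
  other.
\<close>

lemma common_multiple_unit:
  assumes C: "cartier X A" "cartier X B" "cartier X F" and x: "x \<in> X"
    and u1: "unit_at X (\<lambda>z. A x z ^ i / B x z ^ j) x" and u2: "unit_at X (\<lambda>z. A x z ^ k / F x z ^ l) x"
  shows "unit_at X (\<lambda>z. B x z ^ (j * k) / F x z ^ (l * i)) x"
proof -
  have "unit_at X (\<lambda>z. (A x z ^ k / F x z ^ l) ^ i * (1 / (A x z ^ i / B x z ^ j)) ^ k) x"
    using x by (intro unit_at_mult unit_at_power unit_at_inverse u1 u2)
  moreover have "generically X (\<lambda>z. B x z ^ (j * k) / F x z ^ (l * i) =
      (A x z ^ k / F x z ^ l) ^ i * (1 / (A x z ^ i / B x z ^ j)) ^ k)"
  proof (rule generically_mono[OF cartierD(2)[OF C(1) x] _ Xp])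
    fix z assume "A x z \<noteq> 0"
    hence "(A x z ^ k) ^ i / (A x z ^ i) ^ k = 1" by (simp add: mult.commute flip: power_mult)
    thus "B x z ^ (j * k) / F x z ^ (l * i) = (A x z ^ k / F x z ^ l) ^ i * (1 / (A x z ^ i / B x z ^ j)) ^ k"
      by (simp add: power_divide power_mult)
  qed
  ultimately show ?thesis by (rule unit_at_cong[OF _ _ x])
qed

text \<open>
  A power of the local equation of \<open>E\<close> is a unit at \<open>y\<close>, hence so is a power of the
  regular function \<open>E' y\<close>, and then \<open>E' y\<close> itself.
\<close>

lemma unit_outside_support:
  assumes E: "is_qdivisor X E" and E': "effective X E'" and eq: "qdiv_eq X E (E', m)" "m > 0"
    and y: "y \<in> X" "y \<notin> qdiv_support X E"
  shows "unit_at X (E' y) y"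
proof -
  have cE: "cartier X (fst E)" "snd E > 0" using E unfolding is_qdivisor_def by auto
  have cE': "cartier X E'" "\<exists>c. has_value X (E' y) y c" using E' y(1) unfolding effective_def regular_at_def by auto
  obtain n where n: "n > 0" "unit_at X (\<lambda>z. fst E y z ^ n) y"
    using y unfolding qdiv_support_def div_support_def div_mult_def by auto
  obtain M where M: "M > 0" "div_eq X (div_mult (M * m) (fst E)) (div_mult (M * snd E) E')"
    using eq(1) unfolding qdiv_eq_def by auto
  have u1: "unit_at X (\<lambda>z. fst E y z ^ (M * m) / E' y z ^ (M * snd E)) y"
    using div_eq_unit[OF M(2) y(1)] by (simp add: div_mult_def)
  have u2: "unit_at X (\<lambda>z. fst E y z ^ n / E' y z ^ 0) y" using n(2) by simp
  from common_multiple_unit[OF cE(1) cE'(1) cE'(1) y(1) u1 u2]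
  have u: "unit_at X (\<lambda>z. E' y z ^ (M * snd E * n)) y" by simp
  obtain c where c: "has_value X (E' y) y c" using cE'(2) by blast
  obtain b where b: "has_value X (\<lambda>z. E' y z ^ (M * snd E * n)) y b" "b \<noteq> 0" using u unfolding unit_at_def by blast
  have "b = c ^ (M * snd E * n)" using has_value_unique[OF b(1) has_value_power[OF c y(1)] y(1)] .
  hence "c \<noteq> 0" using b(2) M(1) n(1) cE(2) by (auto simp: power_0_left)
  thus ?thesis using c unfolding unit_at_def by blast
qed

text \<open>
  Some multiple of the ample divisor \<open>A'\<close> has a section that is divisible by \<open>l E'\<close> and does not vanish at a given point
  outside \<open>E'\<close>: a power of a form in sections of a very ample multiple that vanishes on \<open>E'\<close>.
\<close>

lemma ample_section_divisible:
  assumes A: "is_qdivisor X A" "qdiv_ample X A" "cartier X A'" "qdiv_eq X A (A', m)" "m > 0"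
    and E': "cartier X E'" "section_of X E' (\<lambda>z. 1) e" and y: "y \<in> X" "e y \<noteq> 0"
  shows "\<exists>j>0. \<exists>\<alpha> a. section_of X (div_mult j A') \<alpha> a \<and> a y \<noteq> 0 \<and>
    (\<forall>x\<in>X. regular_at X (\<lambda>z. \<alpha> z * A' x z ^ j / E' x z ^ l) x)"
proof -
  have cA: "cartier X (fst A)" "snd A > 0" using A(1) unfolding is_qdivisor_def by auto
  obtain F n where F: "n > 0" "ample X F" "qdiv_eq X A (F, n)" using A(2) unfolding qdiv_ample_def by blast
  obtain k where k: "k > 0" "very_ample X (div_mult k F)" and cF: "cartier X F" using F(2) unfolding ample_def by blast
  define V where "V = div_mult k F"
  have cV: "cartier X V" unfolding V_def by (rule cartier_power[OF cF])
  obtain M s where s: "\<forall>i\<le>M. s i \<in> H0 X V" "\<And>x. x \<in> X \<Longrightarrow> \<exists>i\<le>M. s i x \<noteq> 0"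
    "closed_embedding X M (\<lambda>x. line (\<lambda>i. if i \<le> M then s i x else 0))"
    using k(2) unfolding very_ample_def V_def by blast
  obtain N1 where N1: "N1 > 0" "div_eq X (div_mult (N1 * m) (fst A)) (div_mult (N1 * snd A) A')"
    using A(4) unfolding qdiv_eq_def by auto
  obtain N2 where N2: "N2 > 0" "div_eq X (div_mult (N2 * n) (fst A)) (div_mult (N2 * snd A) F)"
    using F(3) unfolding qdiv_eq_def by auto
  \<comment> \<open>\<open>p1 A'\<close> and \<open>p2 F\<close> have the same local equations, up to units.\<close>
  define p1 where "p1 = (N1 * snd A) * (N2 * n)"
  define p2 where "p2 = (N2 * snd A) * (N1 * m)"
  have p: "p1 > 0" "p2 > 0" using N1(1) N2(1) cA(2) F(1) A(5) unfolding p1_def p2_def by auto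
  have uAF: "unit_at X (\<lambda>z. A' x z ^ p1 / F x z ^ p2) x" if x: "x \<in> X" for x
    unfolding p1_def p2_def
    by (rule common_multiple_unit[OF cA(1) A(3) cF x])
      (use div_eq_unit[OF N1(2) x] div_eq_unit[OF N2(2) x] in \<open>simp_all add: div_mult_def\<close>)
  have uAV: "unit_at X (\<lambda>z. A' x z ^ (p1 * k) / V x z ^ p2) x" if x: "x \<in> X" for x
    using unit_at_power[OF uAF[OF x] x, of k]
    by (simp add: V_def div_mult_def power_divide mult.commute flip: power_mult)
  define Z where "Z = {z \<in> X. e z = 0}"
  have "openin (Zariski X) {z \<in> X. e z \<noteq> 0}"
  proof (subst openin_subopen, intro ballI)
    fix x assume "x \<in> {z \<in> X. e z \<noteq> 0}"
    then obtain d g where g: "homogeneous d g" "g (rep x) \<noteq> 0" "\<forall>z\<in>X. g (rep z) \<noteq> 0 \<longrightarrow> e z \<noteq> 0" "x \<in> X"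
      using section_nonvanishing_open[OF E'] by blast
    show "\<exists>T. openin (Zariski X) T \<and> x \<in> T \<and> T \<subseteq> {z \<in> X. e z \<noteq> 0}"
      by (rule exI[of _ "{z \<in> X. g (rep z) \<noteq> 0}"]) (use g open_basic[OF Xp g(1)] in auto)
  qed
  from closedin_diff[OF closedin_topspace this] have Z: "closedin (Zariski X) Z"
    unfolding topspace_Zariski[OF Xp] Z_def by (simp add: set_diff_eq cong: conj_cong)
  obtain q G where G: "q > 0" "homogeneous q G" "G (\<lambda>i. if i \<le> M then s i y else 0) \<noteq> 0"
    "\<And>z. z \<in> Z \<Longrightarrow> G (\<lambda>i. if i \<le> M then s i z else 0) = 0"
    using separating_form[OF s(2,3) Z y(1)] y(2) unfolding Z_def by auto
  define \<sigma> where "\<sigma> = (\<lambda>z. if z \<in> X then G (\<lambda>i. if i \<le> M then s i z else 0) else 0)"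
  obtain \<Gamma> where \<Gamma>: "section_of X (div_mult q V) \<Gamma> \<sigma>" using section_form[OF cV s(1) G(2)] unfolding \<sigma>_def by blast
  have sy: "\<sigma> y \<noteq> 0" using G(3) y(1) unfolding \<sigma>_def by simp
  have van: "\<forall>z\<in>X. e z = 0 \<longrightarrow> \<sigma> z = 0" using G(4) unfolding \<sigma>_def Z_def by simp
  obtain W where W: "\<forall>w\<ge>W. \<forall>z\<in>X. regular_at X (\<lambda>v. (\<Gamma> v * div_mult q V z v) ^ w / E' z v ^ l) z"
    using power_divisible[OF E' cartier_power[OF cV] \<Gamma> van y(1) sy, of l] by (elim exE) (rule that)
  \<comment> \<open>These exponents are chosen such that \<open>j A' = w q V\<close>, with \<open>w \<ge> W\<close>.\<close>
  define w where "w = p2 * Suc W"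
  have "Suc W \<le> w" using mult_le_mono1[of 1 p2 "Suc W"] p(2) unfolding w_def by simp
  hence wW: "w \<ge> W" by simp
  define j where "j = p1 * k * (q * Suc W)"
  have j0: "j > 0" using p(1) k(1) G(1) by (simp add: j_def)
  have uj: "unit_at X (\<lambda>z. A' x z ^ j / div_mult q V x z ^ w) x" if x: "x \<in> X" for x
    using unit_at_power[OF uAV[OF x] x, of "q * Suc W"]
    by (simp only: j_def w_def div_mult_def power_divide mult_ac flip: power_mult)
  define \<alpha> where "\<alpha> z = \<Gamma> z ^ w" for z
  have gen: "generically X (\<lambda>z. \<alpha> z * A' x z ^ j = (\<Gamma> z * div_mult q V x z) ^ w * (A' x z ^ j / div_mult q V x z ^ w))"
    if x: "x \<in> X" for x
    by (rule generically_mono[OF cartierD(2)[OF cartier_power[OF cV, of q] x] _ Xp]) (simp add: \<alpha>_def power_mult_distrib)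
  have "rational X \<alpha>" unfolding \<alpha>_def using \<Gamma> rational_power unfolding section_of_def by blast
  moreover have "regular_at X (\<lambda>z. \<alpha> z * div_mult j A' x z) x" if x: "x \<in> X" for x
  proof -
    have "regular_at X (\<lambda>z. (\<Gamma> z * div_mult q V x z) ^ w * (A' x z ^ j / div_mult q V x z ^ w)) x"
      using x by (intro regular_at_mult regular_at_power section_regular_at[OF \<Gamma>] unit_regular uj)
    from regular_at_cong[OF this gen[OF x] x] show ?thesis by (simp add: div_mult_def)
  qed
  ultimately obtain a where a: "section_of X (div_mult j A') \<alpha> a" using section_exists by blast
  have "unit_at X (\<lambda>z. (\<Gamma> z * div_mult q V y z) ^ w * (A' y z ^ j / div_mult q V y z ^ w)) y"
    by (rule unit_at_mult[OF unit_at_power[OF _ y(1)] uj[OF y(1)] y(1)])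
      (use sy section_unit_at[OF \<Gamma> y(1)] in blast)
  from unit_at_cong[OF this gen[OF y(1)] y(1)]
  have ay: "a y \<noteq> 0" using section_unit_at[OF a y(1)] by (simp add: div_mult_def)
  have "regular_at X (\<lambda>z. \<alpha> z * A' x z ^ j / E' x z ^ l) x" if x: "x \<in> X" for x
  proof -
    have "regular_at X (\<lambda>z. (\<Gamma> z * div_mult q V x z) ^ w / E' x z ^ l * (A' x z ^ j / div_mult q V x z ^ w)) x"
      by (rule regular_at_mult[OF _ unit_regular[OF uj[OF x]] x]) (use W wW x in blast)
    moreover have "generically X (\<lambda>z. \<alpha> z * A' x z ^ j / E' x z ^ l =
        (\<Gamma> z * div_mult q V x z) ^ w / E' x z ^ l * (A' x z ^ j / div_mult q V x z ^ w))"
      by (rule generically_mono[OF gen[OF x] _ Xp]) simp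
    ultimately show ?thesis by (rule regular_at_cong[OF _ _ x])
  qed
  thus ?thesis using j0 a ay by blast
qed

text \<open>
  Every section of a multiple of \<open>D\<close> has a denominator in the series \<open>S\<close> that does not
  vanish at a given point outside the support of \<open>E\<close>: if a section of \<open>j A'\<close> is
  divisible by \<open>l E'\<close>, then its product with a section of \<open>l m D = l (A' + E')\<close> is a
  section of \<open>(j + l) A'\<close>, and these sections are contained in \<open>S\<close>.
\<close>

theorem common_denominator:
  assumes D: "cartier X D" and S: "contains_ample_series X D S A E"
    and y: "y \<in> X" "y \<notin> qdiv_support X E"
  shows "\<exists>m>0. \<forall>l. \<forall>t\<in>H0 X (div_mult (l * m) D). \<exists>j>0. \<exists>c\<in>S (j * m). c y \<noteq> 0 \<and> c * t \<in> S ((j + l) * m)"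
proof -
  obtain m A' E' where m: "m > 0" and A': "cartier X A'" and E': "effective X E'"
    and eqA: "qdiv_eq X A (A', m)" and eqE: "qdiv_eq X E (E', m)"
    and eqD: "div_eq X (div_mult m D) (div_add A' E')"
    and ser0: "\<forall>j>0. \<exists>e. defining_section X (div_mult j E') e \<and>
           (\<forall>s\<in>H0 X (div_mult j A'). \<exists>t\<in>S (j * m).
              section_product X (div_mult j A') s (div_mult j E') e (div_mult (j * m) D) t) \<and>
           S (j * m) \<subseteq> H0 X (div_mult (j * m) D)"
    using S unfolding contains_ample_series_def by (elim exE conjE) (rule that)
  have ser: "\<exists>e. defining_section X (div_mult j E') e \<and>
           (\<forall>s\<in>H0 X (div_mult j A'). \<exists>t\<in>S (j * m).
              section_product X (div_mult j A') s (div_mult j E') e (div_mult (j * m) D) t)" if "j > 0" for j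
    using ser0[rule_format, OF that] by (elim exE conjE) (intro exI conjI)
  have qA: "is_qdivisor X A" "qdiv_ample X A" and qE: "is_qdivisor X E" using S unfolding contains_ample_series_def by auto
  have cE': "cartier X E'" using E' unfolding effective_def by blast
  obtain e1 where "defining_section X (div_mult 1 E') e1" using ser[of 1] by auto
  hence e1: "section_of X E' (\<lambda>z. 1) e1" unfolding defining_section_def by (simp add: div_mult_def)
  have uE: "unit_at X (E' y) y" by (rule unit_outside_support[OF qE E' eqE m y])
  hence e1y: "e1 y \<noteq> 0" using section_unit_at[OF e1 y(1)] by simp
  \<comment> \<open>Products with the canonical section of a multiple of \<open>E'\<close>, as rational functions.\<close>
  have prod: "\<exists>t\<in>S (j * m). section_of X (div_mult (j * m) D) \<phi> t"
    if j: "j > 0" and s: "section_of X (div_mult j A') \<phi> s" for j \<phi> s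
  proof -
    obtain e where e: "defining_section X (div_mult j E') e"
      "\<forall>s\<in>H0 X (div_mult j A'). \<exists>t\<in>S (j * m).
              section_product X (div_mult j A') s (div_mult j E') e (div_mult (j * m) D) t" using ser[OF j] by blast
    have "s \<in> H0 X (div_mult j A')" using s unfolding H0_def by blast
    then obtain t \<phi>' \<epsilon> where t: "t \<in> S (j * m)" "section_of X (div_mult j A') \<phi>' s"
      "section_of X (div_mult j E') \<epsilon> e" "section_of X (div_mult (j * m) D) (\<lambda>z. \<phi>' z * \<epsilon> z) t"
      using e(2) unfolding section_product_def by blast
    have "generically X (\<lambda>z. \<phi> z = \<phi>' z)" by (rule section_determines_function[OF cartier_power[OF A'] s t(2)])
    moreover have "generically X (\<lambda>z. 1 = \<epsilon> z)"
      by (rule section_determines_function[OF cartier_power[OF cE'] _ t(3)]) (use e(1) in \<open>simp add: defining_section_def\<close>)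
    ultimately have "generically X (\<lambda>z. \<phi> z = \<phi>' z * \<epsilon> z)"
      by (rule generically_mono[OF generically_conj _ Xp]) (metis mult.right_neutral)
    from section_cong[OF t(4) this] show ?thesis using t(1) by blast
  qed
  have uD: "unit_at X (\<lambda>z. D x z ^ (k * m) / (A' x z ^ k * E' x z ^ k)) x" if x: "x \<in> X" for x k
    using unit_at_power[OF div_eq_unit[OF eqD x] x, of k]
    by (simp add: div_mult_def div_add_def power_divide power_mult_distrib mult.commute flip: power_mult)
  have nz: "generically X (\<lambda>z. A' x z \<noteq> 0 \<and> E' x z \<noteq> 0 \<and> D x z \<noteq> 0)" if x: "x \<in> X" for x
    by (rule generically_mono[OF generically_conj[OF cartierD(2)[OF A' x]
          generically_conj[OF cartierD(2)[OF cE' x] cartierD(2)[OF D x]]] _ Xp]) simp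
  show ?thesis
  proof (rule exI[of _ m], rule conjI[OF m], intro allI ballI)
    fix l t assume "t \<in> H0 X (div_mult (l * m) D)"
    then obtain \<tau> where t: "section_of X (div_mult (l * m) D) \<tau> t" unfolding H0_def by blast
    obtain j \<alpha> a where j: "j > 0" and a: "section_of X (div_mult j A') \<alpha> a" "a y \<noteq> 0"
      "\<And>x. x \<in> X \<Longrightarrow> regular_at X (\<lambda>z. \<alpha> z * A' x z ^ j / E' x z ^ l) x"
      using ample_section_divisible[OF qA A' eqA m cE' e1 y(1) e1y, of l] by blast
    obtain c where c: "c \<in> S (j * m)" "section_of X (div_mult (j * m) D) \<alpha> c" using prod[OF j a(1)] by blast
    have "unit_at X (\<lambda>z. (\<alpha> z * div_mult j A' y z) * (E' y z ^ j * (D y z ^ (j * m) / (A' y z ^ j * E' y z ^ j)))) y"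
      by (rule unit_at_mult[OF _ unit_at_mult[OF unit_at_power[OF uE y(1)] uD[OF y(1)] y(1)] y(1)])
        (use a(2) section_unit_at[OF a(1) y(1)] in blast)
    moreover have "generically X (\<lambda>z. \<alpha> z * div_mult (j * m) D y z =
        (\<alpha> z * div_mult j A' y z) * (E' y z ^ j * (D y z ^ (j * m) / (A' y z ^ j * E' y z ^ j))))"
      by (rule generically_mono[OF nz[OF y(1)] _ Xp]) (simp add: div_mult_def)
    ultimately have "unit_at X (\<lambda>z. \<alpha> z * div_mult (j * m) D y z) y" by (rule unit_at_cong[OF _ _ y(1)])
    hence cy: "c y \<noteq> 0" using section_unit_at[OF c(2) y(1)] by blast
    have "\<exists>b. section_of X (div_mult (j + l) A') (\<lambda>z. \<alpha> z * \<tau> z) b"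
    proof (rule section_exists)
      show "rational X (\<lambda>z. \<alpha> z * \<tau> z)" using a(1) t unfolding section_of_def by (intro rational_mult) auto
      fix x assume x: "x \<in> X"
      have "regular_at X (\<lambda>z. (\<alpha> z * A' x z ^ j / E' x z ^ l) * ((\<tau> z * div_mult (l * m) D x z) *
          (1 / (D x z ^ (l * m) / (A' x z ^ l * E' x z ^ l))))) x"
        using x by (intro regular_at_mult a(3) section_regular_at[OF t] unit_regular unit_at_inverse uD)
      moreover have "generically X (\<lambda>z. \<alpha> z * \<tau> z * div_mult (j + l) A' x z =
          (\<alpha> z * A' x z ^ j / E' x z ^ l) * ((\<tau> z * div_mult (l * m) D x z) *
          (1 / (D x z ^ (l * m) / (A' x z ^ l * E' x z ^ l)))))"
        by (rule generically_mono[OF nz[OF x] _ Xp]) (simp add: div_mult_def power_add)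
      ultimately show "regular_at X (\<lambda>z. \<alpha> z * \<tau> z * div_mult (j + l) A' x z) x" by (rule regular_at_cong[OF _ _ x])
    qed
    then obtain b where b: "section_of X (div_mult (j + l) A') (\<lambda>z. \<alpha> z * \<tau> z) b" by blast
    have "j + l > 0" using j by simp
    from prod[OF this b] obtain t' where t': "t' \<in> S ((j + l) * m)"
      "section_of X (div_mult ((j + l) * m) D) (\<lambda>z. \<alpha> z * \<tau> z) t'" by blast
    have "section_of X (div_mult ((j + l) * m) D) (\<lambda>z. \<alpha> z * \<tau> z) (\<lambda>z. c z * t z)"
      using section_mult[OF c(2) t] unfolding div_add_mult add_mult_distrib .
    from section_unique[OF this t'(2) generically_all] have "c * t = t'" by (simp add: times_fun_def)
    thus "\<exists>j>0. \<exists>c\<in>S (j * m). c y \<noteq> 0 \<and> c * t \<in> S ((j + l) * m)" using j c(1) cy t'(1) by blast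
  qed
qed

end

section \<open>Finitely generated graded rings\<close>

lemma homogeneous_in_graded_ring:
  assumes G: "graded_ring G" and p: "homogeneous k p" and f: "\<And>i. f i \<in> G e"
  shows "(\<lambda>z. p (\<lambda>i. f i z)) \<in> G (k * e)"
  using p
proof induction
  case (const c)
  have "(\<lambda>z. c * 1 z) \<in> G 0" by (rule fv.subspace_scale[OF graded_ringD(1,2)[OF G]])
  thus ?case by simp
next
  case (coord i) thus ?case using f by simp
next
  case (add d p q)
  from graded_ringD(5)[OF G add.IH] show ?case by (simp add: plus_fun_def)
next
  case (mult d p e' q)
  from graded_ringD(3)[OF G mult.IH] show ?case by (simp add: times_fun_def add_mult_distrib)
qed

definition gen_monomial :: "nat \<Rightarrow> (nat \<Rightarrow> 'z \<Rightarrow> complex) \<Rightarrow> (nat \<Rightarrow> nat) \<Rightarrow> 'z \<Rightarrow> complex" where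
  "gen_monomial r g a = (\<Prod>i<r. g i ^ a i)"

text \<open>Generation of a graded algebra, as a spanning property of monomials in each degree.\<close>

definition generated_by :: "(nat \<Rightarrow> ('z \<Rightarrow> complex) set) \<Rightarrow> nat \<Rightarrow> (nat \<Rightarrow> nat) \<Rightarrow> (nat \<Rightarrow> 'z \<Rightarrow> complex) \<Rightarrow> bool" where
  "generated_by G r d g \<longleftrightarrow> (\<forall>i<r. d i > 0 \<and> g i \<in> G (d i)) \<and>
     (\<forall>k. G k \<subseteq> fv.span (gen_monomial r g ` {a. (\<Sum>i<r. a i * d i) = k}))"

lemma gen_monomial_degree:
  assumes G: "graded_ring G" and g: "\<forall>i<r. g i \<in> G (d i)"
  shows "gen_monomial r g a \<in> G (\<Sum>i<r. a i * d i)"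
  using g unfolding gen_monomial_def
proof (induction r)
  case 0 thus ?case using graded_ringD(2)[OF G] by (simp add: one_fun_def)
next
  case (Suc r)
  have "(\<Prod>i<r. g i ^ a i) * g r ^ a r \<in> G ((\<Sum>i<r. a i * d i) + a r * d r)"
    using Suc by (intro graded_ringD(3)[OF G] graded_ringD(7)[OF G]) auto
  thus ?case unfolding prod.lessThan_Suc sum.lessThan_Suc .
qed

text \<open>
  If all generators are integral over \<open>H\<close>, then \<open>G\<close> is a finite \<open>H\<close>-module: a monomial with a large exponent
  can be rewritten in terms of monomials of smaller total exponent.
\<close>

lemma finite_over_if_integral:
  assumes G: "graded_ring G" and H: "graded_ring H" and gen: "generated_by G r d g"
    and int: "\<And>i. i < r \<Longrightarrow> g i ^ n i \<in> fv.span {h * g i ^ j |h j. j < n i \<and> h \<in> H ((n i - j) * d i)}"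
  shows "finite_over G H"
proof -
  define deg where "deg a = (\<Sum>i<r. a i * d i)" for a :: "nat \<Rightarrow> nat"
  define A where "A = {a. (\<forall>i<r. a i < n i) \<and> (\<forall>i\<ge>r. a i = (0::nat))}"
  define B where "B = (\<lambda>a. (deg a, gen_monomial r g a)) ` A"
  have "finite A"
  proof (rule inj_on_finite[of "\<lambda>a. restrict a {..<r}" A "\<Pi>\<^sub>E i\<in>{..<r}. {..<n i}"])
    show "inj_on (\<lambda>a. restrict a {..<r}) A"
    proof (rule inj_onI, rule ext)
      fix a b i assume ab: "a \<in> A" "b \<in> A" "restrict a {..<r} = restrict b {..<r}"
      show "a i = b i" using fun_cong[OF ab(3), of i] ab(1,2) by (cases "i < r") (auto simp: A_def)
    qed
    show "(\<lambda>a. restrict a {..<r}) ` A \<subseteq> (\<Pi>\<^sub>E i\<in>{..<r}. {..<n i})" by (auto simp: A_def PiE_def extensional_def)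
    show "finite (\<Pi>\<^sub>E i\<in>{..<r}. {..<n i})" by (intro finite_PiE) auto
  qed
  hence "finite B" unfolding B_def by simp
  \<comment> \<open>The induction is on the total exponent, which decreases whenever an integral equation is applied.\<close>
  have red: "h * gen_monomial r g a \<in> fv.span (generated_part B H (l + deg a))" if "h \<in> H l" for h l a
    using that
  proof (induction "\<Sum>i<r. a i" arbitrary: a h l rule: less_induct)
    case less
    show ?case
    proof (cases "\<forall>i<r. a i < n i")
      case True
      define a' where "a' = (\<lambda>i. if i < r then a i else 0)"
      have "a' \<in> A" unfolding A_def a'_def using True by auto
      moreover have "deg a' = deg a" unfolding deg_def a'_def by (intro sum.cong) auto
      moreover have "gen_monomial r g a' = gen_monomial r g a" unfolding gen_monomial_def a'_def by (intro prod.cong) auto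
      ultimately have "(deg a, gen_monomial r g a) \<in> B" unfolding B_def by (intro image_eqI[of _ _ a']) simp_all
      hence "h * gen_monomial r g a \<in> generated_part B H (l + deg a)"
        unfolding generated_part_def using less.prems by (intro CollectI exI conjI) auto
      thus ?thesis by (rule fv.span_base)
    next
      case False
      then obtain i where i: "i < r" "n i \<le> a i" by (auto simp: not_less)
      define rest where "rest = h * (g i ^ (a i - n i) * (\<Prod>j\<in>{..<r} - {i}. g j ^ a j))"
      have "gen_monomial r g a = g i ^ a i * (\<Prod>j\<in>{..<r} - {i}. g j ^ a j)"
        unfolding gen_monomial_def using i(1) by (simp add: prod.remove)
      also have "g i ^ a i = g i ^ (a i - n i) * g i ^ n i" using i(2) by (simp flip: power_add)
      finally have eq: "h * gen_monomial r g a = rest * g i ^ n i" unfolding rest_def by (simp only: mult_ac)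
      show ?thesis unfolding eq
      proof (rule span_mult[OF fv.span_base[of rest "{rest}"] int[OF i(1)]])
        fix u v assume "u \<in> {rest}" "v \<in> {h * g i ^ j |h j. j < n i \<and> h \<in> H ((n i - j) * d i)}"
        then obtain h' j where v: "u = rest" "v = h' * g i ^ j" "j < n i" "h' \<in> H ((n i - j) * d i)" by blast
        define b where "b = a(i := a i - n i + j)"
        have bi: "b i = a i - n i + j" by (simp add: b_def)
        have "gen_monomial r g b = g i ^ b i * (\<Prod>j\<in>{..<r} - {i}. g j ^ b j)"
          unfolding gen_monomial_def using i(1) by (simp add: prod.remove)
        also have "(\<Prod>j\<in>{..<r} - {i}. g j ^ b j) = (\<Prod>j\<in>{..<r} - {i}. g j ^ a j)"
          by (intro prod.cong) (auto simp: b_def)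
        finally have mb: "gen_monomial r g b = g i ^ (a i - n i) * g i ^ j * (\<Prod>j\<in>{..<r} - {i}. g j ^ a j)"
          unfolding bi power_add .
        have uv: "u * v = (h * h') * gen_monomial r g b" unfolding mb v rest_def by (simp only: mult_ac)
        have s: "(\<Sum>k<r. c k) = c i + (\<Sum>k\<in>{..<r} - {i}. c k)" for c :: "nat \<Rightarrow> nat" using i(1) by (simp add: sum.remove)
        have "(\<Sum>k\<in>{..<r} - {i}. b k) = (\<Sum>k\<in>{..<r} - {i}. a k)" by (intro sum.cong) (auto simp: b_def)
        hence "(\<Sum>k<r. b k) < (\<Sum>k<r. a k)" unfolding s[of b] s[of a] bi using i(2) v(3) by simp
        moreover have "h * h' \<in> H (l + (n i - j) * d i)" by (rule graded_ringD(3)[OF H less.prems v(4)])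
        ultimately have "(h * h') * gen_monomial r g b \<in> fv.span (generated_part B H (l + (n i - j) * d i + deg b))"
          by (rule less.hyps)
        moreover have "(n i - j) * d i + deg b = deg a"
        proof -
          have "(\<Sum>k\<in>{..<r} - {i}. b k * d k) = (\<Sum>k\<in>{..<r} - {i}. a k * d k)" by (intro sum.cong) (auto simp: b_def)
          moreover have "(n i - j) * d i + b i * d i = a i * d i" unfolding bi using i(2) v(3) by (simp flip: add_mult_distrib)
          ultimately show ?thesis unfolding deg_def s[of "\<lambda>k. b k * d k"] s[of "\<lambda>k. a k * d k"] by simp
        qed
        ultimately show "u * v \<in> fv.span (generated_part B H (l + deg a))" unfolding uv by (simp add: add.assoc)
      qed simp
    qed
  qed
  have "G k \<subseteq> fv.span (generated_part B H k)" for k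
  proof -
    have "gen_monomial r g ` {a. (\<Sum>i<r. a i * d i) = k} \<subseteq> fv.span (generated_part B H k)"
      using red[OF graded_ringD(2)[OF H]] by (auto simp: deg_def)
    thus ?thesis using gen span_minimal' unfolding generated_by_def by blast
  qed
  moreover have "\<forall>(e, b)\<in>B. b \<in> G e"
    unfolding B_def deg_def using gen_monomial_degree[OF G] gen unfolding generated_by_def by auto
  ultimately show ?thesis unfolding finite_over_def using \<open>finite B\<close> by blast
qed

text \<open>The Veronese subring, with the original grading.\<close>

definition veronese :: "nat \<Rightarrow> (nat \<Rightarrow> ('z \<Rightarrow> complex) set) \<Rightarrow> nat \<Rightarrow> ('z \<Rightarrow> complex) set" where
  "veronese m R k = (if m dvd k then R (k div m) else {0})"

lemma graded_ring_veronese: "graded_ring R \<Longrightarrow> m > 0 \<Longrightarrow> graded_ring (veronese m R)"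
proof -
  assume R: "graded_ring R" and m: "m > 0"
  have "f * g \<in> veronese m R (k + l)" if "f \<in> veronese m R k" "g \<in> veronese m R l" for f g k l
  proof (cases "m dvd k \<and> m dvd l")
    case True
    then obtain a b where ab: "k = m * a" "l = m * b" by blast
    have "f \<in> R a" "g \<in> R b" using that m unfolding veronese_def ab by auto
    from graded_ringD(3)[OF R this] show ?thesis using m unfolding veronese_def ab by (simp flip: add_mult_distrib2)
  next
    case False
    hence "f = 0 \<or> g = 0" using that unfolding veronese_def by auto
    hence "f * g = 0" by auto
    thus ?thesis using graded_ringD(4)[OF R] unfolding veronese_def by simp
  qed
  moreover have "fv.subspace (veronese m R k)" for k
    unfolding veronese_def using graded_ringD(1)[OF R] fv.subspace_single_0 by simp
  moreover have "1 \<in> veronese m R 0" unfolding veronese_def using graded_ringD(2)[OF R] by simp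
  ultimately show "graded_ring (veronese m R)" unfolding graded_ring_def by blast
qed

lemma finite_over_veronese:
  assumes F: "finite_over G (veronese m R)" and m: "m > 0"
  shows "finite_over (\<lambda>k. G (m * k)) R"
proof -
  obtain B where B: "finite B" "\<forall>(e, b)\<in>B. b \<in> G e" "\<And>k. G k \<subseteq> fv.span (generated_part B (veronese m R) k)"
    using F unfolding finite_over_def by blast
  define B' where "B' = (\<lambda>(e, b). (e div m, b)) ` {(e, b) \<in> B. m dvd e}"
  have "finite B'" unfolding B'_def using B(1) by (intro finite_imageI) (auto intro: finite_subset[OF _ B(1)])
  moreover have "\<forall>(e, b)\<in>B'. b \<in> G (m * e)" unfolding B'_def using B(2) by auto
  moreover have "G (m * k) \<subseteq> fv.span (generated_part B' R k)" for k
  proof -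
    have "generated_part B (veronese m R) (m * k) \<subseteq> fv.span (generated_part B' R k)"
    proof
      fix f assume "f \<in> generated_part B (veronese m R) (m * k)"
      then obtain g e b where f: "f = g * b" "(e, b) \<in> B" "e \<le> m * k" "g \<in> veronese m R (m * k - e)"
        unfolding generated_part_def by blast
      show "f \<in> fv.span (generated_part B' R k)"
      proof (cases "m dvd e")
        case True
        then obtain q where q: "e = m * q" by blast
        have "(q, b) \<in> B'" unfolding B'_def using f(2) q m by force
        moreover have "m * k - e = m * (k - q)" unfolding q by (simp add: diff_mult_distrib2)
        hence "g \<in> R (k - q)" using f(4) m unfolding veronese_def by simp
        moreover have "q \<le> k" using f(3) m unfolding q by simp
        ultimately have "f \<in> generated_part B' R k" unfolding generated_part_def f(1) by blast
        thus ?thesis by (rule fv.span_base)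
      next
        case False
        hence "\<not> m dvd (m * k - e)" using f(3) by (metis dvd_triv_left dvd_diffD1)
        hence "f = 0" using f(4) unfolding veronese_def f(1) by (auto simp: fun_eq_iff)
        thus ?thesis using fv.span_zero by simp
      qed
    qed
    thus ?thesis using B(3) span_minimal' by blast
  qed
  ultimately show ?thesis unfolding finite_over_def by blast
qed

text \<open>A finite set of functions serves as a coordinate vector, so that its span consists of linear forms.\<close>

lemma span_finite_coords:
  assumes "finite W"
  shows "\<exists>n x. \<forall>f\<in>fv.span W. f \<in> forms n (x :: 'z \<Rightarrow> cvec) 1 \<and> (\<forall>i<n. (\<lambda>z. x z i) \<in> W)"
proof -
  obtain w n where w: "W = w ` {i. i < (n::nat)}" using finite_imp_nat_seg_image_inj_on[OF assms] by metis
  define x where "x z i = (if i < n then w i z else 0)" for z i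
  have xi: "(\<lambda>z. x z i) = w i" if "i < n" for i using that unfolding x_def by simp
  have "W \<subseteq> forms n x 1" using coord_in_forms[of _ n x] xi unfolding w by fastforce
  hence "fv.span W \<subseteq> forms n x 1" by (rule fv.span_minimal[OF _ subspace_forms])
  thus ?thesis using xi w by (intro exI[of _ n] exI[of _ x]) auto
qed

text \<open>
  The dichotomy for finitely generated graded rings \<open>S \<subseteq> T\<close> with common denominators. The
  Veronese ring of \<open>S\<close> for a common multiple \<open>m\<close> of the degrees of all generators is
  finite over the forms in a basis of \<open>S\<^sub>m\<close>, and powers of the generators of \<open>T\<close>
  lie in \<open>T\<^sub>m\<close>. If all of these are integral over the Veronese ring of \<open>S\<close>, that
  of \<open>T\<close> is finite over it; otherwise it is bigger by the full order of growth.
\<close>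

theorem finite_or_growth:
  fixes S T :: "nat \<Rightarrow> ('z \<Rightarrow> complex) set"
  assumes S: "graded_ring S" "generated_by S r d g" and T: "graded_ring T" "generated_by T q e h"
    and ST: "\<And>k. S k \<subseteq> T k" and dom: "graded_domain T" and fin: "\<And>k. \<exists>W. finite W \<and> T k \<subseteq> fv.span W"
    and m: "m > 0" "\<And>i. i < r \<Longrightarrow> d i dvd m" "\<And>i. i < q \<Longrightarrow> e i dvd m"
    and den: "\<And>t. t \<in> T m \<Longrightarrow> \<exists>j>0. \<exists>c\<in>S (m * j). c \<noteq> 0 \<and> c * t \<in> S (m * (j + 1))"
  shows "finite_over (\<lambda>k. T (m * k)) (\<lambda>k. S (m * k)) \<or>
    (\<exists>d. (\<exists>C. \<forall>k. \<exists>W. finite W \<and> card W \<le> C * (k + 1) ^ d \<and> S (m * k) \<subseteq> fv.span W) \<and>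
      (\<forall>k\<ge>1. fv.dim (S (m * k)) + ((k - 1) div d + 1) ^ d \<le> fv.dim (T (m * k))))"
proof -
  have gS: "graded_ring (\<lambda>k. S (m * k))" and gT: "graded_ring (\<lambda>k. T (m * k))"
    using S(1) T(1) unfolding graded_ring_def by (auto simp: add_mult_distrib2)
  have dT: "graded_domain (\<lambda>k. T (m * k))" using dom unfolding graded_domain_def by blast
  obtain W where W: "W \<subseteq> S m" "fv.independent W" "S m \<subseteq> fv.span W" using fv.maximal_independent_subset by blast
  obtain W0 where "finite W0" "T m \<subseteq> fv.span W0" using fin by blast
  hence "finite W" using fv.independent_span_bound[OF _ W(2)] W(1) ST by blast
  then obtain n x where x: "\<forall>f\<in>fv.span W. f \<in> forms n x 1 \<and> (\<forall>i<n. (\<lambda>z. x z i) \<in> W)"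
    using span_finite_coords by blast
  have xi: "(\<lambda>z. trunc n (x z) i) \<in> S m" for i
  proof (cases "i < n")
    case True thus ?thesis using x fv.span_zero[of W] W(1) by auto
  next
    case False thus ?thesis using graded_ringD(4)[OF S(1)] by (simp add: zero_fun_def)
  qed
  have formsS: "forms n x k \<subseteq> S (m * k)" for k
  proof
    fix f assume "f \<in> forms n x k"
    then obtain p where p: "homogeneous k p" "f = (\<lambda>z. p (trunc n (x z)))" unfolding forms_def by blast
    from homogeneous_in_graded_ring[OF S(1) p(1), of "\<lambda>i z. trunc n (x z) i", OF xi] p(2)
    show "f \<in> S (m * k)" by (simp add: mult.commute)
  qed
  have finS: "finite_over (\<lambda>k. S (m * k)) (forms n x)"
  proof (rule finite_over_veronese[OF _ m(1)], rule finite_over_if_integral[OF S(1) _ S(2)])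
    show "graded_ring (veronese m (forms n x))" by (rule graded_ring_veronese[OF graded_ring_forms m(1)])
    fix i assume i: "i < r"
    have di: "d i > 0" "g i \<in> S (d i)" using S(2) i unfolding generated_by_def by auto
    have "m div d i * d i = m" using m(2)[OF i] by simp
    hence "g i ^ (m div d i) \<in> S m" using graded_ringD(7)[OF S(1) di(2), of "m div d i"] by simp
    hence "g i ^ (m div d i) \<in> forms n x 1" using W(3) x by blast
    hence "g i ^ (m div d i) \<in> veronese m (forms n x) ((m div d i - 0) * d i)"
      using m(1) \<open>m div d i * d i = m\<close> unfolding veronese_def by simp
    moreover have "m div d i > 0" using \<open>m div d i * d i = m\<close> m(1) by (cases "m div d i") auto
    ultimately have "g i ^ (m div d i) * g i ^ 0 \<in> {h * g i ^ j |h j. j < m div d i \<and> h \<in> veronese m (forms n x) ((m div d i - j) * d i)}"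
      by blast
    from fv.span_base[OF this]
    show "g i ^ (m div d i) \<in> fv.span {h * g i ^ j |h j. j < m div d i \<and> h \<in> veronese m (forms n x) ((m div d i - j) * d i)}"
      by simp
  qed
  have main: "\<exists>d. (\<exists>C. \<forall>k. \<exists>W. finite W \<and> card W \<le> C * (k + 1) ^ d \<and> S (m * k) \<subseteq> fv.span W) \<and>
    ((\<exists>N h. (\<forall>i<N. h i \<in> S (m * (N - i))) \<and> t ^ N = (\<Sum>i<N. h i * t ^ i)) \<or>
     (\<forall>k\<ge>1. fv.dim (S (m * k)) + ((k - 1) div d + 1) ^ d \<le> fv.dim (T (m * k))))" if t: "t \<in> T m" for t
  proof -
    obtain j c where c: "j > 0" "c \<in> S (m * j)" "c \<noteq> 0" "c * t \<in> S (m * (j + 1))" using den[OF t] by blast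
    have "t \<in> T (m * 1)" using t by simp
    from integral_or_growth[where R = "\<lambda>k. S (m * k)" and T = "\<lambda>k. T (m * k)",
        OF gS formsS finS gT ST dT fin this c(2,1,3,4)] show ?thesis .
  qed
  show ?thesis
  proof (cases "\<forall>i<q. \<exists>N f. (\<forall>j<N. f j \<in> S (m * (N - j))) \<and> (h i ^ (m div e i)) ^ N = (\<Sum>j<N. f j * (h i ^ (m div e i)) ^ j)")
    case True
    hence "\<exists>N f. \<forall>i<q. P i (N i) (f i)" if "P = (\<lambda>i N f. (\<forall>j<N. f j \<in> S (m * (N - j))) \<and> (h i ^ (m div e i)) ^ N = (\<Sum>j<N. f j * (h i ^ (m div e i)) ^ j))" for P
    proof -
      have P: "\<forall>i\<in>{..<q}. \<exists>N f. P i N f" using True unfolding that by simp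
      from bchoice[OF P] obtain N where N: "\<forall>i\<in>{..<q}. \<exists>f. P i (N i) f" ..
      from bchoice[OF N] obtain f where "\<forall>i\<in>{..<q}. P i (N i) (f i)" ..
      hence "\<forall>i<q. P i (N i) (f i)" by simp
      thus ?thesis by (intro exI)
    qed
    from this[OF refl] obtain N f where Nf: "\<forall>i<q. (\<forall>j<N i. f i j \<in> S (m * (N i - j))) \<and>
        (h i ^ (m div e i)) ^ N i = (\<Sum>j<N i. f i j * (h i ^ (m div e i)) ^ j)" by (elim exE conjE) (rule that)
    have f: "f i j \<in> S (m * (N i - j))" if "i < q" "j < N i" for i j using Nf that by simp
    have f2: "(h i ^ (m div e i)) ^ N i = (\<Sum>j<N i. f i j * (h i ^ (m div e i)) ^ j)" if "i < q" for i using Nf that by simp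
    have "finite_over (\<lambda>k. T (m * k)) (\<lambda>k. S (m * k))"
    proof (rule finite_over_veronese[OF _ m(1)], rule finite_over_if_integral[OF T(1) _ T(2), where n = "\<lambda>i. m div e i * N i"])
      show "graded_ring (veronese m (\<lambda>k. S (m * k)))" by (rule graded_ring_veronese[OF gS m(1)])
      fix i assume i: "i < q"
      let ?k = "m div e i"
      have k: "?k * e i = m" using m(3)[OF i] by simp
      have k0: "?k > 0" using k m(1) by (cases ?k) auto
      have "h i ^ (?k * N i) = (\<Sum>j<N i. f i j * h i ^ (?k * j))" using f2[OF i] by (simp add: power_mult)
      also have "\<dots> \<in> fv.span {f * h i ^ j |f j. j < ?k * N i \<and> f \<in> veronese m (\<lambda>k. S (m * k)) ((?k * N i - j) * e i)}"
      proof (rule fv.span_sum, rule fv.span_base)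
        fix j assume "j \<in> {..<N i}"
        hence j: "j < N i" by simp
        have "(?k * N i - ?k * j) * e i = m * (N i - j)"
          unfolding diff_mult_distrib2[symmetric] using k by (metis mult.assoc mult.commute)
        moreover have "f i j \<in> veronese m (\<lambda>k. S (m * k)) (m * (N i - j))" using f[OF i j] m(1) unfolding veronese_def by simp
        ultimately have "f i j \<in> veronese m (\<lambda>k. S (m * k)) ((?k * N i - ?k * j) * e i)" by simp
        moreover have "?k * j < ?k * N i" using j k0 by simp
        ultimately show "f i j * h i ^ (?k * j) \<in> {f * h i ^ j |f j. j < ?k * N i \<and> f \<in> veronese m (\<lambda>k. S (m * k)) ((?k * N i - j) * e i)}"
          by blast
      qed
      finally show "h i ^ (?k * N i) \<in> fv.span {f * h i ^ j |f j. j < ?k * N i \<and> f \<in> veronese m (\<lambda>k. S (m * k)) ((?k * N i - j) * e i)}" .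
    qed
    thus ?thesis ..
  next
    case False
    then obtain i where i: "i < q"
      "\<not> (\<exists>N f. (\<forall>j<N. f j \<in> S (m * (N - j))) \<and> (h i ^ (m div e i)) ^ N = (\<Sum>j<N. f j * (h i ^ (m div e i)) ^ j))" by blast
    have "h i \<in> T (e i)" using T(2) i(1) unfolding generated_by_def by blast
    moreover have "m div e i * e i = m" using m(3)[OF i(1)] by simp
    ultimately have "h i ^ (m div e i) \<in> T m" using graded_ringD(7)[OF T(1), of "h i" "e i" "m div e i"] by simp
    from main[OF this] i(2) show ?thesis by blast
  qed
qed

text \<open>The product of denominators of the module generators.\<close>

lemma common_conductor:
  fixes S T :: "nat \<Rightarrow> ('z \<Rightarrow> complex) set"
  assumes S: "graded_ring S" and F: "finite_over T S"
    and den: "\<And>e b. b \<in> T e \<Longrightarrow> \<exists>j. \<exists>c\<in>S j. c y \<noteq> 0 \<and> c * b \<in> S (j + e)"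
  shows "\<exists>j. \<exists>c\<in>S j. c y \<noteq> 0 \<and> (\<forall>k. \<forall>f\<in>T k. c * f \<in> S (k + j))"
proof -
  obtain B where B: "finite B" "\<forall>(e, b)\<in>B. b \<in> T e" "\<And>k. T k \<subseteq> fv.span (generated_part B S k)"
    using F unfolding finite_over_def by blast
  have "\<exists>j. \<exists>c\<in>S j. c y \<noteq> 0 \<and> (\<forall>(e, b)\<in>B. c * b \<in> S (j + e))"
    using B(1,2)
  proof induction
    case empty
    show ?case by (rule exI[of _ 0], rule bexI[of _ 1]) (auto intro: graded_ringD(2)[OF S])
  next
    case (insert eb B)
    obtain e b where eb: "eb = (e, b)" by (cases eb)
    have bT: "\<forall>(e, b)\<in>B. b \<in> T e" "b \<in> T e" using insert.prems eb by auto
    obtain j c where c: "c \<in> S j" "c y \<noteq> 0" "\<forall>(e, b)\<in>B. c * b \<in> S (j + e)" using insert.IH[OF bT(1)] by blast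
    obtain i a where a: "a \<in> S i" "a y \<noteq> 0" "a * b \<in> S (i + e)" using den[OF bT(2)] by blast
    have "c * (a * b) \<in> S (j + (i + e))" by (rule graded_ringD(3)[OF S c(1) a(3)])
    hence 1: "(c * a) * b \<in> S ((j + i) + e)" by (simp add: mult.assoc add.assoc)
    have 2: "(c * a) * b' \<in> S ((j + i) + e')" if "(e', b') \<in> B" for e' b'
    proof -
      have "a * (c * b') \<in> S (i + (j + e'))" using c(3) that by (intro graded_ringD(3)[OF S a(1)]) auto
      moreover have "a * (c * b') = (c * a) * b'" "i + (j + e') = (j + i) + e'" by (simp_all only: mult_ac add_ac)
      ultimately show ?thesis by simp
    qed
    have "c * a \<in> S (j + i)" by (rule graded_ringD(3)[OF S c(1) a(1)])
    moreover have "(c * a) y \<noteq> 0" using a(2) c(2) by simp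
    moreover have "\<forall>(e, b)\<in>insert eb B. (c * a) * b \<in> S ((j + i) + e)" using 1 2 eb by auto
    ultimately show ?case by blast
  qed
  then obtain j c where c: "c \<in> S j" "c y \<noteq> 0" "\<forall>(e, b)\<in>B. c * b \<in> S (j + e)" by blast
  have "c * f \<in> S (k + j)" if "f \<in> T k" for f k
  proof -
    have "f \<in> fv.span (generated_part B S k)" using that B(3) by blast
    thus ?thesis
    proof (induction rule: fv.span_induct_alt)
      case base
      have "c * 0 = 0" by simp
      thus ?case using graded_ringD(4)[OF S] by metis
    next
      case (step t u v)
      then obtain g e b where u: "u = g * b" "(e, b) \<in> B" "e \<le> k" "g \<in> S (k - e)" unfolding generated_part_def by blast
      have "g * (c * b) \<in> S ((k - e) + (j + e))" using c(3) u(2) by (intro graded_ringD(3)[OF S u(4)]) auto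
      hence "g * (c * b) \<in> S (k + j)" using u(3) by (simp add: add.commute)
      from fv.subspace_scale[OF graded_ringD(1)[OF S] this, of t]
      have "(\<lambda>x. t * (g * (c * b)) x) + c * v \<in> S (k + j)" using graded_ringD(5)[OF S] step(2) by blast
      moreover have "(\<lambda>x. t * (g * (c * b)) x) + c * v = c * ((\<lambda>x. t * u x) + v)" unfolding u(1)
        by (auto simp: fun_eq_iff algebra_simps)
      ultimately show ?case by (simp only:)
    qed
  qed
  thus ?thesis using c by blast
qed

section \<open>Dimensions and their growth\<close>

lemma span_weighted_pullback:
  fixes u :: "'a \<Rightarrow> complex" and \<rho> :: "'b \<Rightarrow> 'a"
  assumes "u \<in> fv.span U"
  shows "(\<lambda>z. w z * u (\<rho> z)) \<in> fv.span ((\<lambda>u z. w z * u (\<rho> z)) ` U)"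
  using assms
proof (induction rule: fv.span_induct_alt)
  case base
  show ?case using zero_in_span by simp
next
  case (step c u v)
  let ?f = "\<lambda>u z. w z * u (\<rho> z)"
  have "(\<lambda>z. c * ?f u z) + ?f v \<in> fv.span (?f ` U)"
    by (rule fv.span_add[OF fv.span_scale[OF fv.span_base[OF imageI[OF step(1)]]] step(2)])
  moreover have "(\<lambda>z. c * ?f u z) + ?f v = ?f ((\<lambda>x. c * u x) + v)" by (auto simp: fun_eq_iff algebra_simps)
  ultimately show ?case by (simp only:)
qed

text \<open>
  Composition with a map, multiplication by a function, and restriction to a subset are all maps of the form
  \<open>u \<mapsto> w (u \<circ> \<rho>)\<close>.
\<close>

lemma dim_le_if_injective:
  fixes V :: "('a \<Rightarrow> complex) set" and V' :: "('b \<Rightarrow> complex) set"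
  assumes V: "fv.subspace V" "finite U" "V \<subseteq> fv.span U" and V': "finite W" "V' \<subseteq> fv.span W"
    and f: "\<And>u. u \<in> V \<Longrightarrow> (\<lambda>z. w z * u (\<rho> z)) \<in> V'"
    and inj: "\<And>u. u \<in> V \<Longrightarrow> (\<And>z. w z * u (\<rho> z) = 0) \<Longrightarrow> u = 0"
  shows "fv.dim V \<le> fv.dim V'"
proof -
  obtain B where B: "B \<subseteq> V" "fv.independent B" "V \<subseteq> fv.span B" "card B = fv.dim V" by (rule fv.basis_exists)
  obtain B' where B': "B' \<subseteq> V'" "fv.independent B'" "V' \<subseteq> fv.span B'" "card B' = fv.dim V'" by (rule fv.basis_exists)
  have fB: "finite B" using fv.independent_span_bound[OF V(2) B(2)] B(1) V(3) by blast
  have fB': "finite B'" using fv.independent_span_bound[OF V'(1) B'(2)] B'(1) V'(2) by blast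
  have "card B \<le> card B'"
  proof (rule card_le_if_independent_family[OF fB fB', of "\<lambda>u z. w z * u (\<rho> z)"])
    show "(\<lambda>u z. w z * u (\<rho> z)) ` B \<subseteq> fv.span B'" using f B(1) B'(3) by blast
    fix c assume 0: "\<And>z. (\<Sum>u\<in>B. c u * (w z * u (\<rho> z))) = 0"
    let ?v = "\<Sum>u\<in>B. (\<lambda>z. c u * u z)"
    have "?v \<in> V" using B(1) by (intro fv.subspace_sum[OF V(1)] fv.subspace_scale[OF V(1)]) blast
    moreover have "w z * ?v (\<rho> z) = 0" for z
      unfolding sum_fun_apply sum_distrib_left using 0[of z] by (simp only: mult.left_commute)
    ultimately have "?v = 0" by (rule inj)
    thus "\<forall>u\<in>B. c u = 0" using fv.independentD[OF B(2) fB order.refl] by blast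
  qed
  thus ?thesis using B(4) B'(4) by simp
qed

text \<open>
  A bounded shift of the degree does not change the leading term of the growth, because
  \<open>(k + \<Delta>)\<^sup>n / k\<^sup>n\<close> tends to \<open>1\<close>.
\<close>

lemma limsup_shift:
  fixes a b :: "nat \<Rightarrow> nat"
  assumes ev: "\<forall>\<^sub>F k in sequentially. \<exists>\<delta>\<le>\<Delta>. real (a k) + \<epsilon> * (real k ^ n / fact n) \<le> real (b (k + \<delta>))"
  shows "limsup (\<lambda>k. ereal (real (a k) / (real k ^ n / fact n))) + ereal \<epsilon> \<le>
    limsup (\<lambda>k. ereal (real (b k) / (real k ^ n / fact n)))"
proof (rule dense_ge)
  fix x assume x: "limsup (\<lambda>k. ereal (real (b k) / (real k ^ n / fact n))) < x"
  show "limsup (\<lambda>k. ereal (real (a k) / (real k ^ n / fact n))) + ereal \<epsilon> \<le> x"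
  proof (cases x)
    case PInf thus ?thesis by simp
  next
    case MInf thus ?thesis using x by simp
  next
    case (real r)
    have "\<forall>\<^sub>F k in sequentially. ereal (real (b k) / (real k ^ n / fact n)) < ereal r"
      using Limsup_lessD[OF x] unfolding real .
    then obtain K where K: "\<And>k. k \<ge> K \<Longrightarrow> real (b k) / (real k ^ n / fact n) < r"
      unfolding eventually_sequentially by auto
    have "0 \<le> real (b K) / (real K ^ n / fact n)" by simp
    hence r: "r > 0" using K[of K] by linarith
    have "\<forall>\<^sub>F k in sequentially. ereal (real (a k) / (real k ^ n / fact n)) \<le>
        ereal (r * ((real k + real \<Delta>) / real k) ^ n - \<epsilon>)"
      using ev eventually_ge_at_top[of "max K 1"]
    proof eventually_elim
      case (elim k)
      then obtain \<delta> where d: "\<delta> \<le> \<Delta>" "real (a k) + \<epsilon> * (real k ^ n / fact n) \<le> real (b (k + \<delta>))" by blast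
      have k: "k \<ge> K" "k \<ge> 1" using elim(2) by auto
      define v where "v = real k ^ n / fact n"
      have v: "v > 0" unfolding v_def using k by simp
      have "real (b (k + \<delta>)) / (real (k + \<delta>) ^ n / fact n) < r" by (rule K) (use k in simp)
      moreover have "real (k + \<delta>) ^ n / fact n > 0" using k by simp
      ultimately have "real (b (k + \<delta>)) < r * (real (k + \<delta>) ^ n / fact n)" by (simp only: pos_divide_less_eq)
      also have "\<dots> \<le> r * ((real k + real \<Delta>) ^ n / fact n)"
        using r d(1) by (intro mult_left_mono divide_right_mono power_mono) auto
      also have "\<dots> = (r * ((real k + real \<Delta>) / real k) ^ n) * v"
        unfolding v_def power_divide using k by simp
      finally have "real (a k) + \<epsilon> * v \<le> (r * ((real k + real \<Delta>) / real k) ^ n) * v" using d(2) unfolding v_def by linarith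
      hence "real (a k) \<le> (r * ((real k + real \<Delta>) / real k) ^ n - \<epsilon>) * v" by (simp add: left_diff_distrib)
      hence "real (a k) / v \<le> r * ((real k + real \<Delta>) / real k) ^ n - \<epsilon>" using v by (simp only: pos_divide_le_eq)
      thus ?case unfolding v_def by simp
    qed
    hence "limsup (\<lambda>k. ereal (real (a k) / (real k ^ n / fact n))) \<le>
        limsup (\<lambda>k. ereal (r * ((real k + real \<Delta>) / real k) ^ n - \<epsilon>))" by (rule Limsup_mono)
    also have "\<dots> = ereal (r * (1 + 0) ^ n - \<epsilon>)"
    proof (rule lim_imp_Limsup)
      have "(\<lambda>k. r * (1 + real \<Delta> / real k) ^ n - \<epsilon>) \<longlonglongrightarrow> r * (1 + 0) ^ n - \<epsilon>"
        by (intro tendsto_intros lim_const_over_n)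
      moreover have "\<forall>\<^sub>F k in sequentially. r * (1 + real \<Delta> / real k) ^ n - \<epsilon> = r * ((real k + real \<Delta>) / real k) ^ n - \<epsilon>"
        using eventually_gt_at_top[of 0] by eventually_elim (simp add: add_divide_distrib)
      ultimately have "(\<lambda>k. r * ((real k + real \<Delta>) / real k) ^ n - \<epsilon>) \<longlonglongrightarrow> r * (1 + 0) ^ n - \<epsilon>"
        by (rule Lim_transform_eventually)
      thus "(\<lambda>k. ereal (r * ((real k + real \<Delta>) / real k) ^ n - \<epsilon>)) \<longlonglongrightarrow> ereal (r * (1 + 0) ^ n - \<epsilon>)" by simp
    qed simp
    finally have "limsup (\<lambda>k. ereal (real (a k) / (real k ^ n / fact n))) \<le> ereal (r - \<epsilon>)" by simp
    hence "limsup (\<lambda>k. ereal (real (a k) / (real k ^ n / fact n))) + ereal \<epsilon> \<le> ereal (r - \<epsilon>) + ereal \<epsilon>"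
      by (rule add_right_mono)
    thus ?thesis unfolding real by simp
  qed
qed

lemma limsup_finite:
  fixes a :: "nat \<Rightarrow> nat"
  assumes "\<And>k. a k \<le> C * (k + 1) ^ n"
  shows "limsup (\<lambda>k. ereal (real (a k) / (real k ^ n / fact n))) < \<infinity>"
proof -
  have "\<forall>\<^sub>F k in sequentially. ereal (real (a k) / (real k ^ n / fact n)) \<le> ereal (real C * 2 ^ n * fact n)"
    using eventually_ge_at_top[of 1]
  proof eventually_elim
    case (elim k)
    have "real (a k) \<le> real (C * (k + 1) ^ n)" using assms by (simp only: of_nat_le_iff)
    also have "\<dots> = real C * (real k + 1) ^ n" by (simp add: add.commute)
    also have "\<dots> \<le> real C * (2 * real k) ^ n" using elim by (intro mult_left_mono power_mono) auto
    also have "\<dots> = (real C * 2 ^ n * fact n) * (real k ^ n / fact n)" by (simp add: power_mult_distrib)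
    finally have "real (a k) \<le> (real C * 2 ^ n * fact n) * (real k ^ n / fact n)" .
    moreover have "real k ^ n / fact n > 0" using elim by simp
    ultimately show ?case by (simp only: pos_divide_le_eq ereal_less_eq)
  qed
  hence "limsup (\<lambda>k. ereal (real (a k) / (real k ^ n / fact n))) \<le> ereal (real C * 2 ^ n * fact n)"
    by (rule Limsup_bounded)
  thus ?thesis by (rule le_less_trans) simp
qed

lemma limsup_zero:
  fixes a :: "nat \<Rightarrow> nat"
  assumes a: "\<And>k. a k \<le> C * (k + c) ^ d" and d: "d < n"
  shows "limsup (\<lambda>k. ereal (real (a k) / (real k ^ n / fact n))) \<le> 0"
proof -
  define L where "L = real C * (1 + real c) ^ d * fact n"
  have "\<forall>\<^sub>F k in sequentially. ereal (real (a k) / (real k ^ n / fact n)) \<le> ereal (L / real k)"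
    using eventually_ge_at_top[of 1]
  proof eventually_elim
    case (elim k)
    have k: "real k \<ge> 1" using elim by simp
    have "real (a k) \<le> real (C * (k + c) ^ d)" using a by (simp only: of_nat_le_iff)
    also have "\<dots> = real C * (real k + real c) ^ d" by simp
    also have "real c \<le> real c * real k" using k by (simp add: mult_le_cancel_left1)
    hence "real C * (real k + real c) ^ d \<le> real C * ((1 + real c) * real k) ^ d"
      by (intro mult_left_mono power_mono) (auto simp: distrib_right)
    also have "\<dots> = real C * (1 + real c) ^ d * real k ^ d" by (simp add: power_mult_distrib)
    also have "\<dots> \<le> real C * (1 + real c) ^ d * real k ^ (n - 1)"
      using k d by (intro mult_left_mono power_increasing) auto
    also have "\<dots> = (L / real k) * (real k ^ n / fact n)"
    proof -
      have "real k ^ n = real k * real k ^ (n - 1)" using d by (cases n) auto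
      thus ?thesis unfolding L_def using k by simp
    qed
    finally have "real (a k) \<le> (L / real k) * (real k ^ n / fact n)" .
    moreover have "real k ^ n / fact n > 0" using elim by simp
    ultimately show ?case by (simp only: pos_divide_le_eq ereal_less_eq)
  qed
  hence "limsup (\<lambda>k. ereal (real (a k) / (real k ^ n / fact n))) \<le> limsup (\<lambda>k. ereal (L / real k))" by (rule Limsup_mono)
  also have "\<dots> = ereal 0" by (rule lim_imp_Limsup) (simp_all add: lim_const_over_n)
  finally show ?thesis by (simp add: zero_ereal_def)
qed

section \<open>Finitely generated graded linear series\<close>

text \<open>
  The induction principle for a finitely generated series: it is contained in every multiplicative graded family
  \<open>R\<close> of spaces that contains the scalars and the homogeneous components of positive degree of the
  generators.
\<close>

lemma homogeneous_generators:
  assumes gls: "graded_linear_series X D S" and fg: "finitely_generated X S"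
  shows "\<exists>J. finite J \<and> (\<forall>(d, s)\<in>J. d > 0 \<and> s \<in> S d) \<and>
    (\<forall>R. (\<forall>k. fv.subspace (R k)) \<and> range (scalar_section X) \<subseteq> R 0 \<and>
      (\<forall>k l. \<forall>s\<in>R k. \<forall>t\<in>R l. s * t \<in> R (k + l)) \<and> (\<forall>(d, s)\<in>J. s \<in> R d) \<longrightarrow> (\<forall>k. S k \<subseteq> R k))"
proof -
  obtain G where G: "finite G" "generated_algebra X G = graded_algebra S" using fg unfolding finitely_generated_def by blast
  have S0: "S 0 = range (scalar_section X)" and sub: "\<And>k. fv.subspace (S k)"
    using gls unfolding graded_linear_series_def by auto
  define J where "J = (\<lambda>(P, d). (d, coeff P d)) ` (SIGMA P:G. {0<..degree P})"
  have GS: "coeff P d \<in> S d" if "P \<in> G" for P d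
    using generated_algebra.gen[OF that, of X] unfolding G(2) graded_algebra_def by blast
  have "S k \<subseteq> R k" if R: "\<forall>k. fv.subspace (R k)" "range (scalar_section X) \<subseteq> R 0"
      "\<forall>k l. \<forall>s\<in>R k. \<forall>t\<in>R l. s * t \<in> R (k + l)" "\<forall>(d, s)\<in>J. s \<in> R d" for R k
  proof
    fix s assume s: "s \<in> S k"
    have sR: "fv.subspace (R k)" for k using R(1) by blast
    have "\<forall>k. coeff P k \<in> R k" if "P \<in> generated_algebra X G" for P
      using that
    proof induction
      case (scalar c)
      show ?case using R(2) fv.subspace_0[OF sR] by (auto simp: coeff_pCons split: nat.splits)
    next
      case (gen P)
      show ?case
      proof
        fix k
        consider "k = 0" | "0 < k" "k \<le> degree P" | "k > degree P" by linarith
        thus "coeff P k \<in> R k"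
        proof cases
          case 1 thus ?thesis using GS[OF gen, of 0] R(2) S0 by auto
        next
          case 2
          hence "(k, coeff P k) \<in> J" unfolding J_def using gen by force
          thus ?thesis using R(4) by blast
        next
          case 3 thus ?thesis using fv.subspace_0[OF sR] by (simp add: coeff_eq_0)
        qed
      qed
    next
      case (add P Q)
      show ?case
      proof
        fix k show "coeff (P + Q) k \<in> R k" unfolding coeff_add using add.IH by (intro fv.subspace_add[OF sR]) auto
      qed
    next
      case (mult P Q)
      show ?case
      proof
        fix k
        have "coeff P i * coeff Q (k - i) \<in> R k" if "i \<le> k" for i
        proof -
          have "coeff P i * coeff Q (k - i) \<in> R (i + (k - i))" using R(3) mult.IH by blast
          thus ?thesis using that by simp
        qed
        thus "coeff (P * Q) k \<in> R k" unfolding coeff_mult by (intro fv.subspace_sum[OF sR]) auto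
      qed
    qed
    moreover have "monom s k \<in> graded_algebra S"
      unfolding graded_algebra_def using s fv.subspace_0[OF sub] by simp
    ultimately have "coeff (monom s k) k \<in> R k" using G(2) by blast
    thus "s \<in> R k" by simp
  qed
  moreover have "finite J" unfolding J_def using G(1) by (intro finite_imageI finite_SigmaI) auto
  moreover have "\<forall>(d, s)\<in>J. d > 0 \<and> s \<in> S d" unfolding J_def using GS by auto
  ultimately show ?thesis by (intro exI[of _ J]) blast
qed

text \<open>
  The unit of the ring of a series is the function \<open>1\<close> on \<open>X\<close>, extended by \<open>0\<close>. Pulling sections back along a
  retraction of the type of points to \<open>X\<close> makes it the constant function \<open>1\<close>.
\<close>

definition retract :: "point set \<Rightarrow> point \<Rightarrow> point" where
  "retract X z = (if z \<in> X then z else (SOME x. x \<in> X))"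

definition pull :: "point set \<Rightarrow> (point \<Rightarrow> complex) \<Rightarrow> point \<Rightarrow> complex" where
  "pull X s = (\<lambda>z. s (retract X z))"

lemma retract_in: "X \<noteq> {} \<Longrightarrow> retract X z \<in> X"
  unfolding retract_def by (simp add: some_in_eq)

lemma pull_simps:
  "pull X (s * t) = pull X s * pull X t" "pull X (s + t) = pull X s + pull X t" "pull X 0 = 0"
  "pull X (\<lambda>z. c * s z) = (\<lambda>z. c * pull X s z)" "x \<in> X \<Longrightarrow> pull X s x = s x"
  unfolding pull_def retract_def by (auto simp: fun_eq_iff)

lemma pull_scalar: "X \<noteq> {} \<Longrightarrow> pull X (scalar_section X c) = (\<lambda>z. c)"
  using retract_in[of X] unfolding pull_def scalar_section_def restrict_section_def by auto

lemma pull_inject: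
  assumes "pull X s = pull X t" "\<And>x. x \<notin> X \<Longrightarrow> s x = 0" "\<And>x. x \<notin> X \<Longrightarrow> t x = 0"
  shows "s = t"
proof
  fix x show "s x = t x" using fun_cong[OF assms(1), of x] assms(2,3)[of x] pull_simps(5)[of x X] by (cases "x \<in> X") auto
qed

lemma series_vanishes: "graded_linear_series X D S \<Longrightarrow> s \<in> S k \<Longrightarrow> x \<notin> X \<Longrightarrow> s x = 0"
  unfolding graded_linear_series_def H0_def section_of_def by blast

lemma series_finite_dim:
  assumes "graded_linear_series X D S"
  shows "\<exists>B. finite B \<and> S k \<subseteq> fv.span B" "\<exists>B. finite B \<and> pull X ` S k \<subseteq> fv.span B"
    "\<exists>B. finite B \<and> restricted_series Y S k \<subseteq> fv.span B"
proof -
  obtain B where B: "finite B" "S k = fv.span B" using assms unfolding graded_linear_series_def by metis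
  thus "\<exists>B. finite B \<and> S k \<subseteq> fv.span B" by blast
  have "pull X ` S k \<subseteq> fv.span ((\<lambda>u z. 1 * u (retract X z)) ` B)"
    using span_weighted_pullback[where w = "\<lambda>z. 1" and \<rho> = "retract X" and U = B] unfolding B(2) pull_def by auto
  thus "\<exists>B. finite B \<and> pull X ` S k \<subseteq> fv.span B" using B(1) by blast
  have "restrict_section Y s = (\<lambda>z. (if z \<in> Y then 1 else 0) * s z)" for s unfolding restrict_section_def by auto
  hence "restricted_series Y S k \<subseteq> fv.span ((\<lambda>u z. (if z \<in> Y then 1 else 0) * u z) ` B)"
    using span_weighted_pullback[where w = "\<lambda>z. if z \<in> Y then 1 else 0" and \<rho> = "\<lambda>z. z" and U = B]
    unfolding B(2) restricted_series_def by auto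
  thus "\<exists>B. finite B \<and> restricted_series Y S k \<subseteq> fv.span B" using B(1) by blast
qed

lemma graded_ring_pull:
  assumes gls: "graded_linear_series X D S" and X: "X \<noteq> {}"
  shows "graded_ring (\<lambda>k. pull X ` S k)"
proof -
  have S: "\<And>k. fv.subspace (S k)" "S 0 = range (scalar_section X)" "\<And>k l s t. s \<in> S k \<Longrightarrow> t \<in> S l \<Longrightarrow> s * t \<in> S (k + l)"
    using gls unfolding graded_linear_series_def by auto
  have "fv.subspace (pull X ` S k)" for k
  proof (rule fv.subspaceI)
    show "0 \<in> pull X ` S k" using fv.subspace_0[OF S(1)] pull_simps(3) by (metis image_eqI)
    fix f assume "f \<in> pull X ` S k"
    then obtain s where s: "s \<in> S k" "f = pull X s" by blast
    show "(\<lambda>x. c * f x) \<in> pull X ` S k" for c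
      unfolding s(2) pull_simps(4)[symmetric] by (rule imageI[OF fv.subspace_scale[OF S(1) s(1)]])
    fix g assume "g \<in> pull X ` S k"
    then obtain t where t: "t \<in> S k" "g = pull X t" by blast
    show "f + g \<in> pull X ` S k"
      unfolding s(2) t(2) pull_simps(2)[symmetric] by (rule imageI[OF fv.subspace_add[OF S(1) s(1) t(1)]])
  qed
  moreover have "1 \<in> pull X ` S 0"
    unfolding S(2) by (rule image_eqI[of _ _ "scalar_section X 1"]) (auto simp: pull_scalar[OF X])
  moreover have "f * g \<in> pull X ` S (k + l)" if fg: "f \<in> pull X ` S k" "g \<in> pull X ` S l" for f g k l
  proof -
    obtain s t where st: "s \<in> S k" "f = pull X s" "t \<in> S l" "g = pull X t" using fg by blast
    show ?thesis unfolding st(2,4) pull_simps(1)[symmetric] by (rule imageI[OF S(3)[OF st(1,3)]])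
  qed
  ultimately show ?thesis unfolding graded_ring_def by blast
qed

lemma dim_pull:
  assumes gls: "graded_linear_series X D S" and X: "X \<noteq> {}"
  shows "fv.dim (pull X ` S k) = fv.dim (S k)"
proof (rule antisym)
  have sub: "fv.subspace (S k)" using gls unfolding graded_linear_series_def by blast
  obtain B B' where B: "finite B" "S k \<subseteq> fv.span B" "finite B'" "pull X ` S k \<subseteq> fv.span B'"
    using series_finite_dim(1,2)[OF gls] by metis
  show "fv.dim (S k) \<le> fv.dim (pull X ` S k)"
  proof (rule dim_le_if_injective[OF sub B, where w = "\<lambda>z. 1" and \<rho> = "retract X"])
    fix u assume u: "u \<in> S k"
    thus "(\<lambda>z. 1 * u (retract X z)) \<in> pull X ` S k" unfolding pull_def by auto
    assume 0: "\<And>z. 1 * u (retract X z) = 0"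
    show "u = 0"
    proof
      fix x show "u x = 0 x" using 0[of x] series_vanishes[OF gls u, of x] unfolding retract_def by (cases "x \<in> X") auto
    qed
  qed
  show "fv.dim (pull X ` S k) \<le> fv.dim (S k)"
  proof (rule dim_le_if_injective[OF graded_ringD(1)[OF graded_ring_pull[OF gls X]] B(3,4,1,2),
        where w = "\<lambda>z. if z \<in> X then 1 else 0" and \<rho> = "\<lambda>z. z"])
    fix u assume "u \<in> pull X ` S k"
    then obtain s where s: "s \<in> S k" "u = pull X s" by blast
    have "(if z \<in> X then 1 else 0) * u z = s z" for z
      using series_vanishes[OF gls s(1), of z] pull_simps(5)[of z X s] s(2) by auto
    thus "(\<lambda>z. (if z \<in> X then 1 else 0) * u z) \<in> S k" using s(1) by simp
    assume 0: "\<And>z. (if z \<in> X then 1 else 0) * u z = 0"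
    have "s x = 0" if "x \<in> X" for x using 0[of x] that pull_simps(5)[of x X s] s(2) by simp
    thus "u = 0" unfolding s(2) pull_def using retract_in[OF X] by auto
  qed
qed

lemma generated_by_pull:
  assumes gls: "graded_linear_series X D S" and fg: "finitely_generated X S" and X: "X \<noteq> {}"
  shows "\<exists>r d g. generated_by (\<lambda>k. pull X ` S k) r d g"
proof -
  obtain J where J: "finite J" "\<forall>(d, s)\<in>J. d > 0 \<and> s \<in> S d"
    "\<And>R. (\<forall>k. fv.subspace (R k)) \<Longrightarrow> range (scalar_section X) \<subseteq> R 0 \<Longrightarrow>
      (\<forall>k l. \<forall>s\<in>R k. \<forall>t\<in>R l. s * t \<in> R (k + l)) \<Longrightarrow> (\<forall>(d, s)\<in>J. s \<in> R d) \<Longrightarrow> (\<forall>k. S k \<subseteq> R k)"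
    using homogeneous_generators[OF gls fg] by (elim exE conjE) simp
  obtain j and r :: nat where j: "J = j ` {i. i < r}" using finite_imp_nat_seg_image_inj_on[OF J(1)] by metis
  define d where "d i = fst (j i)" for i
  define g where "g i = pull X (snd (j i))" for i
  define Mon where "Mon k = gen_monomial r g ` {a. (\<Sum>i<r. a i * d i) = k}" for k
  define R where "R k = {s. pull X s \<in> fv.span (Mon k)}" for k
  have ji: "d i > 0" "snd (j i) \<in> S (d i)" if "i < r" for i
  proof -
    have "j i \<in> J" unfolding j using that by simp
    from bspec[OF J(2) this] have "case j i of (d, s) \<Rightarrow> d > 0 \<and> s \<in> S d" .
    thus "d i > 0" "snd (j i) \<in> S (d i)" unfolding d_def by (simp_all add: case_prod_beta)
  qed
  have "\<forall>k. S k \<subseteq> R k"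
  proof (rule J(3))
    show "\<forall>k. fv.subspace (R k)"
    proof
      fix k show "fv.subspace (R k)"
        unfolding R_def
      proof (rule fv.subspaceI)
        show "0 \<in> {s. pull X s \<in> fv.span (Mon k)}" using fv.span_zero[of "Mon k"] by (simp only: mem_Collect_eq pull_simps)
        fix s assume s: "s \<in> {s. pull X s \<in> fv.span (Mon k)}"
        show "(\<lambda>x. c * s x) \<in> {s. pull X s \<in> fv.span (Mon k)}" for c
          using s fv.span_scale[of "pull X s" "Mon k" c] by (simp only: mem_Collect_eq pull_simps)
        fix t assume t: "t \<in> {s. pull X s \<in> fv.span (Mon k)}"
        show "s + t \<in> {s. pull X s \<in> fv.span (Mon k)}"
          using s t fv.span_add[of "pull X s" "Mon k" "pull X t"] by (simp only: mem_Collect_eq pull_simps)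
      qed
    qed
    show "range (scalar_section X) \<subseteq> R 0"
    proof
      fix s assume "s \<in> range (scalar_section X)"
      then obtain c where s: "s = scalar_section X c" by blast
      have "gen_monomial r g (\<lambda>i. 0) \<in> Mon 0" unfolding Mon_def by (intro imageI) simp
      moreover have "gen_monomial r g (\<lambda>i. 0) = 1" unfolding gen_monomial_def by simp
      ultimately have "1 \<in> fv.span (Mon 0)" using fv.span_base by metis
      from fv.span_scale[OF this, of c] have "(\<lambda>z. c) \<in> fv.span (Mon 0)" by simp
      thus "s \<in> R 0" unfolding R_def s by (simp only: mem_Collect_eq pull_scalar[OF X])
    qed
    show "\<forall>k l. \<forall>s\<in>R k. \<forall>t\<in>R l. s * t \<in> R (k + l)"
    proof (intro allI ballI)
      fix k l s t assume st: "s \<in> R k" "t \<in> R l"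
      have "pull X s * pull X t \<in> fv.span (Mon (k + l))"
      proof (rule span_mult)
        show "pull X s \<in> fv.span (Mon k)" "pull X t \<in> fv.span (Mon l)" using st unfolding R_def by auto
        fix u v assume "u \<in> Mon k" "v \<in> Mon l"
        then obtain a b where ab: "u = gen_monomial r g a" "(\<Sum>i<r. a i * d i) = k"
          "v = gen_monomial r g b" "(\<Sum>i<r. b i * d i) = l" unfolding Mon_def by blast
        have "u * v = gen_monomial r g (\<lambda>i. a i + b i)"
          unfolding ab gen_monomial_def by (simp only: power_add prod.distrib)
        moreover have "(\<Sum>i<r. (a i + b i) * d i) = k + l" using ab by (simp add: add_mult_distrib sum.distrib)
        ultimately have "u * v \<in> Mon (k + l)" unfolding Mon_def by blast
        thus "u * v \<in> fv.span (Mon (k + l))" by (rule fv.span_base)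
      qed
      thus "s * t \<in> R (k + l)" unfolding R_def by (simp only: mem_Collect_eq pull_simps)
    qed
    show "\<forall>(d, s)\<in>J. s \<in> R d"
    proof -
      have "snd (j i) \<in> R (d i)" if i: "i < r" for i
      proof -
        let ?a = "\<lambda>l. if l = i then 1 else 0 :: nat"
        have "gen_monomial r g ?a = (\<Prod>l<r. if l = i then g l else 1)" unfolding gen_monomial_def by (intro prod.cong) auto
        also have "\<dots> = g i" using i by (simp add: prod.delta)
        finally have "g i = gen_monomial r g ?a" ..
        moreover have "(\<Sum>l<r. ?a l * d l) = d i"
        proof -
          have "(\<Sum>l<r. ?a l * d l) = (\<Sum>l<r. if l = i then d l else 0)" by (intro sum.cong) auto
          thus ?thesis using i by (simp add: sum.delta)
        qed
        ultimately have "g i \<in> Mon (d i)" unfolding Mon_def by blast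
        from fv.span_base[OF this] show ?thesis unfolding R_def g_def by (simp only: mem_Collect_eq)
      qed
      thus ?thesis unfolding j d_def by (auto simp: case_prod_beta)
    qed
  qed
  hence "pull X ` S k \<subseteq> fv.span (Mon k)" for k unfolding R_def by blast
  moreover have "\<forall>i<r. d i > 0 \<and> g i \<in> pull X ` S (d i)" using ji unfolding g_def by blast
  ultimately have "generated_by (\<lambda>k. pull X ` S k) r d g" unfolding generated_by_def Mon_def by blast
  thus ?thesis by blast
qed

section \<open>Growth of a finitely generated series\<close>

context irreducible_projective
begin

lemma section_scalar: "section_of X (div_mult 0 D) (\<lambda>z. c) (scalar_section X c)"
  using rational_const has_value_const[of _ c]
  unfolding section_of_def div_mult_def scalar_section_def restrict_section_def by simp

lemma section_sum:
  assumes D: "cartier X D" and "finite B" and "\<forall>u\<in>B. section_of X D (\<Phi> u) u"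
  shows "section_of X D (\<lambda>z. \<Sum>u\<in>B. c u * \<Phi> u z) (\<lambda>z. \<Sum>u\<in>B. c u * u z)"
  using assms(2,3)
proof induction
  case empty thus ?case using section_zero[OF D] by simp
next
  case (insert u B)
  have "section_of X D (\<lambda>z. c u * \<Phi> u z + (\<Sum>u\<in>B. c u * \<Phi> u z)) (\<lambda>z. c u * u z + (\<Sum>u\<in>B. c u * u z))"
    using insert by (intro section_linear) auto
  thus ?case using insert.hyps by simp
qed

text \<open>A common denominator of the rational functions that define the sections.\<close>

lemma common_poles:
  assumes "finite J" "\<forall>(d, s)\<in>J. s \<in> H0 X (div_mult d D)"
  shows "\<exists>E Q. homogeneous E Q \<and> generically X (\<lambda>z. Q (rep z) \<noteq> 0) \<and>
    (\<forall>(d, s)\<in>J. \<exists>P. homogeneous E P \<and> section_of X (div_mult d D) (\<lambda>z. P (rep z) / Q (rep z)) s)"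
  using assms
proof induction
  case empty
  show ?case by (rule exI[of _ 0], rule exI[of _ "\<lambda>v. 1"]) (auto intro: homogeneous_one generically_all)
next
  case (insert j J)
  obtain d s where j: "j = (d, s)" by (cases j)
  have prems: "\<forall>(d, s)\<in>J. s \<in> H0 X (div_mult d D)" "s \<in> H0 X (div_mult d D)" using insert.prems j by auto
  obtain E Q where Q: "homogeneous E Q" "generically X (\<lambda>z. Q (rep z) \<noteq> 0)"
    "\<forall>(d, s)\<in>J. \<exists>P. homogeneous E P \<and> section_of X (div_mult d D) (\<lambda>z. P (rep z) / Q (rep z)) s"
    using insert.IH[OF prems(1)] by blast
  obtain \<phi> where \<phi>: "section_of X (div_mult d D) \<phi> s" using prems(2) unfolding H0_def by blast
  hence "rational X \<phi>" unfolding section_of_def by blast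
  then obtain e p q where "fraction \<phi> e p q" unfolding rational_iff by blast
  note f = fractionD[OF this]
  define Q' where "Q' = (\<lambda>v. Q v * q v)"
  have Q': "homogeneous (E + e) Q'" unfolding Q'_def by (rule homogeneous.mult[OF Q(1) f(2)])
  have gen: "generically X (\<lambda>z. Q (rep z) \<noteq> 0 \<and> q (rep z) \<noteq> 0 \<and> \<phi> z = p (rep z) / q (rep z))"
    by (rule generically_conj[OF Q(2) f(3)])
  have "generically X (\<lambda>z. Q' (rep z) \<noteq> 0)" unfolding Q'_def by (rule generically_mono[OF gen _ Xp]) simp
  moreover have "\<exists>P. homogeneous (E + e) P \<and> section_of X (div_mult d' D) (\<lambda>z. P (rep z) / Q' (rep z)) s'"
    if J: "(d', s') \<in> J" for d' s'
  proof -
    obtain P where P: "homogeneous E P" "section_of X (div_mult d' D) (\<lambda>z. P (rep z) / Q (rep z)) s'"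
      using Q(3) J by blast
    have "generically X (\<lambda>z. (P (rep z) * q (rep z)) / Q' (rep z) = P (rep z) / Q (rep z))"
      unfolding Q'_def by (rule generically_mono[OF gen _ Xp]) simp
    from section_cong[OF P(2) this] homogeneous.mult[OF P(1) f(2)] show ?thesis
      by (intro exI[of _ "\<lambda>v. P v * q v"]) simp
  qed
  moreover have "\<exists>P. homogeneous (E + e) P \<and> section_of X (div_mult d D) (\<lambda>z. P (rep z) / Q' (rep z)) s"
  proof -
    have "generically X (\<lambda>z. (Q (rep z) * p (rep z)) / Q' (rep z) = \<phi> z)"
      unfolding Q'_def by (rule generically_mono[OF gen _ Xp]) simp
    from section_cong[OF \<phi> this] homogeneous.mult[OF Q(1) f(1)] show ?thesis
      by (intro exI[of _ "\<lambda>v. Q v * p v"]) simp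
  qed
  ultimately show ?case using Q' j by (intro exI[of _ "E + e"] exI[of _ Q'] conjI) auto
qed

text \<open>
  The sections of a finitely generated series in degree \<open>k\<close> have the form \<open>M / Q\<^sup>k\<close> for a fixed \<open>Q\<close> of degree \<open>E\<close>,
  so they grow at most like the forms of degree \<open>E k\<close> on \<open>X\<close>.
\<close>

theorem series_growth:
  assumes D: "cartier X D" and gls: "graded_linear_series X D T" and fg: "finitely_generated X T"
  shows "\<exists>C. \<forall>k. fv.dim (T k) \<le> C * (k + 1) ^ variety_dim X"
proof -
  let ?n = "variety_dim X"
  obtain J where J: "finite J" "\<forall>(d, s)\<in>J. d > 0 \<and> s \<in> T d"
    "\<And>R. (\<forall>k. fv.subspace (R k)) \<Longrightarrow> range (scalar_section X) \<subseteq> R 0 \<Longrightarrow>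
      (\<forall>k l. \<forall>s\<in>R k. \<forall>t\<in>R l. s * t \<in> R (k + l)) \<Longrightarrow> (\<forall>(d, s)\<in>J. s \<in> R d) \<Longrightarrow> (\<forall>k. T k \<subseteq> R k)"
    using homogeneous_generators[OF gls fg] by (elim exE conjE) simp
  have TH: "T k \<subseteq> H0 X (div_mult k D)" for k using gls unfolding graded_linear_series_def by blast
  have "\<forall>(d, s)\<in>J. s \<in> H0 X (div_mult d D)" using J(2) TH by blast
  from common_poles[OF J(1) this] obtain E Q where Q: "homogeneous E Q" "generically X (\<lambda>z. Q (rep z) \<noteq> 0)"
    "\<forall>(d, s)\<in>J. \<exists>P. homogeneous E P \<and> section_of X (div_mult d D) (\<lambda>z. P (rep z) / Q (rep z)) s" by blast
  define sec where "sec k M s \<longleftrightarrow> homogeneous (E * k) M \<and> section_of X (div_mult k D) (\<lambda>z. M (rep z) / Q (rep z) ^ k) s" for k M s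
  define R where "R k = {s. \<exists>M. sec k M s}" for k
  have zero: "sec k (\<lambda>v. 0) (\<lambda>z. 0)" for k
    unfolding sec_def using section_zero[OF cartier_power[OF D], of k] homogeneous_zero by simp
  have lin: "sec k (\<lambda>v. c * M v + M' v) (\<lambda>z. c * s z + t z)" if "sec k M s" "sec k M' t" for k c M M' s t
  proof -
    have s: "section_of X (div_mult k D) (\<lambda>z. c * (M (rep z) / Q (rep z) ^ k) + M' (rep z) / Q (rep z) ^ k) (\<lambda>z. c * s z + t z)"
      using that unfolding sec_def by (intro section_linear) auto
    have "homogeneous (E * k) (\<lambda>v. c * M v + M' v)"
      using that unfolding sec_def by (intro homogeneous.add homogeneous_scale) auto
    thus ?thesis using s unfolding sec_def by (simp add: add_divide_distrib)
  qed
  have "\<forall>k. T k \<subseteq> R k"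
  proof (rule J(3))
    show "\<forall>k. fv.subspace (R k)"
    proof
      fix k show "fv.subspace (R k)"
      proof (rule fv.subspaceI)
        show "0 \<in> R k" unfolding R_def zero_fun_def using zero by blast
        fix s assume "s \<in> R k"
        then obtain M where M: "sec k M s" unfolding R_def by blast
        show "(\<lambda>x. c * s x) \<in> R k" for c unfolding R_def using lin[OF M zero, of c] by auto
        fix t assume "t \<in> R k"
        then obtain M' where M': "sec k M' t" unfolding R_def by blast
        show "s + t \<in> R k" unfolding R_def plus_fun_def using lin[OF M M', of 1] by auto
      qed
    qed
    show "range (scalar_section X) \<subseteq> R 0"
    proof
      fix s assume "s \<in> range (scalar_section X)"
      then obtain c where s: "s = scalar_section X c" by blast
      have "sec 0 (\<lambda>v. c) s" unfolding sec_def s using section_scalar[of D c] homogeneous.const by simp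
      thus "s \<in> R 0" unfolding R_def by blast
    qed
    show "\<forall>k l. \<forall>s\<in>R k. \<forall>t\<in>R l. s * t \<in> R (k + l)"
    proof (intro allI ballI)
      fix k l s t assume "s \<in> R k" "t \<in> R l"
      then obtain M M' where M: "sec k M s" "sec l M' t" unfolding R_def by blast
      have "section_of X (div_mult (k + l) D) (\<lambda>z. M (rep z) / Q (rep z) ^ k * (M' (rep z) / Q (rep z) ^ l)) (\<lambda>z. s z * t z)"
        unfolding div_add_mult[symmetric] using M unfolding sec_def by (intro section_mult) auto
      moreover have "homogeneous (E * (k + l)) (\<lambda>v. M v * M' v)"
        unfolding add_mult_distrib2 using M unfolding sec_def by (intro homogeneous.mult) auto
      ultimately have "sec (k + l) (\<lambda>v. M v * M' v) (\<lambda>z. s z * t z)" unfolding sec_def by (simp add: power_add)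
      thus "s * t \<in> R (k + l)" unfolding R_def times_fun_def by blast
    qed
    show "\<forall>(d, s)\<in>J. s \<in> R d"
    proof (intro ballI, clarify)
      fix d s assume ds: "(d, s) \<in> J"
      then obtain P where P: "homogeneous E P" "section_of X (div_mult d D) (\<lambda>z. P (rep z) / Q (rep z)) s" using Q(3) by blast
      have d: "d > 0" using J(2) ds by blast
      have "generically X (\<lambda>z. (P (rep z) * Q (rep z) ^ (d - 1)) / Q (rep z) ^ d = P (rep z) / Q (rep z))"
      proof (rule generically_mono[OF Q(2) _ Xp])
        fix z assume q: "Q (rep z) \<noteq> 0"
        have "Q (rep z) ^ d = Q (rep z) * Q (rep z) ^ (d - 1)" using d by (cases d) auto
        thus "(P (rep z) * Q (rep z) ^ (d - 1)) / Q (rep z) ^ d = P (rep z) / Q (rep z)" using q by simp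
      qed
      from section_cong[OF P(2) this]
      have "section_of X (div_mult d D) (\<lambda>z. (P (rep z) * Q (rep z) ^ (d - 1)) / Q (rep z) ^ d) s" .
      moreover have "homogeneous (E * d) (\<lambda>v. P v * Q v ^ (d - 1))"
      proof -
        have "E + (d - 1) * E = E * d" using d by (cases d) auto
        thus ?thesis using homogeneous.mult[OF P(1) homogeneous_power[OF Q(1), of "d - 1"]] by simp
      qed
      ultimately have "sec d (\<lambda>v. P v * Q v ^ (d - 1)) s" unfolding sec_def by simp
      thus "s \<in> R d" unfolding R_def by blast
    qed
  qed
  hence TR: "\<forall>t\<in>T k. \<exists>M. sec k M t" for k unfolding R_def by blast
  obtain C where C: "\<And>k. \<exists>W. finite W \<and> card W \<le> C * (k + 1) ^ ?n \<and> forms (Suc N) (coords X) k \<subseteq> fv.span W"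
    using coordinate_ring_growth[OF XN closed irr] by blast
  have "fv.dim (T k) \<le> C * (E + 1) ^ ?n * (k + 1) ^ ?n" for k
  proof -
    obtain M where M: "\<forall>t\<in>T k. sec k (M t) t" using bchoice[OF TR] by blast
    obtain W where W: "finite W" "card W \<le> C * (E * k + 1) ^ ?n" "forms (Suc N) (coords X) (E * k) \<subseteq> fv.span W" using C by blast
    obtain B where B: "B \<subseteq> T k" "fv.independent B" "T k \<subseteq> fv.span B" "card B = fv.dim (T k)" by (rule fv.basis_exists)
    obtain U where "finite U" "T k \<subseteq> fv.span U" using series_finite_dim(1)[OF gls] by blast
    hence fB: "finite B" using fv.independent_span_bound[OF _ B(2)] B(1) by blast
    have "card B \<le> card W"
    proof (rule card_le_if_independent_family[OF fB W(1), of "\<lambda>u z. M u (trunc (Suc N) (coords X z))"])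
      show "(\<lambda>u z. M u (trunc (Suc N) (coords X z))) ` B \<subseteq> fv.span W"
      proof (rule image_subsetI)
        fix u assume "u \<in> B"
        hence "homogeneous (E * k) (M u)" using M B(1) unfolding sec_def by blast
        from formsI[OF this, of "Suc N" "coords X"] show "(\<lambda>z. M u (trunc (Suc N) (coords X z))) \<in> fv.span W" using W(3) by blast
      qed
      fix c assume 0: "\<And>z. (\<Sum>u\<in>B. c u * M u (trunc (Suc N) (coords X z))) = 0"
      have "\<forall>u\<in>B. section_of X (div_mult k D) (\<lambda>z. M u (rep z) / Q (rep z) ^ k) u" using M B(1) unfolding sec_def by blast
      from section_sum[OF cartier_power[OF D] fB this, of c]
      have s: "section_of X (div_mult k D) (\<lambda>z. \<Sum>u\<in>B. c u * (M u (rep z) / Q (rep z) ^ k)) (\<lambda>z. \<Sum>u\<in>B. c u * u z)" .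
      have "generically X (\<lambda>z. (\<Sum>u\<in>B. c u * (M u (rep z) / Q (rep z) ^ k)) = 0)"
      proof (rule generically_all)
        fix z assume z: "z \<in> X"
        have "trunc (Suc N) (coords X z) = rep z" using rep_projective_space[of z N] z XN by auto
        hence "(\<Sum>u\<in>B. c u * M u (rep z)) = 0" using 0[of z] by simp
        thus "(\<Sum>u\<in>B. c u * (M u (rep z) / Q (rep z) ^ k)) = 0" by (simp flip: sum_divide_distrib)
      qed
      from section_unique[OF s section_zero[OF cartier_power[OF D]] this]
      have "(\<lambda>z. \<Sum>u\<in>B. c u * u z) = (\<lambda>z. 0)" .
      moreover have "(\<Sum>u\<in>B. (\<lambda>z. c u * u z)) = (\<lambda>z. \<Sum>u\<in>B. c u * u z)" by (rule ext) (simp only: sum_fun_apply)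
      ultimately have "(\<Sum>u\<in>B. (\<lambda>z. c u * u z)) = 0" by (simp only: zero_fun_def)
      thus "\<forall>u\<in>B. c u = 0" using fv.independentD[OF B(2) fB order.refl] by blast
    qed
    also note W(2)
    also have "C * (E * k + 1) ^ ?n \<le> C * ((E + 1) * (k + 1)) ^ ?n" by (intro mult_le_mono2 power_mono) (auto simp: algebra_simps)
    also have "\<dots> = C * (E + 1) ^ ?n * (k + 1) ^ ?n" by (simp only: power_mult_distrib mult.assoc)
    finally show ?thesis using B(4) by simp
  qed
  thus ?thesis by blast
qed

text \<open>Two nonempty open subsets of an irreducible set meet.\<close>

lemma nonzero_together:
  assumes D: "cartier X D" and s: "s \<in> H0 X (div_mult k D)" and t: "t \<in> H0 X (div_mult l D)"
    and Y: "Y \<subseteq> X" "irreducible_set Y" and x: "x \<in> Y" "s x \<noteq> 0" and x': "x' \<in> Y" "t x' \<noteq> 0"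
  shows "\<exists>z\<in>Y. s z \<noteq> 0 \<and> t z \<noteq> 0"
proof -
  obtain \<phi> \<psi> where \<phi>: "section_of X (div_mult k D) \<phi> s" "section_of X (div_mult l D) \<psi> t" using s t unfolding H0_def by blast
  obtain d g where g: "homogeneous d g" "g (rep x) \<noteq> 0" "\<forall>z\<in>X. g (rep z) \<noteq> 0 \<longrightarrow> s z \<noteq> 0"
    using section_nonvanishing_open[OF cartier_power[OF D] \<phi>(1)] x Y by blast
  obtain e h where h: "homogeneous e h" "h (rep x') \<noteq> 0" "\<forall>z\<in>X. h (rep z) \<noteq> 0 \<longrightarrow> t z \<noteq> 0"
    using section_nonvanishing_open[OF cartier_power[OF D] \<phi>(2)] x' Y by blast
  have "Y \<subseteq> points" using Y(1) Xp by blast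
  from irreducible_witness[OF this Y(2) g(1) h(1) x(1) g(2) x'(1) h(2)]
  obtain z where "z \<in> Y" "g (rep z) \<noteq> 0" "h (rep z) \<noteq> 0" by blast
  thus ?thesis using g(3) h(3) Y(1) by blast
qed

lemma nonempty: "X \<noteq> {}" using irreducible_nonempty[OF irr] .

lemma series_domain:
  assumes D: "cartier X D" and gls: "graded_linear_series X D T"
  shows "graded_domain (\<lambda>k. pull X ` T k)"
  unfolding graded_domain_def
proof (intro allI ballI impI)
  fix k l f g assume f: "f \<in> pull X ` T k" and g: "g \<in> pull X ` T l" and 0: "f * g = 0"
  obtain s t where st: "s \<in> T k" "f = pull X s" "t \<in> T l" "g = pull X t" using f g by blast
  have H: "s \<in> H0 X (div_mult k D)" "t \<in> H0 X (div_mult l D)" using st gls unfolding graded_linear_series_def by blast+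
  show "f = 0 \<or> g = 0"
  proof (rule ccontr)
    assume "\<not> (f = 0 \<or> g = 0)"
    hence "f \<noteq> 0" "g \<noteq> 0" by auto
    then obtain z z' where "s (retract X z) \<noteq> 0" "t (retract X z') \<noteq> 0" unfolding st pull_def by (auto simp: fun_eq_iff)
    from nonzero_together[OF D H order.refl irr retract_in[OF nonempty] this(1) retract_in[OF nonempty] this(2)]
    obtain x where x: "x \<in> X" "s x \<noteq> 0" "t x \<noteq> 0" by blast
    have "(f * g) x = s x * t x" unfolding st using x(1) by (simp add: pull_simps(5))
    thus False using x 0 by simp
  qed
qed

end

section \<open>Conductors and restricted volumes\<close>

text \<open>
  The numerical contradiction: a gap of size \<open>(k / d)\<^sup>d\<close> along the multiples of \<open>m\<close>, where \<open>d\<close> is at least the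
  dimension \<open>n\<close> because the smaller volume is positive, makes the larger volume strictly larger.
\<close>

lemma limsup_gap:
  fixes a b :: "nat \<Rightarrow> nat"
  assumes m: "m > 0" and mono: "\<And>k l. l \<ge> k0 \<Longrightarrow> a k \<le> a (k + l)"
    and a: "\<And>k. a (m * k) \<le> C * (k + 1) ^ d"
    and gap: "\<And>k. k \<ge> 1 \<Longrightarrow> a (m * k) + ((k - 1) div d + 1) ^ d \<le> b (m * k)"
    and pos: "0 < limsup (\<lambda>k. ereal (real (a k) / (real k ^ n / fact n)))"
    and fin: "limsup (\<lambda>k. ereal (real (b k) / (real k ^ n / fact n))) < \<infinity>"
  shows "limsup (\<lambda>k. ereal (real (a k) / (real k ^ n / fact n))) < limsup (\<lambda>k. ereal (real (b k) / (real k ^ n / fact n)))"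
proof -
  \<comment> \<open>The degree \<open>k\<close> is raised to a multiple \<open>m q\<close> of \<open>m\<close> by at least \<open>k0\<close>, so that \<open>a\<close> does not decrease.\<close>
  define q where "q k = (k + k0) div m + 1" for k
  have q1: "q k \<ge> 1" for k unfolding q_def by simp
  have qk: "k + k0 \<le> m * q k" "m * q k \<le> k + (k0 + m)" for k
  proof -
    have "k + k0 = m * ((k + k0) div m) + (k + k0) mod m" by simp
    moreover have "(k + k0) mod m < m" using m by simp
    moreover have "m * q k = m * ((k + k0) div m) + m" unfolding q_def by simp
    ultimately show "k + k0 \<le> m * q k" "m * q k \<le> k + (k0 + m)" by linarith+
  qed
  have up: "a k \<le> a (m * q k)" for k using mono[of "m * q k - k" k] qk(1)[of k] by simp
  have nd: "n \<le> d"
  proof (rule ccontr)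
    assume "\<not> n \<le> d"
    have "a k \<le> C * (k + (k0 + 2)) ^ d" for k
    proof -
      have "q k + 1 \<le> k + (k0 + 2)" unfolding q_def using div_le_dividend[of "k + k0" m] by linarith
      hence "C * (q k + 1) ^ d \<le> C * (k + (k0 + 2)) ^ d" by (intro mult_le_mono2 power_mono) auto
      thus ?thesis using up[of k] a[of "q k"] by linarith
    qed
    from limsup_zero[of a, OF this] \<open>\<not> n \<le> d\<close> pos show False by (simp add: not_le leD)
  qed
  define \<epsilon> where "\<epsilon> = fact n / (real m * real (d + 1)) ^ n"
  have \<epsilon>: "\<epsilon> > 0" unfolding \<epsilon>_def using m by simp
  have "\<exists>\<delta>\<le>k0 + m. real (a k) + \<epsilon> * (real k ^ n / fact n) \<le> real (b (k + \<delta>))" for k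
  proof -
    define x where "x = (q k - 1) div d + 1"
    have "\<epsilon> * (real k ^ n / fact n) = (real k / (real m * real (d + 1))) ^ n"
      unfolding \<epsilon>_def by (simp add: power_divide)
    also have "\<dots> \<le> real x ^ n"
    proof (cases "n = 0")
      case True thus ?thesis by simp
    next
      case False
      hence d: "d > 0" using nd by simp
      have "q k - 1 = d * ((q k - 1) div d) + (q k - 1) mod d" by simp
      moreover have "(q k - 1) mod d < d" using d by simp
      moreover have "d * x = d * ((q k - 1) div d) + d" unfolding x_def by simp
      ultimately have "q k \<le> d * x" by linarith
      hence "m * q k \<le> m * ((d + 1) * x)" by (intro mult_le_mono2) simp
      hence "k \<le> m * ((d + 1) * x)" using qk(1)[of k] by linarith
      also have "\<dots> = x * (m * (d + 1))" by (simp only: mult_ac)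
      finally have "k \<le> x * (m * (d + 1))" .
      hence "real k \<le> real (x * (m * (d + 1)))" by (simp only: of_nat_le_iff)
      hence "real k \<le> real x * (real m * real (d + 1))" by (simp only: of_nat_mult)
      hence "real k / (real m * real (d + 1)) \<le> real x" using m by (simp add: pos_divide_le_eq)
      thus ?thesis by (intro power_mono) auto
    qed
    also have "\<dots> \<le> real x ^ d" using nd unfolding x_def by (intro power_increasing) auto
    finally have "\<epsilon> * (real k ^ n / fact n) \<le> real (x ^ d)" by simp
    moreover have "real (a k + x ^ d) \<le> real (b (m * q k))"
      unfolding of_nat_le_iff using up[of k] gap[OF q1, of k] unfolding x_def by linarith
    ultimately have "real (a k) + \<epsilon> * (real k ^ n / fact n) \<le> real (b (k + (m * q k - k)))"
      using qk(1)[of k] by simp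
    moreover have "m * q k - k \<le> k0 + m" using qk(2)[of k] by simp
    ultimately show ?thesis by blast
  qed
  hence le: "limsup (\<lambda>k. ereal (real (a k) / (real k ^ n / fact n))) + ereal \<epsilon> \<le>
      limsup (\<lambda>k. ereal (real (b k) / (real k ^ n / fact n)))" by (intro limsup_shift[where \<Delta> = "k0 + m"]) simp
  show ?thesis
  proof (cases "limsup (\<lambda>k. ereal (real (a k) / (real k ^ n / fact n)))")
    case (real r)
    have "ereal r < ereal r + ereal \<epsilon>" using \<epsilon> by simp
    thus ?thesis using le unfolding real by (rule less_le_trans)
  qed (use le fin pos in auto)
qed

context irreducible_projective
begin

text \<open>
  If the volumes agree, the growth alternative is excluded. So \<open>T\<close> is finite over \<open>S\<close> along the multiples of some \<open>m\<close>,
  with a conductor that does not vanish at a prescribed point outside \<open>E\<close>.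
\<close>

theorem conductor_exists:
  assumes D: "cartier X D" and S: "graded_linear_series X D S" "finitely_generated X S"
    and T: "graded_linear_series X D T" "finitely_generated X T" and ST: "\<And>k. S k \<subseteq> T k"
    and vol: "series_volume X S = series_volume X T" "series_volume X S > 0"
    and ample: "contains_ample_series X D S A E" and y: "y \<in> X" "y \<notin> qdiv_support X E"
  shows "\<exists>m>0. \<exists>j. \<exists>c\<in>S (m * j). c y \<noteq> 0 \<and> (\<forall>k. \<forall>t\<in>T (m * k). c * t \<in> S (m * (k + j)))"
proof -
  let ?S = "\<lambda>k. pull X ` S k" and ?T = "\<lambda>k. pull X ` T k" and ?n = "variety_dim X"
  obtain m0 where m0: "m0 > 0"
    "\<forall>l. \<forall>t\<in>H0 X (div_mult (l * m0) D). \<exists>j>0. \<exists>c\<in>S (j * m0). c y \<noteq> 0 \<and> c * t \<in> S ((j + l) * m0)"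
    using common_denominator[OF D ample y] by (elim exE conjE) (rule that)
  obtain r d g where g: "generated_by ?S r d g" using generated_by_pull[OF S nonempty] by blast
  obtain q e h where h: "generated_by ?T q e h" using generated_by_pull[OF T nonempty] by blast
  have pos: "i < r \<Longrightarrow> d i > 0" "i < q \<Longrightarrow> e i > 0" for i using g h unfolding generated_by_def by auto
  \<comment> \<open>The denominators have degrees divisible by \<open>m0\<close>; their \<open>M\<close>-th powers have degrees divisible by \<open>m\<close>, which is also a multiple of the degrees of all generators.\<close>
  define M where "M = (\<Prod>i<r. d i) * (\<Prod>i<q. e i)"
  define m where "m = m0 * M"
  have M0: "M > 0" unfolding M_def using pos by (simp add: prod_pos)
  have m: "m > 0" unfolding m_def using M0 m0(1) by simp
  have dvd: "i < r \<Longrightarrow> d i dvd m" "i < q \<Longrightarrow> e i dvd m" for i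
    unfolding m_def M_def by (rule dvd_mult, rule dvd_mult2, rule dvd_prodI, simp, simp)
      (rule dvd_mult, rule dvd_mult, rule dvd_prodI, simp, simp)
  note gS = graded_ring_pull[OF S(1) nonempty] and gT = graded_ring_pull[OF T(1) nonempty]
  note dT = series_domain[OF D T(1)]
  have den: "\<exists>j>0. \<exists>c\<in>?S (m * j). c y \<noteq> 0 \<and> c * b \<in> ?S (m * (j + l))" if b: "b \<in> ?T (m * l)" for b l
  proof -
    obtain t where t: "t \<in> T (m * l)" "b = pull X t" using b by blast
    have "t \<in> H0 X (div_mult (m * l) D)" using t(1) T(1) unfolding graded_linear_series_def by blast
    moreover have "m * l = (M * l) * m0" unfolding m_def by (simp add: mult_ac)
    ultimately have "t \<in> H0 X (div_mult ((M * l) * m0) D)" by simp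
    then obtain j c where c: "j > 0" "c \<in> S (j * m0)" "c y \<noteq> 0" "c * t \<in> S ((j + M * l) * m0)" using m0(2) by blast
    define p where "p = pull X c"
    have p: "p \<in> ?S (j * m0)" "p * b \<in> ?S ((j + M * l) * m0)" "p y \<noteq> 0"
      using c(2-4) y(1) unfolding p_def t(2) pull_simps(1)[symmetric] by (auto simp: pull_simps(5))
    have "p ^ M \<in> ?S (M * (j * m0))" by (rule graded_ringD(7)[OF gS p(1)])
    hence 1: "p ^ M \<in> ?S (m * j)" unfolding m_def by (simp only: mult_ac)
    have "p ^ (M - 1) * (p * b) \<in> ?S ((M - 1) * (j * m0) + (j + M * l) * m0)"
      by (rule graded_ringD(3)[OF gS graded_ringD(7)[OF gS p(1)] p(2)])
    moreover have "(M - 1) * (j * m0) + (j + M * l) * m0 = m * (j + l)"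
      unfolding m_def using M0 by (cases M) (auto simp: algebra_simps)
    moreover have "p ^ (M - 1) * (p * b) = p ^ M * b"
    proof -
      have "p ^ M = p ^ (M - 1) * p" using M0 by (cases M) (auto simp: mult.commute)
      thus ?thesis by (simp only: mult.assoc)
    qed
    ultimately have 2: "p ^ M * b \<in> ?S (m * (j + l))" by (simp only:)
    have "(p ^ M) y \<noteq> 0" unfolding power_fun_apply using p(3) by simp
    thus ?thesis using c(1) 1 2 by blast
  qed
  have den1: "\<exists>j>0. \<exists>c\<in>?S (m * j). c \<noteq> 0 \<and> c * t \<in> ?S (m * (j + 1))" if t: "t \<in> ?T m" for t
  proof -
    have "t \<in> ?T (m * 1)" using t by simp
    from den[OF this] obtain j c where "j > 0" "c \<in> ?S (m * j)" "c y \<noteq> 0" "c * t \<in> ?S (m * (j + 1))" by blast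
    moreover have "c \<noteq> 0" using \<open>c y \<noteq> 0\<close> by auto
    ultimately show ?thesis by blast
  qed
  have gap: "\<not> (\<exists>d. (\<exists>C. \<forall>k. \<exists>W. finite W \<and> card W \<le> C * (k + 1) ^ d \<and> ?S (m * k) \<subseteq> fv.span W) \<and>
      (\<forall>k\<ge>1. fv.dim (?S (m * k)) + ((k - 1) div d + 1) ^ d \<le> fv.dim (?T (m * k))))"
  proof
    assume "\<exists>d. (\<exists>C. \<forall>k. \<exists>W. finite W \<and> card W \<le> C * (k + 1) ^ d \<and> ?S (m * k) \<subseteq> fv.span W) \<and>
      (\<forall>k\<ge>1. fv.dim (?S (m * k)) + ((k - 1) div d + 1) ^ d \<le> fv.dim (?T (m * k)))"
    then obtain d C where d: "\<And>k. \<exists>W. finite W \<and> card W \<le> C * (k + 1) ^ d \<and> ?S (m * k) \<subseteq> fv.span W"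
      "\<And>k. k \<ge> 1 \<Longrightarrow> fv.dim (?S (m * k)) + ((k - 1) div d + 1) ^ d \<le> fv.dim (?T (m * k))" by blast
    obtain k0 where k0: "\<And>l. l \<ge> k0 \<Longrightarrow> S l \<noteq> {0}"
      using ample unfolding contains_ample_series_def eventually_sequentially by blast
    obtain C' where C': "\<And>k. fv.dim (T k) \<le> C' * (k + 1) ^ ?n" using series_growth[OF D T] by blast
    note dim = dim_pull[OF S(1) nonempty] dim_pull[OF T(1) nonempty]
    have "series_volume X S < series_volume X T"
      unfolding series_volume_def
    proof (rule limsup_gap[OF m])
      show "fv.dim (S (m * k)) \<le> C * (k + 1) ^ d" for k
      proof -
        obtain W where W: "finite W" "card W \<le> C * (k + 1) ^ d" "?S (m * k) \<subseteq> fv.span W" using d(1) by blast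
        have "fv.dim (?S (m * k)) \<le> card W" by (rule fv.dim_le_card[OF W(3,1)])
        thus ?thesis using W(2) dim(1) by simp
      qed
      show "fv.dim (S (m * k)) + ((k - 1) div d + 1) ^ d \<le> fv.dim (T (m * k))" if "k \<ge> 1" for k
        using d(2)[OF that] unfolding dim .
      show "0 < limsup (\<lambda>k. ereal (real (fv.dim (S k)) / (real k ^ ?n / fact ?n)))"
        using vol(2) unfolding series_volume_def .
      show "limsup (\<lambda>k. ereal (real (fv.dim (T k)) / (real k ^ ?n / fact ?n))) < \<infinity>"
        by (rule limsup_finite[OF C'])
      fix k l assume l: "k0 \<le> l"
      have "fv.dim (?S k) \<le> fv.dim (?S (k + l))"
      proof -
        have "0 \<in> S l" using S(1) fv.subspace_0 unfolding graded_linear_series_def by blast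
        then obtain s where s: "s \<in> S l" "s \<noteq> 0" using k0[OF l] by auto
        have p0: "pull X s \<noteq> 0" using s pull_inject[of X s 0] series_vanishes[OF S(1) s(1)] pull_simps(3)[of X] by auto
        obtain U W where UW: "finite U" "?S k \<subseteq> fv.span U" "finite W" "?S (k + l) \<subseteq> fv.span W"
          using series_finite_dim(2)[OF S(1)] by metis
        show ?thesis
        proof (rule dim_le_if_injective[OF graded_ringD(1)[OF gS] UW, where w = "pull X s" and \<rho> = "\<lambda>z. z"])
          fix u assume u: "u \<in> ?S k"
          show "(\<lambda>z. pull X s z * u z) \<in> ?S (k + l)"
            using graded_ringD(3)[OF gS imageI[OF s(1)] u] unfolding times_fun_def by (simp only: add.commute)
          assume "\<And>z. pull X s z * u z = 0"
          hence "pull X s * u = 0" by (auto simp: fun_eq_iff)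
          moreover have "pull X s \<in> ?T l" "u \<in> ?T k" using s(1) u ST by blast+
          ultimately have "pull X s = 0 \<or> u = 0" using dT unfolding graded_domain_def by blast
          thus "u = 0" using p0 by blast
        qed
      qed
      thus "fv.dim (S k) \<le> fv.dim (S (k + l))" unfolding dim .
    qed
    thus False using vol(1) by simp
  qed
  have "finite_over (\<lambda>k. ?T (m * k)) (\<lambda>k. ?S (m * k)) \<or> (\<exists>d. (\<exists>C. \<forall>k. \<exists>W. finite W \<and> card W \<le> C * (k + 1) ^ d \<and> ?S (m * k) \<subseteq> fv.span W) \<and>
      (\<forall>k\<ge>1. fv.dim (?S (m * k)) + ((k - 1) div d + 1) ^ d \<le> fv.dim (?T (m * k))))"
    by (rule finite_or_growth[where S = ?S and T = ?T, OF gS g gT h image_mono[OF ST] dT series_finite_dim(2)[OF T(1)] m dvd den1])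
  hence F: "finite_over (\<lambda>k. ?T (m * k)) (\<lambda>k. ?S (m * k))" using gap by blast
  have gSm: "graded_ring (\<lambda>k. ?S (m * k))" using gS unfolding graded_ring_def by (auto simp: add_mult_distrib2)
  have "\<exists>j. \<exists>c\<in>?S (m * j). c y \<noteq> 0 \<and> (\<forall>k. \<forall>f\<in>?T (m * k). c * f \<in> ?S (m * (k + j)))"
    by (rule common_conductor[OF gSm F]) (use den in blast)
  then obtain j c where c: "c \<in> S (m * j)" "pull X c y \<noteq> 0" "\<And>k f. f \<in> ?T (m * k) \<Longrightarrow> pull X c * f \<in> ?S (m * (k + j))" by blast
  have "c * t \<in> S (m * (k + j))" if t: "t \<in> T (m * k)" for k t
  proof -
    have "pull X (c * t) \<in> ?S (m * (k + j))" unfolding pull_simps(1) by (rule c(3)[OF imageI[OF t]])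
    then obtain s where s: "s \<in> S (m * (k + j))" "pull X (c * t) = pull X s" by blast
    have "c * t = s"
      by (rule pull_inject[OF s(2)]) (simp_all add: series_vanishes[OF S(1) c(1)] series_vanishes[OF S(1) s(1)])
    thus ?thesis using s(1) by simp
  qed
  moreover have "c y \<noteq> 0" using c(2) y(1) by (simp add: pull_simps(5))
  ultimately show ?thesis using m c(1) by blast
qed

lemma series_power:
  assumes "graded_linear_series X D T" "t \<in> T l" shows "t ^ Suc n \<in> T (Suc n * l)"
proof (induction n)
  case 0 show ?case using assms(2) by (simp only: power_Suc0_right mult_Suc mult_0 add_0_right)
next
  case (Suc n)
  have "t * t ^ Suc n \<in> T (l + Suc n * l)" using assms Suc unfolding graded_linear_series_def by blast
  thus ?case unfolding power_Suc[of t "Suc n"] mult_Suc[of "Suc n" l] .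
qed

text \<open>
  Multiplication by the conductor \<open>c\<close> embeds the restriction of \<open>T\<close> to
  \<open>Y\<close> into that of \<open>S\<close>, in the degrees divisible by \<open>m\<close>. In any other
  degree where the restriction of \<open>T\<close> is not zero, one first multiplies by a power of a fixed
  nonzero element whose degree lies in the same residue class modulo \<open>m\<close>. Thus the shift of the
  degree is bounded, and the volume of the restriction of \<open>T\<close> is at most that of \<open>S\<close>.
\<close>

theorem restricted_volume_eq:
  assumes D: "cartier X D" and S: "graded_linear_series X D S" and T: "graded_linear_series X D T"
    and ST: "\<And>k. S k \<subseteq> T k" and Y: "Y \<subseteq> X" "irreducible_set Y" "y \<in> Y"
    and m: "m > 0" and c: "c \<in> S (m * j)" "c y \<noteq> 0" "\<And>k t. t \<in> T (m * k) \<Longrightarrow> c * t \<in> S (m * (k + j))"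
  shows "restricted_volume Y S = restricted_volume Y T"
proof -
  let ?S = "restricted_series Y S" and ?T = "restricted_series Y T" and ?n = "variety_dim Y"
  have TH: "T k \<subseteq> H0 X (div_mult k D)" for k using T unfolding graded_linear_series_def by blast
  have Tm: "s \<in> T k \<Longrightarrow> t \<in> T l \<Longrightarrow> s * t \<in> T (k + l)" for s t k l using T unfolding graded_linear_series_def by blast
  have sub: "fv.subspace (restricted_series Y R k)" if R: "graded_linear_series X D R" for R k
  proof (rule fv.subspaceI)
    have Rk: "fv.subspace (R k)" using R unfolding graded_linear_series_def by blast
    have "restrict_section Y 0 = 0" unfolding restrict_section_def by auto
    thus "0 \<in> restricted_series Y R k" unfolding restricted_series_def using fv.subspace_0[OF Rk] by (metis image_eqI)
    fix f assume "f \<in> restricted_series Y R k"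
    then obtain s where s: "s \<in> R k" "f = restrict_section Y s" unfolding restricted_series_def by blast
    have "(\<lambda>x. a * f x) = restrict_section Y (\<lambda>x. a * s x)" for a unfolding s(2) restrict_section_def by auto
    thus "(\<lambda>x. a * f x) \<in> restricted_series Y R k" for a
      unfolding restricted_series_def using fv.subspace_scale[OF Rk s(1)] by (metis image_eqI)
    fix g assume "g \<in> restricted_series Y R k"
    then obtain t where t: "t \<in> R k" "g = restrict_section Y t" unfolding restricted_series_def by blast
    have "f + g = restrict_section Y (s + t)" unfolding s(2) t(2) restrict_section_def by auto
    thus "f + g \<in> restricted_series Y R k"
      unfolding restricted_series_def using fv.subspace_add[OF Rk s(1) t(1)] by (metis image_eqI)
  qed
  have fin: "\<exists>B. finite B \<and> ?S k \<subseteq> fv.span B" "\<exists>B. finite B \<and> ?T k \<subseteq> fv.span B" for k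
    using series_finite_dim(3) S T by blast+
  have "fv.dim (?S k) \<le> fv.dim (?T k)" for k
  proof -
    obtain U W where UW: "finite U" "?S k \<subseteq> fv.span U" "finite W" "?T k \<subseteq> fv.span W" using fin by metis
    show ?thesis
    proof (rule dim_le_if_injective[OF sub[OF S] UW, where w = "\<lambda>z. 1" and \<rho> = "\<lambda>z. z"])
      fix u assume "u \<in> ?S k"
      thus "(\<lambda>z. 1 * u z) \<in> ?T k" using ST unfolding restricted_series_def by auto
    qed auto
  qed
  hence le: "restricted_volume Y S \<le> restricted_volume Y T"
    unfolding restricted_volume_def series_volume_def
    by (intro Limsup_mono always_eventually allI) (simp add: divide_right_mono)
  define \<kappa> where "\<kappa> i = (SOME l. l mod m = i \<and> \<not> ?T l \<subseteq> {0})" for i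
  define \<Delta> where "\<Delta> = (2 * m - 1) * (\<Sum>i<m. \<kappa> i) + m * j"
  have "\<exists>\<delta>\<le>\<Delta>. fv.dim (?T k) \<le> fv.dim (?S (k + \<delta>))" for k
  proof (cases "?T k \<subseteq> {0}")
    case True
    hence "?T k \<subseteq> fv.span {}" by simp
    hence "fv.dim (?T k) \<le> card ({} :: (point \<Rightarrow> complex) set)" by (rule fv.dim_le_card) simp
    thus ?thesis by (intro exI[of _ 0]) simp
  next
    case False
    define l where "l = \<kappa> (k mod m)"
    have "l mod m = k mod m \<and> \<not> ?T l \<subseteq> {0}"
      unfolding l_def \<kappa>_def by (rule someI[of _ k]) (use False in simp)
    hence l: "l mod m = k mod m" "\<not> ?T l \<subseteq> {0}" by auto
    obtain t' where "t' \<in> T l" "restrict_section Y t' \<noteq> 0" using l(2) unfolding restricted_series_def by blast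
    then obtain x where t': "t' \<in> T l" "x \<in> Y" "t' x \<noteq> 0" unfolding restrict_section_def by (auto simp: fun_eq_iff split: if_splits)
    \<comment> \<open>Since \<open>k\<close> and \<open>l\<close> agree modulo \<open>m\<close>, this makes \<open>k + M l\<close> a multiple of \<open>m\<close>; and it is positive for \<open>m = 1\<close> too.\<close>
    define M where "M = 2 * m - 1"
    have MS: "M = Suc (2 * m - 2)" unfolding M_def using m by simp
    have p: "t' ^ M \<in> T (M * l)" unfolding MS by (rule series_power[OF T t'(1)])
    define w where "w = c * t' ^ M"
    have w: "w \<in> T (m * j + M * l)" unfolding w_def using ST c(1) by (intro Tm p) blast
    have wz: "\<exists>z\<in>Y. w z \<noteq> 0"
    proof -
      have "c \<in> H0 X (div_mult (m * j) D)" "t' \<in> H0 X (div_mult l D)" using c(1) t'(1) ST TH by blast+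
      from nonzero_together[OF D this Y c(2) t'(2,3)] show ?thesis unfolding w_def by (auto simp: power_fun_apply)
    qed
    have "m dvd k + M * l"
    proof -
      have "(k + M * l) mod m = (l + M * l) mod m" by (rule mod_add_cong) (simp_all add: l(1))
      also have "l + M * l = m * (2 * l)" unfolding M_def using m by (cases m) (auto simp: algebra_simps)
      finally show ?thesis by (simp add: dvd_eq_mod_eq_0)
    qed
    then obtain K where K: "k + M * l = m * K" by blast
    define \<delta> where "\<delta> = M * l + m * j"
    have kd: "m * (K + j) = k + \<delta>" unfolding \<delta>_def using K by (simp add: add_mult_distrib2)
    obtain U W where UW: "finite U" "?T k \<subseteq> fv.span U" "finite W" "?S (k + \<delta>) \<subseteq> fv.span W" using fin by metis
    have "fv.dim (?T k) \<le> fv.dim (?S (k + \<delta>))"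
    proof (rule dim_le_if_injective[OF sub[OF T] UW, where w = w and \<rho> = "\<lambda>z. z"])
      fix u assume "u \<in> ?T k"
      then obtain t where t: "t \<in> T k" "u = restrict_section Y t" unfolding restricted_series_def by blast
      have "t * t' ^ M \<in> T (k + M * l)" by (rule Tm[OF t(1) p])
      hence "c * (t * t' ^ M) \<in> S (k + \<delta>)" unfolding K kd[symmetric] by (rule c(3))
      moreover have "(\<lambda>z. w z * u z) = restrict_section Y (c * (t * t' ^ M))"
        unfolding w_def t(2) restrict_section_def by (auto simp: mult_ac)
      ultimately show "(\<lambda>z. w z * u z) \<in> ?S (k + \<delta>)" unfolding restricted_series_def by blast
      assume 0: "\<And>z. w z * u z = 0"
      show "u = 0"
      proof (rule ccontr)
        assume "u \<noteq> 0"
        then obtain x' where "x' \<in> Y" "t x' \<noteq> 0" unfolding t(2) restrict_section_def by (auto simp: fun_eq_iff split: if_splits)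
        moreover obtain z where "z \<in> Y" "w z \<noteq> 0" using wz by blast
        moreover have "w \<in> H0 X (div_mult (m * j + M * l) D)" "t \<in> H0 X (div_mult k D)" using w t(1) TH by blast+
        ultimately obtain z' where "z' \<in> Y" "w z' \<noteq> 0" "t z' \<noteq> 0" using nonzero_together[OF D _ _ Y(1,2)] by metis
        thus False using 0[of z'] unfolding t(2) restrict_section_def by simp
      qed
    qed
    moreover have "\<delta> \<le> \<Delta>"
    proof -
      have "l \<le> (\<Sum>i<m. \<kappa> i)" unfolding l_def using m by (intro member_le_sum) auto
      thus ?thesis unfolding \<delta>_def \<Delta>_def M_def by simp
    qed
    ultimately show ?thesis by blast
  qed
  hence "\<exists>\<delta>\<le>\<Delta>. real (fv.dim (?T k)) + 0 * (real k ^ ?n / fact ?n) \<le> real (fv.dim (?S (k + \<delta>)))" for k by simp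
  hence "limsup (\<lambda>k. ereal (real (fv.dim (?T k)) / (real k ^ ?n / fact ?n))) + ereal 0 \<le>
      limsup (\<lambda>k. ereal (real (fv.dim (?S k)) / (real k ^ ?n / fact ?n)))"
    by (intro limsup_shift[where \<Delta> = \<Delta>] always_eventually allI)
  hence "restricted_volume Y T \<le> restricted_volume Y S"
    unfolding restricted_volume_def series_volume_def by (simp flip: zero_ereal_def)
  with le show ?thesis by (rule antisym)
qed

end

theorem theorem4p18:
  fixes X :: "point set" and D :: divisor and S T :: series and A E :: qdivisor
  assumes "projective_variety X"
    and "big X D"
    and "graded_linear_series X D S" and "graded_linear_series X D T"
    and "finitely_generated X S" and "finitely_generated X T"
    and "\<And>k. S k \<subseteq> T k"
    and "series_volume X S = series_volume X T" and "series_volume X S > 0"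
    and "contains_ample_series X D S A E"
  shows "\<forall>Y. closed_subvariety X Y \<and> \<not> Y \<subseteq> qdiv_support X E \<longrightarrow>
           restricted_volume Y S = restricted_volume Y T"
proof (intro allI impI)
  fix Y assume Y: "closed_subvariety X Y \<and> \<not> Y \<subseteq> qdiv_support X E"
  obtain N where N: "closedin (Zariski (projective_space N)) X" and irr: "irreducible_set X"
    using assms(1) unfolding projective_variety_def by blast
  have XN: "X \<subseteq> projective_space N" by (rule closedin_subset_topspace[OF projective_space_points N])
  interpret irreducible_projective X N
    by unfold_locales (use XN N irr projective_space_points in blast)+
  have D: "cartier X D" using assms(2) unfolding big_def by blast
  have YX: "Y \<subseteq> X" "irreducible_set Y"
    using Y closedin_subset_topspace[OF Xp] unfolding closed_subvariety_def by blast+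
  obtain y where y: "y \<in> Y" "y \<notin> qdiv_support X E" using Y by blast
  have "y \<in> X" using y(1) YX(1) by blast
  from conductor_exists[OF D assms(3,5,4,6,7,8,9,10) this y(2)]
  obtain m j c where "m > 0" "c \<in> S (m * j)" "c y \<noteq> 0" "\<forall>k. \<forall>t\<in>T (m * k). c * t \<in> S (m * (k + j))" by blast
  thus "restricted_volume Y S = restricted_volume Y T"
    using restricted_volume_eq[OF D assms(3,4,7) YX y(1), of m c j] by blast
qed

end
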